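(* Let $0<s<1$, $p>1$, $ps<N$, let $\Omega\subset\mathbb{R}^N$ be a smooth open bounded set with $0\in\Omega$, and suppose that $0\le\alpha<ps$ and \[ q\in[p,p^*_\alpha[,\qquad r\in[p,p^*[,\qquad \max\{q,r\}>p,\qquad \begin{cases} \lambda>0,\ \mu>0 & \text{if } \min\{q,r\}>p,\\ 0<\lambda<\lambda_1,\ \mu>0 & \text{if } r=p,\\ \lambda>0,\ 0<\mu<\lambda_{1,\alpha} & \text{if } q=p. \end{cases} \] Then the problem \[ (-\Delta_p)^s u=\lambda|u|^{r-2}u+\mu\frac{|u|^{q-2}u}{|x|^\alpha}\ \text{ in }\Omega,\qquad u=0\ \text{ in }\mathbb{R}^N\setminus\Omega, \] has a positive solution and a sign-changing solution, both of minimal energy.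
   Context: Critical exponents: $p^*=\frac{Np}{N-ps}$ and $p^*_\alpha=\frac{(N-\alpha)p}{N-ps}$. Space: $W^{s,p}_0(\Omega)$ is the set of $u\in L^1_{\rm loc}(\mathbb{R}^N)$ with $u\equiv0$ a.e. in $\mathbb{R}^N\setminus\Omega$ and $[u]_{s,p}^p:=\int_{\mathbb{R}^{2N}}\frac{|u(x)-u(y)|^p}{|x-y|^{N+ps}}\,dx\,dy<+\infty$, a Banach space with norm $[\cdot]_{s,p}$. The operator $(-\Delta_p)^s$ is the differential of $u\mapsto\frac1p[u]_{s,p}^p$ on $W^{s,p}_0(\Omega)$. Weighted eigenvalues: $\lambda_{1,\alpha}:=\inf_{u\in W^{s,p}_0(\Omega)\setminus\{0\}}\frac{[u]_{s,p}^p}{\int_\Omega |u|^p|x|^{-\alpha}\,dx}$ and $\lambda_1:=\lambda_{1,0}$. Energy: $J(u)=\frac1p[u]_{s,p}^p-\frac{\lambda}{r}\int_\Omega|u|^r\,dx-\frac{\mu}{q}\int_\Omega\frac{|u|^q}{|x|^\alpha}\,dx$ on $W^{s,p}_0(\Omega)$. Solutions are weak solutions, i.e. critical points $u\in W^{s,p}_0(\Omega)$ of $J$. A function is sign-changing if both $u^+=\max\{u,0\}$ and $u^-=\min\{u,0\}$ are not identically zero. A positive (resp. sign-changing) solution is "of minimal energy" if it minimizes $J$ among all positive (resp. sign-changing) solutions of the problem. *)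

theory Defs
  imports "HOL-Analysis.Analysis"
begin

text \<open>Euclidean space of dimension \<open>N\<close> is a type \<open>'a\<close> of class \<open>euclidean_space\<close>, with
  \<open>N = DIM('a)\<close>. Elements of the function spaces are genuine functions; equality and pointwise
  conditions are therefore read almost everywhere with respect to \<open>lebesgue\<close>.\<close>

primrec C_diff :: "nat \<Rightarrow> ('a::euclidean_space \<Rightarrow> real) \<Rightarrow> bool" where
  "C_diff 0 f \<longleftrightarrow> continuous_on UNIV f"
| "C_diff (Suc k) f \<longleftrightarrow> f differentiable_on UNIV \<and>
     (\<forall>b\<in>Basis. C_diff k (\<lambda>x. frechet_derivative f (at x) b))"

definition smooth :: "('a::euclidean_space \<Rightarrow> real) \<Rightarrow> bool" where
  "smooth f \<longleftrightarrow> (\<forall>k. C_diff k f)"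

text \<open>Near each boundary point, after a rotation taking the last coordinate direction to \<open>e\<close>,
  the set lies strictly above the graph of a smooth function \<open>g\<close> of the coordinates orthogonal
  to \<open>e\<close>. Here \<open>g\<close> is given on the whole space but is evaluated only on the hyperplane
  orthogonal to \<open>e\<close>.\<close>

definition smooth_boundary :: "'a::euclidean_space set \<Rightarrow> bool" where
  "smooth_boundary \<Omega> \<longleftrightarrow> (\<forall>x0\<in>frontier \<Omega>. \<exists>\<rho>>0. \<exists>e g. norm e = 1 \<and> smooth g \<and>
     \<Omega> \<inter> ball x0 \<rho> = {x \<in> ball x0 \<rho>. g (x - (x \<bullet> e) *\<^sub>R e) < x \<bullet> e})"

definition crit_exp :: "'a::euclidean_space itself \<Rightarrow> real \<Rightarrow> real \<Rightarrow> real \<Rightarrow> real" where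
  "crit_exp _ s p \<alpha> = (real DIM('a) - \<alpha>) * p / (real DIM('a) - p * s)"

definition gagliardo_quotient :: "real \<Rightarrow> real \<Rightarrow> ('a::euclidean_space \<Rightarrow> real) \<Rightarrow> 'a \<times> 'a \<Rightarrow> real" where
  "gagliardo_quotient s p u = (\<lambda>(x, y).
     \<bar>u x - u y\<bar> powr p / norm (x - y) powr (real DIM('a) + p * s))"

definition gagliardo_pow :: "real \<Rightarrow> real \<Rightarrow> ('a::euclidean_space \<Rightarrow> real) \<Rightarrow> real" where
  "gagliardo_pow s p u = (LINT z|lebesgue. gagliardo_quotient s p u z)"

definition gagliardo :: "real \<Rightarrow> real \<Rightarrow> ('a::euclidean_space \<Rightarrow> real) \<Rightarrow> real" where
  "gagliardo s p u = gagliardo_pow s p u powr (1 / p)"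

definition locally_integrable :: "('a::euclidean_space \<Rightarrow> real) \<Rightarrow> bool" where
  "locally_integrable u \<longleftrightarrow> (\<forall>K. compact K \<longrightarrow> set_integrable lebesgue K u)"

definition W0 :: "real \<Rightarrow> real \<Rightarrow> 'a::euclidean_space set \<Rightarrow> ('a \<Rightarrow> real) set" where
  "W0 s p \<Omega> = {u. locally_integrable u \<and> (AE x in lebesgue. x \<notin> \<Omega> \<longrightarrow> u x = 0) \<and>
     integrable lebesgue (gagliardo_quotient s p u)}"

text \<open>In the range \<open>0 \<le> \<alpha> < p * s < N\<close> the weighted integral below is finite on \<open>W0 s p \<Omega>\<close>
  by the fractional Hardy inequality, so it never takes the default value \<open>0\<close> of a divergent
  Bochner integral. The convention \<open>0 powr 0 = 0\<close> only concerns null sets.\<close>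

definition eigenvalue1 :: "real \<Rightarrow> real \<Rightarrow> 'a::euclidean_space set \<Rightarrow> real \<Rightarrow> real" where
  "eigenvalue1 s p \<Omega> \<alpha> =
     (INF u \<in> {u \<in> W0 s p \<Omega>. \<not> (AE x in lebesgue. u x = 0)}.
        gagliardo_pow s p u / (LINT x:\<Omega>|lebesgue. \<bar>u x\<bar> powr p * norm x powr (- \<alpha>)))"

definition energy ::
  "real \<Rightarrow> real \<Rightarrow> 'a::euclidean_space set \<Rightarrow> real \<Rightarrow> real \<Rightarrow> real \<Rightarrow> real \<Rightarrow> real \<Rightarrow> ('a \<Rightarrow> real) \<Rightarrow> real" where
  "energy s p \<Omega> \<alpha> q r lam \<mu> u =
     1 / p * gagliardo_pow s p u
     - lam / r * (LINT x:\<Omega>|lebesgue. \<bar>u x\<bar> powr r)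
     - \<mu> / q * (LINT x:\<Omega>|lebesgue. \<bar>u x\<bar> powr q / norm x powr \<alpha>)"

text \<open>Frechet differentiability at \<open>u\<close> on the Banach space \<open>W0 s p \<Omega>\<close> normed by \<open>gagliardo s p\<close>.
  This space depends on terms and is not a type, so the library's \<open>has_derivative\<close> is written
  out relative to it.\<close>

definition has_differential ::
  "real \<Rightarrow> real \<Rightarrow> 'a::euclidean_space set \<Rightarrow>
     (('a \<Rightarrow> real) \<Rightarrow> real) \<Rightarrow> (('a \<Rightarrow> real) \<Rightarrow> real) \<Rightarrow> ('a \<Rightarrow> real) \<Rightarrow> bool" where
  "has_differential s p \<Omega> F L u \<longleftrightarrow>
     (\<forall>h\<in>W0 s p \<Omega>. \<forall>k\<in>W0 s p \<Omega>. L (\<lambda>x. h x + k x) = L h + L k) \<and>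
     (\<forall>h\<in>W0 s p \<Omega>. \<forall>c. L (\<lambda>x. c * h x) = c * L h) \<and>
     (\<exists>C. \<forall>h\<in>W0 s p \<Omega>. \<bar>L h\<bar> \<le> C * gagliardo s p h) \<and>
     (\<forall>\<epsilon>>0. \<exists>\<delta>>0. \<forall>h\<in>W0 s p \<Omega>. gagliardo s p h < \<delta> \<longrightarrow>
        \<bar>F (\<lambda>x. u x + h x) - F u - L h\<bar> \<le> \<epsilon> * gagliardo s p h)"

definition critical_point ::
  "real \<Rightarrow> real \<Rightarrow> 'a::euclidean_space set \<Rightarrow> (('a \<Rightarrow> real) \<Rightarrow> real) \<Rightarrow> ('a \<Rightarrow> real) \<Rightarrow> bool" where
  "critical_point s p \<Omega> F u \<longleftrightarrow> u \<in> W0 s p \<Omega> \<and> has_differential s p \<Omega> F (\<lambda>_. 0) u"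

definition weak_solution ::
  "real \<Rightarrow> real \<Rightarrow> 'a::euclidean_space set \<Rightarrow> real \<Rightarrow> real \<Rightarrow> real \<Rightarrow> real \<Rightarrow> real \<Rightarrow> ('a \<Rightarrow> real) \<Rightarrow> bool" where
  "weak_solution s p \<Omega> \<alpha> q r lam \<mu> u \<longleftrightarrow> critical_point s p \<Omega> (energy s p \<Omega> \<alpha> q r lam \<mu>) u"

definition positive_on :: "'a::euclidean_space set \<Rightarrow> ('a \<Rightarrow> real) \<Rightarrow> bool" where
  "positive_on \<Omega> u \<longleftrightarrow> (AE x in lebesgue. x \<in> \<Omega> \<longrightarrow> 0 < u x)"

definition sign_changing :: "('a::euclidean_space \<Rightarrow> real) \<Rightarrow> bool" where
  "sign_changing u \<longleftrightarrow> \<not> (AE x in lebesgue. max (u x) 0 = 0) \<and> \<not> (AE x in lebesgue. min (u x) 0 = 0)"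

definition minimizes_among :: "('b \<Rightarrow> real) \<Rightarrow> ('b \<Rightarrow> bool) \<Rightarrow> 'b \<Rightarrow> bool" where
  "minimizes_among F P u \<longleftrightarrow> P u \<and> (\<forall>v. P v \<longrightarrow> F u \<le> F v)"

end

theory Submission
  imports Defs "HOL-Complex_Analysis.Great_Picard"
begin

text \<open>
Write \<open>A u\<close> for the \<open>p\<close>-th power of the Gagliardo seminorm, \<open>B u\<close> and \<open>D u\<close> for the unweighted and the
weighted lower-order integrals with their coefficients, so that the energy is
\<open>J u = A u / p - B u / r - D u / q\<close>. Each term is the integral of a power of a linear image of \<open>u\<close>: the
increments \<open>u x - u y\<close> against the measure with density \<open>|x - y| powr - (N + p s)\<close>, or \<open>u\<close> itself
against a finite measure on \<open>\<Omega>\<close>. So one calculus lemma, \<open>pow_integral_frechet\<close>, gives the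
differentiability of all three, and weak solutions are the zeros of the derivative \<open>dJ u\<close>
(\<open>weak_solution_iff\<close>).

Two facts of functional analysis are needed. The embedding (\<open>embedding\<close>) comes from comparing the
superlevel sets of \<open>u\<close> at the heights \<open>t\<close> and \<open>2 t\<close>: around a point where \<open>|u| > 2 t\<close>, half of a
ball of twice the measure of \<open>{|u| > t}\<close> carries increments larger than \<open>t\<close>. Iterating this
inequality gives the weak Sobolev bound, and the weight is absorbed since
\<open>|x| powr - \<alpha>\<close> has mass at most \<open>C |E| powr (1 - \<alpha> / N)\<close> on a set \<open>E\<close>. Compactness (\<open>compactness\<close>) comes from
averages over dyadic cubes, which approximate bounded families in \<open>L\<^sup>1\<close> uniformly and converge along
a diagonal sequence.

The variational part rests on a hidden convexity. If \<open>a b \<ge> 0\<close> then \<open>|t a + \<tau> b| powr p\<close> is concave as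
a function of \<open>t powr p\<close> and \<open>\<tau> powr p\<close>, hence lies below its tangent plane at \<open>(1, 1)\<close>
(\<open>powr_hidden_convexity\<close>), and the increments of the positive and negative parts of \<open>u\<close> never have opposite
signs. Hence a function \<open>v\<close> with \<open>dJ v v\<^sup>+ = 0\<close> and
\<open>dJ v v\<^sup>- = 0\<close> maximises \<open>J\<close> over all \<open>t v\<^sup>+ + \<tau> v\<^sup>-\<close> with \<open>t, \<tau> \<ge> 0\<close> (\<open>nodal_J_max\<close>). This set of
functions, the nodal Nehari set, contains every sign-changing solution. A minimising sequence in it is bounded, its
limit still changes sign, and projecting the limit back to the set by Poincare--Miranda
(\<open>nodal_projection\<close>) does not raise the energy above the infimum; this gives a minimiser (\<open>nodal_minimizer\<close>). If
\<open>dJ v h < 0\<close> at a minimiser \<open>v\<close>, then the same topological argument finds a point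
\<open>t v\<^sup>+ + \<tau> v\<^sup>- + \<epsilon> h\<close> of the set with \<open>t, \<tau>\<close> close to \<open>1\<close>, and its energy is below that of
\<open>t v\<^sup>+ + \<tau> v\<^sup>-\<close>, hence below \<open>J v\<close>, a contradiction. So the minimiser is a solution
(\<open>nodal_min_critical\<close>).

For the positive solution the same argument runs on the usual Nehari set, with the intermediate value theorem in
place of Poincare--Miranda. Passing to the absolute value makes the minimiser nonnegative, and it is positive by the
strong maximum principle: if \<open>u\<close> vanished on a set \<open>Z\<close> of positive measure, testing with
\<open>\<eta> powr p / (u + \<epsilon>) powr (p - 1)\<close> and Picone's inequality would bound \<open>(\<delta> / \<epsilon>) powr (p - 1)\<close> times the mass of the pairs in
\<open>{u > \<delta>} \<times> Z\<close> uniformly in \<open>\<epsilon>\<close>. Both sets lie anywhere in \<open>\<Omega>\<close>, since the operator is nonlocal.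
\<close>

section \<open>Signed powers and integrals of powers\<close>

text \<open>The derivative of \<open>\<bar>a\<bar> powr m / m\<close>, an odd and multiplicative function of \<open>a\<close>.\<close>

definition dpow :: "real \<Rightarrow> real \<Rightarrow> real" where
  "dpow m a = sgn a * \<bar>a\<bar> powr (m - 1)"

lemma dpow_0 [simp]: "dpow m 0 = 0"
  by (simp add: dpow_def)

lemma dpow_minus: "dpow m (- a) = - dpow m a"
  by (simp add: dpow_def sgn_minus)

lemma abs_dpow: "\<bar>dpow m a\<bar> = \<bar>a\<bar> powr (m - 1)"
  by (cases "a = 0") (auto simp: dpow_def abs_mult abs_sgn_eq)

lemma dpow_mult_self: "dpow m a * a = \<bar>a\<bar> powr m"
proof (cases "a = 0")
  case False
  have "dpow m a * a = \<bar>a\<bar> powr (m - 1) * \<bar>a\<bar> powr 1"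
    using False by (auto simp: dpow_def sgn_if)
  also have "\<dots> = \<bar>a\<bar> powr m"
    using powr_mult_base[of "\<bar>a\<bar>" "m - 1"] by (simp add: mult.commute)
  finally show ?thesis .
qed (simp add: dpow_def)

lemma dpow_mult: "dpow m (a * b) = dpow m a * dpow m b"
  by (simp add: dpow_def sgn_mult abs_mult powr_mult)

lemma dpow_nonneg: "0 \<le> a \<Longrightarrow> dpow m a = a powr (m - 1)"
  by (cases "a = 0") (auto simp: dpow_def)

lemma dpow_mono:
  assumes "1 < m" "a \<le> b" shows "dpow m a \<le> dpow m b"
proof -
  consider "0 \<le> a" | "a < 0" "0 \<le> b" | "b < 0" using assms by linarith
  then show ?thesis
  proof cases
    case 1 then show ?thesis using assms by (simp add: dpow_nonneg powr_mono2)
  next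
    case 2 
    have "dpow m a \<le> 0" using 2 by (simp add: dpow_def)
    moreover have "0 \<le> dpow m b" using 2 by (simp add: dpow_nonneg)
    ultimately show ?thesis by simp
  next
    case 3
    have "dpow m (- b) \<le> dpow m (- a)" using assms 3 by (simp add: dpow_nonneg powr_mono2)
    then show ?thesis by (simp add: dpow_minus)
  qed
qed

lemma dpow_alt: "dpow m a = (max a 0) powr (m - 1) - (max (- a) 0) powr (m - 1)"
  by (auto simp: dpow_def max_def sgn_if)

lemma tendsto_dpow:
  assumes "1 < m" "(f \<longlongrightarrow> a) F" shows "((\<lambda>x. dpow m (f x)) \<longlongrightarrow> dpow m a) F"
  unfolding dpow_alt using assms by (intro tendsto_intros) auto

lemma dpow_measurable [measurable]: "dpow m \<in> borel_measurable borel"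
  unfolding dpow_alt[abs_def] by measurable

lemma powr_mult_abs_le:
  fixes a b m :: real
  assumes "1 < m" shows "\<bar>a\<bar> powr (m - 1) * \<bar>b\<bar> \<le> \<bar>a\<bar> powr m + \<bar>b\<bar> powr m"
proof (cases "\<bar>b\<bar> \<le> \<bar>a\<bar>")
  case True
  have "\<bar>a\<bar> powr (m - 1) * \<bar>b\<bar> \<le> \<bar>a\<bar> powr (m - 1) * \<bar>a\<bar>"
    using True by (intro mult_left_mono) auto
  also have "\<dots> = \<bar>a\<bar> powr m" using powr_mult_base[of "\<bar>a\<bar>" "m - 1"] by (simp add: mult.commute)
  finally show ?thesis by (simp add: add_increasing2)
next
  case False
  have "\<bar>a\<bar> powr (m - 1) * \<bar>b\<bar> \<le> \<bar>b\<bar> powr (m - 1) * \<bar>b\<bar>"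
    using False assms by (intro mult_right_mono powr_mono2) auto
  also have "\<dots> = \<bar>b\<bar> powr m" using powr_mult_base[of "\<bar>b\<bar>" "m - 1"] by (simp add: mult.commute)
  finally show ?thesis by (simp add: add_increasing)
qed

lemma dpow_mult_abs_le: "1 < m \<Longrightarrow> \<bar>dpow m a * b\<bar> \<le> \<bar>a\<bar> powr m + \<bar>b\<bar> powr m"
  by (simp add: abs_mult abs_dpow powr_mult_abs_le)

lemma powr_add_le:
  fixes a b :: real
  assumes "0 \<le> a" "0 \<le> b" "0 < m"
  shows "(a + b) powr m \<le> 2 powr m * (a powr m + b powr m)"
proof -
  have "(a + b) powr m \<le> (2 * max a b) powr m"
    using assms by (intro powr_mono2) auto
  also have "\<dots> = 2 powr m * (max a b) powr m" using assms by (simp add: powr_mult)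
  also have "(max a b) powr m \<le> a powr m + b powr m" by (auto simp: max_def)
  finally show ?thesis by simp
qed

text \<open>This is Young's inequality for the product \<open>dpow m x * y\<close>, rearranged.\<close>

lemma dpow_tangent:
  assumes "1 < m" shows "\<bar>x\<bar> powr m + m * dpow m x * (y - x) \<le> \<bar>y\<bar> powr m"
proof -
  have m: "0 < m" using assms by simp
  have "\<bar>x\<bar> powr (m - 1) * \<bar>y\<bar> \<le> (m - 1) / m * \<bar>x\<bar> powr m + \<bar>y\<bar> powr m / m"
  proof (cases "x = 0 \<or> y = 0")
    case True
    then show ?thesis using assms by auto
  next
    case False
    have "(\<bar>x\<bar> powr m) powr ((m - 1) / m) * (\<bar>y\<bar> powr m) powr (1 / m)
        \<le> (m - 1) / m * \<bar>x\<bar> powr m + 1 / m * \<bar>y\<bar> powr m"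
      using assms False by (intro Youngs_inequality_0) (auto simp: field_simps)
    then show ?thesis using m by (simp add: powr_powr)
  qed
  then have "m * (\<bar>x\<bar> powr (m - 1) * \<bar>y\<bar>) \<le> (m - 1) * \<bar>x\<bar> powr m + \<bar>y\<bar> powr m"
    using m by (simp add: field_simps)
  moreover have "dpow m x * y \<le> \<bar>x\<bar> powr (m - 1) * \<bar>y\<bar>"
    by (metis abs_dpow abs_le_D1 abs_mult order_refl)
  then have "m * (dpow m x * y) \<le> m * (\<bar>x\<bar> powr (m - 1) * \<bar>y\<bar>)" using m by simp
  ultimately have "m * (dpow m x * y) \<le> (m - 1) * \<bar>x\<bar> powr m + \<bar>y\<bar> powr m" by linarith
  moreover have "m * dpow m x * (y - x) = m * (dpow m x * y) - m * \<bar>x\<bar> powr m"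
    unfolding dpow_mult_self[of m x, symmetric] by (simp add: algebra_simps)
  moreover have "(m - 1) * \<bar>x\<bar> powr m = m * \<bar>x\<bar> powr m - \<bar>x\<bar> powr m" by (simp add: algebra_simps)
  ultimately show ?thesis by linarith
qed

text \<open>Convexity of the power, from the tangent inequality at the averaged point.\<close>

lemma powr_jensen:
  fixes a b x y m :: real
  assumes "1 < m" "0 \<le> a" "0 \<le> b" "a + b = 1" "0 \<le> x" "0 \<le> y"
  shows "(a * x + b * y) powr m \<le> a * x powr m + b * y powr m"
proof -
  define c where "c = a * x + b * y"
  have c: "0 \<le> c" unfolding c_def using assms by (intro add_nonneg_nonneg mult_nonneg_nonneg)
  have 1: "c powr m + m * dpow m c * (x - c) \<le> x powr m" using dpow_tangent[OF assms(1), of c x] c assms by simp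
  have 2: "c powr m + m * dpow m c * (y - c) \<le> y powr m" using dpow_tangent[OF assms(1), of c y] c assms by simp
  have "a * (c powr m + m * dpow m c * (x - c)) + b * (c powr m + m * dpow m c * (y - c))
      \<le> a * x powr m + b * y powr m"
    using 1 2 assms by (intro add_mono mult_left_mono) auto
  moreover have "a * (c powr m + m * dpow m c * (x - c)) + b * (c powr m + m * dpow m c * (y - c))
     = (a + b) * c powr m + m * dpow m c * (a * x + b * y - (a + b) * c)" by (simp add: algebra_simps)
  ultimately show ?thesis using assms by (simp add: c_def[symmetric])
qed

text \<open>By multiplicativity, \<open>dpow m (a + b) - dpow m a = dpow m a * (dpow m (1 + b / a) - 1)\<close>. When \<open>b / a\<close> is small the
  second factor is small by continuity at \<open>1\<close>; otherwise \<open>a\<close> is dominated by \<open>b\<close>. One argument thus serves all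
  \<open>m > 1\<close>, without the usual distinction at \<open>m = 2\<close>.\<close>

lemma dpow_diff_le:
  assumes "1 < m" "0 < \<eta>"
  obtains C where "0 \<le> C" "\<And>a b. \<bar>dpow m (a + b) - dpow m a\<bar> \<le> \<eta> * \<bar>a\<bar> powr (m - 1) + C * \<bar>b\<bar> powr (m - 1)"
proof -
  have "isCont (dpow m) 1" unfolding isCont_def using tendsto_dpow[OF assms(1), of "\<lambda>x. x" 1 "at 1"] by simp
  then obtain \<kappa> where \<kappa>: "\<kappa> > 0" "\<And>x. \<bar>x - 1\<bar> < \<kappa> \<Longrightarrow> \<bar>dpow m x - dpow m 1\<bar> < \<eta>"
    using assms(2) unfolding continuous_at_eps_delta by (auto simp: dist_real_def)
  define C where "C = (1 / \<kappa> + 1) powr (m - 1) + (1 / \<kappa>) powr (m - 1)"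
  show thesis
  proof (rule that[of C])
    show "0 \<le> C" by (simp add: C_def)
    fix a b :: real
    show "\<bar>dpow m (a + b) - dpow m a\<bar> \<le> \<eta> * \<bar>a\<bar> powr (m - 1) + C * \<bar>b\<bar> powr (m - 1)"
    proof (cases "\<bar>b\<bar> < \<kappa> * \<bar>a\<bar>")
      case True
      then have a: "a \<noteq> 0" using \<kappa> by auto
      have "\<bar>(1 + b / a) - 1\<bar> < \<kappa>" using True a by (simp add: abs_divide field_simps)
      then have l: "\<bar>dpow m (1 + b / a) - 1\<bar> \<le> \<eta>" using \<kappa>(2)[of "1 + b / a"] by (simp add: dpow_nonneg)
      have "a + b = a * (1 + b / a)" using a by (simp add: field_simps)
      then have "dpow m (a + b) - dpow m a = dpow m a * (dpow m (1 + b / a) - 1)"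
        by (metis dpow_mult right_diff_distrib mult.right_neutral)
      then have "\<bar>dpow m (a + b) - dpow m a\<bar> = \<bar>a\<bar> powr (m - 1) * \<bar>dpow m (1 + b / a) - 1\<bar>"
        by (simp add: abs_mult abs_dpow)
      also have "\<dots> \<le> \<bar>a\<bar> powr (m - 1) * \<eta>" using l by (intro mult_left_mono) auto
      finally show ?thesis using \<open>0 \<le> C\<close> by (simp add: mult.commute add_increasing2)
    next
      case False
      then have ab: "\<bar>a\<bar> \<le> 1 / \<kappa> * \<bar>b\<bar>" using \<kappa>(1) by (simp add: field_simps)
      have "\<bar>dpow m (a + b) - dpow m a\<bar> \<le> \<bar>a + b\<bar> powr (m - 1) + \<bar>a\<bar> powr (m - 1)"
        by (metis abs_dpow abs_triangle_ineq4)
      also have "\<dots> \<le> ((1 / \<kappa> + 1) * \<bar>b\<bar>) powr (m - 1) + (1 / \<kappa> * \<bar>b\<bar>) powr (m - 1)"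
        using ab assms(1) by (intro add_mono powr_mono2) (auto simp: algebra_simps)
      also have "\<dots> = C * \<bar>b\<bar> powr (m - 1)"
        using \<kappa>(1) by (subst powr_mult, simp, simp, subst powr_mult) (auto simp: C_def distrib_right)
      finally show ?thesis using assms(2) by (simp add: add_increasing)
    qed
  qed
qed

definition in_Lm :: "'b measure \<Rightarrow> real \<Rightarrow> ('b \<Rightarrow> real) \<Rightarrow> bool" where
  "in_Lm M m f \<longleftrightarrow> f \<in> borel_measurable M \<and> integrable M (\<lambda>x. \<bar>f x\<bar> powr m)"

definition pow_integral :: "'b measure \<Rightarrow> real \<Rightarrow> ('b \<Rightarrow> real) \<Rightarrow> real" where
  "pow_integral M m f = (\<integral>x. \<bar>f x\<bar> powr m \<partial>M)"

lemma in_Lm_measurable: "in_Lm M m f \<Longrightarrow> f \<in> borel_measurable M" by (simp add: in_Lm_def)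
lemma in_Lm_integrable: "in_Lm M m f \<Longrightarrow> integrable M (\<lambda>x. \<bar>f x\<bar> powr m)" by (simp add: in_Lm_def)
lemma pow_integral_nonneg: "0 \<le> pow_integral M m f" by (simp add: pow_integral_def)

lemma in_Lm_bound2:
  assumes "in_Lm M m f" "in_Lm M m g" "h \<in> borel_measurable M" "0 < m"
    and "AE x in M. \<bar>h x\<bar> \<le> C * (\<bar>f x\<bar> + \<bar>g x\<bar>)"
  shows "in_Lm M m h"
proof -
  define D where "D = \<bar>C\<bar>"
  have "integrable M (\<lambda>x. D powr m * (2 powr m * (\<bar>f x\<bar> powr m + \<bar>g x\<bar> powr m)))"
    using assms by (auto simp: in_Lm_def)
  moreover have "(\<lambda>x. \<bar>h x\<bar> powr m) \<in> borel_measurable M" using assms(3) by measurable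
  moreover have "AE x in M. norm (\<bar>h x\<bar> powr m) \<le> norm (D powr m * (2 powr m * (\<bar>f x\<bar> powr m + \<bar>g x\<bar> powr m)))"
    using assms(5)
  proof eventually_elim
    fix x assume "\<bar>h x\<bar> \<le> C * (\<bar>f x\<bar> + \<bar>g x\<bar>)"
    also have "\<dots> \<le> D * (\<bar>f x\<bar> + \<bar>g x\<bar>)" unfolding D_def by (intro mult_right_mono) auto
    finally have "\<bar>h x\<bar> powr m \<le> (D * (\<bar>f x\<bar> + \<bar>g x\<bar>)) powr m"
      using assms(4) by (intro powr_mono2) auto
    also have "\<dots> = D powr m * (\<bar>f x\<bar> + \<bar>g x\<bar>) powr m" by (simp add: D_def powr_mult)
    also have "\<dots> \<le> D powr m * (2 powr m * (\<bar>f x\<bar> powr m + \<bar>g x\<bar> powr m))"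
      using assms(4) by (intro mult_left_mono powr_add_le) auto
    finally show "norm (\<bar>h x\<bar> powr m) \<le> norm (D powr m * (2 powr m * (\<bar>f x\<bar> powr m + \<bar>g x\<bar> powr m)))"
      by simp
  qed
  ultimately show ?thesis unfolding in_Lm_def using assms(3) Bochner_Integration.integrable_bound by blast
qed

lemma in_Lm_add: "in_Lm M m f \<Longrightarrow> in_Lm M m g \<Longrightarrow> 0 < m \<Longrightarrow> in_Lm M m (\<lambda>x. f x + g x)"
  by (rule in_Lm_bound2[where f=f and g=g and C=1]) (auto dest!: in_Lm_measurable intro: borel_measurable_add)

lemma in_Lm_cmult: "in_Lm M m f \<Longrightarrow> 0 < m \<Longrightarrow> in_Lm M m (\<lambda>x. c * f x)"
  by (rule in_Lm_bound2[where f=f and g=f and C="\<bar>c\<bar>"]) (auto dest: in_Lm_measurable simp: abs_mult algebra_simps)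

lemma pow_integral_cmult: "pow_integral M m (\<lambda>x. c * f x) = \<bar>c\<bar> powr m * pow_integral M m f"
  by (simp add: pow_integral_def abs_mult powr_mult)

lemma integrable_dpow:
  assumes "in_Lm M m f" "in_Lm M m g" "1 < m"
  shows "integrable M (\<lambda>x. dpow m (f x) * g x)"
proof (rule Bochner_Integration.integrable_bound)
  show "integrable M (\<lambda>x. \<bar>f x\<bar> powr m + \<bar>g x\<bar> powr m)" using assms by (auto simp: in_Lm_def)
  show "(\<lambda>x. dpow m (f x) * g x) \<in> borel_measurable M" using assms(1,2)[THEN in_Lm_measurable] by measurable
  show "AE x in M. norm (dpow m (f x) * g x) \<le> norm (\<bar>f x\<bar> powr m + \<bar>g x\<bar> powr m)"
    using dpow_mult_abs_le[OF assms(3)] by (auto simp del: abs_mult)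
qed

text \<open>The error is nonnegative by the tangent inequality at \<open>f\<close>, and the tangent inequality at \<open>f + h\<close> bounds it by
  \<open>m * (dpow m (f + h) - dpow m f) * h\<close>, to which \<open>dpow_diff_le\<close> applies. The number \<open>\<beta>\<close> stands for any bound of the norm of
  \<open>h\<close>, so that the lemma can be combined with an embedding, and so that \<open>h = 0\<close> needs no separate treatment.\<close>

lemma pow_integral_frechet:
  assumes f: "in_Lm M m f" and m: "1 < m" and \<epsilon>: "0 < \<epsilon>"
  shows "\<exists>\<delta>>0. \<forall>h \<beta>. in_Lm M m h \<longrightarrow> pow_integral M m h \<le> \<beta> powr m \<longrightarrow> 0 < \<beta> \<longrightarrow> \<beta> < \<delta> \<longrightarrow>
       \<bar>pow_integral M m (\<lambda>x. f x + h x) - pow_integral M m f - m * (\<integral>x. dpow m (f x) * h x \<partial>M)\<bar> \<le> \<epsilon> * \<beta>"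
proof -
  define F where "F = pow_integral M m f"
  have F: "0 \<le> F" by (simp add: F_def pow_integral_nonneg)
  define \<eta> where "\<eta> = \<epsilon> / (2 * m * (F + 1))"
  have \<eta>: "0 < \<eta>" using \<epsilon> m F by (simp add: \<eta>_def)
  obtain C where C: "0 \<le> C" "\<And>a b. \<bar>dpow m (a + b) - dpow m a\<bar> \<le> \<eta> * \<bar>a\<bar> powr (m - 1) + C * \<bar>b\<bar> powr (m - 1)"
    using dpow_diff_le[OF m \<eta>] by blast
  \<comment> \<open>Half of the error \<open>\<epsilon>\<close> is reserved for the term with \<open>\<eta>\<close>, the other half for \<open>C * \<beta> powr m\<close>.\<close>
  define \<delta> where "\<delta> = (\<epsilon> / (2 * m * (C + 1))) powr (1 / (m - 1))"
  have base: "0 < \<epsilon> / (2 * m * (C + 1))" using \<epsilon> m C by simp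
  show ?thesis
  proof (intro exI[of _ \<delta>] conjI allI impI)
    show "0 < \<delta>" unfolding \<delta>_def using base by (metis less_irrefl powr_gt_zero)
    fix h \<beta> assume h: "in_Lm M m h" "pow_integral M m h \<le> \<beta> powr m" and \<beta>: "0 < \<beta>" "\<beta> < \<delta>"
    have [measurable]: "f \<in> borel_measurable M" "h \<in> borel_measurable M" using f h by (auto simp: in_Lm_def)
    have fh: "in_Lm M m (\<lambda>x. f x + h x)" using m in_Lm_add[OF f h(1)] by simp
    let ?R = "\<lambda>x. \<bar>f x + h x\<bar> powr m - \<bar>f x\<bar> powr m - m * (dpow m (f x) * h x)"
    let ?B = "\<lambda>x. m * (\<eta> * (\<beta> * (\<bar>f x\<bar> powr m + \<bar>h x\<bar> powr m / \<beta> powr m)) + C * \<bar>h x\<bar> powr m)"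
    have R0: "0 \<le> ?R x" for x using dpow_tangent[OF m, of "f x" "f x + h x"] by simp
    have RB: "?R x \<le> ?B x" for x
    proof -
      have "\<bar>f x + h x\<bar> powr m - \<bar>f x\<bar> powr m \<le> m * dpow m (f x + h x) * h x"
        using dpow_tangent[OF m, of "f x + h x" "f x"] by (simp add: algebra_simps)
      then have "?R x \<le> m * ((dpow m (f x + h x) - dpow m (f x)) * h x)" by (simp add: algebra_simps)
      also have "\<dots> \<le> m * (\<bar>dpow m (f x + h x) - dpow m (f x)\<bar> * \<bar>h x\<bar>)"
        using m by (intro mult_left_mono) (auto simp: abs_mult[symmetric])
      also have "\<dots> \<le> m * ((\<eta> * \<bar>f x\<bar> powr (m - 1) + C * \<bar>h x\<bar> powr (m - 1)) * \<bar>h x\<bar>)"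
        using m C(2)[of "f x" "h x"] by (intro mult_left_mono mult_right_mono) auto
      also have "\<dots> = m * (\<eta> * (\<bar>f x\<bar> powr (m - 1) * \<bar>h x\<bar>) + C * (\<bar>h x\<bar> powr (m - 1) * \<bar>h x\<bar>))"
        by (simp add: algebra_simps)
      also have "\<bar>h x\<bar> powr (m - 1) * \<bar>h x\<bar> = \<bar>h x\<bar> powr m"
        using dpow_mult_self[of m "\<bar>h x\<bar>"] by (simp add: dpow_nonneg)
      also have "\<bar>f x\<bar> powr (m - 1) * \<bar>h x\<bar> = \<beta> * (\<bar>f x\<bar> powr (m - 1) * \<bar>h x / \<beta>\<bar>)" using \<beta> by (simp add: abs_divide)
      also have "m * (\<eta> * (\<beta> * (\<bar>f x\<bar> powr (m - 1) * \<bar>h x / \<beta>\<bar>)) + C * \<bar>h x\<bar> powr m)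
          \<le> m * (\<eta> * (\<beta> * (\<bar>f x\<bar> powr m + \<bar>h x / \<beta>\<bar> powr m)) + C * \<bar>h x\<bar> powr m)"
        using m \<eta> \<beta> C(1) powr_mult_abs_le[OF m, of "f x" "h x / \<beta>"] by (intro mult_left_mono add_mono) auto
      also have "\<bar>h x / \<beta>\<bar> powr m = \<bar>h x\<bar> powr m / \<beta> powr m" using \<beta> by (simp add: abs_divide powr_divide)
      finally show ?thesis .
    qed
    have iR: "integrable M ?R" 
      using f h fh integrable_dpow[OF f h(1) m] by (auto simp: in_Lm_def)
    have iB: "integrable M ?B" using f h by (auto simp: in_Lm_def)
    have e: "pow_integral M m (\<lambda>x. f x + h x) - pow_integral M m f - m * (\<integral>x. dpow m (f x) * h x \<partial>M) = (\<integral>x. ?R x \<partial>M)"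
      using f h fh integrable_dpow[OF f h(1) m] by (auto simp: in_Lm_def pow_integral_def)
    have "(\<integral>x. ?R x \<partial>M) \<le> (\<integral>x. ?B x \<partial>M)" using RB by (intro integral_mono iR iB)
    also have "\<dots> = m * (\<eta> * (\<beta> * (F + pow_integral M m h / \<beta> powr m)) + C * pow_integral M m h)"
      using f h by (auto simp: in_Lm_def pow_integral_def F_def)
    also have "\<dots> \<le> m * (\<eta> * (\<beta> * (F + 1)) + C * \<beta> powr m)"
      using h(2) \<beta> m \<eta> C by (intro mult_left_mono add_mono) (auto simp: field_simps)
    also have "\<dots> = \<epsilon> * \<beta> / 2 + m * C * \<beta> powr (m - 1) * \<beta>"
    proof -
      have "\<beta> powr m = \<beta> powr (m - 1) * \<beta>" using dpow_mult_self[of m \<beta>] \<beta> by (simp add: dpow_nonneg)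
      moreover have "m * (\<eta> * (F + 1)) = \<epsilon> / 2" using m F by (simp add: \<eta>_def add_nonneg_eq_0_iff)
      then have "m * (\<eta> * (\<beta> * (F + 1))) = \<epsilon> * \<beta> / 2" by (metis (no_types, opaque_lifting) mult.assoc mult.commute times_divide_eq_right)
      ultimately show ?thesis by (simp add: algebra_simps)
    qed
    also have "m * C * \<beta> powr (m - 1) * \<beta> \<le> \<epsilon> / 2 * \<beta>"
    proof (rule mult_right_mono)
      have "\<beta> powr (m - 1) \<le> \<delta> powr (m - 1)" using \<beta> m by (intro powr_mono2) auto
      also have "\<dots> = \<epsilon> / (2 * m * (C + 1))" using base m by (simp add: \<delta>_def powr_powr del: abs_divide)
      finally have "m * C * \<beta> powr (m - 1) \<le> m * C * (\<epsilon> / (2 * m * (C + 1)))" using m C by (intro mult_left_mono) auto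
      also have "\<dots> = m / m * (\<epsilon> / 2 * (C / (C + 1)))" by simp
        also have "\<dots> = \<epsilon> / 2 * (C / (C + 1))" using m by simp
      also have "\<dots> \<le> \<epsilon> / 2 * 1" using \<epsilon> C by (intro mult_left_mono) (auto simp: field_simps)
      finally show "m * C * \<beta> powr (m - 1) \<le> \<epsilon> / 2" by simp
    qed (use \<beta> in auto)
    finally have "(\<integral>x. ?R x \<partial>M) \<le> \<epsilon> * \<beta>" by (simp add: mult.commute)
    moreover have "0 \<le> (\<integral>x. ?R x \<partial>M)" using R0 by (simp add: Bochner_Integration.integral_nonneg)
    ultimately show "\<bar>pow_integral M m (\<lambda>x. f x + h x) - pow_integral M m f - m * (\<integral>x. dpow m (f x) * h x \<partial>M)\<bar> \<le> \<epsilon> * \<beta>"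
      unfolding e by simp
  qed
qed

lemma pow_integral_has_derivative:
  assumes f: "in_Lm M m f" and h: "in_Lm M m h" and m: "1 < m"
  shows "((\<lambda>t. pow_integral M m (\<lambda>x. f x + t * h x)) has_real_derivative
           m * (\<integral>x. dpow m (f x + t * h x) * h x \<partial>M)) (at t)"
proof -
  define H where "H = (pow_integral M m h + 1) powr (1 / m)"
  have Hp: "H powr m = pow_integral M m h + 1" and H: "0 < H" 
    using m pow_integral_nonneg[of M m h] by (auto simp: H_def powr_powr)
  define g where "g = (\<lambda>x. f x + t * h x)"
  have m0: "0 < m" using m by simp
  have th: "in_Lm M m (\<lambda>x. t * h x)" by (rule in_Lm_cmult[OF h m0])
  have g: "in_Lm M m g" unfolding g_def by (rule in_Lm_add[OF f th m0])
  define D where "D = m * (\<integral>x. dpow m (g x) * h x \<partial>M)"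
  have "(\<lambda>k. (pow_integral M m (\<lambda>x. f x + (t + k) * h x) - pow_integral M m (\<lambda>x. f x + t * h x)) / k) \<midarrow>0\<rightarrow> D"
  proof (rule LIM_I)
    fix e :: real assume e: "0 < e"
    have eH: "0 < e / (2 * H)" using e H by simp
    obtain \<delta> where \<delta>: "0 < \<delta>"
     "\<forall>h \<beta>. in_Lm M m h \<longrightarrow> pow_integral M m h \<le> \<beta> powr m \<longrightarrow> 0 < \<beta> \<longrightarrow> \<beta> < \<delta> \<longrightarrow>
       \<bar>pow_integral M m (\<lambda>x. g x + h x) - pow_integral M m g - m * (\<integral>x. dpow m (g x) * h x \<partial>M)\<bar> \<le> e / (2 * H) * \<beta>"
      using pow_integral_frechet[OF g m eH] by blast
    show "\<exists>s>0. \<forall>x. x \<noteq> 0 \<and> norm (x - 0) < s \<longrightarrow>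
        norm ((pow_integral M m (\<lambda>xa. f xa + (t + x) * h xa) - pow_integral M m (\<lambda>x. f x + t * h x)) / x - D) < e"
    proof (intro exI[of _ "\<delta> / H"] conjI allI impI)
      show "0 < \<delta> / H" using \<delta> H by simp
      fix k :: real assume k: "k \<noteq> 0 \<and> norm (k - 0) < \<delta> / H"
      have "\<bar>pow_integral M m (\<lambda>x. g x + k * h x) - pow_integral M m g - m * (\<integral>x. dpow m (g x) * (k * h x) \<partial>M)\<bar> \<le> e / (2 * H) * (\<bar>k\<bar> * H)"
      proof (rule \<delta>(2)[rule_format])
        show "in_Lm M m (\<lambda>x. k * h x)" by (rule in_Lm_cmult[OF h m0])
        show "pow_integral M m (\<lambda>x. k * h x) \<le> (\<bar>k\<bar> * H) powr m"
          using H by (simp add: pow_integral_cmult powr_mult Hp mult_left_mono)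
        show "0 < \<bar>k\<bar> * H" "\<bar>k\<bar> * H < \<delta>" using k H by (auto simp: field_simps)
      qed
      also have "e / (2 * H) * (\<bar>k\<bar> * H) = e / 2 * \<bar>k\<bar>" using H by simp
      also have "m * (\<integral>x. dpow m (g x) * (k * h x) \<partial>M) = k * D"
        by (simp add: D_def mult.left_commute)
      finally have *: "\<bar>pow_integral M m (\<lambda>x. g x + k * h x) - pow_integral M m g - k * D\<bar> \<le> e / 2 * \<bar>k\<bar>" .
      have "(\<lambda>x. g x + k * h x) = (\<lambda>x. f x + (t + k) * h x)" by (auto simp: g_def algebra_simps)
      then have eq: "(pow_integral M m (\<lambda>xa. f xa + (t + k) * h xa) - pow_integral M m (\<lambda>x. f x + t * h x)) / k - D
         = (pow_integral M m (\<lambda>x. g x + k * h x) - pow_integral M m g - k * D) / k"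
        using k by (simp add: g_def field_simps)
      have "norm ((pow_integral M m (\<lambda>x. g x + k * h x) - pow_integral M m g - k * D) / k) \<le> e / 2"
        using * k by (simp add: abs_divide field_simps)
      then show "norm ((pow_integral M m (\<lambda>xa. f xa + (t + k) * h xa) - pow_integral M m (\<lambda>x. f x + t * h x)) / k - D) < e"
        unfolding eq using e by linarith
    qed
  qed
  then show ?thesis by (simp add: DERIV_def D_def g_def)
qed

lemma dpow_integral_tendsto:
  assumes m: "1 < m" and H: "in_Lm M m H"
    and [measurable]: "\<And>n. f n \<in> borel_measurable M" "\<And>n. g n \<in> borel_measurable M"
      "f' \<in> borel_measurable M" "g' \<in> borel_measurable M"
    and bf: "\<And>n. AE x in M. \<bar>f n x\<bar> \<le> H x" and bg: "\<And>n. AE x in M. \<bar>g n x\<bar> \<le> H x"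
    and cf: "AE x in M. (\<lambda>n. f n x) \<longlonglongrightarrow> f' x" and cg: "AE x in M. (\<lambda>n. g n x) \<longlonglongrightarrow> g' x"
  shows "(\<lambda>n. \<integral>x. dpow m (f n x) * g n x \<partial>M) \<longlonglongrightarrow> (\<integral>x. dpow m (f' x) * g' x \<partial>M)"
proof (rule integral_dominated_convergence[where w="\<lambda>x. \<bar>H x\<bar> powr m"])
  show "integrable M (\<lambda>x. \<bar>H x\<bar> powr m)" using H by (simp add: in_Lm_def)
  show "AE x in M. (\<lambda>n. dpow m (f n x) * g n x) \<longlonglongrightarrow> dpow m (f' x) * g' x"
    using cf cg by eventually_elim (intro tendsto_mult tendsto_dpow m)
  show "AE x in M. norm (dpow m (f n x) * g n x) \<le> \<bar>H x\<bar> powr m" for n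
    using bf[of n] bg[of n]
  proof eventually_elim
    fix x assume a: "\<bar>f n x\<bar> \<le> H x" "\<bar>g n x\<bar> \<le> H x"
    then have h: "0 \<le> H x" by linarith
    have "norm (dpow m (f n x) * g n x) = \<bar>f n x\<bar> powr (m - 1) * \<bar>g n x\<bar>" by (simp add: abs_mult abs_dpow)
    also have "\<dots> \<le> H x powr (m - 1) * H x" using a h m by (intro mult_mono powr_mono2) auto
    also have "\<dots> = \<bar>H x\<bar> powr m" using h dpow_mult_self[of m "H x"] by (simp add: dpow_nonneg)
    finally show "norm (dpow m (f n x) * g n x) \<le> \<bar>H x\<bar> powr m" .
  qed
qed measurable

lemma integral_fatou:
  fixes f :: "nat \<Rightarrow> 'b \<Rightarrow> real"
  assumes i: "\<And>n. integrable M (f n)" and nn: "\<And>n x. 0 \<le> f n x" and [measurable]: "f' \<in> borel_measurable M"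
    and lim: "AE x in M. (\<lambda>n. f n x) \<longlonglongrightarrow> f' x" and le: "\<And>n. (\<integral>x. f n x \<partial>M) \<le> c n" and c: "c \<longlonglongrightarrow> K"
  shows "integrable M f'" "(\<integral>x. f' x \<partial>M) \<le> K"
proof -
  have [measurable]: "f n \<in> borel_measurable M" for n using i by auto
  have f'0: "AE x in M. 0 \<le> f' x" using lim by eventually_elim (rule LIMSEQ_le_const, auto simp: nn)
  have K: "0 \<le> K" by (rule LIMSEQ_le_const[OF c]) (use le nn in \<open>meson Bochner_Integration.integral_nonneg order_trans\<close>)
  have "(\<integral>\<^sup>+x. ennreal (f' x) \<partial>M) = (\<integral>\<^sup>+x. liminf (\<lambda>n. ennreal (f n x)) \<partial>M)"
    by (rule nn_integral_cong_AE, use lim in eventually_elim)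
      (rule lim_imp_Liminf[symmetric], auto intro: tendsto_ennrealI)
  also have "\<dots> \<le> liminf (\<lambda>n. \<integral>\<^sup>+x. ennreal (f n x) \<partial>M)" by (rule nn_integral_liminf) measurable
  also have "\<dots> \<le> liminf (\<lambda>n. ennreal (c n))"
    using le nn i by (intro Liminf_mono always_eventually) (simp add: nn_integral_eq_integral ennreal_leI)
  also have "\<dots> = ennreal K" using c by (intro lim_imp_Liminf) (auto intro: tendsto_ennrealI)
  finally have le: "(\<integral>\<^sup>+x. ennreal (f' x) \<partial>M) \<le> ennreal K" .
  then have fin: "(\<integral>\<^sup>+x. ennreal (f' x) \<partial>M) < \<infinity>" by (simp add: le_less_trans top.not_eq_extremum)
  show i': "integrable M f'" using f'0 fin by (intro integrableI_nonneg) auto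
  show "(\<integral>x. f' x \<partial>M) \<le> K" using le K f'0 i' by (simp add: nn_integral_eq_integral)
qed

text \<open>Boundedness in the higher power makes the \<open>m\<close>-th powers uniformly integrable: cutting them off at height \<open>R\<close>
  changes the integrals by at most \<open>K * R powr ((m - m') / m)\<close>, and the cut-off functions converge by domination.\<close>

lemma pow_integral_vitali:
  assumes fin: "finite_measure M" and m: "0 < m" "m < m'"
    and f: "\<And>n. in_Lm M m' (f n)" and K: "\<And>n. pow_integral M m' (f n) \<le> K"
    and [measurable]: "f' \<in> borel_measurable M" and lim: "AE x in M. (\<lambda>n. f n x) \<longlonglongrightarrow> f' x"
  shows "in_Lm M m' f'" "(\<lambda>n. pow_integral M m (f n)) \<longlonglongrightarrow> pow_integral M m f'"
proof -
  interpret finite_measure M by fact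
  have [measurable]: "f n \<in> borel_measurable M" for n using f by (auto simp: in_Lm_def)
  have lim': "AE x in M. (\<lambda>n. \<bar>f n x\<bar> powr e) \<longlonglongrightarrow> \<bar>f' x\<bar> powr e" if "0 < e" for e
    using lim by eventually_elim (intro tendsto_powr' tendsto_intros, use that in auto)
  have m': "0 < m'" using m by simp
  have fat: "integrable M (\<lambda>x. \<bar>f' x\<bar> powr m')" "(\<integral>x. \<bar>f' x\<bar> powr m' \<partial>M) \<le> K"
    using integral_fatou[of M "\<lambda>n x. \<bar>f n x\<bar> powr m'" "\<lambda>x. \<bar>f' x\<bar> powr m'" "\<lambda>n. K" K] f K lim'[OF m']
    by (auto simp: in_Lm_def pow_integral_def)
  then show f': "in_Lm M m' f'" by (simp add: in_Lm_def)
  have K0: "0 \<le> K" using K pow_integral_nonneg order_trans by blast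
  have low: "in_Lm M m g" if "in_Lm M m' g" for g
  proof -
    have [measurable]: "g \<in> borel_measurable M" using that by (simp add: in_Lm_def)
    have "integrable M (\<lambda>x. 1 + \<bar>g x\<bar> powr m')" using that by (auto simp: in_Lm_def)
    moreover have "\<bar>g x\<bar> powr m \<le> 1 + \<bar>g x\<bar> powr m'" for x
    proof (cases "\<bar>g x\<bar> \<le> 1")
      case True
      then have "\<bar>g x\<bar> powr m \<le> 1" using m by (intro powr_le1) auto
      then show ?thesis by (simp add: add_increasing2)
    next
      case False
      then have "\<bar>g x\<bar> powr m \<le> \<bar>g x\<bar> powr m'" using m by (intro powr_mono) auto
      then show ?thesis by simp
    qed
    ultimately have "integrable M (\<lambda>x. \<bar>g x\<bar> powr m)"
      by (elim Bochner_Integration.integrable_bound) auto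
    then show ?thesis by (simp add: in_Lm_def)
  qed
  define tr where "tr R g = (\<lambda>x. min (\<bar>g x\<bar> powr m) R)" for R :: real and g :: "'a \<Rightarrow> real"
  have tail: "\<bar>pow_integral M m g - (\<integral>x. tr R g x \<partial>M)\<bar> \<le> K * R powr ((m - m') / m)"
    if g: "in_Lm M m' g" "pow_integral M m' g \<le> K" and R: "0 < R" for R g
  proof -
    have [measurable]: "g \<in> borel_measurable M" using g by (simp add: in_Lm_def)
    have ig: "integrable M (\<lambda>x. \<bar>g x\<bar> powr m)" by (rule in_Lm_integrable[OF low[OF g(1)]])
    have it: "integrable M (tr R g)" unfolding tr_def
    proof (rule Bochner_Integration.integrable_bound[OF ig])
      show "AE x in M. norm (min (\<bar>g x\<bar> powr m) R) \<le> norm (\<bar>g x\<bar> powr m)"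
        using R by (intro AE_I2) (simp add: min_def)
    qed measurable
    have pt: "\<bar>g x\<bar> powr m - tr R g x \<le> \<bar>g x\<bar> powr m' * R powr ((m - m') / m)" for x
    proof (cases "\<bar>g x\<bar> powr m \<le> R")
      case True then show ?thesis by (simp add: tr_def)
    next
      case False
      then have gx: "0 < \<bar>g x\<bar>" using R by (cases "g x = 0") auto
      have "\<bar>g x\<bar> powr m = \<bar>g x\<bar> powr m' * (\<bar>g x\<bar> powr m) powr ((m - m') / m)"
      proof -
        have "(\<bar>g x\<bar> powr m) powr ((m - m') / m) = \<bar>g x\<bar> powr (m - m')" using m by (simp add: powr_powr)
        then show ?thesis by (simp add: powr_add[symmetric])
      qed
      also have "\<dots> \<le> \<bar>g x\<bar> powr m' * R powr ((m - m') / m)"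
        using False R m by (intro mult_left_mono powr_mono2') (auto simp: field_simps)
      finally have a: "\<bar>g x\<bar> powr m \<le> \<bar>g x\<bar> powr m' * R powr ((m - m') / m)" .
      have "0 \<le> tr R g x" using R by (simp add: tr_def)
      then show ?thesis using a by linarith
    qed
    have "pow_integral M m g - (\<integral>x. tr R g x \<partial>M) = (\<integral>x. \<bar>g x\<bar> powr m - tr R g x \<partial>M)"
      unfolding pow_integral_def by (rule Bochner_Integration.integral_diff[OF ig it, symmetric])
    moreover have "0 \<le> (\<integral>x. \<bar>g x\<bar> powr m - tr R g x \<partial>M)" by (intro Bochner_Integration.integral_nonneg) (simp add: tr_def)
    moreover have "(\<integral>x. \<bar>g x\<bar> powr m - tr R g x \<partial>M) \<le> (\<integral>x. \<bar>g x\<bar> powr m' * R powr ((m - m') / m) \<partial>M)"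
    proof (rule integral_mono)
      show "integrable M (\<lambda>x. \<bar>g x\<bar> powr m - tr R g x)"
        by (rule Bochner_Integration.integrable_diff[OF ig it])
      show "integrable M (\<lambda>x. \<bar>g x\<bar> powr m' * R powr ((m - m') / m))"
        using in_Lm_integrable[OF g(1)] by simp
    qed (rule pt)
    moreover have "(\<integral>x. \<bar>g x\<bar> powr m' * R powr ((m - m') / m) \<partial>M) = pow_integral M m' g * R powr ((m - m') / m)"
      by (simp add: pow_integral_def)
    moreover have "pow_integral M m' g * R powr ((m - m') / m) \<le> K * R powr ((m - m') / m)" using g by (intro mult_right_mono) auto
    ultimately show ?thesis by linarith
  qed
  show "(\<lambda>n. pow_integral M m (f n)) \<longlonglongrightarrow> pow_integral M m f'"
  proof (rule LIMSEQ_I)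
    fix e :: real assume e: "0 < e"
    have "((\<lambda>R. K * R powr ((m - m') / m)) \<longlongrightarrow> K * 0) at_top"
      using m by (intro tendsto_mult tendsto_const tendsto_neg_powr filterlim_ident) (auto simp: field_simps)
    then have "\<forall>\<^sub>F R in at_top. K * R powr ((m - m') / m) < e / 3"
      using e order_tendstoD(2)[of "\<lambda>R. K * R powr ((m - m') / m)" 0 at_top "e / 3"] by simp
    then have "\<forall>\<^sub>F R in at_top. K * R powr ((m - m') / m) < e / 3 \<and> 0 < R"
      using eventually_gt_at_top[of "0::real"] by eventually_elim auto
    then obtain R where R: "0 < R" "K * R powr ((m - m') / m) < e / 3"
      using eventually_happens'[OF trivial_limit_at_top_linorder] by blast
    have "(\<lambda>n. \<integral>x. tr R (f n) x \<partial>M) \<longlonglongrightarrow> (\<integral>x. tr R f' x \<partial>M)"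
    proof (rule integral_dominated_convergence[where w="\<lambda>x. R"])
      show "(\<lambda>x. tr R f' x) \<in> borel_measurable M" "(\<lambda>x. tr R (f n) x) \<in> borel_measurable M" for n
        unfolding tr_def by measurable
      show "AE x in M. norm (tr R (f n) x) \<le> R" for n using R by (simp add: tr_def)
      show "AE x in M. (\<lambda>n. tr R (f n) x) \<longlonglongrightarrow> tr R f' x"
        using lim'[OF m(1)] by eventually_elim (simp add: tr_def tendsto_min)
    qed simp
    then obtain n0 where n0: "\<And>n. n \<ge> n0 \<Longrightarrow> norm ((\<integral>x. tr R (f n) x \<partial>M) - (\<integral>x. tr R f' x \<partial>M)) < e / 3"
      using e LIMSEQ_D[of "\<lambda>n. \<integral>x. tr R (f n) x \<partial>M" _ "e / 3"] by auto
    show "\<exists>no. \<forall>n\<ge>no. norm (pow_integral M m (f n) - pow_integral M m f') < e"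
    proof (intro exI allI impI)
      fix n assume "n0 \<le> n"
      then show "norm (pow_integral M m (f n) - pow_integral M m f') < e"
        using n0[of n] tail[OF f[of n] K[of n] R(1)] tail[OF f' _ R(1)] fat(2) R(2)
        unfolding real_norm_def pow_integral_def by linarith
    qed
  qed
qed

section \<open>The Gagliardo seminorm as an integral over pairs\<close>

text \<open>Lebesgue measure on pairs is the completion of the product measure, so a null set in one variable has to be
  enlarged to a Borel null set before Fubini applies.\<close>

lemma AE_lebesgue_fst:
  fixes P :: "'a::euclidean_space \<Rightarrow> bool"
  assumes "AE x in lebesgue. P x"
  shows "AE z in (lebesgue :: ('a \<times> 'b::euclidean_space) measure). P (fst z)"
proof -
  have "AE x in lborel. P x" using assms by (simp add: AE_completion_iff)
  then obtain N where N: "N \<in> null_sets lborel" "{x. \<not> P x} \<subseteq> N"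
    by (auto elim!: AE_E simp: null_sets_def)
  have "emeasure (lborel \<Otimes>\<^sub>M lborel) (N \<times> (UNIV::'b set)) = 0"
    using N(1) by (subst lborel.emeasure_pair_measure_Times) (auto simp: null_sets_def)
  then have "N \<times> (UNIV::'b set) \<in> null_sets (lborel \<Otimes>\<^sub>M lborel)"
    using N(1) by (intro null_setsI) (auto simp: null_sets_def)
  then have "N \<times> (UNIV::'b set) \<in> null_sets lborel" by (simp add: lborel_prod)
  then have "AE z in (lborel :: ('a \<times> 'b) measure). P (fst z)"
    by (rule AE_I') (use N(2) in auto)
  then show ?thesis by (simp add: AE_completion_iff)
qed

lemma AE_lebesgue_snd:
  fixes P :: "'b::euclidean_space \<Rightarrow> bool"
  assumes "AE x in lebesgue. P x"
  shows "AE z in (lebesgue :: ('a::euclidean_space \<times> 'b) measure). P (snd z)"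
proof -
  have "AE x in lborel. P x" using assms by (simp add: AE_completion_iff)
  then obtain N where N: "N \<in> null_sets lborel" "{x. \<not> P x} \<subseteq> N"
    by (auto elim!: AE_E simp: null_sets_def)
  have "emeasure (lborel \<Otimes>\<^sub>M lborel) ((UNIV::'a set) \<times> N) = 0"
    using N(1) by (subst lborel.emeasure_pair_measure_Times) (auto simp: null_sets_def)
  then have "(UNIV::'a set) \<times> N \<in> null_sets (lborel \<Otimes>\<^sub>M lborel)"
    using N(1) by (intro null_setsI) (auto simp: null_sets_def)
  then have "(UNIV::'a set) \<times> N \<in> null_sets lborel" by (simp add: lborel_prod)
  then have "AE z in (lborel :: ('a \<times> 'b) measure). P (snd z)"
    by (rule AE_I') (use N(2) in auto)
  then show ?thesis by (simp add: AE_completion_iff)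
qed

lemma lebesgue_measurable_AE_eq:
  fixes f g :: "'a::euclidean_space \<Rightarrow> real"
  assumes g: "g \<in> borel_measurable lebesgue" and eq: "AE x in lebesgue. f x = g x"
  shows "f \<in> borel_measurable lebesgue"
proof -
  obtain N where N: "N \<in> null_sets lebesgue" "\<And>x. x \<in> space lebesgue - N \<Longrightarrow> f x = g x"
    using AE_E3[OF eq] by blast
  have "g \<in> borel_measurable (lebesgue_on (- N))" using g N(1) lebesgue_measurable_diff_null by blast
  then have "f \<in> borel_measurable (lebesgue_on (- N))"
    by (rule measurable_cong[THEN iffD1, rotated]) (use N(2) in auto)
  then show ?thesis using N(1) lebesgue_measurable_diff_null by blast
qed

lemma lebesgue_ex_borel:
  fixes u :: "'a::euclidean_space \<Rightarrow> real"
  assumes "u \<in> borel_measurable lebesgue"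
  obtains v where "v \<in> borel_measurable borel" "AE x in lebesgue. u x = v x"
  using completion_ex_borel_measurable_real[OF assms] by (auto simp: AE_completion_iff)

lemma measurable_lebesgue_fst:
  fixes u :: "'a::euclidean_space \<Rightarrow> real"
  assumes "u \<in> borel_measurable lebesgue"
  shows "(\<lambda>z. u (fst z)) \<in> borel_measurable (lebesgue :: ('a \<times> 'b::euclidean_space) measure)"
proof -
  obtain v where v[measurable]: "v \<in> borel_measurable borel" and eq: "AE x in lebesgue. u x = v x"
    using lebesgue_ex_borel[OF assms] by blast
  have "(\<lambda>z::'a\<times>'b. v (fst z)) \<in> borel_measurable borel" by (simp add: borel_prod[symmetric])
  then have "(\<lambda>z::'a\<times>'b. v (fst z)) \<in> borel_measurable lebesgue" by (simp add: measurable_completion)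
  then show ?thesis by (rule lebesgue_measurable_AE_eq) (rule AE_lebesgue_fst[OF eq])
qed

lemma measurable_lebesgue_snd:
  fixes u :: "'b::euclidean_space \<Rightarrow> real"
  assumes "u \<in> borel_measurable lebesgue"
  shows "(\<lambda>z. u (snd z)) \<in> borel_measurable (lebesgue :: ('a::euclidean_space \<times> 'b) measure)"
proof -
  obtain v where v[measurable]: "v \<in> borel_measurable borel" and eq: "AE x in lebesgue. u x = v x"
    using lebesgue_ex_borel[OF assms] by blast
  have "(\<lambda>z::'a\<times>'b. v (snd z)) \<in> borel_measurable borel" by (simp add: borel_prod[symmetric])
  then have "(\<lambda>z::'a\<times>'b. v (snd z)) \<in> borel_measurable lebesgue" by (simp add: measurable_completion)
  then show ?thesis by (rule lebesgue_measurable_AE_eq) (rule AE_lebesgue_snd[OF eq])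
qed

text \<open>Functions on pairs of points: \<open>dif u\<close> collects the increments of \<open>u\<close>, and the singular kernel is made part of the measure,
  so that the Gagliardo seminorm is the \<open>L\<^sup>p\<close> norm of a linear image of \<open>u\<close>.\<close>

definition dif :: "('a \<Rightarrow> real) \<Rightarrow> 'a \<times> 'a \<Rightarrow> real" where
  "dif u z = u (fst z) - u (snd z)"

definition gagliardo_measure :: "real \<Rightarrow> real \<Rightarrow> ('a::euclidean_space \<times> 'a) measure" where
  "gagliardo_measure s p = density lebesgue (\<lambda>z. ennreal (1 / norm (fst z - snd z) powr (real DIM('a) + p * s)))"

definition weighted_measure :: "'a::euclidean_space set \<Rightarrow> real \<Rightarrow> 'a measure" where
  "weighted_measure \<Omega> \<alpha> = density lebesgue (\<lambda>x. ennreal (indicator \<Omega> x * norm x powr (- \<alpha>)))"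

lemma dif_measurable:
  fixes u :: "'a::euclidean_space \<Rightarrow> real"
  shows "u \<in> borel_measurable lebesgue \<Longrightarrow> dif u \<in> borel_measurable lebesgue"
  unfolding dif_def[abs_def]
  by (intro borel_measurable_diff measurable_lebesgue_fst measurable_lebesgue_snd)

lemma kernel_measurable:
  "(\<lambda>z::'a::euclidean_space \<times> 'a. 1 / norm (fst z - snd z) powr e) \<in> borel_measurable lebesgue"
proof -
  have "(\<lambda>z::'a \<times> 'a. 1 / norm (fst z - snd z) powr e) \<in> borel_measurable borel"
    by (simp add: borel_prod[symmetric])
  then show ?thesis by (simp add: measurable_completion)
qed

lemma weight_measurable:
  assumes "open \<Omega>"
  shows "(\<lambda>x::'a::euclidean_space. indicator \<Omega> x * norm x powr (- \<alpha>) :: real) \<in> borel_measurable lebesgue"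
proof -
  have [measurable]: "\<Omega> \<in> sets borel" using assms by simp
  have "(\<lambda>x::'a. indicator \<Omega> x * norm x powr (- \<alpha>) :: real) \<in> borel_measurable borel" by measurable
  then show ?thesis by (simp add: measurable_completion)
qed

lemma sets_gagliardo_measure [simp, measurable_cong]: "sets (gagliardo_measure s p) = sets lebesgue"
  by (simp add: gagliardo_measure_def)
lemma sets_weighted_measure [simp, measurable_cong]: "sets (weighted_measure \<Omega> \<alpha>) = sets lebesgue"
  by (simp add: weighted_measure_def)
lemma measurable_gagliardo_measure: "f \<in> borel_measurable (gagliardo_measure s p) \<longleftrightarrow> f \<in> borel_measurable lebesgue"
  by (rule measurable_cong_sets[THEN arg_cong[where f="\<lambda>A. f \<in> A"]]) auto
lemma measurable_weighted_measure: "f \<in> borel_measurable (weighted_measure \<Omega> \<alpha>) \<longleftrightarrow> f \<in> borel_measurable lebesgue"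
  by (rule measurable_cong_sets[THEN arg_cong[where f="\<lambda>A. f \<in> A"]]) auto

lemma AE_gagliardo_measure: "AE z in lebesgue. P z \<Longrightarrow> AE z in gagliardo_measure s p. P z"
  unfolding gagliardo_measure_def using kernel_measurable by (subst AE_density) (auto simp: measurable_compose[OF _ measurable_ennreal])

lemma AE_weighted_measure: "open \<Omega> \<Longrightarrow> AE z in lebesgue. P z \<Longrightarrow> AE z in weighted_measure \<Omega> \<alpha>. P z"
  unfolding weighted_measure_def using weight_measurable by (subst AE_density) (auto simp: measurable_compose[OF _ measurable_ennreal])

lemma AE_gagliardo_measure_dif:
  assumes "AE x in lebesgue. P x"
  shows "AE z in gagliardo_measure s p. P (fst z) \<and> P (snd z)"
  using AE_gagliardo_measure[OF AE_lebesgue_fst[OF assms]] AE_gagliardo_measure[OF AE_lebesgue_snd[OF assms]] by eventually_elim simp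

lemma gagliardo_quotient_eq:
  fixes u :: "'a::euclidean_space \<Rightarrow> real"
  shows "gagliardo_quotient s p u = (\<lambda>z. (1 / norm (fst z - snd z) powr (real DIM('a) + p * s)) *\<^sub>R \<bar>dif u z\<bar> powr p)"
  by (auto simp: gagliardo_quotient_def dif_def fun_eq_iff)

lemma integrable_gagliardo_measure_iff:
  fixes f :: "'a::euclidean_space \<times> 'a \<Rightarrow> real"
  assumes "f \<in> borel_measurable lebesgue"
  shows "integrable (gagliardo_measure s p) f \<longleftrightarrow> integrable lebesgue (\<lambda>z. (1 / norm (fst z - snd z) powr (real DIM('a) + p * s)) *\<^sub>R f z)"
  unfolding gagliardo_measure_def using assms by (intro integrable_density kernel_measurable) auto

lemma integral_gagliardo_measure:
  fixes f :: "'a::euclidean_space \<times> 'a \<Rightarrow> real"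
  assumes "f \<in> borel_measurable lebesgue"
  shows "integral\<^sup>L (gagliardo_measure s p) f = integral\<^sup>L lebesgue (\<lambda>z. (1 / norm (fst z - snd z) powr (real DIM('a) + p * s)) *\<^sub>R f z)"
  unfolding gagliardo_measure_def using assms by (intro integral_density kernel_measurable) auto

lemma in_Lm_dif_iff:
  fixes u :: "'a::euclidean_space \<Rightarrow> real"
  assumes u: "u \<in> borel_measurable lebesgue"
  shows "in_Lm (gagliardo_measure s p) p (dif u) \<longleftrightarrow> integrable lebesgue (gagliardo_quotient s p u)"
proof -
  have [measurable]: "dif u \<in> borel_measurable lebesgue" by (rule dif_measurable[OF u])
  have "(\<lambda>z. \<bar>dif u z\<bar> powr p) \<in> borel_measurable lebesgue" by measurable
  then show ?thesis using dif_measurable[OF u]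
    by (simp add: in_Lm_def measurable_gagliardo_measure integrable_gagliardo_measure_iff gagliardo_quotient_eq)
qed

lemma gagliardo_pow_eq:
  fixes u :: "'a::euclidean_space \<Rightarrow> real"
  assumes u: "u \<in> borel_measurable lebesgue"
  shows "gagliardo_pow s p u = pow_integral (gagliardo_measure s p) p (dif u)"
proof -
  have [measurable]: "dif u \<in> borel_measurable lebesgue" by (rule dif_measurable[OF u])
  have "(\<lambda>z. \<bar>dif u z\<bar> powr p) \<in> borel_measurable lebesgue" by measurable
  then show ?thesis by (simp add: pow_integral_def gagliardo_pow_def integral_gagliardo_measure gagliardo_quotient_eq)
qed

lemma gagliardo_pow_nonneg: "0 \<le> gagliardo_pow s p u"
  unfolding gagliardo_pow_def gagliardo_quotient_def by (intro Bochner_Integration.integral_nonneg) auto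

lemma locally_integrable_measurable:
  fixes u :: "'a::euclidean_space \<Rightarrow> real"
  assumes "locally_integrable u" shows "u \<in> borel_measurable lebesgue"
proof (rule borel_measurable_LIMSEQ_real)
  show "(\<lambda>x. indicator (cball 0 (real n)) x *\<^sub>R u x) \<in> borel_measurable lebesgue" for n
  proof -
    have "integrable lebesgue (\<lambda>x. indicator (cball 0 (real n)) x *\<^sub>R u x)"
      using assms compact_cball unfolding locally_integrable_def set_integrable_def by blast
    then show ?thesis by (rule borel_measurable_integrable)
  qed
  fix x :: 'a
  show "(\<lambda>n. indicator (cball 0 (real n)) x *\<^sub>R u x) \<longlonglongrightarrow> u x"
  proof (rule tendsto_eventually)
    obtain n where "norm x \<le> real n" using real_arch_simple by blast
    then show "\<forall>\<^sub>F n in sequentially. indicator (cball 0 (real n)) x *\<^sub>R u x = u x"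
      by (auto simp: eventually_sequentially indicator_def intro!: exI[of _ n])
  qed
qed

locale frac =
  fixes s p :: real and \<Omega> :: "'a::euclidean_space set"
  assumes s0: "0 < s" and s1: "s < 1" and p1: "1 < p" and psN: "p * s < real DIM('a)"
    and open_\<Omega>: "open \<Omega>" and bounded_\<Omega>: "bounded \<Omega>" and zero_\<Omega>: "0 \<in> \<Omega>"
begin

abbreviation "K0 \<equiv> (gagliardo_measure s p :: ('a \<times> 'a) measure)"
abbreviation "W \<equiv> W0 s p \<Omega>"
abbreviation "A \<equiv> (gagliardo_pow s p :: ('a \<Rightarrow> real) \<Rightarrow> real)"

lemma p0: "0 < p" using p1 by simp

lemma W_measurable: "u \<in> W \<Longrightarrow> u \<in> borel_measurable lebesgue"
  by (simp add: W0_def locally_integrable_measurable)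

lemma W_vanish: "u \<in> W \<Longrightarrow> AE x in lebesgue. x \<notin> \<Omega> \<longrightarrow> u x = 0"
  by (simp add: W0_def)

lemma W_dif: "u \<in> W \<Longrightarrow> in_Lm K0 p (dif u)"
  using W_measurable[of u] by (simp add: W0_def in_Lm_dif_iff)

lemma A_eq: "u \<in> W \<Longrightarrow> A u = pow_integral K0 p (dif u)"
  by (simp add: gagliardo_pow_eq W_measurable)

lemma W_integrable:
  assumes "u \<in> W" shows "integrable lebesgue u"
proof -
  have "compact (closure \<Omega>)" using bounded_\<Omega> by (simp add: compact_closure)
  then have i: "integrable lebesgue (\<lambda>x. indicator (closure \<Omega>) x *\<^sub>R u x)"
    using assms by (auto simp: W0_def locally_integrable_def set_integrable_def)
  have "AE x in lebesgue. u x = indicator (closure \<Omega>) x *\<^sub>R u x"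
    using W_vanish[OF assms] by eventually_elim (use closure_subset[of \<Omega>] in \<open>auto simp: indicator_def\<close>)
  then show ?thesis using i integrable_cong_AE[OF W_measurable[OF assms] borel_measurable_integrable[OF i]] by blast
qed

lemma W_intro:
  assumes "integrable lebesgue u" "AE x in lebesgue. x \<notin> \<Omega> \<longrightarrow> u x = 0" "in_Lm K0 p (dif u)"
  shows "u \<in> W"
proof -
  have m: "u \<in> borel_measurable lebesgue" using assms by auto
  have "locally_integrable u" unfolding locally_integrable_def set_integrable_def
    by (intro allI impI integrable_mult_indicator assms(1)) (auto dest: compact_imp_closed)
  then show ?thesis using assms m by (simp add: W0_def in_Lm_dif_iff)
qed

text \<open>All closure properties of the space come from this comparison: linear combinations, truncations
  and the test function of Picone's inequality have increments controlled by those of two members.\<close>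

lemma W_bound2:
  assumes u: "u \<in> W" and v: "v \<in> W" and g: "g \<in> borel_measurable lebesgue"
    and d: "\<And>x y. \<bar>g x - g y\<bar> \<le> C * (\<bar>u x - u y\<bar> + \<bar>v x - v y\<bar>)"
    and b: "\<And>x. \<bar>g x\<bar> \<le> C * (\<bar>u x\<bar> + \<bar>v x\<bar>)"
  shows "g \<in> W"
proof (rule W_intro)
  show "integrable lebesgue g"
    by (rule Bochner_Integration.integrable_bound[of _ "\<lambda>x. C * (\<bar>u x\<bar> + \<bar>v x\<bar>)"])
      (use W_integrable[OF u] W_integrable[OF v] g in \<open>auto intro!: AE_I2 order_trans[OF b]\<close>)
  show "AE x in lebesgue. x \<notin> \<Omega> \<longrightarrow> g x = 0"
    using W_vanish[OF u] W_vanish[OF v]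
  proof eventually_elim
    case (elim x)
    then show ?case using b[of x] by auto
  qed
  show "in_Lm K0 p (dif g)"
    by (rule in_Lm_bound2[OF W_dif[OF u] W_dif[OF v]])
      (use dif_measurable[OF g] p0 d in \<open>auto simp: measurable_gagliardo_measure dif_def\<close>)
qed

lemma W_add: "u \<in> W \<Longrightarrow> v \<in> W \<Longrightarrow> (\<lambda>x. u x + v x) \<in> W"
proof (rule W_bound2[of u v _ 1])
  fix x y
  show "\<bar>u x + v x - (u y + v y)\<bar> \<le> 1 * (\<bar>u x - u y\<bar> + \<bar>v x - v y\<bar>)" by simp
  show "\<bar>u x + v x\<bar> \<le> 1 * (\<bar>u x\<bar> + \<bar>v x\<bar>)" by simp
qed (auto intro!: borel_measurable_add dest: W_measurable)

lemma W_cmult: "u \<in> W \<Longrightarrow> (\<lambda>x. c * u x) \<in> W"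
proof (rule W_bound2[of u u _ "\<bar>c\<bar>"])
  fix x y
  have "\<bar>c * u x - c * u y\<bar> = \<bar>c\<bar> * \<bar>u x - u y\<bar>" by (simp flip: abs_mult right_diff_distrib)
  then show "\<bar>c * u x - c * u y\<bar> \<le> \<bar>c\<bar> * (\<bar>u x - u y\<bar> + \<bar>u x - u y\<bar>)" by (simp add: mult_left_mono)
  show "\<bar>c * u x\<bar> \<le> \<bar>c\<bar> * (\<bar>u x\<bar> + \<bar>u x\<bar>)" by (simp add: abs_mult mult_left_mono)
qed (auto intro!: borel_measurable_times dest: W_measurable)

lemma W_lipschitz:
  assumes u: "u \<in> W" and g: "g \<in> borel_measurable borel" and l: "\<And>a b. \<bar>g a - g b\<bar> \<le> C * \<bar>a - b\<bar>" and 0: "g 0 = (0::real)"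
  shows "(\<lambda>x. g (u x)) \<in> W"
proof (rule W_bound2[OF u u])
  show "(\<lambda>x. g (u x)) \<in> borel_measurable lebesgue" using measurable_compose[OF W_measurable[OF u] g] .
  have C: "0 \<le> C" using l[of 1 0] by simp
  show "\<bar>g (u x) - g (u y)\<bar> \<le> C * (\<bar>u x - u y\<bar> + \<bar>u x - u y\<bar>)" for x y
    using l[of "u x" "u y"] mult_nonneg_nonneg[OF C, of "\<bar>u x - u y\<bar>"] by (simp add: distrib_left)
  show "\<bar>g (u x)\<bar> \<le> C * (\<bar>u x\<bar> + \<bar>u x\<bar>)" for x
    using l[of "u x" 0] 0 mult_nonneg_nonneg[OF C, of "\<bar>u x\<bar>"] by (simp add: distrib_left)
qed

lemma W_abs: "u \<in> W \<Longrightarrow> (\<lambda>x. \<bar>u x\<bar>) \<in> W"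
  by (rule W_lipschitz[of u abs 1]) auto

lemma W_pos: "u \<in> W \<Longrightarrow> (\<lambda>x. max (u x) 0) \<in> W"
  by (rule W_lipschitz[of u "\<lambda>x. max x 0" 1]) auto

lemma W_neg: "u \<in> W \<Longrightarrow> (\<lambda>x. min (u x) 0) \<in> W"
  by (rule W_lipschitz[of u "\<lambda>x. min x 0" 1]) auto

lemma W_cong_AE:
  assumes u: "u \<in> W" and eq: "AE x in lebesgue. v x = u x"
  shows "v \<in> W" "A v = A u"
proof -
  have v: "v \<in> borel_measurable lebesgue" using lebesgue_measurable_AE_eq[OF W_measurable[OF u] eq] .
  have e: "AE z in K0. dif v z = dif u z"
    using AE_gagliardo_measure_dif[OF eq, of s p] by eventually_elim (simp add: dif_def)
  have m: "dif v \<in> borel_measurable K0" "dif u \<in> borel_measurable K0"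
    using dif_measurable[OF v] dif_measurable[OF W_measurable[OF u]] by (auto simp: measurable_gagliardo_measure)
  show "v \<in> W"
  proof (rule W_intro)
    show "integrable lebesgue v" using integrable_cong_AE[OF v W_measurable[OF u] eq] W_integrable[OF u] by simp
    show "AE x in lebesgue. x \<notin> \<Omega> \<longrightarrow> v x = 0" using W_vanish[OF u] eq by eventually_elim simp
    show "in_Lm K0 p (dif v)"
      by (rule in_Lm_bound2[OF W_dif[OF u] W_dif[OF u] m(1) p0, of 1]) (use e in eventually_elim, simp)
  qed
  have "pow_integral K0 p (dif v) = pow_integral K0 p (dif u)" unfolding pow_integral_def
    by (rule integral_cong_AE) (use m e in \<open>auto elim!: eventually_mono\<close>)
  then show "A v = A u" using \<open>v \<in> W\<close> u by (simp add: A_eq)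
qed

lemma W_ex_borel:
  assumes u: "u \<in> W"
  obtains v where "v \<in> borel_measurable borel" "AE x in lebesgue. v x = u x" "v \<in> W" "A v = A u"
proof -
  obtain v where v: "v \<in> borel_measurable borel" "AE x in lebesgue. u x = v x"
    using lebesgue_ex_borel[OF W_measurable[OF u]] by blast
  then have eq: "AE x in lebesgue. v x = u x" by (auto elim!: eventually_mono)
  show thesis using that[OF v(1) eq] W_cong_AE[OF u eq] by blast
qed

lemma A_mono_dif:
  assumes "u \<in> W" "v \<in> W" "\<And>x y. \<bar>u x - u y\<bar> \<le> \<bar>v x - v y\<bar>"
  shows "A u \<le> A v"
  unfolding A_eq[OF assms(1)] A_eq[OF assms(2)] pow_integral_def
  using W_dif[OF assms(1)] W_dif[OF assms(2)] assms(3) p0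
  by (intro integral_mono) (auto simp: in_Lm_def dif_def intro!: powr_mono2)

lemma A_cmult: "u \<in> W \<Longrightarrow> A (\<lambda>x. c * u x) = \<bar>c\<bar> powr p * A u"
proof -
  assume u: "u \<in> W"
  have "dif (\<lambda>x. c * u x) = (\<lambda>z. c * dif u z)" by (auto simp: dif_def algebra_simps)
  then show ?thesis unfolding A_eq[OF u] A_eq[OF W_cmult[OF u]] by (simp add: pow_integral_cmult)
qed

lemma AE_weighted: "AE x in lebesgue. P x \<Longrightarrow> AE x in weighted_measure \<Omega> \<alpha>. P x"
  by (rule AE_weighted_measure[OF open_\<Omega>])

lemma weighted_measure_nonzero_AE:
  assumes "u \<in> W" "AE x in weighted_measure \<Omega> \<alpha>. u x = 0" shows "AE x in lebesgue. u x = 0"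
proof -
  have "AE x in lebesgue. 0 < ennreal (indicator \<Omega> x * norm x powr (- \<alpha>)) \<longrightarrow> u x = 0"
    using assms(2) weight_measurable[OF open_\<Omega>] unfolding weighted_measure_def
    by (subst (asm) AE_density) (auto simp: measurable_compose[OF _ measurable_ennreal])
  moreover have "AE x in lebesgue. x \<noteq> (0::'a)"
    by (simp add: AE_completion AE_lborel_singleton)
  ultimately show ?thesis using W_vanish[OF assms(1)]
    by eventually_elim (auto simp: indicator_def split: if_splits)
qed

lemma pow_integral_weighted:
  assumes "u \<in> borel_measurable lebesgue"
  shows "pow_integral (weighted_measure \<Omega> \<alpha>) m u = (LINT x:\<Omega>|lebesgue. \<bar>u x\<bar> powr m / norm x powr \<alpha>)"
    and "pow_integral (weighted_measure \<Omega> \<alpha>) m u = (LINT x:\<Omega>|lebesgue. \<bar>u x\<bar> powr m * norm x powr (- \<alpha>))"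
proof -
  have "(\<lambda>x. \<bar>u x\<bar> powr m) \<in> borel_measurable lebesgue" using assms by measurable
  then have "pow_integral (weighted_measure \<Omega> \<alpha>) m u = (\<integral>x. (indicator \<Omega> x * norm x powr (- \<alpha>)) *\<^sub>R \<bar>u x\<bar> powr m \<partial>lebesgue)"
    unfolding pow_integral_def weighted_measure_def using weight_measurable[OF open_\<Omega>] by (intro integral_density) auto
  also have "\<dots> = (LINT x:\<Omega>|lebesgue. \<bar>u x\<bar> powr m * norm x powr (- \<alpha>))"
    by (simp add: set_lebesgue_integral_def mult_ac)
  finally show 1: "pow_integral (weighted_measure \<Omega> \<alpha>) m u = (LINT x:\<Omega>|lebesgue. \<bar>u x\<bar> powr m * norm x powr (- \<alpha>))" .
  then show "pow_integral (weighted_measure \<Omega> \<alpha>) m u = (LINT x:\<Omega>|lebesgue. \<bar>u x\<bar> powr m / norm x powr \<alpha>)"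
    by (simp add: powr_minus_divide)
qed

lemma pow_integral_weighted_0:
  assumes "u \<in> borel_measurable lebesgue"
  shows "pow_integral (weighted_measure \<Omega> 0) m u = (LINT x:\<Omega>|lebesgue. \<bar>u x\<bar> powr m)"
proof -
  have [measurable]: "u \<in> borel_measurable lebesgue" "\<Omega> \<in> sets lebesgue" using assms open_\<Omega> by auto
  have "(\<lambda>x. norm x) \<in> borel_measurable (lebesgue :: 'a measure)" by (simp add: measurable_completion)
  then have [measurable]: "(\<lambda>x. norm x powr 0) \<in> borel_measurable (lebesgue :: 'a measure)" by measurable
  have "AE x in lebesgue. x \<noteq> (0::'a)" by (simp add: AE_completion AE_lborel_singleton)
  then show ?thesis unfolding pow_integral_weighted(1)[OF assms] set_lebesgue_integral_def
  proof (intro integral_cong_AE)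
    show "(\<lambda>x. indicator \<Omega> x *\<^sub>R (\<bar>u x\<bar> powr m / norm x powr 0)) \<in> borel_measurable lebesgue"
      "(\<lambda>x. indicator \<Omega> x *\<^sub>R \<bar>u x\<bar> powr m) \<in> borel_measurable lebesgue" by measurable
    show "AE x in lebesgue. indicator \<Omega> x *\<^sub>R (\<bar>u x\<bar> powr m / norm x powr 0) = indicator \<Omega> x *\<^sub>R \<bar>u x\<bar> powr m"
      using \<open>AE x in lebesgue. x \<noteq> (0::'a)\<close> by eventually_elim simp
  qed
qed

end

section \<open>Sobolev embedding into weighted spaces\<close>

lemma dyadic_shell:
  fixes t :: real
  assumes "1 < t"
  obtains k :: nat where "2 ^ k < t" "t \<le> 2 ^ (k + 1)"
proof -
  obtain n :: nat where n: "t < 2 ^ n" using real_arch_pow[of 2 t] by auto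
  then have ex: "\<exists>k::nat. t \<le> 2 ^ (k + 1)"
    by (intro exI[of _ n]) (simp add: order_less_imp_le[OF less_le_trans[OF n]])
  define k where "k = (LEAST k::nat. t \<le> 2 ^ (k + 1))"
  have 1: "t \<le> 2 ^ (k + 1)" unfolding k_def using ex by (rule LeastI_ex)
  have 2: "2 ^ k < t"
  proof (cases k)
    case 0 then show ?thesis using assms by simp
  next
    case (Suc j)
    then have "\<not> t \<le> 2 ^ (j + 1)" unfolding k_def by (metis lessI not_less_Least)
    then show ?thesis using Suc by simp
  qed
  show thesis using that 1 2 by blast
qed

definition unit_ball_measure :: "'a::euclidean_space itself \<Rightarrow> real" where
  "unit_ball_measure _ = measure lborel (ball (0::'a) 1)"

lemma unit_ball_measure_pos: "0 < unit_ball_measure TYPE('a::euclidean_space)"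
  unfolding unit_ball_measure_def using content_ball_pos[of 1 "0::'a"] by simp

lemma emeasure_ball_powr:
  fixes c :: "'a::euclidean_space"
  assumes "0 < r"
  shows "emeasure lborel (ball c r) = ennreal (r powr real DIM('a) * unit_ball_measure TYPE('a))"
proof -
  have "emeasure lebesgue (ball c r) = ennreal (r ^ DIM('a)) * emeasure lebesgue (ball (0::'a) 1)"
    using assms by (intro emeasure_lebesgue_ball_conv_unit_ball) simp
  moreover have "emeasure lborel (ball (0::'a) 1) = ennreal (unit_ball_measure TYPE('a))"
    unfolding unit_ball_measure_def by (rule emeasure_eq_ennreal_measure) (use emeasure_lborel_ball_finite[of "0::'a" 1] in \<open>simp add: less_top[symmetric]\<close>)
  ultimately show ?thesis using assms unit_ball_measure_pos[where 'a='a]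
    by (simp add: powr_realpow ennreal_mult)
qed

text \<open>Radial integrals are estimated by covering the domain by concentric balls \<open>ball 0 (r k)\<close> such that each point lies in
  one on which the integrand is at most \<open>c k\<close>.\<close>

lemma nn_integral_shells:
  fixes f :: "'a::euclidean_space \<Rightarrow> real"
  assumes sh: "\<And>z. z \<in> S \<Longrightarrow> \<exists>k::nat. f z \<le> c k \<and> norm z < r k"
    and c: "\<And>k. 0 \<le> c k" and r: "\<And>k. 0 < r k" and sm: "summable (\<lambda>k. c k * r k powr real DIM('a))"
  shows "(\<integral>\<^sup>+z. ennreal (indicator S z * f z) \<partial>lborel)
     \<le> ennreal (unit_ball_measure TYPE('a) * (\<Sum>k. c k * r k powr real DIM('a)))"
proof -
  let ?w = "unit_ball_measure TYPE('a)"
  have [measurable]: "ball (0::'a) (r k) \<in> sets borel" for k by auto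
  have "(\<integral>\<^sup>+z. ennreal (indicator S z * f z) \<partial>lborel)
      \<le> (\<integral>\<^sup>+z. (\<Sum>k. ennreal (c k) * indicator (ball 0 (r k)) z) \<partial>(lborel :: 'a measure))"
  proof (rule nn_integral_mono)
    fix z :: 'a
    show "ennreal (indicator S z * f z) \<le> (\<Sum>k. ennreal (c k) * indicator (ball 0 (r k)) z)"
    proof (cases "z \<in> S")
      case True
      then obtain k where k: "f z \<le> c k" "norm z < r k" using sh by blast
      have "ennreal (indicator S z * f z) \<le> ennreal (c k) * indicator (ball 0 (r k)) z"
        using k True by (auto intro: ennreal_leI)
      also have "\<dots> = (\<Sum>i\<in>{k}. ennreal (c i) * indicator (ball 0 (r i)) z)"
        by (simp only: sum.insert[OF finite.emptyI] sum.empty empty_iff not_False_eq_True add_0_right)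
      also have "\<dots> \<le> (\<Sum>k. ennreal (c k) * indicator (ball 0 (r k)) z)"
        by (rule sum_le_suminf) auto
      finally show ?thesis .
    qed simp
  qed
  also have "\<dots> = (\<Sum>k. \<integral>\<^sup>+z. ennreal (c k) * indicator (ball 0 (r k)) z \<partial>(lborel :: 'a measure))"
    by (rule nn_integral_suminf) measurable
  also have "\<dots> = (\<Sum>k. ennreal (?w * (c k * r k powr real DIM('a))))"
  proof (rule suminf_cong)
    fix k
    show "(\<integral>\<^sup>+z. ennreal (c k) * indicator (ball 0 (r k)) z \<partial>(lborel :: 'a measure)) = ennreal (?w * (c k * r k powr real DIM('a)))"
      using c[of k] unit_ball_measure_pos[where 'a='a]
      by (subst nn_integral_cmult_indicator) (auto simp: emeasure_ball_powr[OF r] ennreal_mult[symmetric] mult_ac)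
  qed
  also have "\<dots> = ennreal (\<Sum>k. ?w * (c k * r k powr real DIM('a)))"
    using c unit_ball_measure_pos[where 'a='a] sm by (intro suminf_ennreal2) (auto intro: summable_mult)
  also have "\<dots> = ennreal (?w * (\<Sum>k. c k * r k powr real DIM('a)))" using sm by (simp add: suminf_mult)
  finally show ?thesis .
qed

lemma two_powr_nat: "2 powr (real k * a) = (2 powr a) ^ k"
  by (simp add: powr_realpow[symmetric] powr_powr mult.commute)

text \<open>The factor \<open>2 powr \<bar>a\<bar>\<close> covers both signs of \<open>a\<close>, because the power may be largest at either end of a shell.\<close>

lemma nn_integral_norm_powr_ball:
  assumes "a < real DIM('a::euclidean_space)"
  shows "\<exists>C\<ge>0. \<forall>R>0. (\<integral>\<^sup>+z. ennreal (indicator (ball 0 R - {0}) z * norm z powr (- a)) \<partial>(lborel :: 'a measure))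
           \<le> ennreal (C * R powr (real DIM('a) - a))"
proof -
  let ?N = "real DIM('a)" and ?w = "unit_ball_measure TYPE('a)"
  define q where "q = 2 powr (a - ?N)"
  have "2 powr (a - ?N) < 2 powr 0" using assms by (intro powr_less_mono) auto
  then have q: "0 < q" "q < 1" by (auto simp: q_def)
  define C where "C = ?w * (2 powr \<bar>a\<bar> * (\<Sum>k. q ^ k))"
  show ?thesis
  proof (intro exI[of _ C] conjI allI impI)
    show "0 \<le> C" unfolding C_def using unit_ball_measure_pos[where 'a='a] q
      by (intro mult_nonneg_nonneg suminf_nonneg summable_geometric) auto
    fix R :: real assume R: "0 < R"
    define c where "c = (\<lambda>k::nat. R powr (- a) * (2 powr \<bar>a\<bar> * 2 powr (real k * a)))"
    define r where "r = (\<lambda>k::nat. R * 2 powr (- real k))"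
    have cr: "c k * r k powr ?N = (R powr (?N - a) * 2 powr \<bar>a\<bar>) * q ^ k" for k
    proof -
      have "c k * r k powr ?N = (R powr (- a) * R powr ?N) * 2 powr \<bar>a\<bar> * (2 powr (real k * a) * 2 powr (- real k * ?N))"
        using R by (simp add: c_def r_def powr_mult powr_powr mult_ac)
      also have "\<dots> = R powr (?N - a) * 2 powr \<bar>a\<bar> * 2 powr (real k * (a - ?N))"
        by (simp flip: powr_add add: algebra_simps)
      finally show ?thesis by (simp add: two_powr_nat q_def)
    qed
    have "(\<integral>\<^sup>+z. ennreal (indicator (ball 0 R - {0}) z * norm z powr (- a)) \<partial>(lborel :: 'a measure))
        \<le> ennreal (?w * (\<Sum>k. c k * r k powr ?N))"
    proof (rule nn_integral_shells)
      fix z :: 'a assume z: "z \<in> ball 0 R - {0}"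
      define t where "t = R / norm z"
      have t: "1 < t" using z by (simp add: t_def)
      obtain k :: nat where k: "2 ^ k < t" "t \<le> 2 ^ (k + 1)" using dyadic_shell[OF t] by blast
      have k': "2 powr real k < t" "t \<le> 2 powr (real k + 1)" 
        using k by (auto simp: powr_add powr_realpow)
      have "norm z < r k" using z k'(1) by (simp add: r_def t_def powr_minus field_simps)
      moreover have "norm z powr (- a) = R powr (- a) * t powr a"
        using z R by (simp add: t_def powr_divide powr_minus field_simps)
      moreover have "t powr a \<le> 2 powr \<bar>a\<bar> * 2 powr (real k * a)"
      proof (cases "0 \<le> a")
        case True
        then have "t powr a \<le> (2 powr (real k + 1)) powr a" using k'(2) t by (intro powr_mono2) auto
        then show ?thesis using True by (simp add: powr_powr powr_add[symmetric] algebra_simps)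
      next
        case False
        then have "t powr a \<le> (2 powr (real k)) powr a" using k'(1) t by (intro powr_mono2') auto
        also have "\<dots> = 1 * 2 powr (real k * a)" by (simp add: powr_powr)
        also have "\<dots> \<le> 2 powr \<bar>a\<bar> * 2 powr (real k * a)" by (intro mult_right_mono) (auto simp: ge_one_powr_ge_zero)
        finally show ?thesis .
      qed
      ultimately show "\<exists>k. norm z powr (- a) \<le> c k \<and> norm z < r k"
        unfolding c_def by (intro exI[of _ k]) (simp add: mult_left_mono)
    next
      show "summable (\<lambda>k. c k * r k powr ?N)" unfolding cr using q by (intro summable_mult summable_geometric) auto
    qed (use R in \<open>auto simp: c_def r_def\<close>)
    also have "?w * (\<Sum>k. c k * r k powr ?N) = C * R powr (?N - a)"
      unfolding cr C_def using q by (subst suminf_mult) (auto intro!: summable_geometric)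
    finally show "(\<integral>\<^sup>+z. ennreal (indicator (ball 0 R - {0}) z * norm z powr (- a)) \<partial>(lborel :: 'a measure))
           \<le> ennreal (C * R powr (?N - a))" .
  qed
qed

lemma nn_integral_norm_powr_outside:
  assumes "real DIM('a::euclidean_space) < b" "0 < R"
  shows "(\<integral>\<^sup>+z. ennreal (indicator (- cball 0 R) z * norm z powr (- b)) \<partial>(lborel :: 'a measure)) < \<infinity>"
proof -
  let ?N = "real DIM('a)" and ?w = "unit_ball_measure TYPE('a)"
  define q where "q = 2 powr (?N - b)"
  have "2 powr (?N - b) < 2 powr 0" using assms by (intro powr_less_mono) auto
  then have q: "0 < q" "q < 1" by (auto simp: q_def)
  define c where "c = (\<lambda>k::nat. R powr (- b) * 2 powr (- real k * b))"
  \<comment> \<open>One factor \<open>2\<close> more than the outer radius of the shell, to make the inclusion strict.\<close>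
  define r where "r = (\<lambda>k::nat. R * 2 powr (real k + 2))"
  have cr: "c k * r k powr ?N = (R powr (?N - b) * 2 powr (2 * ?N)) * q ^ k" for k
  proof -
    have "c k * r k powr ?N = (R powr (- b) * R powr ?N) * (2 powr (- real k * b) * 2 powr ((real k + 2) * ?N))"
      using assms by (simp add: c_def r_def powr_mult powr_powr mult_ac)
    also have "\<dots> = R powr (?N - b) * 2 powr (2 * ?N + real k * (?N - b))"
      by (simp flip: powr_add add: algebra_simps)
    finally show ?thesis by (simp add: two_powr_nat q_def powr_add)
  qed
  have "(\<integral>\<^sup>+z. ennreal (indicator (- cball 0 R) z * norm z powr (- b)) \<partial>(lborel :: 'a measure))
      \<le> ennreal (?w * (\<Sum>k. c k * r k powr ?N))"
  proof (rule nn_integral_shells)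
    fix z :: 'a assume z: "z \<in> - cball 0 R"
    define t where "t = norm z / R"
    have t: "1 < t" using z assms by (simp add: t_def)
    obtain k :: nat where k: "2 ^ k < t" "t \<le> 2 ^ (k + 1)" using dyadic_shell[OF t] by blast
    have k': "2 powr real k < t" "t \<le> 2 powr (real k + 1)" 
      using k by (auto simp: powr_add powr_realpow)
    have "norm z = R * t" using assms by (simp add: t_def)
    also have "\<dots> \<le> R * 2 powr (real k + 1)" using k' assms by simp
    also have "\<dots> < r k" using assms by (simp add: r_def powr_add)
    finally have 1: "norm z < r k" .
    have "norm z powr (- b) = R powr (- b) * t powr (- b)"
      using \<open>norm z = R * t\<close> assms t by (simp add: powr_mult)
    also have "\<dots> \<le> R powr (- b) * (2 powr real k) powr (- b)"
      using k'(1) assms by (intro mult_left_mono powr_mono2') (auto intro: order_trans)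
    also have "\<dots> = c k" by (simp add: c_def powr_powr)
    finally show "\<exists>k. norm z powr (- b) \<le> c k \<and> norm z < r k" using 1 by blast
  next
    show "summable (\<lambda>k. c k * r k powr ?N)" unfolding cr using q by (intro summable_mult summable_geometric) auto
  qed (use assms in \<open>auto simp: c_def r_def\<close>)
  also have "\<dots> < \<infinity>" by simp
  finally show ?thesis .
qed

text \<open>Split at the radius \<open>\<rho>\<close> of a ball comparable to \<open>E\<close>: inside, integrate the weight; outside, it is at most
  \<open>\<rho> powr - \<alpha>\<close>. Both parts scale like \<open>|E| powr (1 - \<alpha> / N)\<close>.\<close>

lemma emeasure_weighted_measure_le:
  fixes \<Omega> :: "'a::euclidean_space set"
  assumes om: "open \<Omega>" and \<alpha>: "0 \<le> \<alpha>" "\<alpha> < real DIM('a)"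
  shows "\<exists>C\<ge>0. \<forall>E\<in>lmeasurable. emeasure (weighted_measure \<Omega> \<alpha>) E \<le> ennreal (C * measure lebesgue E powr (1 - \<alpha> / real DIM('a)))"
proof -
  let ?N = "real DIM('a)"
  have N: "0 < ?N" by simp
  obtain C where C: "C \<ge> 0" and CR: "\<And>R. R > 0 \<Longrightarrow> (\<integral>\<^sup>+z. ennreal (indicator (ball 0 R - {0}) z * norm z powr (- \<alpha>)) \<partial>(lborel :: 'a measure))
           \<le> ennreal (C * R powr (?N - \<alpha>))"
    using nn_integral_norm_powr_ball[OF \<alpha>(2)] by blast
  show ?thesis
  proof (intro exI[of _ "C + 1"] conjI ballI)
    show "0 \<le> C + 1" using C by simp
    fix E :: "'a set" assume E: "E \<in> lmeasurable"
    have Es: "E \<in> sets lebesgue" using E by auto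
    have em: "emeasure lebesgue E = ennreal (measure lebesgue E)" using E by (simp add: emeasure_eq_measure2)
    have e1: "emeasure (weighted_measure \<Omega> \<alpha>) E = (\<integral>\<^sup>+x. ennreal (indicator \<Omega> x * norm x powr (- \<alpha>)) * indicator E x \<partial>lebesgue)"
      unfolding weighted_measure_def using weight_measurable[OF om] Es by (subst emeasure_density) auto
    show "emeasure (weighted_measure \<Omega> \<alpha>) E \<le> ennreal ((C + 1) * measure lebesgue E powr (1 - \<alpha> / ?N))"
    proof (cases "measure lebesgue E = 0")
      case True
      then have "E \<in> null_sets lebesgue" using em Es by (auto simp: null_sets_def)
      then have "AE x in lebesgue. ennreal (indicator \<Omega> x * norm x powr (- \<alpha>)) * indicator E x = 0"
        by (rule AE_I') (auto simp: indicator_def)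
      then have "emeasure (weighted_measure \<Omega> \<alpha>) E = (\<integral>\<^sup>+x. 0 \<partial>(lebesgue::'a measure))"
        unfolding e1 by (rule nn_integral_cong_AE)
      then show ?thesis by simp
    next
      case False
      define e where "e = measure lebesgue E"
      have e: "0 < e" using False by (simp add: e_def less_le)
      \<comment> \<open>So \<open>\<rho> powr N\<close> is the measure of \<open>E\<close>.\<close>
      define \<rho> where "\<rho> = e powr (1 / ?N)"
      have \<rho>: "0 < \<rho>" using e by (simp add: \<rho>_def)
      have "emeasure (weighted_measure \<Omega> \<alpha>) E \<le> (\<integral>\<^sup>+x. ennreal (indicator (ball 0 \<rho> - {0}) x * norm x powr (- \<alpha>)) + ennreal (\<rho> powr (- \<alpha>)) * indicator E x \<partial>lebesgue)"
        unfolding e1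
      proof (rule nn_integral_mono)
        fix x :: 'a
        show "ennreal (indicator \<Omega> x * norm x powr (- \<alpha>)) * indicator E x
          \<le> ennreal (indicator (ball 0 \<rho> - {0}) x * norm x powr (- \<alpha>)) + ennreal (\<rho> powr (- \<alpha>)) * indicator E x"
        proof (cases "norm x < \<rho>")
          case True
          then show ?thesis by (cases "x = 0") (auto simp: indicator_def)
        next
          case False
          then have "norm x powr (- \<alpha>) \<le> \<rho> powr (- \<alpha>)" using \<rho> \<alpha> by (intro powr_mono2') auto
          then show ?thesis by (auto simp: indicator_def intro: ennreal_leI)
        qed
      qed
      also have "\<dots> = (\<integral>\<^sup>+x. ennreal (indicator (ball 0 \<rho> - {0}) x * norm x powr (- \<alpha>)) \<partial>(lebesgue :: 'a measure)) + ennreal (\<rho> powr (- \<alpha>)) * emeasure lebesgue E"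
      proof -
        have [measurable]: "ball (0::'a) \<rho> - {0} \<in> sets borel" by auto
        have "(\<lambda>x::'a. ennreal (indicator (ball 0 \<rho> - {0}) x * norm x powr (- \<alpha>))) \<in> borel_measurable borel" by measurable
        then have 1: "(\<lambda>x::'a. ennreal (indicator (ball 0 \<rho> - {0}) x * norm x powr (- \<alpha>))) \<in> borel_measurable lebesgue"
          by (simp add: measurable_completion)
        have 2: "(\<lambda>x. ennreal (\<rho> powr (- \<alpha>)) * indicator E x) \<in> borel_measurable lebesgue" using Es by measurable
        show ?thesis unfolding nn_integral_add[OF 1 2] nn_integral_cmult_indicator[OF Es] ..
      qed
      also have "\<dots> \<le> ennreal (C * \<rho> powr (?N - \<alpha>)) + ennreal (\<rho> powr (- \<alpha>)) * ennreal e"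
        unfolding em e_def[symmetric] nn_integral_completion by (intro add_mono CR \<rho> order_refl)
      also have "\<dots> = ennreal (C * \<rho> powr (?N - \<alpha>) + \<rho> powr (- \<alpha>) * e)"
        using C e by (simp add: ennreal_mult[symmetric] ennreal_plus[symmetric] del: ennreal_plus)
      also have "C * \<rho> powr (?N - \<alpha>) + \<rho> powr (- \<alpha>) * e = (C + 1) * e powr (1 - \<alpha> / ?N)"
      proof -
        have "\<rho> powr (?N - \<alpha>) = e powr (1 - \<alpha> / ?N)" by (simp add: \<rho>_def powr_powr diff_divide_distrib)
        moreover have "e powr (1 - \<alpha> / ?N) = e powr 1 * e powr (- (\<alpha> / ?N))" unfolding powr_add[symmetric] by simp
        then have "\<rho> powr (- \<alpha>) * e = e powr (1 - \<alpha> / ?N)" using e by (simp add: \<rho>_def powr_powr)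
        ultimately show ?thesis by (simp add: algebra_simps)
      qed
      finally show ?thesis by (simp add: e_def)
    qed
  qed
qed

context frac
begin

lemma W_ex_borel_supp:
  assumes u: "u \<in> W"
  obtains v where "v \<in> borel_measurable borel" "AE x in lebesgue. v x = u x" "v \<in> W" "A v = A u"
    "\<And>x. x \<notin> \<Omega> \<Longrightarrow> v x = 0"
proof -
  obtain w where w: "w \<in> borel_measurable borel" "AE x in lebesgue. w x = u x" using W_ex_borel[OF u] by blast
  define v where "v = (\<lambda>x. indicator \<Omega> x * w x)"
  have [measurable]: "\<Omega> \<in> sets borel" using open_\<Omega> by simp
  have v: "v \<in> borel_measurable borel" unfolding v_def using w(1) by measurable
  have eq: "AE x in lebesgue. v x = u x"
    using w(2) W_vanish[OF u] by eventually_elim (auto simp: v_def indicator_def)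
  show thesis using that[OF v eq] W_cong_AE[OF u eq] by (auto simp: v_def)
qed

lemma nn_integral_gagliardo:
  assumes u: "u \<in> W" and b: "u \<in> borel_measurable borel"
  shows "(\<integral>\<^sup>+x. \<integral>\<^sup>+y. ennreal (gagliardo_quotient s p u (x, y)) \<partial>lborel \<partial>lborel) = ennreal (A u)"
proof -
  have nn: "0 \<le> gagliardo_quotient s p u z" for z by (simp add: gagliardo_quotient_def split: prod.split)
  have [measurable]: "u \<in> borel_measurable borel" by (rule b)
  have m: "gagliardo_quotient s p u \<in> borel_measurable (borel \<Otimes>\<^sub>M borel)"
    unfolding gagliardo_quotient_def by measurable
  have "(\<integral>\<^sup>+x. \<integral>\<^sup>+y. ennreal (gagliardo_quotient s p u (x, y)) \<partial>lborel \<partial>lborel)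
      = (\<integral>\<^sup>+z. ennreal (gagliardo_quotient s p u z) \<partial>(lborel \<Otimes>\<^sub>M lborel))"
    using m by (intro lborel.nn_integral_fst) (simp add: measurable_compose[OF _ measurable_ennreal])
  also have "\<dots> = (\<integral>\<^sup>+z. ennreal (gagliardo_quotient s p u z) \<partial>lebesgue)"
    by (simp add: lborel_prod nn_integral_completion)
  also have "\<dots> = ennreal (A u)"
    unfolding gagliardo_pow_def using u nn by (intro nn_integral_eq_integral) (auto simp: W0_def)
  finally show ?thesis .
qed

lemma superlevel_lmeasurable:
  fixes u :: "'a \<Rightarrow> real"
  assumes "u \<in> borel_measurable borel" "\<And>x. x \<notin> \<Omega> \<Longrightarrow> u x = 0" "0 \<le> t"
  shows "{x. t < \<bar>u x\<bar>} \<in> lmeasurable" "{x. t < \<bar>u x\<bar>} \<subseteq> \<Omega>" "{x. t < \<bar>u x\<bar>} \<in> sets borel"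
proof -
  show sub: "{x. t < \<bar>u x\<bar>} \<subseteq> \<Omega>"
  proof
    fix x assume x: "x \<in> {x. t < \<bar>u x\<bar>}"
    show "x \<in> \<Omega>" using assms(2)[of x] assms(3) x by (cases "x \<in> \<Omega>") auto
  qed
  show b: "{x. t < \<bar>u x\<bar>} \<in> sets borel" using assms(1) by measurable
  show "{x. t < \<bar>u x\<bar>} \<in> lmeasurable"
    using bounded_subset[OF bounded_\<Omega> sub] b by (intro bounded_set_imp_lmeasurable) auto
qed

text \<open>Choose the radius \<open>R\<close> so that a ball has twice the measure of \<open>{t < \<bar>u\<bar>}\<close>. Around any point with
  \<open>2 * t < \<bar>u\<bar>\<close>, at least half of the ball consists of points with \<open>\<bar>u\<bar> \<le> t\<close>, where the increment exceeds \<open>t\<close>.\<close>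

lemma superlevel_step:
  "\<exists>C>0. \<forall>u t. u \<in> W \<longrightarrow> u \<in> borel_measurable borel \<longrightarrow> (\<forall>x. x \<notin> \<Omega> \<longrightarrow> u x = 0) \<longrightarrow> 0 < t \<longrightarrow>
     measure lebesgue {x. 2 * t < \<bar>u x\<bar>} * t powr p
       \<le> C * A u * measure lebesgue {x. t < \<bar>u x\<bar>} powr (p * s / real DIM('a))"
proof -
  let ?N = "real DIM('a)" and ?w = "unit_ball_measure TYPE('a)"
  define e where "e = ?N + p * s"
  have N: "0 < ?N" by simp
  have e: "0 < e" using N p0 s0 by (simp add: e_def add_pos_pos)
  have w: "0 < ?w" by (rule unit_ball_measure_pos)
  show ?thesis
  proof (intro exI[of _ "(2 / ?w) powr (e / ?N)"] conjI allI impI)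
    show "0 < (2 / ?w) powr (e / ?N)" using w by simp
    fix u t assume u: "u \<in> W" and b: "u \<in> borel_measurable borel" and z: "\<forall>x. x \<notin> \<Omega> \<longrightarrow> u x = 0" and t: "0 < (t::real)"
    define E where "E = {x. t < \<bar>u x\<bar>}"
    define F where "F = {x. 2 * t < \<bar>u x\<bar>}"
    have E: "E \<in> lmeasurable" "E \<in> sets borel" and F: "F \<in> lmeasurable" "F \<in> sets borel"
      unfolding E_def F_def using b z t by (auto intro!: superlevel_lmeasurable)
    have FE: "F \<subseteq> E" using t by (auto simp: E_def F_def)
    define m where "m = measure lebesgue E"
    show "measure lebesgue {x. 2 * t < \<bar>u x\<bar>} * t powr p
       \<le> (2 / ?w) powr (e / ?N) * A u * measure lebesgue {x. t < \<bar>u x\<bar>} powr (p * s / ?N)"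
    proof (cases "m = 0")
      case True
      have "measure lebesgue F \<le> m" unfolding m_def using FE E F by (intro measure_mono_fmeasurable) auto
      then have "measure lebesgue F = 0" using True by (simp add: measure_le_0_iff)
      then show ?thesis by (simp add: F_def gagliardo_pow_nonneg)
    next
      case False
      then have m: "0 < m" by (simp add: m_def less_le)
      \<comment> \<open>A ball of radius \<open>R\<close> has measure \<open>2 * m\<close>.\<close>
      define R where "R = (2 * m / ?w) powr (1 / ?N)"
      have R: "0 < R" using m w by (simp add: R_def)
      have RN: "R powr ?N * ?w = 2 * m" using m w by (simp add: R_def powr_powr)
      define c where "c = t powr p / R powr e"
      have c: "0 \<le> c" by (simp add: c_def)
      have inner: "ennreal (c * m) \<le> (\<integral>\<^sup>+y. ennreal (gagliardo_quotient s p u (x, y)) \<partial>lborel)" if x: "x \<in> F" for x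
      proof -
        have "2 * m = measure lebesgue (ball x R)"
          using emeasure_ball_powr[OF R, of x] RN m by (simp add: measure_def)
        moreover have "measure lebesgue (ball x R) - measure lebesgue E \<le> measure lebesgue (ball x R - E)"
          using E by (intro measure_diff_le_measure_setdiff) auto
        ultimately have "m \<le> measure lebesgue (ball x R - E)" by (simp add: m_def)
        then have "ennreal m \<le> emeasure lborel (ball x R - E)"
          using E emeasure_eq_measure2[of "ball x R - E" lebesgue] by (auto simp: fmeasurable.Diff ennreal_leI)
        then have "ennreal (c * m) \<le> ennreal c * emeasure lborel (ball x R - E)"
          using c m by (simp add: ennreal_mult mult_left_mono)
        also have "\<dots> = (\<integral>\<^sup>+y. ennreal c * indicator (ball x R - E) y \<partial>lborel)"
          using E by (simp add: nn_integral_cmult_indicator)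
        also have "\<dots> \<le> (\<integral>\<^sup>+y. ennreal (gagliardo_quotient s p u (x, y)) \<partial>lborel)"
        proof (rule nn_integral_mono)
          fix y
          show "ennreal c * indicator (ball x R - E) y \<le> ennreal (gagliardo_quotient s p u (x, y))"
          proof (cases "y \<in> ball x R - E")
            case True
            then have d: "norm (x - y) < R" by (simp add: dist_norm)
            have "t \<le> \<bar>u x - u y\<bar>" using x True by (auto simp: F_def E_def)
            then have 1: "t powr p \<le> \<bar>u x - u y\<bar> powr p" using t p0 by (intro powr_mono2) auto
            have xy: "x \<noteq> y" using True x FE by auto
            have "norm (x - y) powr e \<le> R powr e" using d e by (intro powr_mono2) auto
            moreover have "0 < norm (x - y) powr e" using xy by simp
            ultimately have "c \<le> \<bar>u x - u y\<bar> powr p / norm (x - y) powr e"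
              unfolding c_def using 1 by (intro frac_le) auto
            then show ?thesis using True by (simp add: gagliardo_quotient_def e_def ennreal_leI)
          qed simp
        qed
        finally show ?thesis .
      qed
      have "ennreal (measure lebesgue F * (c * m)) = (\<integral>\<^sup>+x. ennreal (c * m) * indicator F x \<partial>lborel)"
      proof -
        have "emeasure lborel F = ennreal (measure lebesgue F)"
          using F emeasure_eq_measure2[of F lebesgue] by simp
        then have "ennreal (measure lebesgue F * (c * m)) = ennreal (c * m) * emeasure lborel F"
          using c m by (simp add: ennreal_mult mult.commute)
        then show ?thesis using F nn_integral_cmult_indicator[of F lborel "ennreal (c * m)"] by simp
      qed
      also have "\<dots> \<le> (\<integral>\<^sup>+x. \<integral>\<^sup>+y. ennreal (gagliardo_quotient s p u (x, y)) \<partial>lborel \<partial>lborel)"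
        by (rule nn_integral_mono) (use inner in \<open>auto simp: indicator_def\<close>)
      also have "\<dots> = ennreal (A u)" by (rule nn_integral_gagliardo[OF u b])
      finally have "measure lebesgue F * (c * m) \<le> A u" by (simp add: gagliardo_pow_nonneg)
      then have "measure lebesgue F * (t powr p) * (m / R powr e) \<le> A u" by (simp add: c_def mult_ac)
      then have "measure lebesgue F * (t powr p) \<le> A u * (R powr e / m)" using m R by (simp add: field_simps)
      also have "R powr e / m = (2 / ?w) powr (e / ?N) * m powr (p * s / ?N)"
      proof -
        have "R powr e = (2 / ?w) powr (e / ?N) * m powr (e / ?N)"
          using m w powr_mult[of "2 / ?w" m "e / ?N"] by (simp add: R_def powr_powr mult.commute)
        moreover have "e / ?N = p * s / ?N + 1" using N by (simp add: e_def field_simps)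
        then have "m powr (e / ?N) = m powr (p * s / ?N) * m" using m by (simp add: powr_add)
        ultimately show ?thesis using m by simp
      qed
      finally show ?thesis by (simp add: E_def F_def m_def mult_ac)
    qed
  qed
qed

text \<open>The critical Sobolev exponent, equal to \<open>crit_exp\<close> at \<open>\<alpha> = 0\<close>.\<close>

definition "pstar = real DIM('a) * p / (real DIM('a) - p * s)"

lemma pstar: "0 < pstar" "pstar * (p * s / real DIM('a)) = pstar - p" "pstar * (1 - p * s / real DIM('a)) = p"
  using psN p0 s0 by (auto simp: pstar_def field_simps)

text \<open>Let \<open>\<phi> t = t powr pstar * |{t < \<bar>u\<bar>}|\<close>. The comparison of heights says \<open>\<phi> (2 t) \<le> C A u (\<phi> t) powr \<theta>\<close> with
  \<open>\<theta> < 1\<close>, by the choice of the exponent. The supremum of \<open>\<phi>\<close> over \<open>{0<..T}\<close> is finite since \<open>\<Omega>\<close> has finite measure, so it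
  can be absorbed into the left-hand side, leaving a bound that does not depend on \<open>T\<close>.\<close>

lemma weak_sobolev:
  "\<exists>C>0. \<forall>u t. u \<in> W \<longrightarrow> u \<in> borel_measurable borel \<longrightarrow> (\<forall>x. x \<notin> \<Omega> \<longrightarrow> u x = 0) \<longrightarrow> 0 < t \<longrightarrow>
     t powr pstar * measure lebesgue {x. t < \<bar>u x\<bar>} \<le> (C * A u) powr (pstar / p)"
proof -
  let ?N = "real DIM('a)"
  define \<theta> where "\<theta> = p * s / ?N"
  have \<theta>: "0 < \<theta>" "\<theta> < 1" using psN p0 s0 by (auto simp: \<theta>_def)
  have th: "1 / (1 - \<theta>) = pstar / p" using \<theta> pstar p0 unfolding \<theta>_def[symmetric] by (simp add: field_simps)
  obtain C where C: "C > 0" and st: "\<And>u t. u \<in> W \<Longrightarrow> u \<in> borel_measurable borel \<Longrightarrow> (\<forall>x. x \<notin> \<Omega> \<longrightarrow> u x = 0) \<Longrightarrow> 0 < t \<Longrightarrow>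
     measure lebesgue {x. 2 * t < \<bar>u x\<bar>} * t powr p \<le> C * A u * measure lebesgue {x. t < \<bar>u x\<bar>} powr \<theta>"
    unfolding \<theta>_def using superlevel_step by blast
  define C' where "C' = 2 powr pstar * C"
  show ?thesis
  proof (intro exI[of _ C'] conjI allI impI)
    show "0 < C'" using C by (simp add: C'_def)
    fix u T assume u: "u \<in> W" and b: "u \<in> borel_measurable borel" and z: "\<forall>x. x \<notin> \<Omega> \<longrightarrow> u x = 0" and T: "0 < (T::real)"
    define \<phi> where "\<phi> = (\<lambda>t. t powr pstar * measure lebesgue {x. t < \<bar>u x\<bar>})"
    have \<phi>0: "0 \<le> \<phi> t" for t by (simp add: \<phi>_def)
    have \<Omega>m: "\<Omega> \<in> lmeasurable" using bounded_\<Omega> open_\<Omega> by (intro bounded_set_imp_lmeasurable) auto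
    have bd: "\<phi> t \<le> T powr pstar * measure lebesgue \<Omega>" if "t \<in> {0<..T}" for t
      unfolding \<phi>_def using that pstar(1) superlevel_lmeasurable[OF b, of t] z \<Omega>m
      by (intro mult_mono powr_mono2 measure_mono_fmeasurable) auto
    \<comment> \<open>Finite because \<open>\<Omega>\<close> is bounded; this is what allows the absorption below.\<close>
    define M where "M = (SUP t\<in>{0<..T}. \<phi> t)"
    have bdd: "bdd_above (\<phi> ` {0<..T})" using bd by (rule bdd_aboveI2)
    have up: "\<phi> t \<le> M" if "t \<in> {0<..T}" for t unfolding M_def using that bdd by (rule cSUP_upper)
    have "\<phi> t \<le> C' * A u * M powr \<theta>" if t: "t \<in> {0<..T}" for t
    proof -
      define h where "h = t / 2"
      have h: "0 < h" "t = 2 * h" "h \<in> {0<..T}" using t by (auto simp: h_def)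
      define mh where "mh = measure lebesgue {x. h < \<bar>u x\<bar>}"
      have "h powr pstar = h powr p * h powr (pstar - p)" by (simp flip: powr_add)
      then have "\<phi> t = 2 powr pstar * h powr (pstar - p) * (measure lebesgue {x. 2 * h < \<bar>u x\<bar>} * h powr p)"
        using h by (simp add: \<phi>_def powr_mult)
      also have "\<dots> \<le> 2 powr pstar * h powr (pstar - p) * (C * A u * mh powr \<theta>)"
        unfolding mh_def using st[OF u b z h(1)] by (intro mult_left_mono) auto
      also have "\<dots> = C' * A u * (h powr (pstar * \<theta>) * mh powr \<theta>)"
        unfolding \<theta>_def pstar(2) C'_def by simp
      also have "h powr (pstar * \<theta>) * mh powr \<theta> = \<phi> h powr \<theta>"
        using h by (simp add: \<phi>_def mh_def powr_mult powr_powr)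
      also have "C' * A u * \<phi> h powr \<theta> \<le> C' * A u * M powr \<theta>"
        using up[OF h(3)] \<phi>0 \<theta> C gagliardo_pow_nonneg[of s p u] by (intro mult_left_mono powr_mono2) (auto simp: C'_def)
      finally show ?thesis .
    qed
    then have MM: "M \<le> C' * A u * M powr \<theta>" unfolding M_def using T by (intro cSUP_least) auto
    have M0: "0 \<le> M" using up[of T] \<phi>0[of T] T by auto
    have "M \<le> (C' * A u) powr (pstar / p)"
    proof (cases "M = 0")
      case False
      then have M: "0 < M" using M0 by simp
      have "M powr (1 - \<theta>) * M powr \<theta> \<le> C' * A u * M powr \<theta>" using MM M by (simp flip: powr_add)
      then have "M powr (1 - \<theta>) \<le> C' * A u" using M by simp
      then have "(M powr (1 - \<theta>)) powr (1 / (1 - \<theta>)) \<le> (C' * A u) powr (1 / (1 - \<theta>))"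
        using \<theta> by (intro powr_mono2) auto
      then show ?thesis using \<theta> M unfolding th[symmetric] by (simp add: powr_powr)
    qed simp
    then show "T powr pstar * measure lebesgue {x. T < \<bar>u x\<bar>} \<le> (C' * A u) powr (pstar / p)"
      using up[of T] T by (auto simp: \<phi>_def)
  qed
qed

lemma weighted_measure_finite:
  assumes "0 \<le> \<alpha>" "\<alpha> < real DIM('a)" shows "finite_measure (weighted_measure \<Omega> \<alpha>)"
proof
  obtain C where C: "\<And>E. E \<in> lmeasurable \<Longrightarrow> emeasure (weighted_measure \<Omega> \<alpha>) E \<le> ennreal (C * measure lebesgue E powr (1 - \<alpha> / real DIM('a)))"
    using emeasure_weighted_measure_le[OF open_\<Omega> assms] by blast
  have "(\<lambda>x. ennreal (indicator \<Omega> x * norm x powr (- \<alpha>)) * indicator UNIV x) = (\<lambda>x. ennreal (indicator \<Omega> x * norm x powr (- \<alpha>)) * indicator \<Omega> x)"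
    by (auto simp: indicator_def)
  then have "emeasure (weighted_measure \<Omega> \<alpha>) UNIV = emeasure (weighted_measure \<Omega> \<alpha>) \<Omega>"
  proof -
    have [measurable]: "(\<lambda>x::'a. indicator \<Omega> x * norm x powr (- \<alpha>) :: real) \<in> borel_measurable lebesgue" "\<Omega> \<in> sets lebesgue"
      using weight_measurable[OF open_\<Omega>] open_\<Omega> by auto
    assume "(\<lambda>x. ennreal (indicator \<Omega> x * norm x powr (- \<alpha>)) * indicator UNIV x) = (\<lambda>x. ennreal (indicator \<Omega> x * norm x powr (- \<alpha>)) * indicator \<Omega> x)"
    then show ?thesis unfolding weighted_measure_def by (subst (1 2) emeasure_density) auto
  qed
  also have "\<dots> \<le> ennreal (C * measure lebesgue \<Omega> powr (1 - \<alpha> / real DIM('a)))"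
    using bounded_\<Omega> open_\<Omega> by (intro C bounded_set_imp_lmeasurable) auto
  finally have "emeasure (weighted_measure \<Omega> \<alpha>) UNIV < \<infinity>" by (rule le_less_trans) simp
  then show "emeasure (weighted_measure \<Omega> \<alpha>) (space (weighted_measure \<Omega> \<alpha>)) \<noteq> \<infinity>" by (simp add: weighted_measure_def)
qed

text \<open>Layer-cake summation over the heights \<open>a * 2 ^ k\<close>. The weighted measure of a superlevel set decays with the exponent
  \<open>crit_exp s p \<alpha>\<close>, which exceeds \<open>m\<close>, so the series is geometric.\<close>

lemma embedding_level:
  assumes \<alpha>: "0 \<le> \<alpha>" "\<alpha> < p * s" and m: "0 < m" "m < crit_exp TYPE('a) s p \<alpha>"
  shows "\<exists>C>0. \<forall>u a. u \<in> W \<longrightarrow> u \<in> borel_measurable borel \<longrightarrow> (\<forall>x. x \<notin> \<Omega> \<longrightarrow> u x = 0) \<longrightarrow> 0 < a \<longrightarrow> A u \<le> a powr p \<longrightarrow>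
     (\<integral>\<^sup>+x. ennreal (\<bar>u x\<bar> powr m) \<partial>weighted_measure \<Omega> \<alpha>) \<le> ennreal (C * a powr m)"
proof -
  let ?N = "real DIM('a)" and ?\<nu> = "weighted_measure \<Omega> \<alpha>"
  have N: "0 < ?N" by simp
  have \<alpha>N: "\<alpha> < ?N" using \<alpha> psN by simp
  define \<kappa> where "\<kappa> = 1 - \<alpha> / ?N"
  have \<kappa>: "0 < \<kappa>" using \<alpha>N by (simp add: \<kappa>_def field_simps)
  define Q where "Q = pstar * \<kappa>"
  have Q: "Q = crit_exp TYPE('a) s p \<alpha>"
  proof -
    have "\<kappa> = (?N - \<alpha>) / ?N" using N unfolding \<kappa>_def by (simp add: diff_divide_distrib)
    then have "Q = (?N / ?N) * ((?N - \<alpha>) * p / (?N - p * s))" by (simp add: Q_def pstar_def)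
    then show ?thesis by (simp add: crit_exp_def)
  qed
  obtain C1 where C1: "C1 \<ge> 0" "\<And>E. E \<in> lmeasurable \<Longrightarrow> emeasure ?\<nu> E \<le> ennreal (C1 * measure lebesgue E powr \<kappa>)"
    using emeasure_weighted_measure_le[OF open_\<Omega> \<alpha>(1) \<alpha>N] unfolding \<kappa>_def by blast
  obtain C2 where C2: "C2 > 0" "\<And>u t. u \<in> W \<Longrightarrow> u \<in> borel_measurable borel \<Longrightarrow> (\<forall>x. x \<notin> \<Omega> \<longrightarrow> u x = 0) \<Longrightarrow> 0 < t \<Longrightarrow>
     t powr pstar * measure lebesgue {x. t < \<bar>u x\<bar>} \<le> (C2 * A u) powr (pstar / p)"
    using weak_sobolev by blast
  define C3 where "C3 = C1 * (C2 powr (pstar / p)) powr \<kappa>"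
  have C3: "0 \<le> C3" using C1 by (simp add: C3_def)
  define V where "V = measure lebesgue \<Omega> powr \<kappa> * C1"
  have V: "0 \<le> V" using C1 by (simp add: V_def)
  have V': "emeasure ?\<nu> \<Omega> \<le> ennreal V" unfolding V_def
  proof -
    have "\<Omega> \<in> lmeasurable" using bounded_\<Omega> open_\<Omega> by (intro bounded_set_imp_lmeasurable) auto
    from C1(2)[OF this] show "emeasure ?\<nu> \<Omega> \<le> ennreal (measure lebesgue \<Omega> powr \<kappa> * C1)" by (simp only: mult.commute)
  qed
  define q where "q = 2 powr (m - Q)"
  have "2 powr (m - Q) < 2 powr 0" using m Q by (intro powr_less_mono) auto
  then have q: "0 < q" "q < 1" by (auto simp: q_def)
  define C where "C = V + 2 powr m * C3 * (\<Sum>k. q ^ k) + 1"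
  have S0: "0 \<le> (\<Sum>k. q ^ k)" using q by (intro suminf_nonneg summable_geometric) auto
  show ?thesis
  proof (intro exI[of _ C] conjI allI impI)
    show "0 < C" unfolding C_def using V C3 S0 by (simp add: add_nonneg_pos)
    fix u a assume u: "u \<in> W" and b: "u \<in> borel_measurable borel" and z: "\<forall>x. x \<notin> \<Omega> \<longrightarrow> u x = 0" and a: "0 < (a::real)" and Aa: "A u \<le> a powr p"
    define E where "E = (\<lambda>k::nat. {x. a * 2 ^ k < \<bar>u x\<bar>})"
    have E: "E k \<in> lmeasurable" "E k \<subseteq> \<Omega>" "E k \<in> sets borel" for k
      unfolding E_def using superlevel_lmeasurable[OF b, of "a * 2 ^ k"] z a by auto
    have \<Omega>b: "\<Omega> \<in> sets lebesgue" using open_\<Omega> by simp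
    have El: "E k \<in> sets lebesgue" for k using E(3) by simp
    have \<nu>E: "emeasure ?\<nu> (E k) \<le> ennreal (C3 * 2 powr (- real k * Q))" for k
    proof -
      define t where "t = a * 2 ^ k"
      have t: "0 < t" using a by (simp add: t_def)
      have "t powr pstar * measure lebesgue (E k) \<le> (C2 * A u) powr (pstar / p)"
        unfolding E_def t_def[symmetric] using C2(2)[OF u b z t] .
      also have "\<dots> \<le> (C2 * a powr p) powr (pstar / p)"
        using Aa C2(1) pstar(1) p0 gagliardo_pow_nonneg[of s p u] by (intro powr_mono2 mult_left_mono) auto
      also have "\<dots> = C2 powr (pstar / p) * a powr pstar" using C2 a p0 by (simp add: powr_mult powr_powr)
      finally have "t powr pstar * measure lebesgue (E k) \<le> C2 powr (pstar / p) * a powr pstar" .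
      moreover have "t powr pstar = a powr pstar * 2 powr (real k * pstar)"
        using a by (simp add: t_def powr_mult powr_realpow[symmetric] powr_powr)
      ultimately have "2 powr (real k * pstar) * measure lebesgue (E k) \<le> C2 powr (pstar / p)"
        using a by (simp add: field_simps)
      then have me: "measure lebesgue (E k) \<le> C2 powr (pstar / p) * 2 powr (- real k * pstar)"
        by (simp add: powr_minus field_simps)
      have "emeasure ?\<nu> (E k) \<le> ennreal (C1 * measure lebesgue (E k) powr \<kappa>)" using C1(2) E(1) by blast
      also have "\<dots> \<le> ennreal (C1 * (C2 powr (pstar / p) * 2 powr (- real k * pstar)) powr \<kappa>)"
        using me C1(1) \<kappa> by (intro ennreal_leI mult_left_mono powr_mono2) auto
      also have "C1 * (C2 powr (pstar / p) * 2 powr (- real k * pstar)) powr \<kappa> = C3 * 2 powr (- real k * Q)"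
        by (simp add: C3_def Q_def powr_mult powr_powr mult_ac)
      finally show ?thesis .
    qed
    have "(\<integral>\<^sup>+x. ennreal (\<bar>u x\<bar> powr m) \<partial>?\<nu>)
       \<le> (\<integral>\<^sup>+x. ennreal (a powr m) * indicator \<Omega> x + (\<Sum>k. ennreal ((a * 2 powr (real k + 1)) powr m) * indicator (E k) x) \<partial>?\<nu>)"
    proof (rule nn_integral_mono)
      fix x
      show "ennreal (\<bar>u x\<bar> powr m) \<le> ennreal (a powr m) * indicator \<Omega> x + (\<Sum>k. ennreal ((a * 2 powr (real k + 1)) powr m) * indicator (E k) x)"
      proof (cases "x \<in> \<Omega>")
        case False then show ?thesis using z by simp
      next
        case True
        show ?thesis
        proof (cases "\<bar>u x\<bar> \<le> a")
          case ua: True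
          then have "\<bar>u x\<bar> powr m \<le> a powr m" using m by (intro powr_mono2) auto
          then have "ennreal (\<bar>u x\<bar> powr m) \<le> ennreal (a powr m) * indicator \<Omega> x" using True by (simp add: ennreal_leI)
          then show ?thesis by (rule order_trans) simp
        next
          case False
          then have "1 < \<bar>u x\<bar> / a" using a by (simp add: field_simps)
          then obtain k :: nat where k: "2 ^ k < \<bar>u x\<bar> / a" "\<bar>u x\<bar> / a \<le> 2 ^ (k + 1)" using dyadic_shell by blast
          have xE: "x \<in> E k" using k(1) a by (simp add: E_def field_simps)
          have "\<bar>u x\<bar> \<le> a * 2 powr (real k + 1)" using k(2) a by (simp add: powr_add powr_realpow field_simps)
          then have "\<bar>u x\<bar> powr m \<le> (a * 2 powr (real k + 1)) powr m" using m by (intro powr_mono2) auto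
          then have "ennreal (\<bar>u x\<bar> powr m) \<le> ennreal ((a * 2 powr (real k + 1)) powr m) * indicator (E k) x"
            using xE by (simp add: ennreal_leI)
          also have "\<dots> = (\<Sum>k\<in>{k}. ennreal ((a * 2 powr (real k + 1)) powr m) * indicator (E k) x)"
            by (simp only: sum.insert[OF finite.emptyI] sum.empty empty_iff not_False_eq_True add_0_right)
          also have "\<dots> \<le> (\<Sum>k. ennreal ((a * 2 powr (real k + 1)) powr m) * indicator (E k) x)"
            by (rule sum_le_suminf) auto
          finally show ?thesis by (rule order_trans) simp
        qed
      qed
    qed
    also have "\<dots> = ennreal (a powr m) * emeasure ?\<nu> \<Omega> + (\<Sum>k. ennreal ((a * 2 powr (real k + 1)) powr m) * emeasure ?\<nu> (E k))"
    proof -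
      have [measurable]: "\<Omega> \<in> sets ?\<nu>" "E k \<in> sets ?\<nu>" for k using \<Omega>b El by auto
      have 1: "(\<lambda>x. ennreal (a powr m) * indicator \<Omega> x) \<in> borel_measurable ?\<nu>" by measurable
      have 2: "(\<lambda>x. \<Sum>k. ennreal ((a * 2 powr (real k + 1)) powr m) * indicator (E k) x) \<in> borel_measurable ?\<nu>" by measurable
      have 3: "(\<integral>\<^sup>+x. (\<Sum>k. ennreal ((a * 2 powr (real k + 1)) powr m) * indicator (E k) x) \<partial>?\<nu>)
        = (\<Sum>k. \<integral>\<^sup>+x. ennreal ((a * 2 powr (real k + 1)) powr m) * indicator (E k) x \<partial>?\<nu>)"
        by (rule nn_integral_suminf) measurable
      have 4: "(\<integral>\<^sup>+x. ennreal ((a * 2 powr (real k + 1)) powr m) * indicator (E k) x \<partial>?\<nu>) = ennreal ((a * 2 powr (real k + 1)) powr m) * emeasure ?\<nu> (E k)" for k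
        by (rule nn_integral_cmult_indicator) measurable
      have 5: "(\<integral>\<^sup>+x. ennreal (a powr m) * indicator \<Omega> x \<partial>?\<nu>) = ennreal (a powr m) * emeasure ?\<nu> \<Omega>"
        by (rule nn_integral_cmult_indicator) measurable
      show ?thesis unfolding nn_integral_add[OF 1 2] 3 4 5 ..
    qed
    also have "\<dots> \<le> ennreal (a powr m) * ennreal V + (\<Sum>k. ennreal ((a * 2 powr (real k + 1)) powr m) * ennreal (C3 * 2 powr (- real k * Q)))"
      by (intro add_mono mult_left_mono V' suminf_le \<nu>E) auto
    also have "(\<Sum>k. ennreal ((a * 2 powr (real k + 1)) powr m) * ennreal (C3 * 2 powr (- real k * Q))) = (\<Sum>k. ennreal (a powr m * 2 powr m * C3 * q ^ k))"
    proof (rule suminf_cong)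
      fix k
      have "(a * 2 powr (real k + 1)) powr m * (C3 * 2 powr (- real k * Q)) = a powr m * C3 * (2 powr ((real k + 1) * m) * 2 powr (- real k * Q))"
        using a by (simp add: powr_mult powr_powr mult_ac)
      also have "2 powr ((real k + 1) * m) * 2 powr (- real k * Q) = 2 powr (m + real k * (m - Q))" by (simp flip: powr_add add: algebra_simps)
      finally have "(a * 2 powr (real k + 1)) powr m * (C3 * 2 powr (- real k * Q)) = a powr m * 2 powr m * C3 * q ^ k"
        by (simp add: powr_add two_powr_nat q_def mult_ac)
      then show "ennreal ((a * 2 powr (real k + 1)) powr m) * ennreal (C3 * 2 powr (- real k * Q)) = ennreal (a powr m * 2 powr m * C3 * q ^ k)"
        using C3 ennreal_mult[of "(a * 2 powr (real k + 1)) powr m" "C3 * 2 powr (- real k * Q)"] by (simp only: mult_nonneg_nonneg powr_ge_zero)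
    qed
    also have "\<dots> = ennreal (\<Sum>k. a powr m * 2 powr m * C3 * q ^ k)"
      using C3 q by (intro suminf_ennreal2) (auto intro!: summable_mult summable_geometric)
    also have "(\<Sum>k. a powr m * 2 powr m * C3 * q ^ k) = a powr m * 2 powr m * C3 * (\<Sum>k. q ^ k)"
      using q by (intro suminf_mult) (auto intro!: summable_geometric)
    also have "ennreal (a powr m) * ennreal V + ennreal (a powr m * 2 powr m * C3 * (\<Sum>k. q ^ k)) = ennreal (a powr m * V + a powr m * 2 powr m * C3 * (\<Sum>k. q ^ k))"
      using V C3 S0 by (simp add: ennreal_mult[symmetric] ennreal_plus[symmetric] del: ennreal_plus)
    also have "\<dots> \<le> ennreal (C * a powr m)"
      by (rule ennreal_leI) (simp add: C_def algebra_simps)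
    finally show "(\<integral>\<^sup>+x. ennreal (\<bar>u x\<bar> powr m) \<partial>?\<nu>) \<le> ennreal (C * a powr m)" .
  qed
qed

text \<open>If \<open>A u = 0\<close>, the level \<open>a\<close> in \<open>embedding_level\<close> can be chosen arbitrarily small.\<close>

theorem embedding:
  assumes \<alpha>: "0 \<le> \<alpha>" "\<alpha> < p * s" and m: "0 < m" "m < crit_exp TYPE('a) s p \<alpha>"
  shows "\<exists>C>0. \<forall>u\<in>W. in_Lm (weighted_measure \<Omega> \<alpha>) m u \<and> pow_integral (weighted_measure \<Omega> \<alpha>) m u \<le> C * A u powr (m / p)"
proof -
  let ?\<nu> = "weighted_measure \<Omega> \<alpha>"
  obtain C where C: "C > 0" "\<And>u a. u \<in> W \<Longrightarrow> u \<in> borel_measurable borel \<Longrightarrow> (\<forall>x. x \<notin> \<Omega> \<longrightarrow> u x = 0) \<Longrightarrow> 0 < a \<Longrightarrow> A u \<le> a powr p \<Longrightarrow>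
     (\<integral>\<^sup>+x. ennreal (\<bar>u x\<bar> powr m) \<partial>?\<nu>) \<le> ennreal (C * a powr m)"
    using embedding_level[OF assms] by blast
  show ?thesis
  proof (intro exI[of _ C] conjI ballI)
    show "0 < C" by (rule C(1))
    fix u assume u: "u \<in> W"
    obtain v where v: "v \<in> borel_measurable borel" "AE x in lebesgue. v x = u x" "v \<in> W" "A v = A u" "\<And>x. x \<notin> \<Omega> \<Longrightarrow> v x = 0"
      using W_ex_borel_supp[OF u] by metis
    have bd: "(\<integral>\<^sup>+x. ennreal (\<bar>u x\<bar> powr m) \<partial>?\<nu>) \<le> ennreal (C * a powr m)" if "0 < a" "A u \<le> a powr p" for a
    proof -
      have "(\<integral>\<^sup>+x. ennreal (\<bar>u x\<bar> powr m) \<partial>?\<nu>) = (\<integral>\<^sup>+x. ennreal (\<bar>v x\<bar> powr m) \<partial>?\<nu>)"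
        by (rule nn_integral_cong_AE, use AE_weighted[OF v(2)] in eventually_elim) simp
      also have "\<dots> \<le> ennreal (C * a powr m)" using C(2)[OF v(3,1)] v(4,5) that by auto
      finally show ?thesis .
    qed
    have um: "u \<in> borel_measurable ?\<nu>" using W_measurable[OF u] by (simp add: measurable_weighted_measure)
    define a where "a = (A u + 1) powr (1 / p)"
    have a: "0 < a" "A u \<le> a powr p" using p0 gagliardo_pow_nonneg[of s p u] by (auto simp: a_def powr_powr)
    have "(\<integral>\<^sup>+x. ennreal (\<bar>u x\<bar> powr m) \<partial>?\<nu>) < \<infinity>" using bd[OF a] by (rule le_less_trans) simp
    then have int: "integrable ?\<nu> (\<lambda>x. \<bar>u x\<bar> powr m)"
      using um by (intro integrableI_nonneg) auto
    then show "in_Lm ?\<nu> m u" using um by (simp add: in_Lm_def)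
    have bd': "pow_integral ?\<nu> m u \<le> C * a powr m" if "0 < a" "A u \<le> a powr p" for a
      using bd[OF that] int C(1) unfolding pow_integral_def by (subst (asm) nn_integral_eq_integral) auto
    show "pow_integral ?\<nu> m u \<le> C * A u powr (m / p)"
    proof (cases "A u = 0")
      case False
      then have "0 < A u" using gagliardo_pow_nonneg[of s p u] by simp
      then show ?thesis using bd'[of "A u powr (1 / p)"] p0 by (simp add: powr_powr)
    next
      case True
      have "pow_integral ?\<nu> m u \<le> 0 + e" if e: "0 < e" for e
        using bd'[of "(e / C) powr (1 / m)"] e C(1) m True by (simp add: powr_powr)
      then have "pow_integral ?\<nu> m u \<le> 0" by (rule field_le_epsilon)
      then show ?thesis using True by simp
    qed
  qed
qed

lemma one_less_crit_exp: "1 < crit_exp TYPE('a) s p 0"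
proof -
  have "real DIM('a) * 1 < real DIM('a) * p" using p1 by (intro mult_strict_left_mono) auto
  then have "real DIM('a) - p * s < real DIM('a) * p" using p0 s0 mult_pos_pos[of p s] by linarith
  then show ?thesis unfolding crit_exp_def using psN by (simp add: field_simps)
qed

lemma AE_zero_if_seminorm_zero:
  assumes u: "u \<in> W" and A0: "A u = 0" shows "AE x in lebesgue. u x = 0"
proof -
  note c = one_less_crit_exp
  obtain C where C: "in_Lm (weighted_measure \<Omega> 0) 1 u" "pow_integral (weighted_measure \<Omega> 0) 1 u \<le> C * A u powr (1 / p)"
    using embedding[of 0 1] p0 s0 c u by auto
  then have "pow_integral (weighted_measure \<Omega> 0) 1 u = 0" using A0 pow_integral_nonneg[of "weighted_measure \<Omega> 0" 1 u] by simp
  then have "AE x in weighted_measure \<Omega> 0. \<bar>u x\<bar> powr 1 = 0"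
    using C(1) unfolding pow_integral_def in_Lm_def by (subst (asm) integral_nonneg_eq_0_iff_AE) auto
  then have "AE x in weighted_measure \<Omega> 0. u x = 0" by eventually_elim simp
  then show ?thesis by (rule weighted_measure_nonzero_AE[OF u])
qed

end

section \<open>Compactness of bounded sequences\<close>

text \<open>Along a subsequence the successive distances are summable, hence so are the successive differences at almost every
  point.\<close>

lemma L1_Cauchy_AE_subseq:
  fixes f :: "nat \<Rightarrow> 'b \<Rightarrow> real"
  assumes i: "\<And>n. integrable M (f n)"
    and C: "\<And>e. 0 < e \<Longrightarrow> \<exists>N. \<forall>m\<ge>N. \<forall>n\<ge>N. (\<integral>x. \<bar>f m x - f n x\<bar> \<partial>M) < e"
  shows "\<exists>r. strict_mono r \<and> (AE x in M. convergent (\<lambda>n. f (r n) x))"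
proof -
  have "\<forall>i::nat. \<exists>N. \<forall>m\<ge>N. \<forall>n\<ge>N. (\<integral>x. \<bar>f m x - f n x\<bar> \<partial>M) < (1/2) ^ i" by (intro allI C) simp
  then obtain N where N: "\<And>i m n. m \<ge> N i \<Longrightarrow> n \<ge> N i \<Longrightarrow> (\<integral>x. \<bar>f m x - f n x\<bar> \<partial>M) < (1/2) ^ i"
    by metis
  \<comment> \<open>Adding up the thresholds makes the sequence increasing.\<close>
  define r where "r = (\<lambda>i::nat. (\<Sum>j\<le>i. N j) + i)"
  have r: "strict_mono r" unfolding strict_mono_Suc_iff r_def by simp
  have rN: "N i \<le> r i" for i
    unfolding r_def by (rule trans_le_add1, rule member_le_sum) auto
  have rN': "N i \<le> r (Suc i)" for i using rN[of i] strict_mono_less[OF r, of i "Suc i"] by simp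
  define d where "d = (\<lambda>i x. \<bar>f (r (Suc i)) x - f (r i) x\<bar>)"
  have [measurable]: "f n \<in> borel_measurable M" for n using i by auto
  have di: "integrable M (d i)" for i unfolding d_def using i by auto
  have "(\<integral>\<^sup>+x. (\<Sum>i. ennreal (d i x)) \<partial>M) = (\<Sum>i. \<integral>\<^sup>+x. ennreal (d i x) \<partial>M)"
    unfolding d_def by (rule nn_integral_suminf) measurable
  also have "\<dots> \<le> (\<Sum>i. ennreal ((1/2) ^ i))"
  proof (rule suminf_le)
    fix i
    have "(\<integral>\<^sup>+x. ennreal (d i x) \<partial>M) = ennreal (\<integral>x. d i x \<partial>M)"
      by (rule nn_integral_eq_integral[OF di]) (simp add: d_def)
    also have "\<dots> \<le> ennreal ((1/2) ^ i)"
      using N[OF rN' rN, of i] unfolding d_def by (intro ennreal_leI) simp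
    finally show "(\<integral>\<^sup>+x. ennreal (d i x) \<partial>M) \<le> ennreal ((1/2) ^ i)" .
  qed auto
  also have "\<dots> = ennreal (\<Sum>i. (1/2) ^ i)" by (rule suminf_ennreal2) (auto intro: summable_geometric)
  also have "\<dots> < \<infinity>" by simp
  finally have "(\<integral>\<^sup>+x. (\<Sum>i. ennreal (d i x)) \<partial>M) \<noteq> \<infinity>" by simp
  then have "AE x in M. (\<Sum>i. ennreal (d i x)) \<noteq> \<infinity>"
    by (intro nn_integral_noteq_infinite) (auto simp: d_def)
  then have "AE x in M. convergent (\<lambda>n. f (r n) x)"
  proof eventually_elim
    fix x assume "(\<Sum>i. ennreal (d i x)) \<noteq> \<infinity>"
    then have "summable (\<lambda>i. d i x)" by (intro summable_suminf_not_top) (auto simp: d_def)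
    then have "summable (\<lambda>i. norm (f (r (Suc i)) x - f (r i) x))" by (simp add: d_def)
    then have "summable (\<lambda>i. f (r (Suc i)) x - f (r i) x)" by (rule summable_norm_cancel)
    then have "convergent (\<lambda>n. \<Sum>i<n. f (r (Suc i)) x - f (r i) x)" by (simp add: summable_iff_convergent)
    then have "convergent (\<lambda>n. f (r n) x - f (r 0) x)" using sum_lessThan_telescope[of "\<lambda>i. f (r i) x"] by simp
    then have "convergent (\<lambda>n. (f (r n) x - f (r 0) x) + f (r 0) x)" by (intro convergent_add convergent_const)
    then show "convergent (\<lambda>n. f (r n) x)" by simp
  qed
  then show ?thesis using r by blast
qed

text \<open>The label of the half-open dyadic cube of side \<open>2 powr - j\<close> that contains \<open>x\<close>, which is its lower corner scaled by \<open>2 ^ j\<close>.\<close>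

definition cell :: "nat \<Rightarrow> 'a::euclidean_space \<Rightarrow> 'a" where
  "cell j x = (\<Sum>b\<in>Basis. of_int \<lfloor>2 ^ j * (x \<bullet> b)\<rfloor> *\<^sub>R b)"

lemma cell_inner: "b \<in> Basis \<Longrightarrow> cell j x \<bullet> b = of_int \<lfloor>2 ^ j * (x \<bullet> b)\<rfloor>"
  unfolding cell_def by (simp add: inner_sum_left_Basis)

lemma countable_range_cell: "countable (range (cell j :: 'a::euclidean_space \<Rightarrow> 'a))"
proof (rule countable_subset)
  show "range (cell j :: 'a \<Rightarrow> 'a) \<subseteq> (\<lambda>f. \<Sum>b\<in>Basis. of_int (f b) *\<^sub>R b) ` (Pi\<^sub>E Basis (\<lambda>_. UNIV :: int set))"
  proof safe
    fix x :: 'a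
    show "cell j x \<in> (\<lambda>f. \<Sum>b\<in>Basis. of_int (f b) *\<^sub>R b) ` (Pi\<^sub>E Basis (\<lambda>_. UNIV :: int set))"
      by (rule image_eqI[of _ _ "restrict (\<lambda>b. \<lfloor>2 ^ j * (x \<bullet> b)\<rfloor>) Basis"]) (auto simp: cell_def intro!: sum.cong)
  qed
  show "countable ((\<lambda>f. \<Sum>b\<in>Basis. of_int (f b) *\<^sub>R (b::'a)) ` (Pi\<^sub>E Basis (\<lambda>_. UNIV :: int set)))"
    by (intro countable_image countable_PiE) auto
qed

lemma cell_measurable [measurable]: "cell j \<in> borel_measurable borel"
  unfolding cell_def[abs_def] by measurable

definition cube :: "nat \<Rightarrow> 'a::euclidean_space \<Rightarrow> 'a set" where
  "cube j c = {y. cell j y = c}"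

lemma cube_sets [measurable]: "cube j c \<in> sets borel"
proof -
  have "cell j -` {c} \<inter> space borel \<in> sets borel" by (rule measurable_sets[OF cell_measurable]) simp
  then show ?thesis by (simp add: cube_def vimage_def)
qed

lemma comp_cell_measurable: "(\<lambda>x. F (cell j x)) \<in> borel_measurable borel" for F :: "'a::euclidean_space \<Rightarrow> real"
proof -
  have 1: "cell j \<in> measurable borel (count_space (range (cell j)))"
    unfolding measurable_count_space_eq_countable[OF countable_range_cell]
    using cube_sets by (auto simp: cube_def vimage_def)
  have 2: "F \<in> measurable (count_space (range (cell j))) borel" by simp
  show ?thesis using measurable_compose[OF 1 2] .
qed

text \<open>A lower bound for the measure suffices below, so only the open box inside the cube and the closed box around it are
  compared with it.\<close>

lemma cube_measure:
  fixes x :: "'a::euclidean_space"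
  shows "cube j (cell j x) \<in> lmeasurable" "(1 / 2 ^ j) ^ DIM('a) \<le> measure lebesgue (cube j (cell j x))"
proof -
  define l where "l = (1 / 2 ^ j) *\<^sub>R cell j x"
  define u where "u = (1 / 2 ^ j) *\<^sub>R (cell j x + One)"
  have lb: "l \<bullet> b = of_int \<lfloor>2 ^ j * (x \<bullet> b)\<rfloor> / 2 ^ j" if "b \<in> Basis" for b
    using that by (simp add: l_def cell_inner)
  have ub: "u \<bullet> b = (of_int \<lfloor>2 ^ j * (x \<bullet> b)\<rfloor> + 1) / 2 ^ j" if "b \<in> Basis" for b
    using that by (simp add: u_def cell_inner inner_add_left)
  have in_cube: "y \<in> cube j (cell j x) \<longleftrightarrow> (\<forall>b\<in>Basis. \<lfloor>2 ^ j * (y \<bullet> b)\<rfloor> = \<lfloor>2 ^ j * (x \<bullet> b)\<rfloor>)" for y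
    unfolding cube_def mem_Collect_eq euclidean_eq_iff[of "cell j y"] by (simp add: cell_inner)
  have sub1: "box l u \<subseteq> cube j (cell j x)"
  proof
    fix y assume y: "y \<in> box l u"
    show "y \<in> cube j (cell j x)" unfolding in_cube
    proof
      fix b :: 'a assume b: "b \<in> Basis"
      have "l \<bullet> b < y \<bullet> b" "y \<bullet> b < u \<bullet> b" using y b by (auto simp: mem_box)
      then have "of_int \<lfloor>2 ^ j * (x \<bullet> b)\<rfloor> < 2 ^ j * (y \<bullet> b)" "2 ^ j * (y \<bullet> b) < of_int \<lfloor>2 ^ j * (x \<bullet> b)\<rfloor> + 1"
        unfolding lb[OF b] ub[OF b] by (auto simp: field_simps)
      then show "\<lfloor>2 ^ j * (y \<bullet> b)\<rfloor> = \<lfloor>2 ^ j * (x \<bullet> b)\<rfloor>" by linarith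
    qed
  qed
  have sub2: "cube j (cell j x) \<subseteq> cbox l u"
  proof
    fix y assume y: "y \<in> cube j (cell j x)"
    show "y \<in> cbox l u" unfolding mem_box
    proof
      fix b :: 'a assume b: "b \<in> Basis"
      have "\<lfloor>2 ^ j * (y \<bullet> b)\<rfloor> = \<lfloor>2 ^ j * (x \<bullet> b)\<rfloor>" using y b in_cube by blast
      then have "of_int \<lfloor>2 ^ j * (x \<bullet> b)\<rfloor> \<le> 2 ^ j * (y \<bullet> b)" "2 ^ j * (y \<bullet> b) \<le> of_int \<lfloor>2 ^ j * (x \<bullet> b)\<rfloor> + 1"
        by linarith+
      then show "l \<bullet> b \<le> y \<bullet> b \<and> y \<bullet> b \<le> u \<bullet> b" unfolding lb[OF b] ub[OF b] by (auto simp: field_simps)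
    qed
  qed
  show lm: "cube j (cell j x) \<in> lmeasurable"
    by (rule bounded_set_imp_lmeasurable) (use sub2 bounded_subset[OF bounded_cbox] in auto)
  have "(1 / 2 ^ j) ^ DIM('a) = measure lebesgue (box l u)"
  proof -
    have "l \<bullet> b \<le> u \<bullet> b" if "b \<in> Basis" for b using that by (simp add: lb ub divide_right_mono)
    then have "measure lborel (box l u) = (\<Prod>b\<in>Basis. (u - l) \<bullet> b)" by (rule measure_lborel_box)
    also have "\<dots> = (\<Prod>b\<in>(Basis::'a set). 1 / 2 ^ j)"
      by (rule prod.cong) (auto simp: inner_diff_left lb ub field_simps)
    finally show ?thesis by simp
  qed
  also have "\<dots> \<le> measure lebesgue (cube j (cell j x))" using sub1 lm by (intro measure_mono_fmeasurable) auto
  finally show "(1 / 2 ^ j) ^ DIM('a) \<le> measure lebesgue (cube j (cell j x))" .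
qed

lemma cube_diam:
  fixes x y :: "'a::euclidean_space"
  assumes "y \<in> cube j (cell j x)" shows "norm (x - y) \<le> real DIM('a) / 2 ^ j"
proof -
  have "cell j y = cell j x" using assms by (simp add: cube_def)
  have "norm (x - y) \<le> (\<Sum>b\<in>Basis. \<bar>(x - y) \<bullet> b\<bar>)" by (rule norm_le_l1)
  also have "\<dots> \<le> (\<Sum>b\<in>(Basis::'a set). 1 / 2 ^ j)"
  proof (rule sum_mono)
    fix b :: 'a assume b: "b \<in> Basis"
    have "of_int \<lfloor>2 ^ j * (y \<bullet> b)\<rfloor> = (of_int \<lfloor>2 ^ j * (x \<bullet> b)\<rfloor> :: real)"
      using \<open>cell j y = cell j x\<close> cell_inner[OF b, of j] by metis
    then have "\<bar>2 ^ j * (x \<bullet> b) - 2 ^ j * (y \<bullet> b)\<bar> \<le> 1" by linarith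
    then have "2 ^ j * \<bar>x \<bullet> b - y \<bullet> b\<bar> \<le> 1" by (simp add: abs_mult flip: right_diff_distrib)
    then show "\<bar>(x - y) \<bullet> b\<bar> \<le> 1 / 2 ^ j" by (simp add: inner_diff_left field_simps)
  qed
  also have "\<dots> = real DIM('a) / 2 ^ j" by simp
  finally show ?thesis .
qed

definition cube_avg :: "nat \<Rightarrow> ('a::euclidean_space \<Rightarrow> real) \<Rightarrow> 'a \<Rightarrow> real" where
  "cube_avg j v x = (\<integral>y. indicator (cube j (cell j x)) y * v y \<partial>lborel) / measure lebesgue (cube j (cell j x))"

lemma cube_avg_measurable: "cube_avg j v \<in> borel_measurable borel"
  unfolding cube_avg_def[abs_def] by (rule comp_cell_measurable[of "\<lambda>c. (\<integral>y. indicator (cube j c) y * v y \<partial>lborel) / measure lebesgue (cube j c)"])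

text \<open>With \<open>\<delta> = h powr s\<close> for the mesh size \<open>h\<close>, the seminorm controls the second term and both terms are of order
  \<open>h powr s\<close>.\<close>

lemma abs_le_threshold:
  fixes d \<delta> p :: real
  assumes "0 < \<delta>" "1 < p" shows "\<bar>d\<bar> \<le> \<delta> + \<delta> powr (1 - p) * \<bar>d\<bar> powr p"
proof (cases "\<bar>d\<bar> \<le> \<delta>")
  case True then show ?thesis using assms by (simp add: add_increasing2)
next
  case False
  have "\<bar>d\<bar> = \<bar>d\<bar> powr (1 - p) * \<bar>d\<bar> powr p" using False assms by (simp flip: powr_add)
  also have "\<dots> \<le> \<delta> powr (1 - p) * \<bar>d\<bar> powr p" using False assms by (intro mult_right_mono powr_mono2') auto
  finally show ?thesis using assms by linarith
qed

context frac
begin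

lemma L1_bound: "\<exists>C>0. \<forall>u\<in>W. (\<integral>x. \<bar>u x\<bar> \<partial>lebesgue) \<le> C * A u powr (1 / p)"
proof -
  note c = one_less_crit_exp
  obtain C where C: "C > 0" "\<And>u. u \<in> W \<Longrightarrow> pow_integral (weighted_measure \<Omega> 0) 1 u \<le> C * A u powr (1 / p)"
    using embedding[of 0 1] p0 s0 c by auto
  show ?thesis
  proof (intro exI[of _ C] conjI ballI C(1))
    fix u assume u: "u \<in> W"
    have "pow_integral (weighted_measure \<Omega> 0) 1 u = (\<integral>x. indicator \<Omega> x *\<^sub>R \<bar>u x\<bar> \<partial>lebesgue)"
      by (simp add: pow_integral_weighted_0 W_measurable u set_lebesgue_integral_def)
    also have "\<dots> = (\<integral>x. \<bar>u x\<bar> \<partial>lebesgue)"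
    proof (rule integral_cong_AE)
      have [measurable]: "u \<in> borel_measurable lebesgue" "\<Omega> \<in> sets lebesgue" using W_measurable[OF u] open_\<Omega> by auto
      show "(\<lambda>x. indicator \<Omega> x *\<^sub>R \<bar>u x\<bar>) \<in> borel_measurable lebesgue" "(\<lambda>x. \<bar>u x\<bar>) \<in> borel_measurable lebesgue" by measurable
      show "AE x in lebesgue. indicator \<Omega> x *\<^sub>R \<bar>u x\<bar> = \<bar>u x\<bar>"
        using W_vanish[OF u] by eventually_elim (auto simp: indicator_def)
    qed
    finally show "(\<integral>x. \<bar>u x\<bar> \<partial>lebesgue) \<le> C * A u powr (1 / p)" using C(2)[OF u] by simp
  qed
qed

text \<open>Averages over cubes approximate bounded subsets of the space in \<open>L\<^sup>1\<close> at a uniform rate. On a cube the kernel is at least a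
  power of its diameter, so the mean of \<open>\<bar>u x - u y\<bar> powr p\<close> over \<open>y\<close> is at most a multiple of the inner Gagliardo integral.\<close>

lemma cube_avg_error:
  assumes u: "u \<in> W" and b: "u \<in> borel_measurable borel"
  shows "(\<integral>\<^sup>+x. ennreal (indicator \<Omega> x * \<bar>u x - cube_avg j u x\<bar>) \<partial>lborel)
    \<le> ennreal ((measure lebesgue \<Omega> + real DIM('a) powr (real DIM('a) + p * s) * A u) * 2 powr (- real j * s))"
proof -
  let ?N = "real DIM('a)"
  \<comment> \<open>The mesh size to the power \<open>s\<close>, which balances the two terms of \<open>abs_le_threshold\<close>.\<close>
  define \<delta> where "\<delta> = 2 powr (- real j * s)"
  have \<delta>: "0 < \<delta>" by (simp add: \<delta>_def)
  define D where "D = ?N powr (?N + p * s)"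
  have D: "0 \<le> D" by (simp add: D_def)
  have [measurable]: "u \<in> borel_measurable borel" "\<Omega> \<in> sets borel" using b open_\<Omega> by auto
  have iu: "integrable lborel u" using W_integrable[OF u] b by (simp add: integrable_completion)
  have e0: "0 < ?N + p * s" using p0 s0 by (simp add: add_pos_pos)
  have pt: "ennreal \<bar>u x - cube_avg j u x\<bar> \<le> ennreal \<delta> + ennreal (D * \<delta>) * (\<integral>\<^sup>+y. ennreal (gagliardo_quotient s p u (x, y)) \<partial>lborel)" for x
  proof -
    define Q where "Q = cube j (cell j x)"
    define m where "m = measure lebesgue Q"
    have Qs: "Q \<in> sets borel" by (simp add: Q_def cube_sets)
    have Ql: "Q \<in> lmeasurable" and m2: "(1 / 2 ^ j) ^ DIM('a) \<le> m" unfolding Q_def m_def by (rule cube_measure)+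
    have m: "0 < m" using m2 by (rule less_le_trans[rotated]) simp
    have eQ: "emeasure lborel Q = ennreal m" using Ql Qs emeasure_eq_measure2[of Q lebesgue] by (simp add: m_def)
    have iQ: "integrable lborel (\<lambda>y. indicator Q y * u y)"
      using integrable_mult_indicator[OF _ iu, of Q] Qs by simp
    have i1: "integrable lborel (indicator Q :: 'a \<Rightarrow> real)" using Qs eQ by (intro integrable_real_indicator) auto
    have "m * (u x - cube_avg j u x) = (\<integral>y. indicator Q y * (u x - u y) \<partial>lborel)"
    proof -
      have "(\<integral>y. indicator Q y * (u x - u y) \<partial>lborel) = (\<integral>y. u x * indicator Q y - indicator Q y * u y \<partial>lborel)"
        by (rule Bochner_Integration.integral_cong) (auto simp: algebra_simps)
      also have "\<dots> = u x * measure lborel Q - (\<integral>y. indicator Q y * u y \<partial>lborel)"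
        using iQ i1 by (subst Bochner_Integration.integral_diff) auto
      finally show ?thesis using m Qs by (simp add: cube_avg_def Q_def[symmetric] m_def algebra_simps)
    qed
    then have "ennreal m * ennreal \<bar>u x - cube_avg j u x\<bar> = ennreal \<bar>\<integral>y. indicator Q y * (u x - u y) \<partial>lborel\<bar>"
      using m by (simp add: ennreal_mult[symmetric] abs_mult flip: abs_mult) (metis abs_mult abs_of_pos)
    also have "\<dots> \<le> (\<integral>\<^sup>+y. ennreal (norm (indicator Q y * (u x - u y))) \<partial>lborel)"
      using integral_norm_bound_ennreal[of lborel "\<lambda>y. indicator Q y * (u x - u y)"] iQ i1 by (simp add: right_diff_distrib)
    also have "\<dots> \<le> (\<integral>\<^sup>+y. ennreal \<delta> * indicator Q y + ennreal (D * \<delta> * (1 / 2 ^ j) ^ DIM('a)) * ennreal (gagliardo_quotient s p u (x, y)) \<partial>lborel)"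
    proof (rule nn_integral_mono)
      fix y
      let ?g = "gagliardo_quotient s p u (x, y)"
      show "ennreal (norm (indicator Q y * (u x - u y))) \<le> ennreal \<delta> * indicator Q y + ennreal (D * \<delta> * (1 / 2 ^ j) ^ DIM('a)) * ennreal ?g"
      proof (cases "y \<in> Q")
        case False then show ?thesis by simp
      next
        case True
        have g0: "0 \<le> ?g" by (simp add: gagliardo_quotient_def)
        have dm: "norm (x - y) \<le> ?N / 2 ^ j" using True cube_diam by (simp add: Q_def)
        have g: "\<bar>u x - u y\<bar> powr p \<le> (?N / 2 ^ j) powr (?N + p * s) * ?g"
        proof (cases "x = y")
          case False
          then have "\<bar>u x - u y\<bar> powr p = norm (x - y) powr (?N + p * s) * ?g" by (simp add: gagliardo_quotient_def)
          also have "\<dots> \<le> (?N / 2 ^ j) powr (?N + p * s) * ?g"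
            using dm g0 e0 by (intro mult_right_mono powr_mono2) auto
          finally show ?thesis .
        qed (simp add: gagliardo_quotient_def)
        have "\<bar>u x - u y\<bar> \<le> \<delta> + \<delta> powr (1 - p) * \<bar>u x - u y\<bar> powr p" by (rule abs_le_threshold[OF \<delta> p1])
        also have "\<dots> \<le> \<delta> + \<delta> powr (1 - p) * ((?N / 2 ^ j) powr (?N + p * s) * ?g)"
          using g by (intro add_left_mono mult_left_mono) auto
        also have "\<delta> powr (1 - p) * ((?N / 2 ^ j) powr (?N + p * s) * ?g) = D * \<delta> * (1 / 2 ^ j) ^ DIM('a) * ?g"
        proof -
          have "(?N / 2 ^ j) powr (?N + p * s) = D * 2 powr (- real j * (?N + p * s))"
            by (simp add: D_def powr_divide powr_realpow[symmetric] powr_powr powr_minus_divide)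
          moreover have "\<delta> powr (1 - p) = 2 powr (- real j * s * (1 - p))" by (simp add: \<delta>_def powr_powr)
          moreover have "(1 / 2 ^ j :: real) ^ DIM('a) = 2 powr (- real j * ?N)"
            by (simp add: powr_realpow[symmetric] powr_powr powr_minus_divide power_one_over power_mult[symmetric])
          moreover have "2 powr (- real j * s * (1 - p)) * 2 powr (- real j * (?N + p * s)) = \<delta> * 2 powr (- real j * ?N)"
            unfolding \<delta>_def powr_add[symmetric] by (simp add: algebra_simps)
          ultimately show ?thesis by (simp add: mult_ac)
        qed
        finally have "\<bar>u x - u y\<bar> \<le> \<delta> + D * \<delta> * (1 / 2 ^ j) ^ DIM('a) * ?g" .
        then have "ennreal \<bar>u x - u y\<bar> \<le> ennreal (\<delta> + D * \<delta> * (1 / 2 ^ j) ^ DIM('a) * ?g)" by (rule ennreal_leI)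
        also have "\<dots> = ennreal \<delta> + ennreal (D * \<delta> * (1 / 2 ^ j) ^ DIM('a)) * ennreal ?g"
          using \<delta> D g0 by (subst ennreal_plus) (auto simp: ennreal_mult)
        finally show ?thesis using True by simp
      qed
    qed
    also have "\<dots> = ennreal \<delta> * ennreal m + ennreal (D * \<delta> * (1 / 2 ^ j) ^ DIM('a)) * (\<integral>\<^sup>+y. ennreal (gagliardo_quotient s p u (x, y)) \<partial>lborel)"
    proof -
      have [measurable]: "(\<lambda>y. ennreal (gagliardo_quotient s p u (x, y))) \<in> borel_measurable borel"
        unfolding gagliardo_quotient_def by simp
      have 1: "(\<lambda>y. ennreal \<delta> * indicator Q y) \<in> borel_measurable lborel" using Qs by measurable
      have 2: "(\<lambda>y. ennreal (D * \<delta> * (1 / 2 ^ j) ^ DIM('a)) * ennreal (gagliardo_quotient s p u (x, y))) \<in> borel_measurable lborel" by measurable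
      have 3: "(\<integral>\<^sup>+y. ennreal \<delta> * indicator Q y \<partial>lborel) = ennreal \<delta> * emeasure lborel Q"
        using Qs by (intro nn_integral_cmult_indicator) auto
      show ?thesis unfolding nn_integral_add[OF 1 2] 3 eQ by (subst nn_integral_cmult) auto
    qed
    also have "\<dots> \<le> ennreal \<delta> * ennreal m + ennreal (D * \<delta> * m) * (\<integral>\<^sup>+y. ennreal (gagliardo_quotient s p u (x, y)) \<partial>lborel)"
      using m2 D \<delta> by (intro add_left_mono mult_right_mono ennreal_leI mult_left_mono) auto
    also have "\<dots> = ennreal m * (ennreal \<delta> + ennreal (D * \<delta>) * (\<integral>\<^sup>+y. ennreal (gagliardo_quotient s p u (x, y)) \<partial>lborel))"
      using m D \<delta> by (simp add: ennreal_mult distrib_left mult_ac)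
    finally show ?thesis using m by (simp add: ennreal_mult_le_mult_iff)
  qed
  have "\<Omega> \<in> lmeasurable" using bounded_\<Omega> open_\<Omega> by (intro bounded_set_imp_lmeasurable) auto
  then have e\<Omega>: "emeasure lborel \<Omega> = ennreal (measure lebesgue \<Omega>)" using emeasure_eq_measure2[of \<Omega> lebesgue] open_\<Omega> by simp
  have "(\<integral>\<^sup>+x. ennreal (indicator \<Omega> x * \<bar>u x - cube_avg j u x\<bar>) \<partial>lborel)
    \<le> (\<integral>\<^sup>+x. ennreal \<delta> * indicator \<Omega> x + ennreal (D * \<delta>) * (\<integral>\<^sup>+y. ennreal (gagliardo_quotient s p u (x, y)) \<partial>lborel) \<partial>lborel)"
    by (rule nn_integral_mono) (use pt in \<open>auto simp: indicator_def\<close>)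
  also have "\<dots> = ennreal \<delta> * ennreal (measure lebesgue \<Omega>) + ennreal (D * \<delta>) * ennreal (A u)"
  proof -
    have [measurable]: "(\<lambda>z. ennreal (gagliardo_quotient s p u z)) \<in> borel_measurable (borel \<Otimes>\<^sub>M borel)"
      unfolding gagliardo_quotient_def by measurable
    have 0: "(\<lambda>x. \<integral>\<^sup>+y. ennreal (gagliardo_quotient s p u (x, y)) \<partial>lborel) \<in> borel_measurable lborel" by measurable
    have 1: "(\<lambda>x. ennreal \<delta> * indicator \<Omega> x) \<in> borel_measurable lborel" by measurable
    have 2: "(\<lambda>x. ennreal (D * \<delta>) * (\<integral>\<^sup>+y. ennreal (gagliardo_quotient s p u (x, y)) \<partial>lborel)) \<in> borel_measurable lborel" using 0 by measurable
    have 3: "(\<integral>\<^sup>+x. ennreal \<delta> * indicator \<Omega> x \<partial>lborel) = ennreal \<delta> * emeasure lborel \<Omega>"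
      by (intro nn_integral_cmult_indicator) auto
    show ?thesis unfolding nn_integral_add[OF 1 2] 3 e\<Omega> nn_integral_cmult[OF 0] nn_integral_gagliardo[OF u b] ..
  qed
  also have "\<dots> = ennreal ((measure lebesgue \<Omega> + D * A u) * \<delta>)"
    using \<delta> D gagliardo_pow_nonneg[of s p u]
    by (simp add: ennreal_mult[symmetric] ennreal_plus[symmetric] algebra_simps del: ennreal_plus)
  finally show ?thesis by (simp add: D_def \<delta>_def)
qed

text \<open>Lower semicontinuity: the increments converge almost everywhere on pairs, and Fatou applies to them.\<close>

lemma A_fatou:
  assumes f: "\<And>n. f n \<in> W" and c: "\<And>n. A (f n) \<le> c n" "c \<longlonglongrightarrow> K"
    and u: "u \<in> borel_measurable lebesgue" and lim: "AE x in lebesgue. (\<lambda>n. f n x) \<longlonglongrightarrow> u x"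
  shows "u \<in> W" "A u \<le> K"
proof -
  obtain B where B: "\<And>n. c n \<le> B" using convergent_imp_Bseq[of c] c(2) unfolding convergent_def Bseq_def
    by (metis abs_le_D1 real_norm_def)
  obtain C where C: "C > 0" "\<And>u. u \<in> W \<Longrightarrow> (\<integral>x. \<bar>u x\<bar> \<partial>lebesgue) \<le> C * A u powr (1 / p)" using L1_bound by blast
  have mu: "dif u \<in> borel_measurable K0" using dif_measurable[OF u] by (simp add: measurable_gagliardo_measure)
  have "integrable lebesgue (\<lambda>x. \<bar>u x\<bar>)"
  proof (rule integral_fatou(1)[where f="\<lambda>n x. \<bar>f n x\<bar>" and c="\<lambda>n. C * B powr (1 / p)"])
    show "integrable lebesgue (\<lambda>x. \<bar>f n x\<bar>)" for n using W_integrable[OF f] by simp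
    show "(\<lambda>x. \<bar>u x\<bar>) \<in> borel_measurable lebesgue" using u by measurable
    show "AE x in lebesgue. (\<lambda>n. \<bar>f n x\<bar>) \<longlonglongrightarrow> \<bar>u x\<bar>" using lim by eventually_elim (rule tendsto_rabs)
    show "(\<integral>x. \<bar>f n x\<bar> \<partial>lebesgue) \<le> C * B powr (1 / p)" for n
    proof (rule order_trans[OF C(2)[OF f]])
      show "C * A (f n) powr (1 / p) \<le> C * B powr (1 / p)"
        using C(1) c(1)[of n] B[of n] p0 gagliardo_pow_nonneg[of s p "f n"] by (intro mult_left_mono powr_mono2) auto
    qed
  qed auto
  then have iu: "integrable lebesgue u" using u integrable_abs_iff by blast
  have limd: "AE z in K0. (\<lambda>n. dif (f n) z) \<longlonglongrightarrow> dif u z"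
    using AE_gagliardo_measure_dif[OF lim, of s p] by eventually_elim (auto simp: dif_def intro!: tendsto_diff)
  have limp: "AE z in K0. (\<lambda>n. \<bar>dif (f n) z\<bar> powr p) \<longlonglongrightarrow> \<bar>dif u z\<bar> powr p"
    using limd by eventually_elim (intro tendsto_powr' tendsto_intros, use p0 in auto)
  have le: "(\<integral>z. \<bar>dif (f n) z\<bar> powr p \<partial>K0) \<le> c n" for n
    using c(1)[of n] A_eq[OF f[of n]] by (simp add: pow_integral_def)
  have mu': "(\<lambda>z. \<bar>dif u z\<bar> powr p) \<in> borel_measurable K0" using mu by measurable
  note fat = integral_fatou[OF in_Lm_integrable[OF W_dif[OF f]] _ mu' limp le c(2)]
  have "in_Lm K0 p (dif u)" using fat(1) mu by (simp add: in_Lm_def)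
  moreover have "AE x in lebesgue. x \<notin> \<Omega> \<longrightarrow> u x = 0"
  proof -
    have "AE x in lebesgue. \<forall>n. x \<notin> \<Omega> \<longrightarrow> f n x = 0" unfolding AE_all_countable using W_vanish[OF f] by blast
    then show ?thesis using lim
    proof eventually_elim
      case (elim x)
      show ?case
      proof
        assume "x \<notin> \<Omega>"
        then have "(\<lambda>n. f n x) = (\<lambda>n. 0)" using elim by auto
        then show "u x = 0" using elim(2) LIMSEQ_unique tendsto_const by metis
      qed
    qed
  qed
  ultimately show uW: "u \<in> W" using iu by (intro W_intro)
  show "A u \<le> K" using fat(2) by (simp add: A_eq[OF uW] pow_integral_def)
qed

text \<open>There are countably many dyadic cubes, so one diagonal extraction makes all cube averages converge. At each level the
  averages are bounded functions on a set of finite measure, hence converge in \<open>L\<^sup>1\<close>; by the uniform rate the sequence itself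
  is Cauchy in \<open>L\<^sup>1\<close>.\<close>

theorem compactness:
  fixes f :: "nat \<Rightarrow> 'a \<Rightarrow> real"
  assumes f: "\<And>n. f n \<in> W" and K: "\<And>n. A (f n) \<le> K"
  shows "\<exists>k u. strict_mono k \<and> u \<in> W \<and> (AE x in lebesgue. (\<lambda>n. f (k n) x) \<longlonglongrightarrow> u x)"
proof -
  let ?N = "real DIM('a)"
  have "\<forall>n. \<exists>v. v \<in> borel_measurable borel \<and> (AE x in lebesgue. v x = f n x) \<and> v \<in> W \<and> A v = A (f n) \<and> (\<forall>x. x \<notin> \<Omega> \<longrightarrow> v x = 0)"
    using W_ex_borel_supp[OF f] by metis
  then obtain v where vb: "\<And>n. v n \<in> borel_measurable borel" and veq: "\<And>n. AE x in lebesgue. v n x = f n x"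
    and vW: "\<And>n. v n \<in> W" and vA: "\<And>n. A (v n) = A (f n)" and v0: "\<And>n x. x \<notin> \<Omega> \<Longrightarrow> v n x = 0"
    by metis
  have [measurable]: "v n \<in> borel_measurable borel" "\<Omega> \<in> sets borel" for n using vb open_\<Omega> by auto
  have iv: "integrable lborel (v n)" for n using W_integrable[OF vW] vb by (simp add: integrable_completion)
  have \<Omega>m: "\<Omega> \<in> lmeasurable" using bounded_\<Omega> open_\<Omega> by (intro bounded_set_imp_lmeasurable) auto
  have K0: "0 \<le> K" using K gagliardo_pow_nonneg order_trans by blast
  obtain C0 where C0: "C0 > 0" "\<And>u. u \<in> W \<Longrightarrow> (\<integral>x. \<bar>u x\<bar> \<partial>lebesgue) \<le> C0 * A u powr (1 / p)" using L1_bound by blast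
  define C where "C = C0 * K powr (1 / p)"
  have C: "(\<integral>x. \<bar>v n x\<bar> \<partial>lborel) \<le> C" for n
  proof -
    have "(\<integral>x. \<bar>v n x\<bar> \<partial>lborel) = (\<integral>x. \<bar>v n x\<bar> \<partial>lebesgue)" by (simp add: integral_completion)
    also have "\<dots> \<le> C0 * A (v n) powr (1 / p)" by (rule C0(2)[OF vW])
    also have "\<dots> \<le> C" unfolding C_def using C0(1) K[of n] vA[of n] p0 gagliardo_pow_nonneg[of s p "v n"]
      by (intro mult_left_mono powr_mono2) auto
    finally show ?thesis .
  qed
  \<comment> \<open>The integrals over all cubes, indexed by level and label, are bounded uniformly in \<open>n\<close>.\<close>
  define I where "I = (\<lambda>n (j, c). \<integral>y. indicator (cube j c) y * v n y \<partial>lborel)"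
  have Ib: "norm (I n q) \<le> C" for n q
  proof -
    obtain j c where q: "q = (j, c)" by (cases q)
    have ii: "integrable lborel (\<lambda>y. indicator (cube j c) y * v n y)"
      using integrable_mult_indicator[OF _ iv, of "cube j c"] cube_sets by simp
    have "norm (I n q) \<le> (\<integral>y. norm (indicator (cube j c) y * v n y) \<partial>lborel)"
      unfolding I_def q using integral_norm_bound by simp
    also have "\<dots> \<le> (\<integral>y. \<bar>v n y\<bar> \<partial>lborel)"
      by (rule integral_mono[OF integrable_norm[OF ii] integrable_abs[OF iv]]) (auto simp: indicator_def)
    finally show ?thesis using C[of n] by simp
  qed
  have cnt: "countable (SIGMA j:UNIV. range (cell j :: 'a \<Rightarrow> 'a))" by (intro countable_SIGMA countable_range_cell) auto
  obtain k :: "nat \<Rightarrow> nat" where k: "strict_mono k" and kc: "\<And>q. q \<in> (SIGMA j:UNIV. range (cell j :: 'a \<Rightarrow> 'a)) \<Longrightarrow> \<exists>l. (\<lambda>n. I (k n) q) \<longlonglongrightarrow> l"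
    using function_convergent_subsequence[OF cnt, of I C] Ib by metis
  define w where "w = (\<lambda>n. v (k n))"
  define P where "P = (\<lambda>j n. cube_avg j (w n))"
  have P: "P j n x = I (k n) (j, cell j x) / measure lebesgue (cube j (cell j x))" for j n x
    by (simp add: P_def cube_avg_def I_def w_def)
  have Pm[measurable]: "P j n \<in> borel_measurable borel" for j n unfolding P_def by (rule cube_avg_measurable)
  have wm[measurable]: "w n \<in> borel_measurable borel" for n by (simp add: w_def)
  have Pconv: "convergent (\<lambda>n. P j n x)" for j x
  proof -
    obtain l where "(\<lambda>n. I (k n) (j, cell j x)) \<longlonglongrightarrow> l" using kc[of "(j, cell j x)"] by auto
    moreover have "0 < measure lebesgue (cube j (cell j x))"
      by (rule less_le_trans[OF _ cube_measure(2)]) simp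
    ultimately have "(\<lambda>n. P j n x) \<longlonglongrightarrow> l / measure lebesgue (cube j (cell j x))" unfolding P 
      by (intro tendsto_divide tendsto_const) auto
    then show ?thesis by (auto simp: convergent_def)
  qed
  have Pb: "\<bar>P j n x\<bar> \<le> C * (2 ^ j) ^ DIM('a)" for j n x
  proof -
    have "\<bar>P j n x\<bar> = norm (I (k n) (j, cell j x)) / measure lebesgue (cube j (cell j x))"
      unfolding P by (simp add: abs_divide)
    also have "\<dots> \<le> C / (1 / 2 ^ j) ^ DIM('a)"
      using cube_measure(2)[of j x] Ib by (intro frac_le order_trans[OF norm_ge_zero Ib]) auto
    finally show ?thesis by (simp add: power_one_over)
  qed
  have v\<Omega>: "indicator \<Omega> x * w n x = w n x" for x n using v0[of x] by (auto simp: w_def indicator_def)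
  have iw: "integrable lborel (w n)" for n by (simp add: w_def iv)
  have i\<Omega>: "integrable lborel (\<lambda>x. indicator \<Omega> x * c)" for c :: real
    using \<Omega>m open_\<Omega> emeasure_eq_measure2[of \<Omega> lebesgue] by (intro integrable_mult_left integrable_real_indicator) auto
  have iP: "integrable lborel (\<lambda>x. indicator \<Omega> x * P j n x)" for j n
    by (rule Bochner_Integration.integrable_bound[OF i\<Omega>[of "C * (2 ^ j) ^ DIM('a)"]])
      (use Pb in \<open>auto simp: indicator_def intro!: AE_I2 order_trans[OF Pb]\<close>)
  have i1: "integrable lborel (\<lambda>x. indicator \<Omega> x * \<bar>w n x - P j n x\<bar>)" for n j
  proof -
    have "integrable lborel (\<lambda>x. \<bar>indicator \<Omega> x * w n x - indicator \<Omega> x * P j n x\<bar>)"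
      unfolding v\<Omega> by (intro integrable_abs Bochner_Integration.integrable_diff iw iP)
    then show ?thesis by (rule Bochner_Integration.integrable_cong[THEN iffD1, rotated -1]) (auto simp: indicator_def)
  qed
  define E where "E = (\<lambda>j::nat. (measure lebesgue \<Omega> + ?N powr (?N + p * s) * K) * 2 powr (- real j * s))"
  have err: "(\<integral>x. indicator \<Omega> x * \<bar>w n x - P j n x\<bar> \<partial>lborel) \<le> E j" for n j
  proof -
    have "ennreal (\<integral>x. indicator \<Omega> x * \<bar>w n x - P j n x\<bar> \<partial>lborel) = (\<integral>\<^sup>+x. ennreal (indicator \<Omega> x * \<bar>w n x - P j n x\<bar>) \<partial>lborel)"
      by (rule nn_integral_eq_integral[OF i1, symmetric]) auto
    also have "\<dots> \<le> ennreal ((measure lebesgue \<Omega> + ?N powr (?N + p * s) * A (w n)) * 2 powr (- real j * s))"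
      unfolding P_def w_def by (rule cube_avg_error[OF vW vb])
    also have "\<dots> \<le> ennreal (E j)" unfolding E_def w_def using K vA by (intro ennreal_leI mult_right_mono add_left_mono mult_left_mono) auto
    finally show ?thesis using K0 by (subst (asm) ennreal_le_iff) (auto simp: E_def)
  qed
  have "((\<lambda>j. (2 powr - s) ^ j) \<longlongrightarrow> 0) sequentially"
  proof (rule LIMSEQ_realpow_zero)
    have "2 powr (- s) < 2 powr 0" using s0 by (intro powr_less_mono) auto
    then show "2 powr (- s) < 1" by simp
  qed simp
  then have "(\<lambda>j. (measure lebesgue \<Omega> + ?N powr (?N + p * s) * K) * (2 powr - s) ^ j) \<longlonglongrightarrow> (measure lebesgue \<Omega> + ?N powr (?N + p * s) * K) * 0"
    by (intro tendsto_mult tendsto_const)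
  then have E0: "E \<longlonglongrightarrow> 0" unfolding E_def using two_powr_nat[of _ "- s"] by simp
  have Cau: "\<exists>N. \<forall>m\<ge>N. \<forall>n\<ge>N. (\<integral>x. \<bar>w m x - w n x\<bar> \<partial>lborel) < e" if e: "0 < e" for e
  proof -
    obtain j where j: "E j < e / 4" using order_tendstoD(2)[OF E0, of "e / 4"] e by (auto simp: eventually_sequentially)
    define g where "g = (\<lambda>x. lim (\<lambda>n. P j n x))"
    have gm[measurable]: "g \<in> borel_measurable borel" unfolding g_def by measurable
    have Pg: "(\<lambda>n. P j n x) \<longlonglongrightarrow> g x" for x unfolding g_def using Pconv convergent_LIMSEQ_iff by blast
    define B where "B = C * (2 ^ j) ^ DIM('a)"
    have gB: "\<bar>g x\<bar> \<le> B" for x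
      by (rule LIMSEQ_le_const2[OF tendsto_rabs[OF Pg]]) (use Pb in \<open>auto simp: B_def\<close>)
    have "(\<lambda>n. \<integral>x. indicator \<Omega> x * \<bar>P j n x - g x\<bar> \<partial>lborel) \<longlonglongrightarrow> (\<integral>x. 0 \<partial>(lborel :: 'a measure))"
    proof (rule integral_dominated_convergence[where w="\<lambda>x. indicator \<Omega> x * (2 * B)"])
      show "AE x in lborel. (\<lambda>n. indicator \<Omega> x * \<bar>P j n x - g x\<bar>) \<longlonglongrightarrow> 0"
      proof (rule AE_I2)
        fix x
        have "(\<lambda>n. indicator \<Omega> x * \<bar>P j n x - g x\<bar>) \<longlonglongrightarrow> indicator \<Omega> x * \<bar>g x - g x\<bar>"
          by (intro tendsto_intros Pg)
        then show "(\<lambda>n. indicator \<Omega> x * \<bar>P j n x - g x\<bar>) \<longlonglongrightarrow> 0" by simp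
      qed
      show "AE x in lborel. norm (indicator \<Omega> x * \<bar>P j n x - g x\<bar>) \<le> indicator \<Omega> x * (2 * B)" for n
      proof (rule AE_I2)
        fix x show "norm (indicator \<Omega> x * \<bar>P j n x - g x\<bar>) \<le> indicator \<Omega> x * (2 * B)"
          using Pb[of j n x] gB[of x] by (auto simp: indicator_def B_def)
      qed
    qed (use i\<Omega> in auto)
    then have "(\<lambda>n. \<integral>x. indicator \<Omega> x * \<bar>P j n x - g x\<bar> \<partial>lborel) \<longlonglongrightarrow> 0" by simp
    from order_tendstoD(2)[OF this, of "e / 4"] e obtain N where
      N: "\<And>n. n \<ge> N \<Longrightarrow> (\<integral>x. indicator \<Omega> x * \<bar>P j n x - g x\<bar> \<partial>lborel) < e / 4" by (auto simp: eventually_sequentially)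
    have ig: "integrable lborel (\<lambda>x. indicator \<Omega> x * g x)"
      by (rule Bochner_Integration.integrable_bound[OF i\<Omega>[of B]])
        (auto simp: indicator_def intro!: AE_I2 order_trans[OF gB])
    have i2: "integrable lborel (\<lambda>x. indicator \<Omega> x * \<bar>P j n x - g x\<bar>)" for n
    proof -
      have "integrable lborel (\<lambda>x. \<bar>indicator \<Omega> x * P j n x - indicator \<Omega> x * g x\<bar>)"
        by (intro integrable_abs Bochner_Integration.integrable_diff ig iP)
      then show ?thesis by (rule Bochner_Integration.integrable_cong[THEN iffD1, rotated -1]) (auto simp: indicator_def)
    qed
    show ?thesis
    proof (intro exI[of _ N] allI impI)
      fix m n assume mn: "N \<le> m" "N \<le> n"
      let ?a = "\<lambda>n x. indicator \<Omega> x * \<bar>w n x - P j n x\<bar> :: real" and ?b = "\<lambda>n x. indicator \<Omega> x * \<bar>P j n x - g x\<bar> :: real"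
      have "(\<integral>x. \<bar>w m x - w n x\<bar> \<partial>lborel) \<le> (\<integral>x. ?a m x + ?b m x + ?a n x + ?b n x \<partial>lborel)"
      proof (rule integral_mono)
        show "integrable lborel (\<lambda>x. \<bar>w m x - w n x\<bar>)" using iw by auto
        show "integrable lborel (\<lambda>x. ?a m x + ?b m x + ?a n x + ?b n x)" by (intro Bochner_Integration.integrable_add i1 i2)
        fix x show "\<bar>w m x - w n x\<bar> \<le> ?a m x + ?b m x + ?a n x + ?b n x"
          using v\<Omega>[of x m] v\<Omega>[of x n] by (cases "x \<in> \<Omega>") auto
      qed
      also have "\<dots> = (\<integral>x. ?a m x \<partial>lborel) + (\<integral>x. ?b m x \<partial>lborel) + (\<integral>x. ?a n x \<partial>lborel) + (\<integral>x. ?b n x \<partial>lborel)"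
        by (simp add: i1 i2)
      also have "\<dots> < e" using err[of m j] err[of n j] N[OF mn(1)] N[OF mn(2)] j by linarith
      finally show "(\<integral>x. \<bar>w m x - w n x\<bar> \<partial>lborel) < e" .
    qed
  qed
  obtain r where r: "strict_mono r" "AE x in lborel. convergent (\<lambda>n. w (r n) x)"
    using L1_Cauchy_AE_subseq[OF iw Cau] by blast
  define u where "u = (\<lambda>x. lim (\<lambda>n. w (r n) x))"
  have "u \<in> borel_measurable borel" unfolding u_def by measurable
  then have um: "u \<in> borel_measurable lebesgue" by (simp add: measurable_completion)
  have lim1: "AE x in lebesgue. (\<lambda>n. w (r n) x) \<longlonglongrightarrow> u x"
    using AE_completion[OF r(2)] by eventually_elim (simp add: u_def convergent_LIMSEQ_iff)
  have "AE x in lebesgue. \<forall>n. v n x = f n x" unfolding AE_all_countable using veq by blast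
  with lim1 have lim2: "AE x in lebesgue. (\<lambda>n. f ((k \<circ> r) n) x) \<longlonglongrightarrow> u x"
    by eventually_elim (simp add: w_def)
  have "u \<in> W" by (rule A_fatou(1)[OF f K tendsto_const um lim2])
  then show ?thesis using lim2 strict_mono_o[OF k r(1)] by blast
qed

text \<open>There is room for an exponent between \<open>m\<close> and the critical one, in which the sequence is bounded by the embedding.\<close>

lemma pow_integral_weighted_tendsto:
  assumes \<alpha>: "0 \<le> \<alpha>" "\<alpha> < p * s" and m: "0 < m" "m < crit_exp TYPE('a) s p \<alpha>"
    and f: "\<And>n. f n \<in> W" and K: "\<And>n. A (f n) \<le> K" and u: "u \<in> W"
    and lim: "AE x in lebesgue. (\<lambda>n. f n x) \<longlonglongrightarrow> u x"
  shows "(\<lambda>n. pow_integral (weighted_measure \<Omega> \<alpha>) m (f n)) \<longlonglongrightarrow> pow_integral (weighted_measure \<Omega> \<alpha>) m u"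
proof -
  define m' where "m' = (m + crit_exp TYPE('a) s p \<alpha>) / 2"
  have m': "m < m'" "m' < crit_exp TYPE('a) s p \<alpha>" "0 < m'" using m by (auto simp: m'_def)
  obtain C where C: "C > 0" "\<And>u. u \<in> W \<Longrightarrow> in_Lm (weighted_measure \<Omega> \<alpha>) m' u" "\<And>u. u \<in> W \<Longrightarrow> pow_integral (weighted_measure \<Omega> \<alpha>) m' u \<le> C * A u powr (m' / p)"
    using embedding[OF \<alpha> m'(3,2)] by blast
  show ?thesis
  proof (rule pow_integral_vitali(2)[OF weighted_measure_finite m(1) m'(1)])
    show "0 \<le> \<alpha>" "\<alpha> < real DIM('a)" using \<alpha> psN by auto
    show "in_Lm (weighted_measure \<Omega> \<alpha>) m' (f n)" for n by (rule C(2)[OF f])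
    show "pow_integral (weighted_measure \<Omega> \<alpha>) m' (f n) \<le> C * K powr (m' / p)" for n
    proof (rule order_trans[OF C(3)[OF f]])
      show "C * A (f n) powr (m' / p) \<le> C * K powr (m' / p)"
        using C(1) K[of n] p0 m' gagliardo_pow_nonneg[of s p "f n"] by (intro mult_left_mono powr_mono2) auto
    qed
    show "u \<in> borel_measurable (weighted_measure \<Omega> \<alpha>)" using W_measurable[OF u] by (simp add: measurable_weighted_measure)
    show "AE x in weighted_measure \<Omega> \<alpha>. (\<lambda>n. f n x) \<longlonglongrightarrow> u x" by (rule AE_weighted[OF lim])
  qed
qed

end

section \<open>The energy and its derivative\<close>

text \<open>A fixed point of the map \<open>z \<mapsto> z + (F z, G z)\<close>, clamped to the square, is a common zero: on a face the sign condition
  forces the map to move points inwards.\<close>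

lemma poincare_miranda:
  fixes F G :: "real \<times> real \<Rightarrow> real"
  assumes \<rho>R: "\<rho> < R"
    and F: "continuous_on (cbox (\<rho>, \<rho>) (R, R)) F" and G: "continuous_on (cbox (\<rho>, \<rho>) (R, R)) G"
    and F1: "\<And>y. y \<in> {\<rho>..R} \<Longrightarrow> 0 < F (\<rho>, y)" and F2: "\<And>y. y \<in> {\<rho>..R} \<Longrightarrow> F (R, y) < 0"
    and G1: "\<And>x. x \<in> {\<rho>..R} \<Longrightarrow> 0 < G (x, \<rho>)" and G2: "\<And>x. x \<in> {\<rho>..R} \<Longrightarrow> G (x, R) < 0"
  shows "\<exists>x\<in>{\<rho>..R}. \<exists>y\<in>{\<rho>..R}. F (x, y) = 0 \<and> G (x, y) = 0"
proof -
  let ?S = "cbox (\<rho>, \<rho>) (R, R)"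
  have S: "(x, y) \<in> ?S \<longleftrightarrow> x \<in> {\<rho>..R} \<and> y \<in> {\<rho>..R}" for x y
    by (auto simp: cbox_Pair_eq)
  \<comment> \<open>Clamping to the interval keeps the map inside the square.\<close>
  define cl where "cl = (\<lambda>x. max \<rho> (min R x))"
  define T where "T = (\<lambda>z. (cl (fst z + F z), cl (snd z + G z)))"
  have "\<exists>z\<in>?S. T z = z"
  proof (rule brouwer)
    show "continuous_on ?S T" unfolding T_def cl_def using F G by (intro continuous_intros)
    show "T \<in> ?S \<rightarrow> ?S" using \<rho>R by (auto simp: T_def cl_def S)
    have "(\<rho>, \<rho>) \<in> ?S" unfolding S using \<rho>R by simp
    then show "?S \<noteq> {}" by blast
  qed auto
  then obtain x y where xy: "(x, y) \<in> ?S" "T (x, y) = (x, y)" by (metis prod.collapse)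
  then have e: "cl (x + F (x, y)) = x" "cl (y + G (x, y)) = y" by (auto simp: T_def)
  have x: "x \<in> {\<rho>..R}" and y: "y \<in> {\<rho>..R}" using xy S by auto
  have "F (x, y) = 0"
    using e(1) F1[OF y] F2[OF y] x \<rho>R unfolding cl_def by (auto simp: max_def min_def split: if_splits)
  moreover have "G (x, y) = 0"
    using e(2) G1[OF x] G2[OF x] y \<rho>R unfolding cl_def by (auto simp: max_def min_def split: if_splits)
  ultimately show ?thesis using x y by blast
qed

lemma perturb_positive:
  fixes F :: "real \<times> real \<Rightarrow> real"
  assumes F: "continuous_on UNIV F" and \<rho>R: "\<rho> \<le> R" and pos: "\<And>x. x \<in> {\<rho>..R} \<Longrightarrow> 0 < F (x, 0)"
  shows "\<exists>e>0. \<forall>\<epsilon>\<in>{0..e}. \<forall>x\<in>{\<rho>..R}. 0 < F (x, \<epsilon>)"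
proof -
  have "continuous_on {\<rho>..R} (\<lambda>x. F (x, 0))"
    by (rule continuous_on_compose2[OF F]) (auto intro!: continuous_intros)
  then obtain x0 where x0: "x0 \<in> {\<rho>..R}" "\<And>x. x \<in> {\<rho>..R} \<Longrightarrow> F (x0, 0) \<le> F (x, 0)"
    using continuous_attains_inf[of "{\<rho>..R}" "\<lambda>x. F (x, 0)"] \<rho>R by (metis atLeastatMost_empty_iff2 compact_Icc not_le)
  have "uniformly_continuous_on (cbox (\<rho>, 0) (R, 1)) F"
    by (rule compact_uniformly_continuous) (auto intro: continuous_on_subset[OF F])
  then obtain d where d: "d > 0" "\<And>z z'. z \<in> cbox (\<rho>, 0) (R, 1) \<Longrightarrow> z' \<in> cbox (\<rho>, 0) (R, 1) \<Longrightarrow> dist z' z < d \<Longrightarrow> dist (F z') (F z) < F (x0, 0)"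
    using pos[OF x0(1)] unfolding uniformly_continuous_on_def by metis
  show ?thesis
  proof (intro exI[of _ "min 1 (d / 2)"] conjI ballI)
    show "0 < min 1 (d / 2)" using d by simp
    fix \<epsilon> x assume a: "\<epsilon> \<in> {0..min 1 (d / 2)}" "x \<in> {\<rho>..R}"
    have "dist (F (x, \<epsilon>)) (F (x, 0)) < F (x0, 0)"
      using a d(1) by (intro d(2)) (auto simp: cbox_Pair_eq dist_Pair_Pair)
    then show "0 < F (x, \<epsilon>)" using x0(2)[OF a(2)] by (auto simp: dist_real_def)
  qed
qed

lemma continuous_on_UNIV_sequentially:
  fixes f :: "'a::metric_space \<Rightarrow> 'b::metric_space"
  assumes "\<And>x l. x \<longlonglongrightarrow> l \<Longrightarrow> (\<lambda>n. f (x n)) \<longlonglongrightarrow> f l"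
  shows "continuous_on UNIV f"
  unfolding continuous_on_sequentially using assms by (auto simp: o_def)

lemma dpow_mult_mono:
  assumes "1 < p" "0 \<le> a * b" "\<tau> \<le> \<tau>'"
  shows "dpow p (t * a + \<tau> * b) * a \<le> dpow p (t * a + \<tau>' * b) * a"
proof -
  consider "a = 0" | "0 < a" "0 \<le> b" | "a < 0" "b \<le> 0"
    using assms(2) by (fastforce simp: zero_le_mult_iff)
  then show ?thesis
  proof cases
    case 2
    then have "dpow p (t * a + \<tau> * b) \<le> dpow p (t * a + \<tau>' * b)"
      using assms by (intro dpow_mono add_left_mono mult_right_mono) auto
    then show ?thesis using 2 by (intro mult_right_mono) auto
  next
    case 3
    then have "dpow p (t * a + \<tau>' * b) \<le> dpow p (t * a + \<tau> * b)"
      using assms by (intro dpow_mono add_left_mono mult_right_mono_neg) auto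
    then show ?thesis using 3 by (intro mult_right_mono_neg) auto
  qed simp
qed

text \<open>The weights \<open>a / (a + b)\<close> and \<open>b / (a + b)\<close> are nonnegative, so Jensen applies to \<open>(t a + \<tau> b) / (a + b)\<close>. The bound is
  attained for \<open>t = \<tau>\<close>: it is the tangent plane of a concave function of \<open>t powr p\<close> and \<open>\<tau> powr p\<close>.\<close>

lemma powr_hidden_convexity:
  assumes "1 < p" "0 \<le> a * b" "0 \<le> t" "0 \<le> \<tau>"
  shows "\<bar>t * a + \<tau> * b\<bar> powr p \<le> t powr p * (dpow p (a + b) * a) + \<tau> powr p * (dpow p (a + b) * b)"
proof (cases "a + b = 0")
  case True
  then have ab: "a = - b" by simp
  then have "b * b = 0" using assms(2) zero_le_square[of b] by (simp only: minus_mult_left[symmetric])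
  then have "a = 0 \<and> b = 0" using ab by simp
  then show ?thesis by simp
next
  case False
  define \<theta> where "\<theta> = a / (a + b)"
  have ab: "a = (a + b) * \<theta>" "b = (a + b) * (1 - \<theta>)" using False by (auto simp: \<theta>_def field_simps)
  have "0 \<le> a * (a + b)" "0 \<le> b * (a + b)" using assms(2) by (auto simp: algebra_simps)
  then have \<theta>: "0 \<le> \<theta>" "0 \<le> 1 - \<theta>" 
  proof -
    have "1 - \<theta> = b / (a + b)" using False by (simp add: \<theta>_def field_simps)
    then have "\<theta> = a * (a + b) / (a + b)^2" "1 - \<theta> = b * (a + b) / (a + b)^2"
      using False by (simp_all add: \<theta>_def power2_eq_square)
    then show "0 \<le> \<theta>" "0 \<le> 1 - \<theta>" using \<open>0 \<le> a * (a + b)\<close> \<open>0 \<le> b * (a + b)\<close> by auto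
  qed
  have "(a + b) * (\<theta> * t + (1 - \<theta>) * \<tau>) = ((a + b) * \<theta>) * t + ((a + b) * (1 - \<theta>)) * \<tau>" by (simp only: distrib_left mult.assoc)
  also have "\<dots> = a * t + b * \<tau>" by (simp only: ab[symmetric])
  also have "\<dots> = t * a + \<tau> * b" by (simp add: mult.commute)
  finally have "t * a + \<tau> * b = (a + b) * (\<theta> * t + (1 - \<theta>) * \<tau>)" ..
  then have "\<bar>t * a + \<tau> * b\<bar> powr p = \<bar>a + b\<bar> powr p * (\<theta> * t + (1 - \<theta>) * \<tau>) powr p"
    using \<theta> assms by (simp add: abs_mult powr_mult)
  also have "\<dots> \<le> \<bar>a + b\<bar> powr p * (\<theta> * t powr p + (1 - \<theta>) * \<tau> powr p)"
    using \<theta> assms by (intro mult_left_mono powr_jensen) auto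
  also have "\<dots> = dpow p (a + b) * ((a + b) * \<theta> * t powr p + (a + b) * (1 - \<theta>) * \<tau> powr p)"
    unfolding dpow_mult_self[symmetric] by (simp add: algebra_simps)
  also have "\<dots> = t powr p * (dpow p (a + b) * a) + \<tau> powr p * (dpow p (a + b) * b)"
    unfolding ab[symmetric] by (simp add: algebra_simps)
  finally show ?thesis .
qed

definition pos_part :: "('a \<Rightarrow> real) \<Rightarrow> 'a \<Rightarrow> real" where "pos_part u = (\<lambda>x. max (u x) 0)"
definition neg_part :: "('a \<Rightarrow> real) \<Rightarrow> 'a \<Rightarrow> real" where "neg_part u = (\<lambda>x. min (u x) 0)"

lemma pos_add_neg: "pos_part u x + neg_part u x = u x"
  by (simp add: pos_part_def neg_part_def max_def min_def)
lemma pos_mult_neg: "pos_part u x * neg_part u x = 0"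
  by (simp add: pos_part_def neg_part_def max_def min_def)
text \<open>Both truncations are nondecreasing functions of the value of \<open>u\<close>.\<close>

lemma dif_pos_neg: "0 \<le> dif (pos_part u) z * dif (neg_part u) z"
  by (auto simp: dif_def pos_part_def neg_part_def max_def min_def mult_nonneg_nonneg mult_nonpos_nonpos zero_le_mult_iff)

locale nehari = frac s p \<Omega> for s p :: real and \<Omega> :: "'a::euclidean_space set" +
  fixes \<alpha> q r lam \<mu> :: real
  assumes \<alpha>0: "0 \<le> \<alpha>" and \<alpha>s: "\<alpha> < p * s"
    and q: "p \<le> q" "q < crit_exp TYPE('a) s p \<alpha>" and r: "p \<le> r" "r < crit_exp TYPE('a) s p 0"
    and qr: "max q r > p" and lam0: "0 < lam" and \<mu>0: "0 < \<mu>"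
    and lam1: "r = p \<Longrightarrow> lam < eigenvalue1 s p \<Omega> 0" and \<mu>1: "q = p \<Longrightarrow> \<mu> < eigenvalue1 s p \<Omega> \<alpha>"
begin

abbreviation "Mr \<equiv> weighted_measure \<Omega> 0"
abbreviation "Mq \<equiv> weighted_measure \<Omega> \<alpha>"

text \<open>The energy is \<open>J\<close>, and \<open>dJ u h\<close> is its derivative at \<open>u\<close> in the direction \<open>h\<close>; \<open>dA\<close> is the part of it that comes from
  the seminorm. The sum \<open>S\<close> contains those lower-order terms whose homogeneity exceeds \<open>p\<close>; at least one of them is present since
  \<open>max q r > p\<close>.\<close>

definition "B u = lam * pow_integral Mr r u"
definition "D u = \<mu> * pow_integral Mq q u"
definition "dA u h = (\<integral>z. dpow p (dif u z) * dif h z \<partial>K0)"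
definition "J u = A u / p - B u / r - D u / q"
definition "dJ u h = dA u h - lam * (\<integral>x. dpow r (u x) * h x \<partial>Mr) - \<mu> * (\<integral>x. dpow q (u x) * h x \<partial>Mq)"
definition "S u = (if r = p then 0 else B u) + (if q = p then 0 else D u)"

lemma r1: "1 < r" and q1: "1 < q" and r0: "0 < r" and q0: "0 < q" using p1 q r by auto
lemma ps0: "0 < p * s" using p0 s0 by simp

lemma energy_eq:
  assumes u: "u \<in> W" shows "energy s p \<Omega> \<alpha> q r lam \<mu> u = J u"
  unfolding energy_def J_def B_def D_def pow_integral_weighted_0[OF W_measurable[OF u]] pow_integral_weighted(1)[OF W_measurable[OF u], of \<alpha>]
  by simp

lemma emb_r: "\<exists>C>0. \<forall>u\<in>W. in_Lm Mr r u \<and> pow_integral Mr r u \<le> C * A u powr (r / p)"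
  by (rule embedding) (use ps0 r r0 in auto)
lemma emb_q: "\<exists>C>0. \<forall>u\<in>W. in_Lm Mq q u \<and> pow_integral Mq q u \<le> C * A u powr (q / p)"
  by (rule embedding) (use \<alpha>0 \<alpha>s q q0 in auto)
lemma in_Lm_r: "u \<in> W \<Longrightarrow> in_Lm Mr r u" using emb_r by blast
lemma in_Lm_q: "u \<in> W \<Longrightarrow> in_Lm Mq q u" using emb_q by blast

lemma W_zero: "(\<lambda>x. 0) \<in> W"
  by (rule W_intro) (auto simp: in_Lm_def dif_def[abs_def])

lemma W_lin: "f \<in> W \<Longrightarrow> g \<in> W \<Longrightarrow> h \<in> W \<Longrightarrow> (\<lambda>x. a * f x + b * g x + c * h x) \<in> W"
  by (rule W_add[OF W_add[OF W_cmult W_cmult] W_cmult])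

lemma W_pos_part: "u \<in> W \<Longrightarrow> pos_part u \<in> W" unfolding pos_part_def by (rule W_pos)
lemma W_neg_part: "u \<in> W \<Longrightarrow> neg_part u \<in> W" unfolding neg_part_def by (rule W_neg)

lemma integrable_A_term: "u \<in> W \<Longrightarrow> h \<in> W \<Longrightarrow> integrable K0 (\<lambda>z. dpow p (dif u z) * dif h z)"
  by (rule integrable_dpow[OF W_dif W_dif p1])
lemma integrable_r_term: "u \<in> W \<Longrightarrow> h \<in> W \<Longrightarrow> integrable Mr (\<lambda>x. dpow r (u x) * h x)"
  by (rule integrable_dpow[OF in_Lm_r in_Lm_r r1])
lemma integrable_q_term: "u \<in> W \<Longrightarrow> h \<in> W \<Longrightarrow> integrable Mq (\<lambda>x. dpow q (u x) * h x)"
  by (rule integrable_dpow[OF in_Lm_q in_Lm_q q1])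

lemma B_nonneg: "0 \<le> B u" and D_nonneg: "0 \<le> D u"
  using lam0 \<mu>0 by (auto simp: B_def D_def intro!: mult_nonneg_nonneg pow_integral_nonneg)
lemma S_nonneg: "0 \<le> S u" using B_nonneg D_nonneg by (simp add: S_def)

lemma dA_self: "u \<in> W \<Longrightarrow> dA u u = A u"
  by (simp add: dA_def dpow_mult_self A_eq pow_integral_def)

lemma dJ_self: "u \<in> W \<Longrightarrow> dJ u u = A u - B u - D u"
  by (simp add: dJ_def dA_self B_def D_def pow_integral_def dpow_mult_self)

lemma dJ_add:
  assumes "u \<in> W" "g \<in> W" "h \<in> W" shows "dJ u (\<lambda>x. g x + h x) = dJ u g + dJ u h"
proof -
  have d: "dif (\<lambda>x. g x + h x) z = dif g z + dif h z" for z by (simp add: dif_def)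
  show ?thesis unfolding dJ_def dA_def d distrib_left
    using integrable_A_term[OF assms(1,2)] integrable_A_term[OF assms(1,3)] integrable_r_term[OF assms(1,2)] integrable_r_term[OF assms(1,3)] integrable_q_term[OF assms(1,2)] integrable_q_term[OF assms(1,3)]
    by (simp add: algebra_simps)
qed

lemma dJ_cmult: "dJ u (\<lambda>x. c * h x) = c * dJ u h"
proof -
  have d: "dif (\<lambda>x. c * h x) z = c * dif h z" for z by (simp add: dif_def algebra_simps)
  have m: "a * (c * b) = c * (a * b)" for a b :: real by simp
  show ?thesis unfolding dJ_def dA_def d m by (simp add: algebra_simps)
qed

lemma J_has_derivative:
  assumes u: "u \<in> W" and h: "h \<in> W"
  shows "((\<lambda>t. J (\<lambda>x. u x + t * h x)) has_real_derivative dJ (\<lambda>x. u x + t * h x) h) (at t)"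
proof -
  have uh: "(\<lambda>x. u x + t * h x) \<in> W" for t by (rule W_add[OF u W_cmult[OF h]])
  have d: "dif (\<lambda>x. u x + t * h x) = (\<lambda>z. dif u z + t * dif h z)" for t by (auto simp: dif_def algebra_simps)
  have 1: "((\<lambda>t. pow_integral K0 p (\<lambda>z. dif u z + t * dif h z)) has_real_derivative p * dA (\<lambda>x. u x + t * h x) h) (at t)"
    unfolding dA_def d by (rule pow_integral_has_derivative[OF W_dif[OF u] W_dif[OF h] p1])
  have 2: "((\<lambda>t. pow_integral Mr r (\<lambda>x. u x + t * h x)) has_real_derivative r * (\<integral>x. dpow r (u x + t * h x) * h x \<partial>Mr)) (at t)"
    by (rule pow_integral_has_derivative[OF in_Lm_r[OF u] in_Lm_r[OF h] r1])
  have 3: "((\<lambda>t. pow_integral Mq q (\<lambda>x. u x + t * h x)) has_real_derivative q * (\<integral>x. dpow q (u x + t * h x) * h x \<partial>Mq)) (at t)"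
    by (rule pow_integral_has_derivative[OF in_Lm_q[OF u] in_Lm_q[OF h] q1])
  have "J (\<lambda>x. u x + t * h x) = pow_integral K0 p (\<lambda>z. dif u z + t * dif h z) / p - lam * pow_integral Mr r (\<lambda>x. u x + t * h x) / r
     - \<mu> * pow_integral Mq q (\<lambda>x. u x + t * h x) / q" for t
    unfolding J_def B_def D_def A_eq[OF uh] d by simp
  moreover have "((\<lambda>t. pow_integral K0 p (\<lambda>z. dif u z + t * dif h z) / p - lam * pow_integral Mr r (\<lambda>x. u x + t * h x) / r
     - \<mu> * pow_integral Mq q (\<lambda>x. u x + t * h x) / q) has_real_derivative
     p * dA (\<lambda>x. u x + t * h x) h / p - lam * (r * (\<integral>x. dpow r (u x + t * h x) * h x \<partial>Mr)) / r
     - \<mu> * (q * (\<integral>x. dpow q (u x + t * h x) * h x \<partial>Mq)) / q) (at t)"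
    by (intro DERIV_diff DERIV_cdivide DERIV_cmult 1 2 3)
  ultimately show ?thesis unfolding dJ_def using p0 r0 q0 by simp
qed

text \<open>At a critical point the Frechet estimates of the three integrals add up to \<open>J (u + h) - J u\<close>, because the linear terms
  cancel. The constants \<open>cr\<close> and \<open>cq\<close> turn a bound of the seminorm of \<open>h\<close> into bounds in the two lower-order norms.\<close>

lemma J_critical_difference:
  assumes u: "u \<in> W" and c: "\<And>h. h \<in> W \<Longrightarrow> dJ u h = 0" and \<epsilon>: "0 < \<epsilon>"
  shows "\<exists>\<delta>>0. \<forall>h\<in>W. \<forall>\<beta>. 0 < \<beta> \<longrightarrow> \<beta> < \<delta> \<longrightarrow> A h \<le> \<beta> powr p \<longrightarrow> \<bar>J (\<lambda>x. u x + h x) - J u\<bar> \<le> \<epsilon> * \<beta>"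
proof -
  obtain Cr where Cr: "Cr > 0" "\<And>u. u \<in> W \<Longrightarrow> pow_integral Mr r u \<le> Cr * A u powr (r / p)" using emb_r by blast
  obtain Cq where Cq: "Cq > 0" "\<And>u. u \<in> W \<Longrightarrow> pow_integral Mq q u \<le> Cq * A u powr (q / p)" using emb_q by blast
  define cr where "cr = Cr powr (1 / r)"
  define cq where "cq = Cq powr (1 / q)"
  have cr: "0 < cr" "cr powr r = Cr" and cq: "0 < cq" "cq powr q = Cq" 
    using Cr Cq r0 q0 by (auto simp: cr_def cq_def powr_powr)
  define e1 where "e1 = \<epsilon> * p / 3"
  define e2 where "e2 = \<epsilon> * r / (3 * lam * cr)"
  define e3 where "e3 = \<epsilon> * q / (3 * \<mu> * cq)"
  have e: "0 < e1" "0 < e2" "0 < e3" using \<epsilon> p0 r0 q0 lam0 \<mu>0 cr cq by (auto simp: e1_def e2_def e3_def)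
  obtain d1 where d1: "0 < d1" "\<And>h \<beta>. in_Lm K0 p h \<Longrightarrow> pow_integral K0 p h \<le> \<beta> powr p \<Longrightarrow> 0 < \<beta> \<Longrightarrow> \<beta> < d1 \<Longrightarrow>
       \<bar>pow_integral K0 p (\<lambda>x. dif u x + h x) - pow_integral K0 p (dif u) - p * (\<integral>x. dpow p (dif u x) * h x \<partial>K0)\<bar> \<le> e1 * \<beta>"
    using pow_integral_frechet[OF W_dif[OF u] p1 e(1)] by blast
  obtain d2 where d2: "0 < d2" "\<And>h \<beta>. in_Lm Mr r h \<Longrightarrow> pow_integral Mr r h \<le> \<beta> powr r \<Longrightarrow> 0 < \<beta> \<Longrightarrow> \<beta> < d2 \<Longrightarrow>
       \<bar>pow_integral Mr r (\<lambda>x. u x + h x) - pow_integral Mr r u - r * (\<integral>x. dpow r (u x) * h x \<partial>Mr)\<bar> \<le> e2 * \<beta>"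
    using pow_integral_frechet[OF in_Lm_r[OF u] r1 e(2)] by blast
  obtain d3 where d3: "0 < d3" "\<And>h \<beta>. in_Lm Mq q h \<Longrightarrow> pow_integral Mq q h \<le> \<beta> powr q \<Longrightarrow> 0 < \<beta> \<Longrightarrow> \<beta> < d3 \<Longrightarrow>
       \<bar>pow_integral Mq q (\<lambda>x. u x + h x) - pow_integral Mq q u - q * (\<integral>x. dpow q (u x) * h x \<partial>Mq)\<bar> \<le> e3 * \<beta>"
    using pow_integral_frechet[OF in_Lm_q[OF u] q1 e(3)] by blast
  define \<delta> where "\<delta> = min d1 (min (d2 / cr) (d3 / cq))"
  show ?thesis
  proof (intro exI[of _ \<delta>] conjI ballI allI impI)
    show "0 < \<delta>" using d1 d2 d3 cr cq by (simp add: \<delta>_def)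
    fix h \<beta> assume h: "h \<in> W" and \<beta>: "0 < \<beta>" "\<beta> < \<delta>" and Ah: "A h \<le> \<beta> powr p"
    have \<beta>': "\<beta> < d1" "cr * \<beta> < d2" "cq * \<beta> < d3" using \<beta> cr cq by (auto simp: \<delta>_def field_simps)
    have uh: "(\<lambda>x. u x + h x) \<in> W" by (rule W_add[OF u h])
    have d: "dif (\<lambda>x. u x + h x) = (\<lambda>z. dif u z + dif h z)" by (auto simp: dif_def)
    define P where "P = pow_integral K0 p (\<lambda>x. dif u x + dif h x) - pow_integral K0 p (dif u) - p * (\<integral>x. dpow p (dif u x) * dif h x \<partial>K0)"
    define R where "R = pow_integral Mr r (\<lambda>x. u x + h x) - pow_integral Mr r u - r * (\<integral>x. dpow r (u x) * h x \<partial>Mr)"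
    define Q where "Q = pow_integral Mq q (\<lambda>x. u x + h x) - pow_integral Mq q u - q * (\<integral>x. dpow q (u x) * h x \<partial>Mq)"
    have P: "\<bar>P\<bar> \<le> e1 * \<beta>" unfolding P_def using Ah A_eq[OF h] by (intro d1(2) W_dif[OF h] \<beta> \<beta>') auto
    have "pow_integral Mr r h \<le> Cr * (\<beta> powr p) powr (r / p)"
      using Ah Cr p0 r0 gagliardo_pow_nonneg[of s p h] by (intro order_trans[OF Cr(2)[OF h]] mult_left_mono powr_mono2) auto
    also have "\<dots> = (cr * \<beta>) powr r" using \<beta> cr p0 by (simp add: powr_powr powr_mult)
    finally have R: "\<bar>R\<bar> \<le> e2 * (cr * \<beta>)" unfolding R_def using \<beta> cr \<beta>' by (intro d2(2) in_Lm_r[OF h]) auto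
    have "pow_integral Mq q h \<le> Cq * (\<beta> powr p) powr (q / p)"
      using Ah Cq p0 q0 gagliardo_pow_nonneg[of s p h] by (intro order_trans[OF Cq(2)[OF h]] mult_left_mono powr_mono2) auto
    also have "\<dots> = (cq * \<beta>) powr q" using \<beta> cq p0 by (simp add: powr_powr powr_mult)
    finally have Q: "\<bar>Q\<bar> \<le> e3 * (cq * \<beta>)" unfolding Q_def using \<beta> cq \<beta>' by (intro d3(2) in_Lm_q[OF h]) auto
    have "J (\<lambda>x. u x + h x) - J u = J (\<lambda>x. u x + h x) - J u - dJ u h" using c[OF h] by simp
    also have "\<dots> = P / p - lam / r * R - \<mu> / q * Q"
      unfolding J_def dJ_def dA_def B_def D_def A_eq[OF uh] A_eq[OF u] d P_def R_def Q_def using p0 r0 q0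
      by (simp add: diff_divide_distrib right_diff_distrib)
    also have "\<bar>\<dots>\<bar> \<le> \<bar>P / p\<bar> + \<bar>lam / r * R\<bar> + \<bar>\<mu> / q * Q\<bar>"
    proof -
      have "\<bar>x - y - z\<bar> \<le> \<bar>x\<bar> + \<bar>y\<bar> + \<bar>z\<bar>" for x y z :: real by linarith
      then show ?thesis .
    qed
    also have "\<dots> = \<bar>P\<bar> / p + lam / r * \<bar>R\<bar> + \<mu> / q * \<bar>Q\<bar>"
      using p0 r0 q0 lam0 \<mu>0 by (simp add: abs_mult)
    also have "\<dots> \<le> (e1 * \<beta>) / p + lam / r * (e2 * (cr * \<beta>)) + \<mu> / q * (e3 * (cq * \<beta>))"
      using P R Q p0 r0 q0 lam0 \<mu>0 by (intro add_mono divide_right_mono mult_left_mono) auto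
    also have "\<dots> = \<epsilon> * \<beta>" using p0 r0 q0 lam0 \<mu>0 cr(1) cq(1) by (simp add: e1_def e2_def e3_def)
    finally show "\<bar>J (\<lambda>x. u x + h x) - J u\<bar> \<le> \<epsilon> * \<beta>" .
  qed
qed

text \<open>A zero Frechet differential forces every directional derivative to vanish; the converse is the uniform estimate of
  \<open>J_critical_difference\<close>. Functions \<open>h\<close> of seminorm zero are reached by letting \<open>\<beta>\<close> tend to \<open>0\<close>.\<close>

lemma weak_solution_iff:
  "weak_solution s p \<Omega> \<alpha> q r lam \<mu> u \<longleftrightarrow> u \<in> W \<and> (\<forall>h\<in>W. dJ u h = 0)"
proof
  assume ws: "weak_solution s p \<Omega> \<alpha> q r lam \<mu> u"
  then have u: "u \<in> W" by (simp add: weak_solution_def critical_point_def)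
  have fd: "\<exists>\<delta>>0. \<forall>h\<in>W. gagliardo s p h < \<delta> \<longrightarrow>
        \<bar>energy s p \<Omega> \<alpha> q r lam \<mu> (\<lambda>x. u x + h x) - energy s p \<Omega> \<alpha> q r lam \<mu> u\<bar> \<le> \<epsilon> * gagliardo s p h" if "0 < \<epsilon>" for \<epsilon>
    using ws that by (auto simp: weak_solution_def critical_point_def has_differential_def)
  have "dJ u h = 0" if h: "h \<in> W" for h
  proof -
    define G where "G = gagliardo s p h"
    have G: "0 \<le> G" by (simp add: G_def gagliardo_def)
    have der: "((\<lambda>t. J (\<lambda>x. u x + t * h x)) has_real_derivative dJ u h) (at 0)"
      using J_has_derivative[OF u h, of 0] by simp
    have "((\<lambda>t. J (\<lambda>x. u x + t * h x)) has_real_derivative 0) (at 0)"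
      unfolding DERIV_def
    proof (rule LIM_I)
      fix e :: real assume e: "0 < e"
      define e' where "e' = e / (2 * (G + 1))"
      have e': "0 < e'" using e G by (simp add: e'_def)
      obtain \<delta> where \<delta>: "\<delta> > 0" "\<And>h. h \<in> W \<Longrightarrow> gagliardo s p h < \<delta> \<Longrightarrow>
        \<bar>energy s p \<Omega> \<alpha> q r lam \<mu> (\<lambda>x. u x + h x) - energy s p \<Omega> \<alpha> q r lam \<mu> u\<bar> \<le> e' * gagliardo s p h"
        using fd[OF e'] by blast
      show "\<exists>sa>0. \<forall>x. x \<noteq> 0 \<and> norm (x - 0) < sa \<longrightarrow>
              norm ((J (\<lambda>xa. u xa + (0 + x) * h xa) - J (\<lambda>x. u x + 0 * h x)) / x - 0) < e"
      proof (intro exI[of _ "\<delta> / (G + 1)"] conjI allI impI)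
        show "0 < \<delta> / (G + 1)" using \<delta> G by simp
        fix t :: real assume t: "t \<noteq> 0 \<and> norm (t - 0) < \<delta> / (G + 1)"
        have th: "(\<lambda>x. t * h x) \<in> W" by (rule W_cmult[OF h])
        have g: "gagliardo s p (\<lambda>x. t * h x) = \<bar>t\<bar> * G"
          using p0 by (simp add: gagliardo_def G_def A_cmult[OF h] powr_mult powr_powr)
        have "\<bar>t\<bar> * (G + 1) < \<delta>" using t G by (simp add: field_simps)
        then have "\<bar>t\<bar> * G < \<delta>" using t by (simp add: algebra_simps) 
        then have "\<bar>energy s p \<Omega> \<alpha> q r lam \<mu> (\<lambda>x. u x + t * h x) - energy s p \<Omega> \<alpha> q r lam \<mu> u\<bar> \<le> e' * (\<bar>t\<bar> * G)"
          using \<delta>(2)[OF th] g by simp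
        then have "\<bar>J (\<lambda>x. u x + t * h x) - J u\<bar> \<le> e' * (\<bar>t\<bar> * G)"
          by (simp add: energy_eq u W_add[OF u th])
        then have "\<bar>J (\<lambda>x. u x + t * h x) - J u\<bar> / \<bar>t\<bar> \<le> e' * G" using t by (simp add: field_simps)
        also have "e' * G \<le> e / 2" using e G by (simp add: e'_def field_simps)
        also have "\<dots> < e" using e by simp
        finally show "norm ((J (\<lambda>x. u x + (0 + t) * h x) - J (\<lambda>x. u x + 0 * h x)) / t - 0) < e"
          by (simp add: abs_divide)
      qed
    qed
    then show ?thesis using der DERIV_unique by blast
  qed
  then show "u \<in> W \<and> (\<forall>h\<in>W. dJ u h = 0)" using u by blast
next
  assume a: "u \<in> W \<and> (\<forall>h\<in>W. dJ u h = 0)"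
  then have u: "u \<in> W" and c: "\<And>h. h \<in> W \<Longrightarrow> dJ u h = 0" by auto
  have "has_differential s p \<Omega> (energy s p \<Omega> \<alpha> q r lam \<mu>) (\<lambda>_. 0) u"
    unfolding has_differential_def
  proof (intro conjI allI impI ballI)
    show "\<exists>C. \<forall>h\<in>W. \<bar>0\<bar> \<le> C * gagliardo s p h" by (rule exI[of _ 0]) simp
    fix \<epsilon> :: real assume \<epsilon>: "0 < \<epsilon>"
    obtain \<delta> where \<delta>: "0 < \<delta>" "\<And>h \<beta>. h \<in> W \<Longrightarrow> 0 < \<beta> \<Longrightarrow> \<beta> < \<delta> \<Longrightarrow> A h \<le> \<beta> powr p \<Longrightarrow> \<bar>J (\<lambda>x. u x + h x) - J u\<bar> \<le> \<epsilon> * \<beta>"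
      using J_critical_difference[OF u c \<epsilon>] by blast
    show "\<exists>\<delta>>0. \<forall>h\<in>W. gagliardo s p h < \<delta> \<longrightarrow>
        \<bar>energy s p \<Omega> \<alpha> q r lam \<mu> (\<lambda>x. u x + h x) - energy s p \<Omega> \<alpha> q r lam \<mu> u - 0\<bar> \<le> \<epsilon> * gagliardo s p h"
    proof (intro exI[of _ \<delta>] conjI ballI impI \<delta>(1))
      fix h assume h: "h \<in> W" and g: "gagliardo s p h < \<delta>"
      let ?d = "\<bar>J (\<lambda>x. u x + h x) - J u\<bar>"
      have gp: "gagliardo s p h powr p = A h" using p0 gagliardo_pow_nonneg[of s p h] by (simp add: gagliardo_def powr_powr)
      have "?d \<le> \<epsilon> * gagliardo s p h"
      proof (cases "gagliardo s p h = 0")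
        case False
        then have "0 < gagliardo s p h" by (simp add: gagliardo_def)
        then show ?thesis using \<delta>(2)[OF h _ g] gp by simp
      next
        case True
        have A0: "A h = 0" using gp True p0 by simp
        have "?d \<le> 0 + e" if e: "0 < e" for e
        proof -
          define \<beta> where "\<beta> = min (\<delta> / 2) (e / \<epsilon>)"
          have \<beta>: "0 < \<beta>" "\<beta> < \<delta>" "\<beta> \<le> e / \<epsilon>" using \<delta>(1) e \<epsilon> by (auto simp: \<beta>_def)
          have "?d \<le> \<epsilon> * \<beta>" using \<beta> A0 by (intro \<delta>(2) h) auto
          also have "\<dots> \<le> e" using \<beta>(3) \<epsilon> by (simp add: field_simps)
          finally show ?thesis by simp
        qed
        then have "?d \<le> 0" by (rule field_le_epsilon)
        then show ?thesis using True by simp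
      qed
      then show "\<bar>energy s p \<Omega> \<alpha> q r lam \<mu> (\<lambda>x. u x + h x) - energy s p \<Omega> \<alpha> q r lam \<mu> u - 0\<bar> \<le> \<epsilon> * gagliardo s p h"
        by (simp add: energy_eq u W_add[OF u h])
    qed
  qed auto
  then show "weak_solution s p \<Omega> \<alpha> q r lam \<mu> u" using u by (simp add: weak_solution_def critical_point_def)
qed

end

section \<open>The energy along rays and quadrants\<close>

lemma pow_integral_eq_0_AE:
  assumes "in_Lm M m f" "pow_integral M m f = 0" shows "AE x in M. f x = 0"
proof -
  have "AE x in M. \<bar>f x\<bar> powr m = 0"
    using assms unfolding pow_integral_def in_Lm_def by (subst (asm) integral_nonneg_eq_0_iff_AE) auto
  then show ?thesis by eventually_elim simp
qed

lemma pow_integral_AE_0: "f \<in> borel_measurable M \<Longrightarrow> AE x in M. f x = 0 \<Longrightarrow> pow_integral M m f = 0"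
  unfolding pow_integral_def by (subst integral_cong_AE[of _ _ "\<lambda>x. 0"]) (auto elim!: eventually_mono)

lemma small_powr:
  fixes e B \<epsilon> :: real
  assumes "0 < e" "0 \<le> B" "0 < \<epsilon>"
  shows "\<exists>\<rho>>0. \<forall>t. 0 < t \<longrightarrow> t \<le> \<rho> \<longrightarrow> t powr e * B < \<epsilon>"
proof (intro exI[of _ "(\<epsilon> / (B + 1)) powr (1 / e)"] conjI allI impI)
  have pos: "0 < \<epsilon> / (B + 1)" using assms by simp
  then show "0 < (\<epsilon> / (B + 1)) powr (1 / e)" by (metis less_irrefl powr_gt_zero)
  fix t :: real assume t: "0 < t" "t \<le> (\<epsilon> / (B + 1)) powr (1 / e)"
  have "t powr e \<le> ((\<epsilon> / (B + 1)) powr (1 / e)) powr e" using t assms by (intro powr_mono2) auto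
  also have "\<dots> = \<epsilon> / (B + 1)" using pos assms by (simp add: powr_powr del: abs_divide)
  finally have "t powr e * B \<le> \<epsilon> / (B + 1) * B" using assms by (intro mult_right_mono)
  also have "\<dots> < \<epsilon>" using assms by (simp add: field_simps)
  finally show "t powr e * B < \<epsilon>" .
qed

lemma large_powr:
  fixes e B x :: real
  assumes "0 < e" "0 < B"
  shows "\<exists>R. \<forall>t\<ge>R. x < t powr e * B"
proof (intro exI[of _ "(\<bar>x\<bar> / B + 1) powr (1 / e)"] allI impI)
  fix t assume t: "(\<bar>x\<bar> / B + 1) powr (1 / e) \<le> t"
  have pos: "0 < \<bar>x\<bar> / B + 1" using assms by (simp add: add_nonneg_pos)
  have "\<bar>x\<bar> / B + 1 = ((\<bar>x\<bar> / B + 1) powr (1 / e)) powr e" using pos assms by (simp add: powr_powr)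
  also have "\<dots> \<le> t powr e" using t assms by (intro powr_mono2) auto
  finally have "(\<bar>x\<bar> / B + 1) * B \<le> t powr e * B" using assms by (intro mult_right_mono) auto
  moreover have "(\<bar>x\<bar> / B + 1) * B = \<bar>x\<bar> + B" using assms by (simp add: field_simps)
  ultimately show "x < t powr e * B" using assms by linarith
qed

context nehari
begin

text \<open>The infimum bounds the quotient from below; where the denominator vanishes the inequality is trivial.\<close>

lemma eigenvalue_bound:
  assumes u: "u \<in> W" shows "eigenvalue1 s p \<Omega> \<beta> * pow_integral (weighted_measure \<Omega> \<beta>) p u \<le> A u"
proof (cases "AE x in lebesgue. u x = 0")
  case True
  have "pow_integral (weighted_measure \<Omega> \<beta>) p u = 0"
    by (rule pow_integral_AE_0) (use W_measurable[OF u] AE_weighted[OF True] in \<open>auto simp: measurable_weighted_measure\<close>)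
  then show ?thesis by (simp add: gagliardo_pow_nonneg)
next
  case False
  let ?I = "pow_integral (weighted_measure \<Omega> \<beta>) p u"
  show ?thesis
  proof (cases "?I = 0")
    case I: False
    then have I: "0 < ?I" using pow_integral_nonneg[of "weighted_measure \<Omega> \<beta>" p u] by simp
    have "eigenvalue1 s p \<Omega> \<beta> \<le> A u / (LINT x:\<Omega>|lebesgue. \<bar>u x\<bar> powr p * norm x powr (- \<beta>))"
      unfolding eigenvalue1_def
    proof (rule cINF_lower)
      show "bdd_below ((\<lambda>u. A u / (LINT x:\<Omega>|lebesgue. \<bar>u x\<bar> powr p * norm x powr (- \<beta>))) ` {u \<in> W. \<not> (AE x in lebesgue. u x = 0)})"
      proof (rule bdd_belowI2)
        fix v assume "v \<in> {u \<in> W. \<not> (AE x in lebesgue. u x = 0)}"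
        then have "v \<in> W" by simp
        then show "0 \<le> A v / (LINT x:\<Omega>|lebesgue. \<bar>v x\<bar> powr p * norm x powr (- \<beta>))"
          by (simp add: pow_integral_weighted(2)[OF W_measurable, symmetric] pow_integral_nonneg gagliardo_pow_nonneg)
      qed
    qed (use u False in simp)
    then have "eigenvalue1 s p \<Omega> \<beta> \<le> A u / ?I" by (simp add: pow_integral_weighted(2)[OF W_measurable[OF u]])
    then show ?thesis using I by (simp add: field_simps)
  qed (simp add: gagliardo_pow_nonneg)
qed

text \<open>This is the only place where the eigenvalue conditions enter: a term of the same homogeneity \<open>p\<close> as \<open>A\<close> absorbs only a
  fraction of it.\<close>

lemma coercive: "\<exists>c>0. \<forall>u\<in>W. c * A u \<le> A u - (if r = p then B u else 0) - (if q = p then D u else 0)"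
proof -
  have aux: "(1 - l / e) * a \<le> a - l * i" if "e * i \<le> a" "0 < l" "l < e" for l e i a :: real
  proof -
    have "l * i \<le> l / e * a" using that by (simp add: field_simps)
    then show ?thesis by (simp add: algebra_simps)
  qed
  consider "r = p" "q \<noteq> p" | "q = p" "r \<noteq> p" | "q \<noteq> p" "r \<noteq> p" using qr by (cases "r = p"; cases "q = p") auto
  then show ?thesis
  proof cases
    case 1
    have l: "lam < eigenvalue1 s p \<Omega> 0" by (rule lam1[OF 1(1)])
    show ?thesis
    proof (rule exI[of _ "1 - lam / eigenvalue1 s p \<Omega> 0"], intro conjI ballI)
      show "0 < 1 - lam / eigenvalue1 s p \<Omega> 0" using l lam0 by simp
      fix u assume "u \<in> W"
      from aux[OF eigenvalue_bound[OF this] lam0 l]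
      show "(1 - lam / eigenvalue1 s p \<Omega> 0) * A u \<le> A u - (if r = p then B u else 0) - (if q = p then D u else 0)"
        unfolding B_def using 1 by simp
    qed
  next
    case 2
    have l: "\<mu> < eigenvalue1 s p \<Omega> \<alpha>" by (rule \<mu>1[OF 2(1)])
    show ?thesis
    proof (rule exI[of _ "1 - \<mu> / eigenvalue1 s p \<Omega> \<alpha>"], intro conjI ballI)
      show "0 < 1 - \<mu> / eigenvalue1 s p \<Omega> \<alpha>" using l \<mu>0 by simp
      fix u assume "u \<in> W"
      from aux[OF eigenvalue_bound[OF this] \<mu>0 l]
      show "(1 - \<mu> / eigenvalue1 s p \<Omega> \<alpha>) * A u \<le> A u - (if r = p then B u else 0) - (if q = p then D u else 0)"
        unfolding D_def using 2 by simp
    qed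
  next
    case 3 then show ?thesis by (intro exI[of _ 1]) auto
  qed
qed

lemma nonzero_pos:
  assumes u: "u \<in> W" and nz: "\<not> (AE x in lebesgue. u x = 0)"
  shows "0 < A u" "0 < B u" "0 < D u" "0 < S u"
proof -
  have "pow_integral Mr r u \<noteq> 0" using pow_integral_eq_0_AE[OF in_Lm_r[OF u]] weighted_measure_nonzero_AE[OF u] nz by blast
  then show b: "0 < B u" using pow_integral_nonneg[of Mr r u] lam0 by (simp add: B_def)
  have "pow_integral Mq q u \<noteq> 0" using pow_integral_eq_0_AE[OF in_Lm_q[OF u]] weighted_measure_nonzero_AE[OF u] nz by blast
  then show d: "0 < D u" using pow_integral_nonneg[of Mq q u] \<mu>0 by (simp add: D_def)
  have "A u \<noteq> 0" using AE_zero_if_seminorm_zero[OF u] nz by blast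
  then show "0 < A u" using gagliardo_pow_nonneg[of s p u] by simp
  show "0 < S u" using b d qr by (auto simp: S_def)
qed

lemma lower_terms_zero: "u \<in> W \<Longrightarrow> AE x in lebesgue. u x = 0 \<Longrightarrow> B u = 0 \<and> D u = 0 \<and> S u = 0"
proof -
  assume u: "u \<in> W" and z: "AE x in lebesgue. u x = 0"
  have "pow_integral Mr r u = 0" "pow_integral Mq q u = 0"
    by (rule pow_integral_AE_0, use W_measurable[OF u] AE_weighted[OF z] in \<open>auto simp: measurable_weighted_measure\<close>)+
  then show ?thesis by (auto simp: B_def D_def S_def)
qed

text \<open>Where \<open>A f\<close> is at most the sum of the lower-order terms, coercivity gives \<open>c * A f \<le> S f\<close>, while for
  \<open>A f \<le> 1\<close> the embedding gives \<open>S f \<le> C * A f powr (m / p)\<close> with the smallest exponent \<open>m > p\<close> that occurs.\<close>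

lemma S_lower_bound: "\<exists>\<delta>>0. \<forall>f\<in>W. 0 < A f \<longrightarrow> A f \<le> B f + D f \<longrightarrow> \<delta> \<le> S f"
proof -
  obtain c where c: "c > 0" "\<And>u. u \<in> W \<Longrightarrow> c * A u \<le> A u - (if r = p then B u else 0) - (if q = p then D u else 0)"
    using coercive by blast
  obtain Cr where Cr: "Cr > 0" "\<And>u. u \<in> W \<Longrightarrow> pow_integral Mr r u \<le> Cr * A u powr (r / p)" using emb_r by blast
  obtain Cq where Cq: "Cq > 0" "\<And>u. u \<in> W \<Longrightarrow> pow_integral Mq q u \<le> Cq * A u powr (q / p)" using emb_q by blast
  define m where "m = (if r = p then q else if q = p then r else min q r)"
  have m: "p < m" using qr q r by (auto simp: m_def)
  define C where "C = lam * Cr + \<mu> * Cq"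
  have C: "0 < C" using lam0 \<mu>0 Cr Cq by (simp add: C_def add_pos_pos)
  \<comment> \<open>The solution of \<open>c * a = C * a powr (m / p)\<close>, capped at \<open>1\<close> where the smallest exponent dominates.\<close>
  define a0 where "a0 = min 1 ((c / C) powr (p / (m - p)))"
  have "0 < c / C" using c C by simp
  then have a0: "0 < a0" by (auto simp: a0_def)
  show ?thesis
  proof (intro exI[of _ "c * a0"] conjI ballI impI)
    show "0 < c * a0" using c a0 by simp
    fix f assume f: "f \<in> W" and Af: "0 < A f" and le: "A f \<le> B f + D f"
    have cS: "c * A f \<le> S f" using c(2)[OF f] le by (auto simp: S_def split: if_splits)
    have "a0 \<le> A f"
    proof (cases "A f \<le> 1")
      case False then show ?thesis by (simp add: a0_def)
    next
      case True
      have bB: "B f \<le> lam * Cr * A f powr (m / p)" if "r \<noteq> p"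
      proof -
        have "B f \<le> lam * (Cr * A f powr (r / p))" unfolding B_def using Cr(2)[OF f] lam0 by (intro mult_left_mono) auto
        also have "\<dots> \<le> lam * (Cr * A f powr (m / p))"
          using that True Af lam0 Cr(1) p0 by (intro mult_left_mono powr_mono') (auto simp: m_def divide_right_mono)
        finally show ?thesis by simp
      qed
      have bD: "D f \<le> \<mu> * Cq * A f powr (m / p)" if "q \<noteq> p"
      proof -
        have "D f \<le> \<mu> * (Cq * A f powr (q / p))" unfolding D_def using Cq(2)[OF f] \<mu>0 by (intro mult_left_mono) auto
        also have "\<dots> \<le> \<mu> * (Cq * A f powr (m / p))"
          using that True Af \<mu>0 Cq(1) p0 by (intro mult_left_mono powr_mono') (auto simp: m_def divide_right_mono)
        finally show ?thesis by simp
      qed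
      have n: "0 \<le> lam * Cr * A f powr (m / p)" "0 \<le> \<mu> * Cq * A f powr (m / p)" using lam0 \<mu>0 Cr Cq by auto
      have "S f \<le> lam * Cr * A f powr (m / p) + \<mu> * Cq * A f powr (m / p)"
        using bB bD n by (auto simp: S_def intro: add_mono)
      then have "c * A f \<le> C * A f powr (m / p)" using cS by (simp add: C_def algebra_simps)
      also have "A f powr (m / p) = A f powr ((m - p) / p) * A f"
      proof -
        have "m / p = (m - p) / p + 1" using p0 by (simp add: field_simps)
        then show ?thesis using Af by (simp add: powr_add)
      qed
      finally have "c \<le> C * A f powr ((m - p) / p)" using Af by simp
      then have "c / C \<le> A f powr ((m - p) / p)" using C by (simp add: field_simps)
      then have "(c / C) powr (p / (m - p)) \<le> (A f powr ((m - p) / p)) powr (p / (m - p))"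
        using m p0 \<open>0 < c / C\<close> by (intro powr_mono2) auto
      also have "\<dots> = A f" using m p0 Af by (simp add: powr_powr)
      finally show ?thesis by (simp add: a0_def)
    qed
    then have "c * a0 \<le> c * A f" using c by simp
    then show "c * a0 \<le> S f" using cS by simp
  qed
qed

text \<open>On the Nehari set \<open>A u = B u + D u\<close>, so \<open>J u\<close> is a combination of \<open>B u\<close> and \<open>D u\<close> in which the terms of
  homogeneity \<open>p\<close> drop out.\<close>

lemma J_nehari_bound:
  "\<exists>\<kappa>>0. \<exists>c>0. \<forall>u\<in>W. dJ u u = 0 \<longrightarrow> \<kappa> * S u \<le> J u \<and> c * A u \<le> S u"
proof -
  obtain c where c: "c > 0" "\<And>u. u \<in> W \<Longrightarrow> c * A u \<le> A u - (if r = p then B u else 0) - (if q = p then D u else 0)"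
    using coercive by blast
  define \<kappa> where "\<kappa> = (if r = p then 1 / p - 1 / q else if q = p then 1 / p - 1 / r else min (1 / p - 1 / q) (1 / p - 1 / r))"
  have dq: "q \<noteq> p \<Longrightarrow> 0 < 1 / p - 1 / q" and dr: "r \<noteq> p \<Longrightarrow> 0 < 1 / p - 1 / r" using p0 q r by (auto simp: field_simps)
  have \<kappa>: "0 < \<kappa>" using qr q r dq dr by (auto simp: \<kappa>_def)
  have k1: "q \<noteq> p \<Longrightarrow> \<kappa> \<le> 1 / p - 1 / q" and k2: "r \<noteq> p \<Longrightarrow> \<kappa> \<le> 1 / p - 1 / r" by (auto simp: \<kappa>_def)
  show ?thesis
  proof (rule exI[of _ \<kappa>], intro conjI \<kappa>, rule exI[of _ c], intro conjI c(1) ballI impI)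
    fix u assume u: "u \<in> W" and Eu: "dJ u u = 0"
    have e: "A u = B u + D u" using dJ_self[OF u] Eu by simp
    show "c * A u \<le> S u" using c(2)[OF u] e by (auto simp: S_def split: if_splits)
    have J: "J u = (1 / p - 1 / r) * B u + (1 / p - 1 / q) * D u" unfolding J_def e by (simp add: algebra_simps add_divide_distrib)
    have "\<kappa> * (if r = p then 0 else B u) \<le> (1 / p - 1 / r) * B u" using k2 B_nonneg[of u] by (auto intro: mult_right_mono)
    moreover have "\<kappa> * (if q = p then 0 else D u) \<le> (1 / p - 1 / q) * D u" using k1 D_nonneg[of u] by (auto intro: mult_right_mono)
    ultimately show "\<kappa> * S u \<le> J u" unfolding J S_def distrib_left by linarith
  qed
qed

text \<open>With \<open>x = dA u f\<close>, \<open>b = B f\<close>, \<open>d = D f\<close> this is the derivative of the energy in the direction \<open>f\<close> at \<open>t u\<close>, where \<open>f\<close> is a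
  sign component of \<open>u\<close>.\<close>

definition "fibre x b d t = t powr (p - 1) * x - t powr (r - 1) * b - t powr (q - 1) * d"

lemma fibre_signs:
  assumes x: "(if r = p then b else 0) + (if q = p then d else 0) < x"
    and b: "0 < b" and d: "0 < d"
  shows "\<exists>\<rho>>0. \<forall>t. 0 < t \<longrightarrow> t \<le> \<rho> \<longrightarrow> 0 < fibre x b d t" "\<exists>R. \<forall>t\<ge>R. 0 < t \<longrightarrow> fibre x b d t < 0"
proof -
  have pr: "fibre x b d t = t powr (p - 1) * (x - t powr (r - p) * b - t powr (q - p) * d)" if "0 < t" for t
  proof -
    have "t powr (r - 1) = t powr (p - 1) * t powr (r - p)" "t powr (q - 1) = t powr (p - 1) * t powr (q - p)"
      by (simp_all flip: powr_add)
    then show ?thesis by (simp add: fibre_def algebra_simps)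
  qed
  define e where "e = (x - ((if r = p then b else 0) + (if q = p then d else 0))) / 2"
  have e: "0 < e" using x by (simp add: e_def)
  have "\<exists>\<rho>>0. \<forall>t. 0 < t \<longrightarrow> t \<le> \<rho> \<longrightarrow> r \<noteq> p \<longrightarrow> t powr (r - p) * b < e"
    using small_powr[of "r - p" b e] b e r by (cases "r = p") (auto intro: exI[of _ 1])
  then obtain \<rho>1 where \<rho>1: "0 < \<rho>1" "\<And>t. 0 < t \<Longrightarrow> t \<le> \<rho>1 \<Longrightarrow> r \<noteq> p \<Longrightarrow> t powr (r - p) * b < e" by blast
  have "\<exists>\<rho>>0. \<forall>t. 0 < t \<longrightarrow> t \<le> \<rho> \<longrightarrow> q \<noteq> p \<longrightarrow> t powr (q - p) * d < e"
    using small_powr[of "q - p" d e] d e q by (cases "q = p") (auto intro: exI[of _ 1])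
  then obtain \<rho>2 where \<rho>2: "0 < \<rho>2" "\<And>t. 0 < t \<Longrightarrow> t \<le> \<rho>2 \<Longrightarrow> q \<noteq> p \<Longrightarrow> t powr (q - p) * d < e" by blast
  show "\<exists>\<rho>>0. \<forall>t. 0 < t \<longrightarrow> t \<le> \<rho> \<longrightarrow> 0 < fibre x b d t"
  proof (intro exI[of _ "min \<rho>1 \<rho>2"] conjI allI impI)
    show "0 < min \<rho>1 \<rho>2" using \<rho>1 \<rho>2 by simp
    fix t assume t: "0 < t" "t \<le> min \<rho>1 \<rho>2"
    have "t powr (r - p) * b < e + (if r = p then b else 0)" using \<rho>1(2)[of t] t e by auto
    moreover have "t powr (q - p) * d < e + (if q = p then d else 0)" using \<rho>2(2)[of t] t e by auto
    ultimately have "0 < x - t powr (r - p) * b - t powr (q - p) * d" unfolding e_def by (simp add: field_simps split: if_splits)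
    then show "0 < fibre x b d t" using t by (simp add: pr)
  qed
  consider "p < r" | "p < q" using qr by linarith
  then show "\<exists>R. \<forall>t\<ge>R. 0 < t \<longrightarrow> fibre x b d t < 0"
  proof cases
    case 1
    then obtain R where R: "\<And>t. t \<ge> R \<Longrightarrow> x < t powr (r - p) * b" using large_powr[of "r - p" b x] b by auto
    show ?thesis
    proof (intro exI[of _ R] allI impI)
      fix t assume t: "R \<le> t" "0 < t"
      have "0 \<le> t powr (q - p) * d" using d by simp
      then have "x - t powr (r - p) * b - t powr (q - p) * d < 0" using R[OF t(1)] by linarith
      then show "fibre x b d t < 0" using t by (simp add: pr mult_pos_neg)
    qed
  next
    case 2
    then obtain R where R: "\<And>t. t \<ge> R \<Longrightarrow> x < t powr (q - p) * d" using large_powr[of "q - p" d x] d by auto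
    show ?thesis
    proof (intro exI[of _ R] allI impI)
      fix t assume t: "R \<le> t" "0 < t"
      have "0 \<le> t powr (r - p) * b" using b by simp
      then have "x - t powr (r - p) * b - t powr (q - p) * d < 0" using R[OF t(1)] by linarith
      then show "fibre x b d t < 0" using t by (simp add: pr mult_pos_neg)
    qed
  qed
qed

lemma split_dpow:
  fixes f g t \<tau> :: real
  assumes "f * g = 0" "0 \<le> t" shows "dpow m (t * f + \<tau> * g) * f = t powr (m - 1) * \<bar>f\<bar> powr m"
proof (cases "f = 0")
  case False
  then have "g = 0" using assms by simp
  then show ?thesis using assms(2) by (simp add: dpow_mult dpow_nonneg mult.assoc dpow_mult_self)
qed simp

lemma split_powr:
  fixes f g t \<tau> :: real
  assumes "f * g = 0" "0 \<le> t" "0 \<le> \<tau>" shows "\<bar>t * f + \<tau> * g\<bar> powr m = t powr m * \<bar>f\<bar> powr m + \<tau> powr m * \<bar>g\<bar> powr m"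
  using assms by (cases "f = 0") (auto simp: abs_mult powr_mult)

lemma dJ_split:
  assumes f: "f \<in> W" and g: "g \<in> W" and w: "w \<in> W" and weq: "\<And>x. w x = t * f x + \<tau> * g x"
    and fg: "\<And>x. f x * g x = 0" and t: "0 \<le> t"
  shows "dJ w f = dA w f - t powr (r - 1) * B f - t powr (q - 1) * D f"
  unfolding dJ_def B_def D_def pow_integral_def weq split_dpow[OF fg t] by (simp add: algebra_simps)

text \<open>The nonlocal interaction of \<open>f\<close> and \<open>g\<close> is monotone in the coefficient \<open>\<tau>\<close>, since their increments never have opposite
  signs. Comparing \<open>\<tau>\<close> with \<open>t\<close> reduces the derivative to the diagonal, where it is explicit.\<close>

lemma dJ_split_bounds:
  assumes f: "f \<in> W" and g: "g \<in> W" and w: "w \<in> W" and weq: "\<And>x. w x = t * f x + \<tau> * g x"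
    and u: "u \<in> W" "\<And>x. u x = f x + g x"
    and fg: "\<And>x. f x * g x = 0" and d: "\<And>z. 0 \<le> dif f z * dif g z" and t: "0 < t" and \<tau>: "0 \<le> \<tau>"
  shows "t \<le> \<tau> \<Longrightarrow> fibre (dA u f) (B f) (D f) t \<le> dJ w f" "\<tau> \<le> t \<Longrightarrow> dJ w f \<le> fibre (dA u f) (B f) (D f) t"
proof -
  have t': "0 \<le> t" using t by simp
  have dw: "dif w z = t * dif f z + \<tau> * dif g z" for z by (simp add: dif_def weq algebra_simps)
  have du: "dif u z = dif f z + dif g z" for z by (simp add: dif_def u(2))
  have tX: "t powr (p - 1) * dA u f = (\<integral>z. dpow p (t * dif f z + t * dif g z) * dif f z \<partial>K0)"
  proof -
    have "dpow p (t * dif f z + t * dif g z) * dif f z = t powr (p - 1) * (dpow p (dif u z) * dif f z)" for z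
      unfolding distrib_left[symmetric] du dpow_mult dpow_nonneg[OF t'] by simp
    then show ?thesis unfolding dA_def by (simp only: Bochner_Integration.integral_mult_right_zero)
  qed
  have it: "integrable K0 (\<lambda>z. dpow p (t * dif f z + t * dif g z) * dif f z)"
  proof -
    have tu: "(\<lambda>x. t * u x) \<in> W" by (rule W_cmult[OF u(1)])
    have "dif (\<lambda>x. t * u x) z = t * dif f z + t * dif g z" for z by (simp add: dif_def u(2) algebra_simps)
    then show ?thesis using integrable_A_term[OF tu f] by simp
  qed
  have iw: "integrable K0 (\<lambda>z. dpow p (t * dif f z + \<tau> * dif g z) * dif f z)" using integrable_A_term[OF w f] by (simp add: dw)
  have Xw: "dA w f = (\<integral>z. dpow p (t * dif f z + \<tau> * dif g z) * dif f z \<partial>K0)" by (simp add: dA_def dw)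
  note dJ = dJ_split[OF f g w weq fg t']
  show "fibre (dA u f) (B f) (D f) t \<le> dJ w f" if "t \<le> \<tau>"
  proof -
    have "t powr (p - 1) * dA u f \<le> dA w f" unfolding tX Xw
      by (rule integral_mono[OF it iw]) (rule dpow_mult_mono[OF p1 d that])
    then show ?thesis unfolding dJ fibre_def by simp
  qed
  show "dJ w f \<le> fibre (dA u f) (B f) (D f) t" if "\<tau> \<le> t"
  proof -
    have "dA w f \<le> t powr (p - 1) * dA u f" unfolding tX Xw
      by (rule integral_mono[OF iw it]) (rule dpow_mult_mono[OF p1 d that])
    then show ?thesis unfolding dJ fibre_def by simp
  qed
qed

lemma dA_ge_A:
  assumes f: "f \<in> W" and g: "g \<in> W" and u: "u \<in> W" "\<And>x. u x = f x + g x" and d: "\<And>z. 0 \<le> dif f z * dif g z"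
  shows "A f \<le> dA u f"
proof -
  have du: "dif u z = dif f z + dif g z" for z by (simp add: dif_def u(2))
  have "dA f f \<le> dA u f" unfolding dA_def
  proof (rule integral_mono[OF integrable_A_term[OF f f] integrable_A_term[OF u(1) f]])
    fix z
    show "dpow p (dif f z) * dif f z \<le> dpow p (dif u z) * dif f z" 
      using dpow_mult_mono[OF p1 d, of 0 1 1 z] by (simp add: du)
  qed
  then show ?thesis by (simp add: dA_self f)
qed

text \<open>Hidden convexity bounds \<open>A w\<close> by \<open>t powr p * dA u f + \<tau> powr p * dA u g\<close>, and the Nehari identities replace these by
  lower-order terms. The difference then splits into one-variable functions \<open>t powr p / p - t powr m / m\<close> with \<open>m \<ge> p\<close>, which are
  largest at \<open>t = 1\<close>.\<close>

lemma J_split_le: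
  assumes f: "f \<in> W" and g: "g \<in> W" and w: "w \<in> W" and weq: "\<And>x. w x = t * f x + \<tau> * g x"
    and u: "u \<in> W" "\<And>x. u x = f x + g x"
    and fg: "\<And>x. f x * g x = 0" and d: "\<And>z. 0 \<le> dif f z * dif g z" and t: "0 \<le> t" and \<tau>: "0 \<le> \<tau>"
    and Ef: "dJ u f = 0" and Eg: "dJ u g = 0"
  shows "J w \<le> J u"
proof -
  have gf: "g x * f x = 0" for x using fg[of x] by (simp add: mult.commute)
  have u': "u x = 1 * f x + 1 * g x" "u x = 1 * g x + 1 * f x" for x by (simp_all add: u(2))
  have Xf: "dA u f = B f + D f" using dJ_split[OF f g u(1) u'(1) fg] Ef by simp
  have Xg: "dA u g = B g + D g" using dJ_split[OF g f u(1) u'(2) gf] Eg by simp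
  have Bw: "B w = t powr r * B f + \<tau> powr r * B g"
    unfolding B_def pow_integral_def weq split_powr[OF fg t \<tau>] using in_Lm_r[OF f] in_Lm_r[OF g] by (simp add: in_Lm_def algebra_simps)
  have Dw: "D w = t powr q * D f + \<tau> powr q * D g"
    unfolding D_def pow_integral_def weq split_powr[OF fg t \<tau>] using in_Lm_q[OF f] in_Lm_q[OF g] by (simp add: in_Lm_def algebra_simps)
  have dw: "dif w z = t * dif f z + \<tau> * dif g z" for z by (simp add: dif_def weq algebra_simps)
  have du: "dif u z = dif f z + dif g z" for z by (simp add: dif_def u(2))
  have "A w \<le> (\<integral>z. t powr p * (dpow p (dif u z) * dif f z) + \<tau> powr p * (dpow p (dif u z) * dif g z) \<partial>K0)"
    unfolding A_eq[OF w] pow_integral_def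
  proof (rule integral_mono)
    show "integrable K0 (\<lambda>z. \<bar>dif w z\<bar> powr p)" by (rule in_Lm_integrable[OF W_dif[OF w]])
    show "integrable K0 (\<lambda>z. t powr p * (dpow p (dif u z) * dif f z) + \<tau> powr p * (dpow p (dif u z) * dif g z))"
      using integrable_A_term[OF u(1) f] integrable_A_term[OF u(1) g] by simp
    show "\<bar>dif w z\<bar> powr p \<le> t powr p * (dpow p (dif u z) * dif f z) + \<tau> powr p * (dpow p (dif u z) * dif g z)" for z
      unfolding dw du by (rule powr_hidden_convexity[OF p1 d t \<tau>])
  qed
  also have "\<dots> = t powr p * dA u f + \<tau> powr p * dA u g" unfolding dA_def using integrable_A_term[OF u(1) f] integrable_A_term[OF u(1) g] by simp
  finally have Aw: "A w \<le> t powr p * (B f + D f) + \<tau> powr p * (B g + D g)" unfolding Xf Xg .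
  have "\<bar>u x\<bar> powr m = \<bar>f x\<bar> powr m + \<bar>g x\<bar> powr m" for x m using split_powr[OF fg, of 1 1 x m] by (simp add: u(2))
  then have Bu: "B u = B f + B g" and Du: "D u = D f + D g"
    unfolding B_def D_def pow_integral_def using in_Lm_r[OF f] in_Lm_r[OF g] in_Lm_q[OF f] in_Lm_q[OF g] by (simp_all add: in_Lm_def algebra_simps)
  have "dJ u u = dJ u (\<lambda>x. f x + g x)" using u(2) by (metis ext)
  then have "dJ u u = 0" using dJ_add[OF u(1) f g] Ef Eg by simp
  then have Au: "A u = B f + D f + (B g + D g)" using dJ_self[OF u(1)] Bu Du by simp
  \<comment> \<open>The tangent inequality at \<open>1\<close> for the power \<open>m / p\<close> of \<open>a powr p\<close>.\<close>
  have sc: "a powr p / p - a powr m / m \<le> 1 / p - 1 / m" if "0 \<le> a" "p \<le> m" for a m :: real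
  proof -
    have "(a powr p) * 1 \<le> 1 / (m / p) * (a powr p) powr (m / p) + (1 - 1 / (m / p)) * 1"
    proof (cases "m = p")
      case True then show ?thesis using p0 that by simp
    next
      case False
      then have m: "1 < m / p" using that p0 by simp
      have "\<bar>1\<bar> powr (m / p) + (m / p) * dpow (m / p) 1 * (a powr p - 1) \<le> \<bar>a powr p\<bar> powr (m / p)"
        by (rule dpow_tangent[OF m])
      then have "(m / p) * (a powr p) \<le> (a powr p) powr (m / p) + (m / p - 1)" by (simp add: dpow_def algebra_simps)
      then have "a powr p \<le> ((a powr p) powr (m / p) + (m / p - 1)) / (m / p)"
        using m by (subst pos_le_divide_eq) (auto simp: mult.commute)
      also have "\<dots> = 1 / (m / p) * (a powr p) powr (m / p) + (1 - 1 / (m / p)) * 1"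
        using m p0 that by (simp only: add_divide_distrib diff_divide_distrib) simp
      finally show ?thesis by simp
    qed
    also have "(a powr p) powr (m / p) = a powr m" using p0 by (simp add: powr_powr)
    finally have "a powr p \<le> p / m * a powr m + (1 - p / m)" using p0 that by (simp add: field_simps)
    then have "a powr p / p \<le> (p / m * a powr m + (1 - p / m)) / p" using p0 by (intro divide_right_mono) auto
    also have "\<dots> = a powr m / m + 1 / p - 1 / m" using p0 that by (simp add: field_simps)
    finally show ?thesis by simp
  qed
  have "J w \<le> (t powr p * (B f + D f) + \<tau> powr p * (B g + D g)) / p - B w / r - D w / q"
    unfolding J_def using Aw p0 by (intro diff_right_mono divide_right_mono) auto
  also have "\<dots> = (t powr p / p - t powr r / r) * B f + (t powr p / p - t powr q / q) * D f
      + (\<tau> powr p / p - \<tau> powr r / r) * B g + (\<tau> powr p / p - \<tau> powr q / q) * D g"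
    unfolding Bw Dw by (simp add: algebra_simps add_divide_distrib)
  also have "\<dots> \<le> (1 / p - 1 / r) * B f + (1 / p - 1 / q) * D f + (1 / p - 1 / r) * B g + (1 / p - 1 / q) * D g"
    using sc t \<tau> q(1) r(1) B_nonneg D_nonneg by (intro add_mono mult_right_mono) auto
  also have "\<dots> = J u" unfolding J_def Au Bu Du by (simp add: algebra_simps add_divide_distrib)
  finally show ?thesis .
qed

lemma dJ_tendsto:
  assumes u: "u \<in> W" and h: "h \<in> W" and w: "\<And>n. w n \<in> W" "w' \<in> W" and g: "\<And>n. g n \<in> W" "g' \<in> W"
    and bw: "\<And>n x y. \<bar>w n x - w n y\<bar> \<le> C * (\<bar>u x - u y\<bar> + \<bar>h x - h y\<bar>)" "\<And>n x. \<bar>w n x\<bar> \<le> C * (\<bar>u x\<bar> + \<bar>h x\<bar>)"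
    and bg: "\<And>n x y. \<bar>g n x - g n y\<bar> \<le> C * (\<bar>u x - u y\<bar> + \<bar>h x - h y\<bar>)" "\<And>n x. \<bar>g n x\<bar> \<le> C * (\<bar>u x\<bar> + \<bar>h x\<bar>)"
    and cw: "\<And>x. (\<lambda>n. w n x) \<longlonglongrightarrow> w' x" and cg: "\<And>x. (\<lambda>n. g n x) \<longlonglongrightarrow> g' x"
  shows "(\<lambda>n. dJ (w n) (g n)) \<longlonglongrightarrow> dJ w' g'"
proof -
  have inLH: "in_Lm M m (\<lambda>z. C * (\<bar>a z\<bar> + \<bar>b z\<bar>))" if "in_Lm M m a" "in_Lm M m b" "0 < m" for M :: "'z measure" and m a b
  proof (rule in_Lm_bound2[OF that(1,2) _ that(3), of _ "\<bar>C\<bar>"])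
    have [measurable]: "a \<in> borel_measurable M" "b \<in> borel_measurable M" using that by (auto simp: in_Lm_def)
    show "(\<lambda>z. C * (\<bar>a z\<bar> + \<bar>b z\<bar>)) \<in> borel_measurable M" by measurable
  qed (simp add: abs_mult)
  have mK: "dif v \<in> borel_measurable K0" if "v \<in> W" for v using W_dif[OF that] by (simp add: in_Lm_def)
  have mr: "v \<in> borel_measurable Mr" if "v \<in> W" for v using in_Lm_r[OF that] by (simp add: in_Lm_def)
  have mq: "v \<in> borel_measurable Mq" if "v \<in> W" for v using in_Lm_q[OF that] by (simp add: in_Lm_def)
  have 1: "(\<lambda>n. dA (w n) (g n)) \<longlonglongrightarrow> dA w' g'"
    unfolding dA_def
  proof (rule dpow_integral_tendsto[OF p1 inLH[OF W_dif[OF u] W_dif[OF h] p0] mK[OF w(1)] mK[OF g(1)] mK[OF w(2)] mK[OF g(2)]])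
  qed (auto intro!: tendsto_diff cw cg AE_I2 simp: dif_def bw bg)
  have 2: "(\<lambda>n. \<integral>x. dpow r (w n x) * g n x \<partial>Mr) \<longlonglongrightarrow> (\<integral>x. dpow r (w' x) * g' x \<partial>Mr)"
    by (rule dpow_integral_tendsto[OF r1 inLH[OF in_Lm_r[OF u] in_Lm_r[OF h] r0]])
      (auto intro!: mr w g cw cg AE_I2 simp: bw bg)
  have 3: "(\<lambda>n. \<integral>x. dpow q (w n x) * g n x \<partial>Mq) \<longlonglongrightarrow> (\<integral>x. dpow q (w' x) * g' x \<partial>Mq)"
    by (rule dpow_integral_tendsto[OF q1 inLH[OF in_Lm_q[OF u] in_Lm_q[OF h] q0]])
      (auto intro!: mq w g cw cg AE_I2 simp: bw bg)
  show ?thesis unfolding dJ_def by (intro tendsto_diff tendsto_mult tendsto_const 1 2 3)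
qed

text \<open>A three-parameter family through \<open>u\<close>, reached at \<open>(1, 1, 0)\<close>: scale the two sign components separately and move in the
  direction \<open>h\<close>.\<close>

definition deformation :: "('a \<Rightarrow> real) \<Rightarrow> ('a \<Rightarrow> real) \<Rightarrow> real \<times> real \<times> real \<Rightarrow> 'a \<Rightarrow> real" where
  "deformation u h z = (\<lambda>x. fst z * pos_part u x + fst (snd z) * neg_part u x + snd (snd z) * h x)"

text \<open>A bound for the coefficients. The summand \<open>1\<close> lets the same constant dominate \<open>h\<close> itself.\<close>

definition deformation_bd :: "real \<times> real \<times> real \<Rightarrow> real" where
  "deformation_bd z = \<bar>fst z\<bar> + \<bar>fst (snd z)\<bar> + \<bar>snd (snd z)\<bar> + 1"

lemma deformation_W: "u \<in> W \<Longrightarrow> h \<in> W \<Longrightarrow> deformation u h z \<in> W"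
  unfolding deformation_def by (intro W_lin W_pos_part W_neg_part)

lemma part_diff: "\<bar>pos_part u x - pos_part u y\<bar> \<le> \<bar>u x - u y\<bar>" "\<bar>neg_part u x - neg_part u y\<bar> \<le> \<bar>u x - u y\<bar>"
  "\<bar>pos_part u x\<bar> \<le> \<bar>u x\<bar>" "\<bar>neg_part u x\<bar> \<le> \<bar>u x\<bar>"
  by (auto simp: pos_part_def neg_part_def max_def min_def)

lemma deformation_bound: "\<bar>deformation u h z x - deformation u h z y\<bar> \<le> deformation_bd z * (\<bar>u x - u y\<bar> + \<bar>h x - h y\<bar>)"
  "\<bar>deformation u h z x\<bar> \<le> deformation_bd z * (\<bar>u x\<bar> + \<bar>h x\<bar>)"
proof -
  have gen: "\<bar>a * P + b * Q + c * H\<bar> \<le> (\<bar>a\<bar> + \<bar>b\<bar> + \<bar>c\<bar> + 1) * (U + V)"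
    if "\<bar>P\<bar> \<le> U" "\<bar>Q\<bar> \<le> U" "\<bar>H\<bar> \<le> V" for a b c P Q H U V :: real
  proof -
    have "\<bar>a * P + b * Q + c * H\<bar> \<le> \<bar>a\<bar> * \<bar>P\<bar> + \<bar>b\<bar> * \<bar>Q\<bar> + \<bar>c\<bar> * \<bar>H\<bar>"
      unfolding abs_mult[symmetric] by linarith
    also have "\<dots> \<le> \<bar>a\<bar> * (U + V) + \<bar>b\<bar> * (U + V) + \<bar>c\<bar> * (U + V)"
      using that by (intro add_mono mult_left_mono) auto
    also have "\<dots> \<le> (\<bar>a\<bar> + \<bar>b\<bar> + \<bar>c\<bar> + 1) * (U + V)" using that by (simp add: algebra_simps)
    finally show ?thesis .
  qed
  have e: "deformation u h z x - deformation u h z y = fst z * (pos_part u x - pos_part u y) + fst (snd z) * (neg_part u x - neg_part u y) + snd (snd z) * (h x - h y)"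
    by (simp add: deformation_def algebra_simps)
  show "\<bar>deformation u h z x - deformation u h z y\<bar> \<le> deformation_bd z * (\<bar>u x - u y\<bar> + \<bar>h x - h y\<bar>)"
    unfolding e deformation_bd_def by (rule gen) (use part_diff in auto)
  show "\<bar>deformation u h z x\<bar> \<le> deformation_bd z * (\<bar>u x\<bar> + \<bar>h x\<bar>)"
    unfolding deformation_def deformation_bd_def by (rule gen) (use part_diff in auto)
qed

lemma deformation_tendsto: "z \<longlonglongrightarrow> l \<Longrightarrow> (\<lambda>n. deformation u h (z n) x) \<longlonglongrightarrow> deformation u h l x"
  unfolding deformation_def by (intro tendsto_intros)

lemma deformation_bd_bounded:
  assumes "z \<longlonglongrightarrow> l" shows "\<exists>C. \<forall>n. deformation_bd (z n) \<le> C"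
proof -
  have "(\<lambda>n. deformation_bd (z n)) \<longlonglongrightarrow> deformation_bd l" unfolding deformation_bd_def by (intro tendsto_intros assms)
  then have "Bseq (\<lambda>n. deformation_bd (z n))" using convergentI convergent_imp_Bseq by blast
  then show ?thesis unfolding Bseq_def by (metis abs_le_D1 real_norm_def)
qed

lemma deformation_continuous:
  assumes u: "u \<in> W" and h: "h \<in> W" and g: "\<And>z. g z \<in> W"
    and bg: "\<And>z x y. \<bar>g z x - g z y\<bar> \<le> deformation_bd z * (\<bar>u x - u y\<bar> + \<bar>h x - h y\<bar>)" "\<And>z x. \<bar>g z x\<bar> \<le> deformation_bd z * (\<bar>u x\<bar> + \<bar>h x\<bar>)"
    and cg: "\<And>z l x. z \<longlonglongrightarrow> l \<Longrightarrow> (\<lambda>n. g (z n) x) \<longlonglongrightarrow> g l x"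
  shows "continuous_on UNIV (\<lambda>z. dJ (deformation u h z) (g z))"
proof (rule continuous_on_UNIV_sequentially)
  fix z :: "nat \<Rightarrow> real \<times> real \<times> real" and l assume zl: "z \<longlonglongrightarrow> l"
  obtain C where C: "\<And>n. deformation_bd (z n) \<le> C" using deformation_bd_bounded[OF zl] by blast
  have b: "a \<le> C * (\<bar>x\<bar> + \<bar>y\<bar>)" if "a \<le> deformation_bd (z n) * (\<bar>x\<bar> + \<bar>y\<bar>)" for a x y n
    using that mult_right_mono[OF C[of n], of "\<bar>x\<bar> + \<bar>y\<bar>"] by linarith
  show "(\<lambda>n. dJ (deformation u h (z n)) (g (z n))) \<longlonglongrightarrow> dJ (deformation u h l) (g l)"
    by (rule dJ_tendsto[OF u h deformation_W[OF u h] deformation_W[OF u h] g g _ _ _ _ deformation_tendsto[OF zl] cg[OF zl]])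
      (rule b, (rule deformation_bound bg))+
qed

lemma deformation_continuous_pos:
  assumes u: "u \<in> W" and h: "h \<in> W"
  shows "continuous_on UNIV (\<lambda>z. dJ (deformation u h z) (pos_part (deformation u h z)))"
proof (rule deformation_continuous[OF u h])
  fix z x y
  show "pos_part (deformation u h z) \<in> W" by (rule W_pos_part[OF deformation_W[OF u h]])
  show "\<bar>pos_part (deformation u h z) x - pos_part (deformation u h z) y\<bar> \<le> deformation_bd z * (\<bar>u x - u y\<bar> + \<bar>h x - h y\<bar>)"
    using part_diff(1)[of "deformation u h z" x y] deformation_bound(1)[of u h z x y] by linarith
  show "\<bar>pos_part (deformation u h z) x\<bar> \<le> deformation_bd z * (\<bar>u x\<bar> + \<bar>h x\<bar>)"
    using part_diff(3)[of "deformation u h z" x] deformation_bound(2)[of u h z x] by linarith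
next
  fix z :: "nat \<Rightarrow> real \<times> real \<times> real" and l x assume "z \<longlonglongrightarrow> l"
  then show "(\<lambda>n. pos_part (deformation u h (z n)) x) \<longlonglongrightarrow> pos_part (deformation u h l) x"
    unfolding pos_part_def by (intro tendsto_max tendsto_const deformation_tendsto)
qed

lemma deformation_continuous_neg:
  assumes u: "u \<in> W" and h: "h \<in> W"
  shows "continuous_on UNIV (\<lambda>z. dJ (deformation u h z) (neg_part (deformation u h z)))"
proof (rule deformation_continuous[OF u h])
  fix z x y
  show "neg_part (deformation u h z) \<in> W" by (rule W_neg_part[OF deformation_W[OF u h]])
  show "\<bar>neg_part (deformation u h z) x - neg_part (deformation u h z) y\<bar> \<le> deformation_bd z * (\<bar>u x - u y\<bar> + \<bar>h x - h y\<bar>)"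
    using part_diff(2)[of "deformation u h z" x y] deformation_bound(1)[of u h z x y] by linarith
  show "\<bar>neg_part (deformation u h z) x\<bar> \<le> deformation_bd z * (\<bar>u x\<bar> + \<bar>h x\<bar>)"
    using part_diff(4)[of "deformation u h z" x] deformation_bound(2)[of u h z x] by linarith
next
  fix z :: "nat \<Rightarrow> real \<times> real \<times> real" and l x assume "z \<longlonglongrightarrow> l"
  then show "(\<lambda>n. neg_part (deformation u h (z n)) x) \<longlonglongrightarrow> neg_part (deformation u h l) x"
    unfolding neg_part_def by (intro tendsto_min tendsto_const deformation_tendsto)
qed

lemma deformation_continuous_self: "u \<in> W \<Longrightarrow> h \<in> W \<Longrightarrow> continuous_on UNIV (\<lambda>z. dJ (deformation u h z) (deformation u h z))"
  by (rule deformation_continuous) (auto intro!: deformation_W deformation_bound deformation_tendsto)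
lemma deformation_continuous_h: "u \<in> W \<Longrightarrow> h \<in> W \<Longrightarrow> continuous_on UNIV (\<lambda>z. dJ (deformation u h z) h)"
proof (rule deformation_continuous)
  fix z x y
  have c: "1 \<le> deformation_bd z" by (simp add: deformation_bd_def)
  show "\<bar>h x - h y\<bar> \<le> deformation_bd z * (\<bar>u x - u y\<bar> + \<bar>h x - h y\<bar>)"
    using mult_mono[OF c, of "\<bar>h x - h y\<bar>" "\<bar>u x - u y\<bar> + \<bar>h x - h y\<bar>"] c by simp
  show "\<bar>h x\<bar> \<le> deformation_bd z * (\<bar>u x\<bar> + \<bar>h x\<bar>)"
    using mult_mono[OF c, of "\<bar>h x\<bar>" "\<bar>u x\<bar> + \<bar>h x\<bar>"] c by simp
qed auto

end

section \<open>Minimisers and their criticality\<close>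

context nehari
begin

text \<open>The nodal Nehari set. The derivative is taken along the sign components of \<open>v\<close> at \<open>v\<close> itself; because of the
  interaction term this differs from the derivative at a sign component.\<close>

definition "nodal v \<longleftrightarrow> v \<in> W \<and> sign_changing v \<and> dJ v (pos_part v) = 0 \<and> dJ v (neg_part v) = 0"
definition "on_nehari v \<longleftrightarrow> v \<in> W \<and> \<not> (AE x in lebesgue. v x = 0) \<and> dJ v v = 0"

lemma sign_changing_iff:
  "sign_changing u \<longleftrightarrow> \<not> (AE x in lebesgue. pos_part u x = 0) \<and> \<not> (AE x in lebesgue. neg_part u x = 0)"
  by (simp add: sign_changing_def pos_part_def neg_part_def)

lemma deformation_0: "deformation u h (t, \<tau>, 0) = (\<lambda>x. t * pos_part u x + \<tau> * neg_part u x)"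
  by (simp add: deformation_def)

lemma scale_parts: "(\<lambda>x. t * pos_part u x + t * neg_part u x) = (\<lambda>x. t * u x)"
  unfolding distrib_left[symmetric] pos_add_neg ..

lemma parts_of_combination:
  assumes "0 \<le> t" "0 \<le> \<tau>"
  shows "pos_part (\<lambda>x. t * pos_part u x + \<tau> * neg_part u x) = (\<lambda>x. t * pos_part u x)"
    "neg_part (\<lambda>x. t * pos_part u x + \<tau> * neg_part u x) = (\<lambda>x. \<tau> * neg_part u x)"
proof -
  have "max (t * max a 0 + \<tau> * min a 0) 0 = t * max a 0" "min (t * max a 0 + \<tau> * min a 0) 0 = \<tau> * min a 0" for a :: real
    using assms by (cases "0 \<le> a"; simp add: max_def min_def mult_nonneg_nonneg mult_nonneg_nonpos antisym)+
  then show "pos_part (\<lambda>x. t * pos_part u x + \<tau> * neg_part u x) = (\<lambda>x. t * pos_part u x)"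
    "neg_part (\<lambda>x. t * pos_part u x + \<tau> * neg_part u x) = (\<lambda>x. \<tau> * neg_part u x)"
    by (simp_all add: pos_part_def neg_part_def)
qed

lemma combination_W: "u \<in> W \<Longrightarrow> (\<lambda>x. t * pos_part u x + \<tau> * neg_part u x) \<in> W"
  by (rule W_add[OF W_cmult[OF W_pos_part] W_cmult[OF W_neg_part]])

text \<open>On the faces \<open>t = \<rho>\<close> and \<open>t = R\<close> of the square \<open>{\<rho>..R} \<times> {\<rho>..R}\<close> the other coefficient is on a known side of \<open>t\<close>, so the
  sign of the derivative is that of the fibre.\<close>

lemma face_pos:
  assumes u: "u \<in> W" and t: "0 < t" and \<tau>: "0 \<le> \<tau>"
  defines "P \<equiv> fibre (dA u (pos_part u)) (B (pos_part u)) (D (pos_part u)) t"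
  shows "t \<le> \<tau> \<Longrightarrow> 0 < P \<Longrightarrow> 0 < dJ (deformation u h (t, \<tau>, 0)) (pos_part (deformation u h (t, \<tau>, 0)))"
    "\<tau> \<le> t \<Longrightarrow> P < 0 \<Longrightarrow> dJ (deformation u h (t, \<tau>, 0)) (pos_part (deformation u h (t, \<tau>, 0))) < 0"
proof -
  have t': "0 \<le> t" using t by simp
  have e: "dJ (deformation u h (t, \<tau>, 0)) (pos_part (deformation u h (t, \<tau>, 0))) = t * dJ (deformation u h (t, \<tau>, 0)) (pos_part u)"
    unfolding deformation_0 parts_of_combination[OF t' \<tau>] dJ_cmult ..
  note b = dJ_split_bounds[OF W_pos_part[OF u] W_neg_part[OF u] combination_W[OF u] refl u pos_add_neg[symmetric] pos_mult_neg dif_pos_neg t \<tau>]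
  show "0 < dJ (deformation u h (t, \<tau>, 0)) (pos_part (deformation u h (t, \<tau>, 0)))" if "t \<le> \<tau>" "0 < P"
    using b(1)[OF that(1)] that(2) t unfolding e unfolding P_def deformation_0 by simp
  show "dJ (deformation u h (t, \<tau>, 0)) (pos_part (deformation u h (t, \<tau>, 0))) < 0" if "\<tau> \<le> t" "P < 0"
    using b(2)[OF that(1)] that(2) t unfolding e unfolding P_def deformation_0 by (simp add: mult_pos_neg)
qed

lemma face_neg:
  assumes u: "u \<in> W" and t: "0 \<le> t" and \<tau>: "0 < \<tau>"
  defines "P \<equiv> fibre (dA u (neg_part u)) (B (neg_part u)) (D (neg_part u)) \<tau>"
  shows "\<tau> \<le> t \<Longrightarrow> 0 < P \<Longrightarrow> 0 < dJ (deformation u h (t, \<tau>, 0)) (neg_part (deformation u h (t, \<tau>, 0)))"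
    "t \<le> \<tau> \<Longrightarrow> P < 0 \<Longrightarrow> dJ (deformation u h (t, \<tau>, 0)) (neg_part (deformation u h (t, \<tau>, 0))) < 0"
proof -
  have \<tau>': "0 \<le> \<tau>" using \<tau> by simp
  have e: "dJ (deformation u h (t, \<tau>, 0)) (neg_part (deformation u h (t, \<tau>, 0))) = \<tau> * dJ (deformation u h (t, \<tau>, 0)) (neg_part u)"
    unfolding deformation_0 parts_of_combination[OF t \<tau>'] dJ_cmult ..
  have weq: "t * pos_part u x + \<tau> * neg_part u x = \<tau> * neg_part u x + t * pos_part u x" for x by simp
  have ueq: "u x = neg_part u x + pos_part u x" for x using pos_add_neg[of u x] by simp
  have pm: "neg_part u x * pos_part u x = 0" for x using pos_mult_neg[of u x] by (simp add: mult.commute)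
  have pd: "0 \<le> dif (neg_part u) z * dif (pos_part u) z" for z using dif_pos_neg[of u z] by (simp add: mult.commute)
  note b = dJ_split_bounds[OF W_neg_part[OF u] W_pos_part[OF u] combination_W[OF u] weq u ueq pm pd \<tau> t]
  show "0 < dJ (deformation u h (t, \<tau>, 0)) (neg_part (deformation u h (t, \<tau>, 0)))" if "\<tau> \<le> t" "0 < P"
    using b(1)[OF that(1)] that(2) \<tau> unfolding e unfolding P_def deformation_0 by simp
  show "dJ (deformation u h (t, \<tau>, 0)) (neg_part (deformation u h (t, \<tau>, 0))) < 0" if "t \<le> \<tau>" "P < 0"
    using b(2)[OF that(1)] that(2) \<tau> unfolding e unfolding P_def deformation_0 by (simp add: mult_pos_neg)
qed

text \<open>At \<open>\<epsilon> = 0\<close> the sign conditions of Poincare--Miranda hold strictly on the four faces, and by compactness they persist for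
  small \<open>\<epsilon>\<close>. This one statement serves twice: with \<open>\<epsilon> = 0\<close> and a large square it projects to the nodal set, and with a
  small square around \<open>(1, 1)\<close> it perturbs a minimiser inside the set.\<close>

lemma nodal_family:
  assumes u: "u \<in> W" and h: "h \<in> W" and \<rho>: "0 < \<rho>" "\<rho> < R"
    and pp: "0 < fibre (dA u (pos_part u)) (B (pos_part u)) (D (pos_part u)) \<rho>"
    and pR: "fibre (dA u (pos_part u)) (B (pos_part u)) (D (pos_part u)) R < 0"
    and np: "0 < fibre (dA u (neg_part u)) (B (neg_part u)) (D (neg_part u)) \<rho>"
    and nR: "fibre (dA u (neg_part u)) (B (neg_part u)) (D (neg_part u)) R < 0"
  shows "\<exists>e>0. \<forall>\<epsilon>\<in>{0..e}. \<exists>t\<in>{\<rho>..R}. \<exists>\<tau>\<in>{\<rho>..R}.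
     dJ (deformation u h (t, \<tau>, \<epsilon>)) (pos_part (deformation u h (t, \<tau>, \<epsilon>))) = 0 \<and> dJ (deformation u h (t, \<tau>, \<epsilon>)) (neg_part (deformation u h (t, \<tau>, \<epsilon>))) = 0"
proof -
  let ?F = "\<lambda>z. dJ (deformation u h z) (pos_part (deformation u h z))" and ?G = "\<lambda>z. dJ (deformation u h z) (neg_part (deformation u h z))"
  have F: "continuous_on UNIV ?F" and G: "continuous_on UNIV ?G" by (rule deformation_continuous_pos[OF u h] deformation_continuous_neg[OF u h])+
  have cF: "continuous_on UNIV (\<lambda>y. ?F (k y))" and cG: "continuous_on UNIV (\<lambda>y. ?G (k y))" if "continuous_on UNIV k" for k :: "real \<times> real \<Rightarrow> real \<times> real \<times> real"
    using continuous_on_compose2[OF F that] continuous_on_compose2[OF G that] by auto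
  have R: "0 < R" "\<rho> \<le> R" using \<rho> by auto
  have "\<exists>e>0. \<forall>\<epsilon>\<in>{0..e}. \<forall>y\<in>{\<rho>..R}. 0 < ?F (\<rho>, y, \<epsilon>)"
    using perturb_positive[of "\<lambda>y. ?F (\<rho>, fst y, snd y)" \<rho> R] face_pos(1)[OF u \<rho>(1) _ _ pp] \<rho> R
    by (force intro!: cF continuous_intros)
  then obtain e1 where e1: "0 < e1" "\<And>\<epsilon> y. \<epsilon> \<in> {0..e1} \<Longrightarrow> y \<in> {\<rho>..R} \<Longrightarrow> 0 < ?F (\<rho>, y, \<epsilon>)" by blast
  have "\<exists>e>0. \<forall>\<epsilon>\<in>{0..e}. \<forall>y\<in>{\<rho>..R}. 0 < - ?F (R, y, \<epsilon>)"
    using perturb_positive[of "\<lambda>y. - ?F (R, fst y, snd y)" \<rho> R] face_pos(2)[OF u R(1) _ _ pR] \<rho> R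
    by (force intro!: continuous_on_minus cF continuous_intros)
  then obtain e2 where e2: "0 < e2" "\<And>\<epsilon> y. \<epsilon> \<in> {0..e2} \<Longrightarrow> y \<in> {\<rho>..R} \<Longrightarrow> 0 < - ?F (R, y, \<epsilon>)" by blast
  have "\<exists>e>0. \<forall>\<epsilon>\<in>{0..e}. \<forall>y\<in>{\<rho>..R}. 0 < ?G (y, \<rho>, \<epsilon>)"
    using perturb_positive[of "\<lambda>y. ?G (fst y, \<rho>, snd y)" \<rho> R] face_neg(1)[OF u _ \<rho>(1) _ np] \<rho> R
    by (force intro!: cG continuous_intros)
  then obtain e3 where e3: "0 < e3" "\<And>\<epsilon> y. \<epsilon> \<in> {0..e3} \<Longrightarrow> y \<in> {\<rho>..R} \<Longrightarrow> 0 < ?G (y, \<rho>, \<epsilon>)" by blast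
  have "\<exists>e>0. \<forall>\<epsilon>\<in>{0..e}. \<forall>y\<in>{\<rho>..R}. 0 < - ?G (y, R, \<epsilon>)"
    using perturb_positive[of "\<lambda>y. - ?G (fst y, R, snd y)" \<rho> R] face_neg(2)[OF u _ R(1) _ nR] \<rho> R
    by (force intro!: continuous_on_minus cG continuous_intros)
  then obtain e4 where e4: "0 < e4" "\<And>\<epsilon> y. \<epsilon> \<in> {0..e4} \<Longrightarrow> y \<in> {\<rho>..R} \<Longrightarrow> 0 < - ?G (y, R, \<epsilon>)" by blast
  show ?thesis
  proof (intro exI[of _ "min (min e1 e2) (min e3 e4)"] conjI ballI)
    show "0 < min (min e1 e2) (min e3 e4)" using e1 e2 e3 e4 by simp
    fix \<epsilon> assume \<epsilon>: "\<epsilon> \<in> {0..min (min e1 e2) (min e3 e4)}"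
    show "\<exists>t\<in>{\<rho>..R}. \<exists>\<tau>\<in>{\<rho>..R}. ?F (t, \<tau>, \<epsilon>) = 0 \<and> ?G (t, \<tau>, \<epsilon>) = 0"
    proof (rule poincare_miranda[of \<rho> R "\<lambda>y. ?F (fst y, snd y, \<epsilon>)" "\<lambda>y. ?G (fst y, snd y, \<epsilon>)", simplified])
      show "continuous_on (cbox (\<rho>, \<rho>) (R, R)) (\<lambda>y. ?F (fst y, snd y, \<epsilon>))"
        by (rule continuous_on_subset[OF cF]) (auto intro!: continuous_intros)
      show "continuous_on (cbox (\<rho>, \<rho>) (R, R)) (\<lambda>y. ?G (fst y, snd y, \<epsilon>))"
        by (rule continuous_on_subset[OF cG]) (auto intro!: continuous_intros)
    qed (use \<rho> \<epsilon> e1(2) e2(2) e3(2) e4(2) in auto)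
  qed
qed

text \<open>The analogue of \<open>nodal_family\<close> for a single coefficient.\<close>

lemma nehari_family:
  assumes u: "u \<in> W" and h: "h \<in> W" and \<rho>: "0 < \<rho>" "\<rho> < R"
    and pp: "0 < fibre (A u) (B u) (D u) \<rho>" and pR: "fibre (A u) (B u) (D u) R < 0"
  shows "\<exists>e>0. \<forall>\<epsilon>\<in>{0..e}. \<exists>t\<in>{\<rho>..R}. dJ (deformation u h (t, t, \<epsilon>)) (deformation u h (t, t, \<epsilon>)) = 0"
proof -
  let ?F = "\<lambda>z. dJ (deformation u h z) (deformation u h z)"
  have F: "continuous_on UNIV ?F" by (rule deformation_continuous_self[OF u h])
  have cF: "continuous_on S (\<lambda>y. ?F (k y))" if "continuous_on S k" for k :: "'z::topological_space \<Rightarrow> real \<times> real \<times> real" and S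
    using continuous_on_compose2[OF F that] by auto
  have f0: "deformation u h (t, t, 0) = (\<lambda>x. t * u x)" for t unfolding deformation_0 scale_parts ..
  have b: "fibre (A u) (B u) (D u) t \<le> dJ (\<lambda>x. t * u x) u" "dJ (\<lambda>x. t * u x) u \<le> fibre (A u) (B u) (D u) t" if t: "0 < t" for t
  proof -
    have "dif (\<lambda>x. 0) z = 0" for z :: "'a \<times> 'a" by (simp add: dif_def)
    then show "fibre (A u) (B u) (D u) t \<le> dJ (\<lambda>x. t * u x) u" "dJ (\<lambda>x. t * u x) u \<le> fibre (A u) (B u) (D u) t"
      using dJ_split_bounds[OF u W_zero W_cmult[OF u, of t], of t t u] t u by (simp_all add: dA_self)
  qed
  have F0: "?F (t, t, 0) = t * dJ (\<lambda>x. t * u x) u" for t unfolding f0 dJ_cmult ..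
  have "0 < ?F (\<rho>, \<rho>, 0)" unfolding F0 using b(1)[OF \<rho>(1)] pp \<rho> by simp
  moreover have "0 < - ?F (R, R, 0)" unfolding F0 using b(2)[of R] pR \<rho> by (simp add: mult_pos_neg)
  moreover have c1: "continuous_on UNIV (\<lambda>y::real \<times> real. ?F (\<rho>, \<rho>, snd y))" by (intro cF continuous_intros)
  moreover have c2: "continuous_on UNIV (\<lambda>y::real \<times> real. - ?F (R, R, snd y))" by (intro continuous_on_minus cF continuous_intros)
  ultimately have "\<exists>e>0. \<forall>\<epsilon>\<in>{0..e}. \<forall>y\<in>{0..0::real}. 0 < ?F (\<rho>, \<rho>, \<epsilon>)" "\<exists>e>0. \<forall>\<epsilon>\<in>{0..e}. \<forall>y\<in>{0..0::real}. 0 < - ?F (R, R, \<epsilon>)"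
    using perturb_positive[of "\<lambda>y. ?F (\<rho>, \<rho>, snd y)" 0 0] perturb_positive[of "\<lambda>y. - ?F (R, R, snd y)" 0 0]
    by auto
  then obtain e1 e2 where e: "0 < e1" "0 < e2" "\<And>\<epsilon>. \<epsilon> \<in> {0..e1} \<Longrightarrow> 0 < ?F (\<rho>, \<rho>, \<epsilon>)" "\<And>\<epsilon>. \<epsilon> \<in> {0..e2} \<Longrightarrow> 0 < - ?F (R, R, \<epsilon>)"
    by auto
  show ?thesis
  proof (intro exI[of _ "min e1 e2"] conjI ballI)
    show "0 < min e1 e2" using e by simp
    fix \<epsilon> assume \<epsilon>: "\<epsilon> \<in> {0..min e1 e2}"
    have "\<exists>t. \<rho> \<le> t \<and> t \<le> R \<and> ?F (t, t, \<epsilon>) = 0"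
    proof (rule IVT2')
      show "?F (R, R, \<epsilon>) \<le> 0" "0 \<le> ?F (\<rho>, \<rho>, \<epsilon>)" using e(3)[of \<epsilon>] e(4)[of \<epsilon>] \<epsilon> by auto
      show "continuous_on {\<rho>..R} (\<lambda>t. ?F (t, t, \<epsilon>))" by (intro cF continuous_intros)
    qed (use \<rho> in auto)
    then show "\<exists>t\<in>{\<rho>..R}. ?F (t, t, \<epsilon>) = 0" by auto
  qed
qed

lemma fibre_pos_window:
  assumes "(if r = p then b1 else 0) + (if q = p then d1 else 0) < x1" "0 < b1" "0 < d1"
    and "(if r = p then b2 else 0) + (if q = p then d2 else 0) < x2" "0 < b2" "0 < d2"
  shows "\<exists>\<rho> R. 0 < \<rho> \<and> \<rho> < R \<and> 0 < fibre x1 b1 d1 \<rho> \<and> fibre x1 b1 d1 R < 0 \<and> 0 < fibre x2 b2 d2 \<rho> \<and> fibre x2 b2 d2 R < 0"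
proof -
  obtain \<rho>1 R1 where 1: "0 < \<rho>1" "\<And>t. 0 < t \<Longrightarrow> t \<le> \<rho>1 \<Longrightarrow> 0 < fibre x1 b1 d1 t" "\<And>t. t \<ge> R1 \<Longrightarrow> 0 < t \<Longrightarrow> fibre x1 b1 d1 t < 0"
    using fibre_signs[OF assms(1-3)] by blast
  obtain \<rho>2 R2 where 2: "0 < \<rho>2" "\<And>t. 0 < t \<Longrightarrow> t \<le> \<rho>2 \<Longrightarrow> 0 < fibre x2 b2 d2 t" "\<And>t. t \<ge> R2 \<Longrightarrow> 0 < t \<Longrightarrow> fibre x2 b2 d2 t < 0"
    using fibre_signs[OF assms(4-6)] by blast
  show ?thesis
    by (rule exI[of _ "min \<rho>1 \<rho>2"], rule exI[of _ "max (max R1 R2) (min \<rho>1 \<rho>2 + 1)"])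
      (use 1 2 in \<open>auto simp: max_def min_def\<close>)
qed

lemma fibre_self:
  assumes "0 < b" "0 < d" "0 < t"
  shows "t < 1 \<Longrightarrow> 0 < fibre (b + d) b d t" "1 < t \<Longrightarrow> fibre (b + d) b d t < 0"
proof -
  have e: "fibre (b + d) b d t = (t powr (p - 1) - t powr (r - 1)) * b + (t powr (p - 1) - t powr (q - 1)) * d"
    by (simp add: fibre_def algebra_simps)
  show "0 < fibre (b + d) b d t" if t: "t < 1"
  proof -
    have wk: "t powr (r - 1) \<le> t powr (p - 1)" "t powr (q - 1) \<le> t powr (p - 1)" using assms t r q by (auto intro!: powr_mono')
    have str: "r \<noteq> p \<Longrightarrow> t powr (r - 1) < t powr (p - 1)" "q \<noteq> p \<Longrightarrow> t powr (q - 1) < t powr (p - 1)"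
      using assms t r q by (auto intro!: powr_less_mono')
    show ?thesis unfolding e
    proof (cases "r = p")
      case True
      then have "q \<noteq> p" using qr by auto
      then show "0 < (t powr (p - 1) - t powr (r - 1)) * b + (t powr (p - 1) - t powr (q - 1)) * d"
        using str assms True by simp
    next
      case False
      then have "0 < (t powr (p - 1) - t powr (r - 1)) * b" using str assms by simp
      moreover have "0 \<le> (t powr (p - 1) - t powr (q - 1)) * d" using wk assms by simp
      ultimately show "0 < (t powr (p - 1) - t powr (r - 1)) * b + (t powr (p - 1) - t powr (q - 1)) * d" by linarith
    qed
  qed
  show "fibre (b + d) b d t < 0" if t: "1 < t"
  proof -
    have wk: "t powr (p - 1) \<le> t powr (r - 1)" "t powr (p - 1) \<le> t powr (q - 1)" using assms t r q by (auto intro!: powr_mono)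
    have str: "r \<noteq> p \<Longrightarrow> t powr (p - 1) < t powr (r - 1)" "q \<noteq> p \<Longrightarrow> t powr (p - 1) < t powr (q - 1)"
      using assms t r q by (auto intro!: powr_less_mono)
    show ?thesis unfolding e
    proof (cases "r = p")
      case True
      then have "q \<noteq> p" using qr by auto
      then show "(t powr (p - 1) - t powr (r - 1)) * b + (t powr (p - 1) - t powr (q - 1)) * d < 0"
        using str assms True by (simp add: mult_neg_pos)
    next
      case False
      then have "(t powr (p - 1) - t powr (r - 1)) * b < 0" using str assms by (simp add: mult_neg_pos)
      moreover have "(t powr (p - 1) - t powr (q - 1)) * d \<le> 0" using wk assms by (simp add: mult_nonpos_nonneg)
      ultimately show "(t powr (p - 1) - t powr (r - 1)) * b + (t powr (p - 1) - t powr (q - 1)) * d < 0" by linarith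
    qed
  qed
qed

lemma coercive_strict:
  assumes "u \<in> W" "0 < A u" shows "(if r = p then B u else 0) + (if q = p then D u else 0) < A u"
proof -
  obtain c where "c > 0" "c * A u \<le> A u - (if r = p then B u else 0) - (if q = p then D u else 0)"
    using coercive assms(1) by blast
  moreover have "0 < c * A u" using calculation assms(2) by simp
  ultimately show ?thesis by linarith
qed

lemma dA_pos: "u \<in> W \<Longrightarrow> A (pos_part u) \<le> dA u (pos_part u)"
  by (rule dA_ge_A[OF W_pos_part W_neg_part _ pos_add_neg[symmetric] dif_pos_neg])
lemma dA_neg: "u \<in> W \<Longrightarrow> A (neg_part u) \<le> dA u (neg_part u)"
proof -
  assume u: "u \<in> W"
  have ueq: "u x = neg_part u x + pos_part u x" for x using pos_add_neg[of u x] by simp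
  have pd: "0 \<le> dif (neg_part u) z * dif (pos_part u) z" for z using dif_pos_neg[of u z] by (simp add: mult.commute)
  show ?thesis by (rule dA_ge_A[OF W_neg_part[OF u] W_pos_part[OF u] u ueq pd])
qed

lemma sign_changing_comb:
  assumes u: "sign_changing u" and t: "0 < t" "0 < \<tau>"
  shows "sign_changing (\<lambda>x. t * pos_part u x + \<tau> * neg_part u x)"
  using assms by (simp add: sign_changing_iff parts_of_combination)

lemma nodal_projection:
  assumes u: "u \<in> W" and sc: "sign_changing u"
  shows "\<exists>t>0. \<exists>\<tau>>0. nodal (\<lambda>x. t * pos_part u x + \<tau> * neg_part u x)"
proof -
  have nz: "\<not> (AE x in lebesgue. pos_part u x = 0)" "\<not> (AE x in lebesgue. neg_part u x = 0)" using sc by (auto simp: sign_changing_iff)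
  note P = nonzero_pos[OF W_pos_part[OF u] nz(1)] and N = nonzero_pos[OF W_neg_part[OF u] nz(2)]
  obtain \<rho> R where "0 < \<rho>" "\<rho> < R"
    "0 < fibre (dA u (pos_part u)) (B (pos_part u)) (D (pos_part u)) \<rho>" "fibre (dA u (pos_part u)) (B (pos_part u)) (D (pos_part u)) R < 0"
    "0 < fibre (dA u (neg_part u)) (B (neg_part u)) (D (neg_part u)) \<rho>" "fibre (dA u (neg_part u)) (B (neg_part u)) (D (neg_part u)) R < 0"
    using fibre_pos_window[OF less_le_trans[OF coercive_strict[OF W_pos_part[OF u] P(1)] dA_pos[OF u]] P(2,3)
       less_le_trans[OF coercive_strict[OF W_neg_part[OF u] N(1)] dA_neg[OF u]] N(2,3)] by blast
  note pr = this
  obtain e where e: "e > 0" "\<forall>\<epsilon>\<in>{0..e}. \<exists>t\<in>{\<rho>..R}. \<exists>\<tau>\<in>{\<rho>..R}.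
     dJ (deformation u u (t, \<tau>, \<epsilon>)) (pos_part (deformation u u (t, \<tau>, \<epsilon>))) = 0 \<and> dJ (deformation u u (t, \<tau>, \<epsilon>)) (neg_part (deformation u u (t, \<tau>, \<epsilon>))) = 0"
    using nodal_family[OF u u pr] by blast
  have "0 \<in> {0..e}" using e by simp
  with e(2) obtain t \<tau> where t: "t \<in> {\<rho>..R}" "\<tau> \<in> {\<rho>..R}"
     "dJ (deformation u u (t, \<tau>, 0)) (pos_part (deformation u u (t, \<tau>, 0))) = 0" "dJ (deformation u u (t, \<tau>, 0)) (neg_part (deformation u u (t, \<tau>, 0))) = 0" by blast
  have pos: "0 < t" "0 < \<tau>" using t(1,2) pr(1) by auto
  then have "nodal (\<lambda>x. t * pos_part u x + \<tau> * neg_part u x)"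
    unfolding nodal_def using t(3,4) combination_W[OF u] sign_changing_comb[OF sc] unfolding deformation_0 by blast
  then show ?thesis using pos by blast
qed

lemma nehari_projection:
  assumes u: "u \<in> W" and nz: "\<not> (AE x in lebesgue. u x = 0)"
  shows "\<exists>t>0. on_nehari (\<lambda>x. t * u x)"
proof -
  note P = nonzero_pos[OF u nz]
  obtain \<rho> R where pr: "0 < \<rho>" "\<rho> < R" "0 < fibre (A u) (B u) (D u) \<rho>" "fibre (A u) (B u) (D u) R < 0"
    using fibre_pos_window[OF coercive_strict[OF u P(1)] P(2,3) coercive_strict[OF u P(1)] P(2,3)] by blast
  obtain e where e: "e > 0" "\<forall>\<epsilon>\<in>{0..e}. \<exists>t\<in>{\<rho>..R}. dJ (deformation u u (t, t, \<epsilon>)) (deformation u u (t, t, \<epsilon>)) = 0"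
    using nehari_family[OF u u pr] by blast
  have "0 \<in> {0..e}" using e by simp
  with e(2) obtain t where t: "t \<in> {\<rho>..R}" "dJ (deformation u u (t, t, 0)) (deformation u u (t, t, 0)) = 0" by blast
  have f0: "deformation u u (t, t, 0) = (\<lambda>x. t * u x)" unfolding deformation_0 scale_parts ..
  have "0 < t" using t pr by auto
  then show ?thesis using t(2) nz W_cmult[OF u] unfolding f0 on_nehari_def by auto
qed

lemma nodal_J_max:
  assumes v: "nodal v" and t: "0 \<le> t" "0 \<le> \<tau>"
  shows "J (\<lambda>x. t * pos_part v x + \<tau> * neg_part v x) \<le> J v"
proof -
  have vW: "v \<in> W" and Ev: "dJ v (pos_part v) = 0" "dJ v (neg_part v) = 0" using v by (auto simp: nodal_def)
  show ?thesis
    by (rule J_split_le[OF W_pos_part[OF vW] W_neg_part[OF vW] combination_W[OF vW] refl vW pos_add_neg[symmetric] pos_mult_neg dif_pos_neg t Ev])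
qed

lemma nehari_J_max:
  assumes v: "on_nehari v" and t: "0 \<le> t"
  shows "J (\<lambda>x. t * v x) \<le> J v"
proof -
  have vW: "v \<in> W" and Ev: "dJ v v = 0" using v by (auto simp: on_nehari_def)
  have z: "dJ v (\<lambda>x. 0) = 0" using dJ_cmult[of v 0 v] by simp
  have "dif (\<lambda>x. 0) z = 0" for z :: "'a \<times> 'a" by (simp add: dif_def)
  then show ?thesis using J_split_le[OF vW W_zero W_cmult[OF vW, of t], of t 0 v] vW t Ev z by simp
qed

lemma nodal_dJ_self: "nodal v \<Longrightarrow> dJ v v = 0"
proof -
  assume v: "nodal v"
  then have vW: "v \<in> W" by (simp add: nodal_def)
  have "dJ v v = dJ v (\<lambda>x. pos_part v x + neg_part v x)" by (simp add: pos_add_neg)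
  also have "\<dots> = 0" using dJ_add[OF vW W_pos_part[OF vW] W_neg_part[OF vW]] v by (simp add: nodal_def)
  finally show ?thesis .
qed

lemma nodal_dA_eq:
  assumes v: "nodal v"
  shows "dA v (pos_part v) = B (pos_part v) + D (pos_part v)" "dA v (neg_part v) = B (neg_part v) + D (neg_part v)"
proof -
  have vW: "v \<in> W" and Ev: "dJ v (pos_part v) = 0" "dJ v (neg_part v) = 0" using v by (auto simp: nodal_def)
  have e1: "v x = 1 * pos_part v x + 1 * neg_part v x" and e2: "v x = 1 * neg_part v x + 1 * pos_part v x" for x
    using pos_add_neg[of v x] by simp_all
  have pm: "neg_part v x * pos_part v x = 0" for x using pos_mult_neg[of v x] by (simp add: mult.commute)
  show "dA v (pos_part v) = B (pos_part v) + D (pos_part v)"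
    using dJ_split[OF W_pos_part[OF vW] W_neg_part[OF vW] vW e1 pos_mult_neg] Ev by simp
  show "dA v (neg_part v) = B (neg_part v) + D (neg_part v)"
    using dJ_split[OF W_neg_part[OF vW] W_pos_part[OF vW] vW e2 pm] Ev by simp
qed

lemma B_tendsto:
  assumes "\<And>n. f n \<in> W" "\<And>n. A (f n) \<le> K" "u \<in> W" "AE x in lebesgue. (\<lambda>n. f n x) \<longlonglongrightarrow> u x"
  shows "(\<lambda>n. B (f n)) \<longlonglongrightarrow> B u" "(\<lambda>n. D (f n)) \<longlonglongrightarrow> D u" "(\<lambda>n. S (f n)) \<longlonglongrightarrow> S u"
proof -
  show b: "(\<lambda>n. B (f n)) \<longlonglongrightarrow> B u"
    unfolding B_def by (intro tendsto_mult tendsto_const pow_integral_weighted_tendsto[OF _ ps0 r0 r(2) assms]) simp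
  show d: "(\<lambda>n. D (f n)) \<longlonglongrightarrow> D u"
    unfolding D_def by (intro tendsto_mult tendsto_const pow_integral_weighted_tendsto[OF \<alpha>0 \<alpha>s q0 q(2) assms])
  show "(\<lambda>n. S (f n)) \<longlonglongrightarrow> S u" unfolding S_def by (intro tendsto_add) (auto intro: b d)
qed

text \<open>The lower-order terms converge by compactness while \<open>A\<close> is lower semicontinuous.\<close>

lemma minseq_limit:
  assumes v: "\<And>n. v n \<in> W" and K: "\<And>n. A (v n) \<le> K" and u: "u \<in> W"
    and lim: "AE x in lebesgue. (\<lambda>n. v n x) \<longlonglongrightarrow> u x" and t: "0 \<le> t" "0 \<le> \<tau>"
    and Jc: "(\<lambda>n. J (v n)) \<longlonglongrightarrow> c"
    and le: "\<And>n. J (\<lambda>x. t * pos_part (v n) x + \<tau> * neg_part (v n) x) \<le> J (v n)"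
  shows "J (\<lambda>x. t * pos_part u x + \<tau> * neg_part u x) \<le> c"
proof -
  define f where "f = (\<lambda>n x. t * pos_part (v n) x + \<tau> * neg_part (v n) x)"
  define w where "w = (\<lambda>x. t * pos_part u x + \<tau> * neg_part u x)"
  have f: "f n \<in> W" for n unfolding f_def by (rule combination_W[OF v])
  have w: "w \<in> W" unfolding w_def by (rule combination_W[OF u])
  have limf: "AE x in lebesgue. (\<lambda>n. f n x) \<longlonglongrightarrow> w x"
    using lim by eventually_elim (auto simp: f_def w_def pos_part_def neg_part_def intro!: tendsto_intros)
  have Af: "A (f n) \<le> (t + \<tau>) powr p * K" for n
  proof -
    have "A (f n) \<le> A (\<lambda>x. (t + \<tau>) * v n x)"
    proof (rule A_mono_dif[OF f W_cmult[OF v]])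
      fix x y
      have "\<bar>f n x - f n y\<bar> = \<bar>t * (pos_part (v n) x - pos_part (v n) y) + \<tau> * (neg_part (v n) x - neg_part (v n) y)\<bar>"
        by (simp add: f_def algebra_simps)
      also have "\<dots> \<le> t * \<bar>pos_part (v n) x - pos_part (v n) y\<bar> + \<tau> * \<bar>neg_part (v n) x - neg_part (v n) y\<bar>"
        using abs_triangle_ineq[of "t * (pos_part (v n) x - pos_part (v n) y)" "\<tau> * (neg_part (v n) x - neg_part (v n) y)"] t
        by (simp add: abs_mult)
      also have "\<dots> \<le> t * \<bar>v n x - v n y\<bar> + \<tau> * \<bar>v n x - v n y\<bar>"
        using t part_diff by (intro add_mono mult_left_mono) auto
      also have "\<dots> = (t + \<tau>) * \<bar>v n x - v n y\<bar>" by (simp add: distrib_right)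
      also have "\<dots> = \<bar>(t + \<tau>) * (v n x - v n y)\<bar>" using t by (simp add: abs_mult)
      also have "\<dots> = \<bar>(t + \<tau>) * v n x - (t + \<tau>) * v n y\<bar>" by (simp only: right_diff_distrib)
      finally show "\<bar>f n x - f n y\<bar> \<le> \<bar>(t + \<tau>) * v n x - (t + \<tau>) * v n y\<bar>" .
    qed
    also have "\<dots> = (t + \<tau>) powr p * A (v n)" using t by (simp add: A_cmult[OF v])
    also have "\<dots> \<le> (t + \<tau>) powr p * K" using K by (intro mult_left_mono) auto
    finally show ?thesis .
  qed
  note lims = B_tendsto[OF f Af w limf]
  have cn: "A (f n) \<le> p * (J (v n) + B (f n) / r + D (f n) / q)" for n
  proof -
    have "J (f n) \<le> J (v n)" using le[of n] by (simp add: f_def)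
    then have "A (f n) / p \<le> J (v n) + B (f n) / r + D (f n) / q" unfolding J_def[of "f n"] by simp
    then show ?thesis using p0 by (simp add: field_simps)
  qed
  have "(\<lambda>n. p * (J (v n) + B (f n) / r + D (f n) / q)) \<longlonglongrightarrow> p * (c + B w / r + D w / q)"
    using r0 q0 by (intro tendsto_intros Jc lims) auto
  from A_fatou(2)[OF f cn this W_measurable[OF w] limf]
  have "A w / p \<le> c + B w / r + D w / q" using p0 by (simp add: field_simps)
  then show ?thesis unfolding w_def[symmetric] J_def[of w] by simp
qed

lemma minimizing_sequence:
  assumes ne: "P v0" and lb: "\<And>v. P v \<Longrightarrow> 0 \<le> J v"
  shows "\<exists>v c. (\<forall>n::nat. P (v n)) \<and> (\<lambda>n. J (v n)) \<longlonglongrightarrow> c \<and> (\<forall>w. P w \<longrightarrow> c \<le> J w)"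
proof -
  define c where "c = Inf (J ` {v. P v})"
  have bdd: "bdd_below (J ` {v. P v})" by (rule bdd_belowI2[of _ 0]) (use lb in auto)
  have low: "c \<le> J w" if "P w" for w unfolding c_def using that by (intro cINF_lower bdd) auto
  have "\<exists>v. P v \<and> J v < c + 1 / real (Suc n)" for n
  proof -
    have "Inf (J ` {v. P v}) < c + 1 / real (Suc n)" by (simp add: c_def)
    then obtain y where "y \<in> J ` {v. P v}" "y < c + 1 / real (Suc n)" using cInf_lessD[of "J ` {v. P v}"] ne by blast
    then show ?thesis by blast
  qed
  then obtain v where v: "\<And>n. P (v n)" "\<And>n. J (v n) < c + 1 / real (Suc n)" by metis
  have "(\<lambda>n. J (v n)) \<longlonglongrightarrow> c"
  proof (rule tendsto_sandwich[of "\<lambda>n. c" _ _ "\<lambda>n. c + 1 / real (Suc n)"])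
    have "(\<lambda>n. c + 1 / real (Suc n)) \<longlonglongrightarrow> c + 0" by (intro tendsto_add tendsto_const lim_1_over_n LIMSEQ_Suc[OF lim_1_over_n])
    then show "(\<lambda>n. c + 1 / real (Suc n)) \<longlonglongrightarrow> c" by simp
  qed (use v low in \<open>auto intro!: always_eventually less_imp_le\<close>)
  then show ?thesis using v(1) low by blast
qed

lemma bounded_minseq:
  assumes v: "\<And>n. v n \<in> W" "\<And>n. dJ (v n) (v n) = 0" and Jc: "(\<lambda>n. J (v n)) \<longlonglongrightarrow> c"
  shows "\<exists>K. \<forall>n. A (v n) \<le> K"
proof -
  obtain \<kappa> a where k: "\<kappa> > 0" "a > 0" "\<And>u. u \<in> W \<Longrightarrow> dJ u u = 0 \<Longrightarrow> \<kappa> * S u \<le> J u \<and> a * A u \<le> S u"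
    using J_nehari_bound by blast
  have "Bseq (\<lambda>n. J (v n))" using Jc convergentI convergent_imp_Bseq by blast
  then obtain Bd where Bd: "\<And>n. J (v n) \<le> Bd" unfolding Bseq_def by (metis abs_le_D1 real_norm_def)
  have "A (v n) \<le> Bd / (\<kappa> * a)" for n
  proof -
    have "\<kappa> * (a * A (v n)) \<le> \<kappa> * S (v n)" using k(3)[OF v] k(1) by simp
    then have "\<kappa> * a * A (v n) \<le> Bd" using k(3)[OF v, of n] Bd[of n] by linarith
    then show ?thesis using k(1,2) by (simp add: field_simps)
  qed
  then show ?thesis by blast
qed

lemma J_nonneg_nehari: "u \<in> W \<Longrightarrow> dJ u u = 0 \<Longrightarrow> 0 \<le> J u"
proof -
  assume u: "u \<in> W" "dJ u u = 0"
  obtain \<kappa> where "\<kappa> > 0" "\<kappa> * S u \<le> J u" using J_nehari_bound u by blast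
  then show ?thesis using S_nonneg[of u] by (metis mult_nonneg_nonneg less_imp_le order_trans)
qed

text \<open>The quantity \<open>S\<close> is bounded below along the sequence and passes to the limit.\<close>

lemma limit_nonzero:
  assumes f: "\<And>n. f n \<in> W" and K: "\<And>n. A (f n) \<le> K" and u: "u \<in> W"
    and lim: "AE x in lebesgue. (\<lambda>n. f n x) \<longlonglongrightarrow> u x"
    and nz: "\<And>n. \<not> (AE x in lebesgue. f n x = 0)" and le: "\<And>n. A (f n) \<le> B (f n) + D (f n)"
  shows "\<not> (AE x in lebesgue. u x = 0)"
proof -
  obtain \<delta> where \<delta>: "\<delta> > 0" "\<And>f. f \<in> W \<Longrightarrow> 0 < A f \<Longrightarrow> A f \<le> B f + D f \<Longrightarrow> \<delta> \<le> S f" using S_lower_bound by blast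
  have "\<delta> \<le> S u"
    by (rule LIMSEQ_le_const[OF B_tendsto(3)[OF f K u lim]]) (use \<delta>(2)[OF f nonzero_pos(1)[OF f nz] le] in auto)
  then show ?thesis using lower_terms_zero[OF u] \<delta>(1) by auto
qed

text \<open>The limit \<open>u\<close> of a minimising sequence keeps both signs but need not lie in the nodal set. Its projection
  \<open>t u\<^sup>+ + \<tau> u\<^sup>-\<close> does, and its energy is at most the limit of the energies of \<open>t v\<^sub>n\<^sup>+ + \<tau> v\<^sub>n\<^sup>-\<close>, which the maximum property
  bounds by those of \<open>v\<^sub>n\<close>.\<close>

theorem nodal_minimizer:
  assumes w0: "w0 \<in> W" "sign_changing w0"
  shows "\<exists>v. nodal v \<and> (\<forall>w. nodal w \<longrightarrow> J v \<le> J w)"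
proof -
  obtain v0 where "nodal v0" using nodal_projection[OF w0] by blast
  moreover have "0 \<le> J v" if "nodal v" for v using J_nonneg_nehari[of v] nodal_dJ_self[OF that] that by (simp add: nodal_def)
  ultimately obtain v c where v: "\<And>n. nodal (v n)" and Jc: "(\<lambda>n. J (v n)) \<longlonglongrightarrow> c" and low: "\<And>w. nodal w \<Longrightarrow> c \<le> J w"
    using minimizing_sequence[of nodal] by metis
  have vW: "v n \<in> W" for n using v[of n] by (simp add: nodal_def)
  obtain K where K: "\<And>n. A (v n) \<le> K" using bounded_minseq[OF vW nodal_dJ_self[OF v] Jc] by blast
  have "\<exists>k u. strict_mono k \<and> u \<in> W \<and> (AE x in lebesgue. (\<lambda>n. v (k n) x) \<longlonglongrightarrow> u x)"
    by (rule compactness[OF vW K])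
  then obtain k u where k: "strict_mono k" and u: "u \<in> W" and lim: "AE x in lebesgue. (\<lambda>n. v (k n) x) \<longlonglongrightarrow> u x"
    by (elim exE conjE)
  have sc: "\<not> (AE x in lebesgue. pos_part (v n) x = 0)" "\<not> (AE x in lebesgue. neg_part (v n) x = 0)" for n
    using v[of n] by (auto simp: nodal_def sign_changing_iff)
  have "\<not> (AE x in lebesgue. pos_part u x = 0)"
  proof (rule limit_nonzero[of "\<lambda>n. pos_part (v (k n))" K])
    show "AE x in lebesgue. (\<lambda>n. pos_part (v (k n)) x) \<longlonglongrightarrow> pos_part u x"
      using lim by eventually_elim (auto simp: pos_part_def intro!: tendsto_intros)
    show "A (pos_part (v (k n))) \<le> K" for n
      using A_mono_dif[OF W_pos_part[OF vW] vW part_diff(1), of "k n"] K[of "k n"] by simp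
    show "A (pos_part (v (k n))) \<le> B (pos_part (v (k n))) + D (pos_part (v (k n)))" for n
      using dA_pos[OF vW, of "k n"] nodal_dA_eq(1)[OF v, of "k n"] by simp
  qed (use sc in \<open>auto intro: W_pos_part vW u\<close>)
  moreover have "\<not> (AE x in lebesgue. neg_part u x = 0)"
  proof (rule limit_nonzero[of "\<lambda>n. neg_part (v (k n))" K])
    show "AE x in lebesgue. (\<lambda>n. neg_part (v (k n)) x) \<longlonglongrightarrow> neg_part u x"
      using lim by eventually_elim (auto simp: neg_part_def intro!: tendsto_intros)
    show "A (neg_part (v (k n))) \<le> K" for n
      using A_mono_dif[OF W_neg_part[OF vW] vW part_diff(2), of "k n"] K[of "k n"] by simp
    show "A (neg_part (v (k n))) \<le> B (neg_part (v (k n))) + D (neg_part (v (k n)))" for n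
      using dA_neg[OF vW, of "k n"] nodal_dA_eq(2)[OF v, of "k n"] by simp
  qed (use sc in \<open>auto intro: W_neg_part vW u\<close>)
  ultimately have "sign_changing u" by (simp add: sign_changing_iff)
  then obtain t \<tau> where t: "0 < t" "0 < \<tau>" "nodal (\<lambda>x. t * pos_part u x + \<tau> * neg_part u x)" using nodal_projection[OF u] by blast
  have "J (\<lambda>x. t * pos_part u x + \<tau> * neg_part u x) \<le> c"
  proof (rule minseq_limit[OF vW K u lim])
    show "(\<lambda>n. J (v (k n))) \<longlonglongrightarrow> c" using LIMSEQ_subseq_LIMSEQ[OF Jc k] by (simp add: o_def)
  qed (use t nodal_J_max[OF v] in auto)
  then show ?thesis using t(3) low
    by (intro exI[of _ "\<lambda>x. t * pos_part u x + \<tau> * neg_part u x"] conjI allI impI) (auto intro: order_trans)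
qed

theorem nehari_minimizer:
  assumes w0: "w0 \<in> W" "\<not> (AE x in lebesgue. w0 x = 0)"
  shows "\<exists>v. on_nehari v \<and> (\<forall>w. on_nehari w \<longrightarrow> J v \<le> J w)"
proof -
  obtain v0 where "on_nehari v0" using nehari_projection[OF w0] by blast
  moreover have "0 \<le> J v" if "on_nehari v" for v using J_nonneg_nehari[of v] that by (simp add: on_nehari_def)
  ultimately obtain v c where v: "\<And>n. on_nehari (v n)" and Jc: "(\<lambda>n. J (v n)) \<longlonglongrightarrow> c" and low: "\<And>w. on_nehari w \<Longrightarrow> c \<le> J w"
    using minimizing_sequence[of on_nehari] by metis
  have vW: "v n \<in> W" and vE: "dJ (v n) (v n) = 0" and vz: "\<not> (AE x in lebesgue. v n x = 0)" for n using v[of n] by (auto simp: on_nehari_def)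
  obtain K where K: "\<And>n. A (v n) \<le> K" using bounded_minseq[OF vW vE Jc] by blast
  have "\<exists>k u. strict_mono k \<and> u \<in> W \<and> (AE x in lebesgue. (\<lambda>n. v (k n) x) \<longlonglongrightarrow> u x)"
    by (rule compactness[OF vW K])
  then obtain k u where k: "strict_mono k" and u: "u \<in> W" and lim: "AE x in lebesgue. (\<lambda>n. v (k n) x) \<longlonglongrightarrow> u x"
    by (elim exE conjE)
  have "\<not> (AE x in lebesgue. u x = 0)"
  proof (rule limit_nonzero[OF vW K u lim vz])
    show "A (v (k n)) \<le> B (v (k n)) + D (v (k n))" for n using dJ_self[OF vW, of "k n"] vE[of "k n"] by simp
  qed
  then obtain t where t: "0 < t" "on_nehari (\<lambda>x. t * u x)" using nehari_projection[OF u] by blast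
  have "J (\<lambda>x. t * pos_part u x + t * neg_part u x) \<le> c"
  proof (rule minseq_limit[OF vW K u lim])
    show "(\<lambda>n. J (v (k n))) \<longlonglongrightarrow> c" using LIMSEQ_subseq_LIMSEQ[OF Jc k] by (simp add: o_def)
  qed (use t nehari_J_max[OF v] in \<open>auto simp: scale_parts\<close>)
  then show ?thesis unfolding scale_parts using t(2) low
    by (intro exI[of _ "\<lambda>x. t * u x"] conjI allI impI) (auto intro: order_trans)
qed

lemma deformation_continuous_B:
  assumes u: "u \<in> W" and h: "h \<in> W" and g: "\<And>z. g z \<in> W"
    and bg: "\<And>z x. \<bar>g z x\<bar> \<le> deformation_bd z * (\<bar>u x\<bar> + \<bar>h x\<bar>)"
    and cg: "\<And>z l x. z \<longlonglongrightarrow> l \<Longrightarrow> (\<lambda>n. g (z n) x) \<longlonglongrightarrow> g l x"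
  shows "continuous_on UNIV (\<lambda>z. B (g z))"
proof (rule continuous_on_UNIV_sequentially)
  fix z :: "nat \<Rightarrow> real \<times> real \<times> real" and l assume zl: "z \<longlonglongrightarrow> l"
  obtain C where C: "\<And>n. deformation_bd (z n) \<le> C" using deformation_bd_bounded[OF zl] by blast
  have mr: "v \<in> borel_measurable Mr" if "v \<in> W" for v using in_Lm_r[OF that] by (simp add: in_Lm_def)
  have [measurable]: "u \<in> borel_measurable Mr" "h \<in> borel_measurable Mr" by (rule mr[OF u] mr[OF h])+
  have H: "in_Lm Mr r (\<lambda>x. C * (\<bar>u x\<bar> + \<bar>h x\<bar>))"
    by (rule in_Lm_bound2[OF in_Lm_r[OF u] in_Lm_r[OF h] _ r0, of _ "\<bar>C\<bar>"]) (measurable, simp add: abs_mult)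
  have b: "\<bar>g (z n) x\<bar> \<le> C * (\<bar>u x\<bar> + \<bar>h x\<bar>)" for n x
    using bg[of "z n" x] mult_right_mono[OF C[of n], of "\<bar>u x\<bar> + \<bar>h x\<bar>"] by linarith
  have "(\<lambda>n. \<integral>x. dpow r (g (z n) x) * g (z n) x \<partial>Mr) \<longlonglongrightarrow> (\<integral>x. dpow r (g l x) * g l x \<partial>Mr)"
    by (rule dpow_integral_tendsto[OF r1 H mr[OF g] mr[OF g] mr[OF g] mr[OF g]]) (auto intro!: b cg[OF zl])
  then show "(\<lambda>n. B (g (z n))) \<longlonglongrightarrow> B (g l)" unfolding B_def pow_integral_def dpow_mult_self by (intro tendsto_mult tendsto_const)
qed

lemma deformation_1: "deformation v h (1, 1, 0) = v"
  by (rule ext) (simp add: deformation_0 pos_add_neg)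

lemma dist_triple_le: "dist (t, \<tau>, \<epsilon>) (a, b, c) \<le> \<bar>t - a\<bar> + \<bar>\<tau> - b\<bar> + \<bar>\<epsilon> - c\<bar>" for t \<tau> \<epsilon> a b c :: real
proof -
  have "dist (t, \<tau>, \<epsilon>) (a, b, c) = norm (t - a, \<tau> - b, \<epsilon> - c)" by (simp add: dist_norm)
  also have "\<dots> \<le> norm (t - a) + norm (\<tau> - b, \<epsilon> - c)" by (rule norm_Pair_le)
  also have "norm (\<tau> - b, \<epsilon> - c) \<le> norm (\<tau> - b) + norm (\<epsilon> - c)" by (rule norm_Pair_le)
  finally show ?thesis by simp
qed

lemma open_nbhd:
  fixes F :: "real \<times> real \<times> real \<Rightarrow> real"
  assumes "continuous_on UNIV F" "0 < F (1, 1, 0)"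
  shows "\<exists>d>0. \<forall>t \<tau> \<epsilon>. \<bar>t - 1\<bar> \<le> d \<longrightarrow> \<bar>\<tau> - 1\<bar> \<le> d \<longrightarrow> \<bar>\<epsilon>\<bar> \<le> d \<longrightarrow> 0 < F (t, \<tau>, \<epsilon>)"
proof -
  have "open (F -` {0<..})" by (rule open_vimage[OF _ assms(1)]) simp
  then obtain e where e: "e > 0" "\<And>z. dist z (1, 1, 0) < e \<Longrightarrow> 0 < F z"
  proof -
    have "(1, 1, 0) \<in> F -` {0<..}" using assms(2) by simp
    with \<open>open (F -` {0<..})\<close> obtain e where "e > 0" "\<forall>z. dist z (1, 1, 0) < e \<longrightarrow> z \<in> F -` {0<..}"
      unfolding open_dist by blast
    then show thesis by (intro that[of e]) (blast, blast)
  qed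
  show ?thesis
  proof (intro exI[of _ "e / 4"] conjI allI impI)
    show "0 < e / 4" using e by simp
    fix t \<tau> \<epsilon> assume "\<bar>t - 1\<bar> \<le> e / 4" "\<bar>\<tau> - 1\<bar> \<le> e / 4" "\<bar>\<epsilon>\<bar> \<le> e / 4"
    then show "0 < F (t, \<tau>, \<epsilon>)" using dist_triple_le[of t \<tau> \<epsilon> 1 1 0] e(1) by (intro e(2)) auto
  qed
qed

text \<open>The derivative in the direction \<open>h\<close> stays negative in a neighbourhood of \<open>(1, 1, 0)\<close>, by continuity.\<close>

lemma descent:
  assumes v: "v \<in> W" and h: "h \<in> W" and neg: "dJ v h < 0"
  shows "\<exists>d>0. \<forall>t \<tau> \<epsilon>. \<bar>t - 1\<bar> \<le> d \<longrightarrow> \<bar>\<tau> - 1\<bar> \<le> d \<longrightarrow> 0 < \<epsilon> \<longrightarrow> \<epsilon> \<le> d \<longrightarrow> J (deformation v h (t, \<tau>, \<epsilon>)) < J (deformation v h (t, \<tau>, 0))"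
proof -
  have "\<exists>d>0. \<forall>t \<tau> \<epsilon>. \<bar>t - 1\<bar> \<le> d \<longrightarrow> \<bar>\<tau> - 1\<bar> \<le> d \<longrightarrow> \<bar>\<epsilon>\<bar> \<le> d \<longrightarrow> 0 < - dJ (deformation v h (t, \<tau>, \<epsilon>)) h"
    by (rule open_nbhd) (use neg in \<open>auto simp: deformation_1 intro!: continuous_on_minus deformation_continuous_h v h\<close>)
  then obtain d where d: "d > 0" "\<And>t \<tau> \<epsilon>. \<bar>t - 1\<bar> \<le> d \<Longrightarrow> \<bar>\<tau> - 1\<bar> \<le> d \<Longrightarrow> \<bar>\<epsilon>\<bar> \<le> d \<Longrightarrow> 0 < - dJ (deformation v h (t, \<tau>, \<epsilon>)) h"
    by blast
  show ?thesis
  proof (intro exI[of _ d] conjI allI impI d(1))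
    fix t \<tau> \<epsilon> assume a: "\<bar>t - 1\<bar> \<le> d" "\<bar>\<tau> - 1\<bar> \<le> d" "0 < \<epsilon>" "\<epsilon> \<le> d"
    define z where "z = deformation v h (t, \<tau>, 0)"
    have z: "z \<in> W" unfolding z_def by (rule deformation_W[OF v h])
    have fz: "deformation v h (t, \<tau>, \<theta>) = (\<lambda>x. z x + \<theta> * h x)" for \<theta> by (simp add: z_def deformation_def)
    have "J (\<lambda>x. z x + \<epsilon> * h x) < J (\<lambda>x. z x + 0 * h x)"
    proof (rule DERIV_neg_imp_decreasing[OF a(3)])
      fix \<theta> assume \<theta>: "0 \<le> \<theta>" "\<theta> \<le> \<epsilon>"
      have "dJ (\<lambda>x. z x + \<theta> * h x) h < 0" using d(2)[OF a(1,2), of \<theta>] \<theta> a by (simp add: fz)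
      then show "\<exists>y. ((\<lambda>\<theta>. J (\<lambda>x. z x + \<theta> * h x)) has_real_derivative y) (at \<theta>) \<and> y < 0"
        using J_has_derivative[OF z h] by blast
    qed
    then show "J (deformation v h (t, \<tau>, \<epsilon>)) < J (deformation v h (t, \<tau>, 0))" by (simp add: fz)
  qed
qed

lemma B_pos_nonzero: "g \<in> W \<Longrightarrow> 0 < B g \<Longrightarrow> \<not> (AE x in lebesgue. g x = 0)"
  using lower_terms_zero by auto

text \<open>The nodal set is not a manifold on which Lagrange multipliers would be available. Instead, a descent direction \<open>h\<close> is
  combined with a correction of the two coefficients: the corrected point lies in the nodal set, and its energy is smaller than at
  \<open>\<epsilon> = 0\<close>, where the maximum property applies.\<close>

theorem nodal_min_critical:
  assumes v: "nodal v" and min: "\<And>w. nodal w \<Longrightarrow> J v \<le> J w" and h: "h \<in> W"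
  shows "dJ v h = 0"
proof -
  have vW: "v \<in> W" and Ev: "dJ v (pos_part v) = 0" "dJ v (neg_part v) = 0" and sc: "sign_changing v" using v by (auto simp: nodal_def)
  have nz: "\<not> (AE x in lebesgue. pos_part v x = 0)" "\<not> (AE x in lebesgue. neg_part v x = 0)" using sc by (auto simp: sign_changing_iff)
  note P = nonzero_pos[OF W_pos_part[OF vW] nz(1)] and N = nonzero_pos[OF W_neg_part[OF vW] nz(2)]
  have False if h: "h \<in> W" and neg: "dJ v h < 0" for h
  proof -
    obtain d1 where d1: "d1 > 0" "\<And>t \<tau> \<epsilon>. \<bar>t - 1\<bar> \<le> d1 \<Longrightarrow> \<bar>\<tau> - 1\<bar> \<le> d1 \<Longrightarrow> 0 < \<epsilon> \<Longrightarrow> \<epsilon> \<le> d1 \<Longrightarrow> J (deformation v h (t, \<tau>, \<epsilon>)) < J (deformation v h (t, \<tau>, 0))"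
      using descent[OF vW h neg] by blast
    \<comment> \<open>The deformed function still changes sign: \<open>B\<close> detects the vanishing of a sign component and is continuous.\<close>
    have "\<exists>d>0. \<forall>t \<tau> \<epsilon>. \<bar>t - 1\<bar> \<le> d \<longrightarrow> \<bar>\<tau> - 1\<bar> \<le> d \<longrightarrow> \<bar>\<epsilon>\<bar> \<le> d \<longrightarrow> 0 < B (pos_part (deformation v h (t, \<tau>, \<epsilon>)))"
    proof (rule open_nbhd, rule deformation_continuous_B[OF vW h W_pos_part[OF deformation_W[OF vW h]]])
      show "\<bar>pos_part (deformation v h z) x\<bar> \<le> deformation_bd z * (\<bar>v x\<bar> + \<bar>h x\<bar>)" for z x
        using part_diff(3)[of "deformation v h z" x] deformation_bound(2)[of v h z x] by linarith
      show "(\<lambda>n. pos_part (deformation v h (z n)) x) \<longlonglongrightarrow> pos_part (deformation v h l) x" if "z \<longlonglongrightarrow> l" for z l x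
        unfolding pos_part_def by (intro tendsto_max tendsto_const deformation_tendsto that)
    qed (simp add: deformation_1 P)
    then obtain d2 where d2: "d2 > 0" "\<And>t \<tau> \<epsilon>. \<bar>t - 1\<bar> \<le> d2 \<Longrightarrow> \<bar>\<tau> - 1\<bar> \<le> d2 \<Longrightarrow> \<bar>\<epsilon>\<bar> \<le> d2 \<Longrightarrow> 0 < B (pos_part (deformation v h (t, \<tau>, \<epsilon>)))" by blast
    have "\<exists>d>0. \<forall>t \<tau> \<epsilon>. \<bar>t - 1\<bar> \<le> d \<longrightarrow> \<bar>\<tau> - 1\<bar> \<le> d \<longrightarrow> \<bar>\<epsilon>\<bar> \<le> d \<longrightarrow> 0 < B (neg_part (deformation v h (t, \<tau>, \<epsilon>)))"
    proof (rule open_nbhd, rule deformation_continuous_B[OF vW h W_neg_part[OF deformation_W[OF vW h]]])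
      show "\<bar>neg_part (deformation v h z) x\<bar> \<le> deformation_bd z * (\<bar>v x\<bar> + \<bar>h x\<bar>)" for z x
        using part_diff(4)[of "deformation v h z" x] deformation_bound(2)[of v h z x] by linarith
      show "(\<lambda>n. neg_part (deformation v h (z n)) x) \<longlonglongrightarrow> neg_part (deformation v h l) x" if "z \<longlonglongrightarrow> l" for z l x
        unfolding neg_part_def by (intro tendsto_min tendsto_const deformation_tendsto that)
    qed (simp add: deformation_1 N)
    then obtain d3 where d3: "d3 > 0" "\<And>t \<tau> \<epsilon>. \<bar>t - 1\<bar> \<le> d3 \<Longrightarrow> \<bar>\<tau> - 1\<bar> \<le> d3 \<Longrightarrow> \<bar>\<epsilon>\<bar> \<le> d3 \<Longrightarrow> 0 < B (neg_part (deformation v h (t, \<tau>, \<epsilon>)))" by blast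
    define \<delta> where "\<delta> = min (1 / 2) (min d1 (min d2 d3))"
    have \<delta>: "0 < \<delta>" "\<delta> < 1" "\<delta> \<le> d1" "\<delta> \<le> d2" "\<delta> \<le> d3" using d1 d2 d3 by (auto simp: \<delta>_def)
    have "\<exists>e>0. \<forall>\<epsilon>\<in>{0..e}. \<exists>t\<in>{1 - \<delta>..1 + \<delta>}. \<exists>\<tau>\<in>{1 - \<delta>..1 + \<delta>}.
     dJ (deformation v h (t, \<tau>, \<epsilon>)) (pos_part (deformation v h (t, \<tau>, \<epsilon>))) = 0 \<and> dJ (deformation v h (t, \<tau>, \<epsilon>)) (neg_part (deformation v h (t, \<tau>, \<epsilon>))) = 0"
      by (rule nodal_family[OF vW h]) (use \<delta> fibre_self P N in \<open>auto simp: nodal_dA_eq[OF v]\<close>)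
    then obtain e where e: "e > 0" "\<forall>\<epsilon>\<in>{0..e}. \<exists>t\<in>{1 - \<delta>..1 + \<delta>}. \<exists>\<tau>\<in>{1 - \<delta>..1 + \<delta>}.
     dJ (deformation v h (t, \<tau>, \<epsilon>)) (pos_part (deformation v h (t, \<tau>, \<epsilon>))) = 0 \<and> dJ (deformation v h (t, \<tau>, \<epsilon>)) (neg_part (deformation v h (t, \<tau>, \<epsilon>))) = 0" by blast
    define \<epsilon> where "\<epsilon> = min e \<delta>"
    have \<epsilon>: "\<epsilon> \<in> {0..e}" "0 < \<epsilon>" "\<epsilon> \<le> \<delta>" using e \<delta> by (auto simp: \<epsilon>_def)
    obtain t \<tau> where t: "t \<in> {1 - \<delta>..1 + \<delta>}" "\<tau> \<in> {1 - \<delta>..1 + \<delta>}"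
      "dJ (deformation v h (t, \<tau>, \<epsilon>)) (pos_part (deformation v h (t, \<tau>, \<epsilon>))) = 0" "dJ (deformation v h (t, \<tau>, \<epsilon>)) (neg_part (deformation v h (t, \<tau>, \<epsilon>))) = 0"
      using e(2) \<epsilon>(1) by blast
    have tt: "\<bar>t - 1\<bar> \<le> \<delta>" "\<bar>\<tau> - 1\<bar> \<le> \<delta>" "0 \<le> t" "0 \<le> \<tau>" using t(1,2) \<delta> by auto
    let ?w = "deformation v h (t, \<tau>, \<epsilon>)"
    have "sign_changing ?w" unfolding sign_changing_iff
      using d2(2)[of t \<tau> \<epsilon>] d3(2)[of t \<tau> \<epsilon>] tt \<epsilon> \<delta> B_pos_nonzero[OF W_pos_part[OF deformation_W[OF vW h]]] B_pos_nonzero[OF W_neg_part[OF deformation_W[OF vW h]]]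
      by auto
    then have "nodal ?w" using t(3,4) deformation_W[OF vW h] by (simp add: nodal_def)
    then have "J v \<le> J ?w" by (rule min)
    also have "\<dots> < J (deformation v h (t, \<tau>, 0))" using tt \<epsilon> \<delta> by (intro d1(2)) auto
    also have "\<dots> \<le> J v" unfolding deformation_0 using nodal_J_max[OF v] tt by blast
    finally show False by simp
  qed
  from this[OF h] this[OF W_cmult[OF h, of "-1"]] show ?thesis unfolding dJ_cmult by fastforce
qed

theorem nehari_min_critical:
  assumes v: "on_nehari v" and min: "\<And>w. on_nehari w \<Longrightarrow> J v \<le> J w" and h: "h \<in> W"
  shows "dJ v h = 0"
proof -
  have vW: "v \<in> W" and Ev: "dJ v v = 0" and nz: "\<not> (AE x in lebesgue. v x = 0)" using v by (auto simp: on_nehari_def)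
  note P = nonzero_pos[OF vW nz]
  have False if h: "h \<in> W" and neg: "dJ v h < 0" for h
  proof -
    obtain d1 where d1: "d1 > 0" "\<And>t \<tau> \<epsilon>. \<bar>t - 1\<bar> \<le> d1 \<Longrightarrow> \<bar>\<tau> - 1\<bar> \<le> d1 \<Longrightarrow> 0 < \<epsilon> \<Longrightarrow> \<epsilon> \<le> d1 \<Longrightarrow> J (deformation v h (t, \<tau>, \<epsilon>)) < J (deformation v h (t, \<tau>, 0))"
      using descent[OF vW h neg] by blast
    have "\<exists>d>0. \<forall>t \<tau> \<epsilon>. \<bar>t - 1\<bar> \<le> d \<longrightarrow> \<bar>\<tau> - 1\<bar> \<le> d \<longrightarrow> \<bar>\<epsilon>\<bar> \<le> d \<longrightarrow> 0 < B (deformation v h (t, \<tau>, \<epsilon>))"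
      by (rule open_nbhd, rule deformation_continuous_B[OF vW h deformation_W[OF vW h]]) (auto simp: deformation_1 P intro: deformation_bound deformation_tendsto)
    then obtain d2 where d2: "d2 > 0" "\<And>t \<tau> \<epsilon>. \<bar>t - 1\<bar> \<le> d2 \<Longrightarrow> \<bar>\<tau> - 1\<bar> \<le> d2 \<Longrightarrow> \<bar>\<epsilon>\<bar> \<le> d2 \<Longrightarrow> 0 < B (deformation v h (t, \<tau>, \<epsilon>))" by blast
    define \<delta> where "\<delta> = min (1 / 2) (min d1 d2)"
    have \<delta>: "0 < \<delta>" "\<delta> < 1" "\<delta> \<le> d1" "\<delta> \<le> d2" using d1 d2 by (auto simp: \<delta>_def)
    have Av: "A v = B v + D v" using dJ_self[OF vW] Ev by simp
    have "\<exists>e>0. \<forall>\<epsilon>\<in>{0..e}. \<exists>t\<in>{1 - \<delta>..1 + \<delta>}. dJ (deformation v h (t, t, \<epsilon>)) (deformation v h (t, t, \<epsilon>)) = 0"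
      by (rule nehari_family[OF vW h]) (use \<delta> fibre_self P in \<open>auto simp: Av\<close>)
    then obtain e where e: "e > 0" "\<forall>\<epsilon>\<in>{0..e}. \<exists>t\<in>{1 - \<delta>..1 + \<delta>}. dJ (deformation v h (t, t, \<epsilon>)) (deformation v h (t, t, \<epsilon>)) = 0" by blast
    define \<epsilon> where "\<epsilon> = min e \<delta>"
    have \<epsilon>: "\<epsilon> \<in> {0..e}" "0 < \<epsilon>" "\<epsilon> \<le> \<delta>" using e \<delta> by (auto simp: \<epsilon>_def)
    obtain t where t: "t \<in> {1 - \<delta>..1 + \<delta>}" "dJ (deformation v h (t, t, \<epsilon>)) (deformation v h (t, t, \<epsilon>)) = 0"
      using e(2) \<epsilon>(1) by blast
    have tt: "\<bar>t - 1\<bar> \<le> \<delta>" "0 \<le> t" using t(1) \<delta> by auto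
    let ?w = "deformation v h (t, t, \<epsilon>)"
    have "on_nehari ?w" using t(2) deformation_W[OF vW h] B_pos_nonzero[OF deformation_W[OF vW h]] d2(2)[of t t \<epsilon>] tt \<epsilon> \<delta> by (auto simp: on_nehari_def)
    then have "J v \<le> J ?w" by (rule min)
    also have "\<dots> < J (deformation v h (t, t, 0))" using tt \<epsilon> \<delta> by (intro d1(2)) auto
    also have "deformation v h (t, t, 0) = (\<lambda>x. t * v x)" unfolding deformation_0 scale_parts ..
    also have "J (\<lambda>x. t * v x) \<le> J v" using nehari_J_max[OF v tt(2)] .
    finally show False by simp
  qed
  from this[OF h] this[OF W_cmult[OF h, of "-1"]] show ?thesis unfolding dJ_cmult by fastforce
qed

text \<open>Taking absolute values does not increase \<open>A\<close> and leaves the lower-order terms unchanged, so the projection of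
  \<open>\<bar>v\<bar>\<close> to the Nehari set is again a minimiser, by the maximum property of \<open>v\<close> on its ray.\<close>

lemma nehari_minimizer_nonneg:
  assumes w0: "w0 \<in> W" "\<not> (AE x in lebesgue. w0 x = 0)"
  shows "\<exists>v. on_nehari v \<and> (\<forall>x. 0 \<le> v x) \<and> (\<forall>w. on_nehari w \<longrightarrow> J v \<le> J w)"
proof -
  obtain v where v: "on_nehari v" and min: "\<And>w. on_nehari w \<Longrightarrow> J v \<le> J w" using nehari_minimizer[OF w0] by blast
  have vW: "v \<in> W" and nz: "\<not> (AE x in lebesgue. v x = 0)" using v by (auto simp: on_nehari_def)
  obtain t where t: "0 < t" "on_nehari (\<lambda>x. t * \<bar>v x\<bar>)" using nehari_projection[OF W_abs[OF vW]] nz by auto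
  have "A (\<lambda>x. t * \<bar>v x\<bar>) \<le> A (\<lambda>x. t * v x)"
    by (rule A_mono_dif[OF W_cmult[OF W_abs[OF vW]] W_cmult[OF vW]])
      (use t in \<open>simp add: abs_mult abs_triangle_ineq3 flip: right_diff_distrib\<close>)
  moreover have "B (\<lambda>x. t * \<bar>v x\<bar>) = B (\<lambda>x. t * v x)" "D (\<lambda>x. t * \<bar>v x\<bar>) = D (\<lambda>x. t * v x)"
    by (simp_all add: B_def D_def pow_integral_def abs_mult)
  ultimately have "J (\<lambda>x. t * \<bar>v x\<bar>) \<le> J (\<lambda>x. t * v x)" unfolding J_def using p0 by (simp add: divide_right_mono)
  also have "\<dots> \<le> J v" using nehari_J_max[OF v] t by simp
  finally show ?thesis using t min by (intro exI[of _ "\<lambda>x. t * \<bar>v x\<bar>"]) (auto intro: order_trans)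
qed

end

section \<open>Cutoffs and the strong maximum principle\<close>

text \<open>A Lipschitz function that is \<open>1\<close> on \<open>ball c R\<close> and \<open>0\<close> outside \<open>ball c (2 * R)\<close>.\<close>

definition cutoff :: "'a::euclidean_space \<Rightarrow> real \<Rightarrow> 'a \<Rightarrow> real" where
  "cutoff c R x = max 0 (min 1 (2 - norm (x - c) / R))"

lemma cutoff_bounds: "0 \<le> cutoff c R x" "cutoff c R x \<le> 1"
  by (auto simp: cutoff_def)

lemma cutoff_1: "0 < R \<Longrightarrow> x \<in> ball c R \<Longrightarrow> cutoff c R x = 1"
  by (simp add: cutoff_def dist_norm norm_minus_commute field_simps)

lemma cutoff_0: "0 < R \<Longrightarrow> x \<notin> ball c (2 * R) \<Longrightarrow> cutoff c R x = 0"
  by (simp add: cutoff_def dist_norm norm_minus_commute field_simps)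

lemma cutoff_lipschitz:
  assumes "0 < R" shows "\<bar>cutoff c R x - cutoff c R y\<bar> \<le> norm (x - y) / R"
proof -
  have "\<bar>norm (x - c) - norm (y - c)\<bar> \<le> norm (x - y)" using norm_triangle_ineq3[of "x - c" "y - c"] by simp
  then have "\<bar>norm (x - c) / R - norm (y - c) / R\<bar> \<le> norm (x - y) / R"
    using assms by (simp add: divide_right_mono flip: diff_divide_distrib)
  then show ?thesis unfolding cutoff_def by (auto simp: max_def min_def abs_if split: if_splits)
qed

lemma cutoff_measurable: "cutoff c R \<in> borel_measurable borel"
  unfolding cutoff_def[abs_def] by measurable

lemma nn_integral_lborel_translate:
  fixes f :: "'a::euclidean_space \<Rightarrow> ennreal"
  assumes [measurable]: "f \<in> borel_measurable borel"
  shows "(\<integral>\<^sup>+y. f (y - x) \<partial>lborel) = (\<integral>\<^sup>+y. f y \<partial>lborel)"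
proof -
  have "(\<integral>\<^sup>+y. f y \<partial>lborel) = (\<integral>\<^sup>+y. f y \<partial>distr lborel borel ((+) (- x)))" by (simp add: lborel_distr_plus)
  also have "\<dots> = (\<integral>\<^sup>+y. f (- x + y) \<partial>lborel)" by (rule nn_integral_distr) measurable
  finally show ?thesis by simp
qed

text \<open>For \<open>t = b / a < 1\<close> write \<open>c \<le> (1 - t) * (\<bar>c - d\<bar> / (1 - t)) + t * (d / t)\<close> and apply convexity of the power.\<close>

lemma discrete_picone:
  fixes a b c d p :: real
  assumes p: "1 < p" and a: "0 < a" and b: "0 < b" and c: "0 \<le> c" and d: "0 \<le> d"
  shows "dpow p (a - b) * (c powr p * a powr (1 - p) - d powr p * b powr (1 - p)) \<le> \<bar>c - d\<bar> powr p"
proof -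
  have main: "dpow p (a - b) * (c powr p * a powr (1 - p) - d powr p * b powr (1 - p)) \<le> \<bar>c - d\<bar> powr p"
    if ab: "b < a" "0 < b" and c: "0 \<le> c" and d: "0 \<le> d" for a b c d :: real
  proof -
    define t where "t = b / a"
    have t: "0 < t" "t < 1" using ab by (auto simp: t_def)
    have a0: "0 < a" using ab by simp
    have "c \<le> (1 - t) * (\<bar>c - d\<bar> / (1 - t)) + t * (d / t)" using t by simp
    then have "c powr p \<le> ((1 - t) * (\<bar>c - d\<bar> / (1 - t)) + t * (d / t)) powr p"
      using c p by (intro powr_mono2) auto
    also have "\<dots> \<le> (1 - t) * (\<bar>c - d\<bar> / (1 - t)) powr p + t * (d / t) powr p"
      using t d by (intro powr_jensen p) auto
    also have "(1 - t) * (\<bar>c - d\<bar> / (1 - t)) powr p = (1 - t) powr (1 - p) * \<bar>c - d\<bar> powr p"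
      using t by (simp add: powr_divide powr_diff)
    also have "t * (d / t) powr p = t powr (1 - p) * d powr p"
      using t d by (simp add: powr_divide powr_diff)
    finally have cp: "c powr p - t powr (1 - p) * d powr p \<le> (1 - t) powr (1 - p) * \<bar>c - d\<bar> powr p" by simp
    have b': "b = a * t" using a0 by (simp add: t_def)
    have amb: "a - b = a * (1 - t)" by (simp add: b' right_diff_distrib)
    have "dpow p (a - b) = (a * (1 - t)) powr (p - 1)" unfolding amb using a0 t by (intro dpow_nonneg) auto
    then have dp: "dpow p (a - b) = a powr (p - 1) * (1 - t) powr (p - 1)" using a0 t by (simp add: powr_mult)
    have bp: "b powr (1 - p) = a powr (1 - p) * t powr (1 - p)" using a0 t by (simp add: b' powr_mult)
    have aa: "a powr (p - 1) * a powr (1 - p) = 1" and tt: "(1 - t) powr (p - 1) * (1 - t) powr (1 - p) = 1"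
      using a0 t by (simp_all flip: powr_add)
    have "dpow p (a - b) * (c powr p * a powr (1 - p) - d powr p * b powr (1 - p))
       = (a powr (p - 1) * a powr (1 - p)) * ((1 - t) powr (p - 1) * (c powr p - t powr (1 - p) * d powr p))"
      unfolding dp bp by (simp add: algebra_simps)
    also have "\<dots> \<le> (1 - t) powr (p - 1) * ((1 - t) powr (1 - p) * \<bar>c - d\<bar> powr p)"
      unfolding aa using cp by (simp add: mult_left_mono)
    also have "\<dots> = \<bar>c - d\<bar> powr p" using tt by (simp flip: mult.assoc)
    finally show ?thesis .
  qed
  consider "a = b" | "b < a" | "a < b" by linarith
  then show ?thesis
  proof cases
    case 2 then show ?thesis using main b c d by blast
  next
    case 3
    have "dpow p (a - b) * (c powr p * a powr (1 - p) - d powr p * b powr (1 - p)) = dpow p (b - a) * (d powr p * b powr (1 - p) - c powr p * a powr (1 - p))"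
      using dpow_minus[of p "b - a"] by (simp add: algebra_simps)
    also have "\<dots> \<le> \<bar>d - c\<bar> powr p" by (rule main[OF 3 a d c])
    finally show ?thesis by (simp add: abs_minus_commute)
  qed simp
qed

lemma powr_diff_le_unit:
  fixes a b p :: real
  assumes "1 < p" "0 \<le> a" "a \<le> 1" "0 \<le> b" "b \<le> 1" shows "\<bar>a powr p - b powr p\<bar> \<le> p * \<bar>a - b\<bar>"
proof -
  have main: "a powr p - b powr p \<le> p * \<bar>a - b\<bar>" if "0 \<le> a" "a \<le> 1" "0 \<le> b" for a b :: real
  proof -
    have "a powr p + p * dpow p a * (b - a) \<le> b powr p" using dpow_tangent[OF assms(1), of a b] that by simp
    then have "a powr p - b powr p \<le> p * (dpow p a * (a - b))" by (simp add: algebra_simps)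
    also have "\<dots> \<le> p * (1 * \<bar>a - b\<bar>)"
    proof (rule mult_left_mono)
      have "dpow p a * (a - b) \<le> dpow p a * \<bar>a - b\<bar>" using that by (intro mult_left_mono) (auto simp: dpow_nonneg)
      also have "\<dots> \<le> 1 * \<bar>a - b\<bar>" using that assms(1) by (intro mult_right_mono) (auto simp: dpow_nonneg intro: powr_le1)
      finally show "dpow p a * (a - b) \<le> 1 * \<bar>a - b\<bar>" .
    qed (use assms in auto)
    finally show ?thesis by simp
  qed
  show ?thesis using main[of a b] main[of b a] assms by (simp add: abs_le_iff abs_minus_commute)
qed

lemma powr_neg_diff_le:
  fixes a b p e :: real
  assumes "1 < p" "0 < e" "e \<le> a" "e \<le> b" shows "\<bar>a powr (1 - p) - b powr (1 - p)\<bar> \<le> (p - 1) * e powr (- p) * \<bar>a - b\<bar>"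
proof -
  have main: "\<bar>a powr (1 - p) - b powr (1 - p)\<bar> \<le> (p - 1) * e powr (- p) * \<bar>a - b\<bar>" if "e \<le> a" "a < b" for a b :: real
  proof -
    have "\<exists>z. a < z \<and> z < b \<and> b powr (1 - p) - a powr (1 - p) = (b - a) * ((1 - p) * z powr (1 - p - 1))"
      using that assms by (intro MVT2) (auto intro!: derivative_eq_intros)
    then obtain z where z: "a < z" "z < b" "b powr (1 - p) - a powr (1 - p) = (b - a) * ((1 - p) * z powr (- p))" by auto
    have "\<bar>a powr (1 - p) - b powr (1 - p)\<bar> = (p - 1) * z powr (- p) * \<bar>a - b\<bar>"
      using z assms that by (subst abs_minus_commute) (simp add: z(3) abs_mult)
    also have "\<dots> \<le> (p - 1) * e powr (- p) * \<bar>a - b\<bar>"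
      using z that assms by (intro mult_right_mono mult_left_mono powr_mono2') auto
    finally show ?thesis .
  qed
  consider "a = b" | "a < b" | "b < a" by linarith
  then show ?thesis
  proof cases
    case 3 then show ?thesis using main[of b a] assms by (simp add: abs_minus_commute)
  qed (use main assms in auto)
qed

lemma lebesgue_positive_borel_subset:
  fixes P :: "'a::euclidean_space set"
  assumes "P \<in> sets lebesgue" "P \<notin> null_sets lebesgue"
  obtains Q where "Q \<in> sets borel" "Q \<subseteq> P" "emeasure lborel Q \<noteq> 0"
proof -
  obtain S N N' where SN: "P = S \<union> N" "N \<subseteq> N'" "N' \<in> null_sets lborel" "S \<in> sets lborel"
    using sets_completionE[OF assms(1)] by metis
  have "emeasure lborel S \<noteq> 0"
  proof
    assume "emeasure lborel S = 0"
    then have "S \<in> null_sets lborel" using SN(4) by auto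
    then have "S \<union> N' \<in> null_sets lebesgue" using SN(3) by (intro null_sets_completionI) auto
    then have "P \<in> null_sets lebesgue" using SN by (auto intro: null_sets_completion_subset)
    then show False using assms(2) by simp
  qed
  then show thesis using that[of S] SN by auto
qed

context frac
begin

lemma AE_K0_iff: "(AE z in K0. P z) \<longleftrightarrow> (AE z in lebesgue. fst z \<noteq> snd z \<longrightarrow> P z)"
proof -
  have "(AE z in K0. P z) \<longleftrightarrow> (AE z in lebesgue. 0 < ennreal (1 / norm (fst z - snd z :: 'a) powr (real DIM('a) + p * s)) \<longrightarrow> P z)"
    unfolding gagliardo_measure_def using kernel_measurable by (subst AE_density) (auto simp: measurable_compose[OF _ measurable_ennreal])
  then show ?thesis by simp
qed

text \<open>A nonzero increment needs an endpoint in the ball of radius \<open>2 * R\<close>, and in the difference of the two points the quotient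
  is dominated by an integrable function: near \<open>0\<close> by the Lipschitz bound, since \<open>s < 1\<close>, and far away by the decay of the kernel.\<close>

lemma cutoff_W:
  assumes R: "0 < R" and sub: "ball c (2 * R) \<subseteq> \<Omega>"
  shows "cutoff c R \<in> W"
proof -
  let ?N = "real DIM('a)" and ?\<eta> = "cutoff c R"
  have ps: "0 < p * s" using p0 s0 by simp
  have aN: "?N + p * s - p < ?N" using s1 p0 by simp
  have bN: "?N < ?N + p * s" using ps by simp
  define U where "U = ball c (2 * R)"
  have [measurable]: "U \<in> sets borel" "ball (0::'a) R - {0} \<in> sets borel" "- cball (0::'a) (R / 2) \<in> sets borel"
    by (auto simp: U_def)
  define k1 where "k1 = (\<lambda>z::'a. indicator (ball 0 R - {0}) z * norm z powr (- (?N + p * s - p)) :: real)"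
  define k2 where "k2 = (\<lambda>z::'a. indicator (- cball 0 (R / 2)) z * norm z powr (- (?N + p * s)) :: real)"
  define k where "k = (\<lambda>z::'a. ennreal (R powr (- p)) * ennreal (k1 z) + ennreal (k2 z))"
  have [measurable]: "k1 \<in> borel_measurable borel" "k2 \<in> borel_measurable borel" unfolding k1_def k2_def by measurable
  have km[measurable]: "k \<in> borel_measurable borel" unfolding k_def by measurable
  obtain C where C: "(\<integral>\<^sup>+z. ennreal (k1 z) \<partial>lborel) \<le> ennreal (C * R powr (?N - (?N + p * s - p)))"
    unfolding k1_def using nn_integral_norm_powr_ball[OF aN] R by blast
  have k2: "(\<integral>\<^sup>+z. ennreal (k2 z) \<partial>lborel) < \<infinity>"
    unfolding k2_def using R by (intro nn_integral_norm_powr_outside[OF bN]) simp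
  have "(\<integral>\<^sup>+z. k z \<partial>lborel) = ennreal (R powr (- p)) * (\<integral>\<^sup>+z. ennreal (k1 z) \<partial>lborel) + (\<integral>\<^sup>+z. ennreal (k2 z) \<partial>lborel)"
    unfolding k_def by (subst nn_integral_add) (auto simp: nn_integral_cmult)
  also have "\<dots> < \<infinity>" using C k2 by (auto simp: ennreal_mult_less_top intro: le_less_trans)
  finally have kfin: "(\<integral>\<^sup>+z. k z \<partial>lborel) < \<infinity>" .
  have kk: "k (y - x) = k (x - y)" for x y unfolding k_def k1_def k2_def
    by (simp add: indicator_def norm_minus_commute dist_norm)
  have gk: "ennreal (gagliardo_quotient s p ?\<eta> (x, y)) \<le> indicator U x * k (y - x) + indicator U y * k (y - x)" for x y
  proof (cases "x \<in> U \<or> y \<in> U")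
    case False
    then show ?thesis using cutoff_0[OF R, of _ c] by (simp add: gagliardo_quotient_def U_def)
  next
    case True
    have "ennreal (gagliardo_quotient s p ?\<eta> (x, y)) \<le> k (y - x)"
    proof (cases "x = y")
      case True then show ?thesis by (simp add: gagliardo_quotient_def)
    next
      case xy: False
      let ?d = "norm (x - y)"
      have d: "0 < ?d" using xy by simp
      show ?thesis
      proof (cases "?d < R")
        case True
        have "\<bar>?\<eta> x - ?\<eta> y\<bar> powr p \<le> (?d / R) powr p" using cutoff_lipschitz[OF R] p0 by (intro powr_mono2) auto
        also have "\<dots> = R powr (- p) * ?d powr p" using R d by (simp add: powr_divide powr_minus_divide)
        finally have "gagliardo_quotient s p ?\<eta> (x, y) \<le> R powr (- p) * ?d powr p / ?d powr (?N + p * s)"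
          by (simp add: gagliardo_quotient_def divide_right_mono)
        also have "\<dots> = R powr (- p) * ?d powr (- (?N + p * s - p))"
          by (simp add: powr_diff)
        also have "\<dots> = R powr (- p) * k1 (y - x)" using True xy by (simp add: k1_def norm_minus_commute)
        finally have "ennreal (gagliardo_quotient s p ?\<eta> (x, y)) \<le> ennreal (R powr (- p)) * ennreal (k1 (y - x))"
          by (subst ennreal_mult[symmetric]) (auto simp: k1_def intro: ennreal_leI)
        then show ?thesis unfolding k_def by (rule order_trans) simp
      next
        case False
        have "\<bar>?\<eta> x - ?\<eta> y\<bar> \<le> 1" using cutoff_bounds[of c R x] cutoff_bounds[of c R y] by linarith
        then have "\<bar>?\<eta> x - ?\<eta> y\<bar> powr p \<le> 1" using p0 by (intro powr_le1) auto
        then have "gagliardo_quotient s p ?\<eta> (x, y) \<le> 1 / ?d powr (?N + p * s)"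
          by (simp add: gagliardo_quotient_def divide_right_mono)
        also have "\<dots> = ?d powr (- (?N + p * s))" by (rule powr_minus_divide[symmetric])
        also have "\<dots> = k2 (y - x)" using False R by (simp add: k2_def norm_minus_commute)
        finally have "ennreal (gagliardo_quotient s p ?\<eta> (x, y)) \<le> ennreal (k2 (y - x))" by (rule ennreal_leI)
        then show ?thesis unfolding k_def by (rule order_trans) simp
      qed
    qed
    moreover have "k (y - x) \<le> indicator U x * k (y - x) + indicator U y * k (y - x)"
      using True by (auto simp: indicator_def)
    ultimately show ?thesis by (rule order_trans)
  qed
  have [measurable]: "?\<eta> \<in> borel_measurable borel" by (rule cutoff_measurable)
  have eU: "emeasure lborel U < \<infinity>" using emeasure_lborel_ball_finite[of c "2 * R"] by (simp add: U_def)
  have gm[measurable]: "gagliardo_quotient s p ?\<eta> \<in> borel_measurable (borel \<Otimes>\<^sub>M borel)"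
    unfolding gagliardo_quotient_def by measurable
  have "(\<integral>\<^sup>+z. ennreal (gagliardo_quotient s p ?\<eta> z) \<partial>lebesgue) = (\<integral>\<^sup>+z. ennreal (gagliardo_quotient s p ?\<eta> z) \<partial>(lborel \<Otimes>\<^sub>M lborel))"
    by (simp add: lborel_prod nn_integral_completion)
  also have "\<dots> = (\<integral>\<^sup>+x. \<integral>\<^sup>+y. ennreal (gagliardo_quotient s p ?\<eta> (x, y)) \<partial>lborel \<partial>lborel)"
    by (rule lborel.nn_integral_fst[symmetric]) measurable
  also have "\<dots> \<le> (\<integral>\<^sup>+x. \<integral>\<^sup>+y. indicator U x * k (y - x) + indicator U y * k (y - x) \<partial>lborel \<partial>lborel)"
    by (intro nn_integral_mono gk)
  also have "\<dots> = (\<integral>\<^sup>+x. \<integral>\<^sup>+y. indicator U x * k (y - x) \<partial>lborel \<partial>lborel) + (\<integral>\<^sup>+x. \<integral>\<^sup>+y. indicator U y * k (y - x) \<partial>lborel \<partial>lborel)"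
    by (subst nn_integral_add, measurable, subst nn_integral_add, measurable)
  also have "(\<integral>\<^sup>+x. \<integral>\<^sup>+y. indicator U x * k (y - x) \<partial>lborel \<partial>lborel) = emeasure lborel U * (\<integral>\<^sup>+z. k z \<partial>lborel)"
    by (simp add: nn_integral_cmult nn_integral_lborel_translate nn_integral_multc)
  also have "(\<integral>\<^sup>+x. \<integral>\<^sup>+y. indicator U y * k (y - x) \<partial>lborel \<partial>lborel) = (\<integral>\<^sup>+y. \<integral>\<^sup>+x. indicator U y * k (y - x) \<partial>lborel \<partial>lborel)"
    by (rule lborel_pair.Fubini'[symmetric]) measurable
  also have "\<dots> = (\<integral>\<^sup>+y. \<integral>\<^sup>+x. indicator U y * k (x - y) \<partial>lborel \<partial>lborel)" by (simp add: kk)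
  also have "\<dots> = emeasure lborel U * (\<integral>\<^sup>+z. k z \<partial>lborel)"
    by (simp add: nn_integral_cmult nn_integral_lborel_translate nn_integral_multc)
  also have "emeasure lborel U * (\<integral>\<^sup>+z. k z \<partial>lborel) + emeasure lborel U * (\<integral>\<^sup>+z. k z \<partial>lborel) < \<infinity>"
    using eU kfin by (simp add: ennreal_mult_less_top)
  finally have fin: "(\<integral>\<^sup>+z. ennreal (gagliardo_quotient s p ?\<eta> z) \<partial>lebesgue) < \<infinity>" .
  have \<eta>m: "?\<eta> \<in> borel_measurable lebesgue" using cutoff_measurable[of c R] by (simp add: measurable_completion)
  have "gagliardo_quotient s p ?\<eta> \<in> borel_measurable lebesgue"
    using gm by (simp add: borel_prod measurable_completion)
  then have "integrable lebesgue (gagliardo_quotient s p ?\<eta>)"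
    using fin by (intro integrableI_nonneg) (auto simp: gagliardo_quotient_def split: prod.split)
  then have "in_Lm K0 p (dif ?\<eta>)" using in_Lm_dif_iff[OF \<eta>m] by blast
  moreover have "integrable lebesgue ?\<eta>"
  proof (rule Bochner_Integration.integrable_bound)
    show "integrable lebesgue (indicator U :: 'a \<Rightarrow> real)" using eU by (intro integrable_real_indicator) (auto simp: U_def)
    show "AE x in lebesgue. norm (?\<eta> x) \<le> norm (indicator U x :: real)"
      using cutoff_bounds[of c R] cutoff_0[OF R, of _ c] by (auto simp: U_def indicator_def)
  qed (rule \<eta>m)
  moreover have "AE x in lebesgue. x \<notin> \<Omega> \<longrightarrow> ?\<eta> x = 0" by (intro AE_I2 impI cutoff_0[OF R]) (use sub in auto)
  ultimately show ?thesis by (intro W_intro)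
qed

lemma AE_zero_ball_absurd:
  assumes "open G" "x \<in> G" "AE y in lebesgue. y \<notin> G" shows False
  using mem_closed_if_AE_lebesgue[of "- G" x] assms by (auto simp: closed_Compl)

text \<open>The difference of two cutoffs around \<open>0\<close> and around a point at distance \<open>\<rho> / 2\<close>, with disjoint supports.\<close>

lemma ex_sign_changing: "\<exists>w\<in>W. sign_changing w"
proof -
  obtain \<rho> where \<rho>: "0 < \<rho>" "ball 0 \<rho> \<subseteq> \<Omega>" using open_\<Omega> zero_\<Omega> by (meson openE)
  define c where "c = (\<rho> / 2) *\<^sub>R (SOME b::'a. b \<in> Basis)"
  have nc: "norm c = \<rho> / 2" using \<rho> by (simp add: c_def norm_Basis[OF SOME_Basis])
  define R where "R = \<rho> / 8"
  have R: "0 < R" using \<rho> by (simp add: R_def)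
  have "ball 0 (2 * R) \<subseteq> \<Omega>" using \<rho> by (auto simp: R_def)
  then have w1: "cutoff 0 R \<in> W" by (rule cutoff_W[OF R])
  have "ball c (2 * R) \<subseteq> \<Omega>"
  proof
    fix x assume "x \<in> ball c (2 * R)"
    then have "norm (x - c) < \<rho> / 4" by (simp add: R_def dist_norm norm_minus_commute)
    then have "norm x < \<rho>" using norm_triangle_sub[of x c] nc \<rho> by linarith
    then show "x \<in> \<Omega>" using \<rho> by auto
  qed
  then have w2: "cutoff c R \<in> W" by (rule cutoff_W[OF R])
  define w where "w = (\<lambda>x. cutoff 0 R x + (- 1) * cutoff c R x)"
  have wW: "w \<in> W" unfolding w_def by (rule W_add[OF w1 W_cmult[OF w2]])
  have wp: "w x = 1" if "x \<in> ball 0 R" for x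
  proof -
    have "norm x < \<rho> / 8" using that by (simp add: R_def)
    then have "\<not> norm (x - c) < \<rho> / 4" using norm_triangle_sub[of c x] nc \<rho> by (simp add: norm_minus_commute)
    then have "x \<notin> ball c (2 * R)" by (simp add: R_def dist_norm norm_minus_commute)
    from cutoff_0[OF R this] show ?thesis using cutoff_1[OF R that] by (simp add: w_def)
  qed
  have wn: "w x = - 1" if "x \<in> ball c R" for x
  proof -
    have "norm (x - c) < \<rho> / 8" using that by (simp add: R_def dist_norm norm_minus_commute)
    then have "\<not> norm x < \<rho> / 4" using norm_triangle_sub[of c x] nc \<rho> by (simp add: norm_minus_commute)
    then have "x \<notin> ball 0 (2 * R)" by (simp add: R_def)
    from cutoff_0[OF R this] show ?thesis using cutoff_1[OF R that] by (simp add: w_def)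
  qed
  have "\<not> (AE x in lebesgue. max (w x) 0 = 0)"
  proof
    assume "AE x in lebesgue. max (w x) 0 = 0"
    then have "AE x in lebesgue. x \<notin> ball (0::'a) R" by eventually_elim (use wp in auto)
    then show False using AE_zero_ball_absurd[of "ball 0 R" 0] R by simp
  qed
  moreover have "\<not> (AE x in lebesgue. min (w x) 0 = 0)"
  proof
    assume "AE x in lebesgue. min (w x) 0 = 0"
    then have "AE x in lebesgue. x \<notin> ball c R" by eventually_elim (use wn in auto)
    then show False using AE_zero_ball_absurd[of "ball c R" c] R by simp
  qed
  ultimately show ?thesis using wW by (auto simp: sign_changing_def)
qed

text \<open>The test function is Lipschitz in the pair \<open>(u, \<eta>)\<close>, because \<open>\<eta>\<close> is bounded by \<open>1\<close> and \<open>u + e\<close> is bounded below by \<open>e\<close>.\<close>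

lemma picone_test_W:
  assumes u: "u \<in> W" and u0: "\<And>x. 0 \<le> u x" and R: "0 < R" and sub: "ball c (2 * R) \<subseteq> \<Omega>" and e: "0 < e"
  shows "(\<lambda>x. cutoff c R x powr p * (u x + e) powr (1 - p)) \<in> W"
proof -
  let ?\<eta> = "cutoff c R"
  define C where "C = p * e powr (1 - p) + (p - 1) * e powr (- p)"
  have C1: "0 \<le> p * e powr (1 - p)" "0 \<le> (p - 1) * e powr (- p)" using p1 by auto
  have le: "(u x + e) powr (1 - p) \<le> e powr (1 - p)" for x using u0[of x] e p1 by (intro powr_mono2') auto
  have [measurable]: "u \<in> borel_measurable lebesgue" by (rule W_measurable[OF u])
  have [measurable]: "?\<eta> \<in> borel_measurable lebesgue" using cutoff_measurable[of c R] by (simp add: measurable_completion)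
  show ?thesis
  proof (rule W_bound2[OF u cutoff_W[OF R sub], of _ C])
    show "(\<lambda>x. ?\<eta> x powr p * (u x + e) powr (1 - p)) \<in> borel_measurable lebesgue" by measurable
    fix x y
    have "\<bar>?\<eta> x powr p * (u x + e) powr (1 - p) - ?\<eta> y powr p * (u y + e) powr (1 - p)\<bar>
       = \<bar>(?\<eta> x powr p - ?\<eta> y powr p) * (u x + e) powr (1 - p) + ?\<eta> y powr p * ((u x + e) powr (1 - p) - (u y + e) powr (1 - p))\<bar>"
      by (simp add: algebra_simps)
    also have "\<dots> \<le> \<bar>?\<eta> x powr p - ?\<eta> y powr p\<bar> * (u x + e) powr (1 - p) + ?\<eta> y powr p * \<bar>(u x + e) powr (1 - p) - (u y + e) powr (1 - p)\<bar>"
      by (rule order_trans[OF abs_triangle_ineq]) (simp add: abs_mult)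
    also have "\<dots> \<le> (p * \<bar>?\<eta> x - ?\<eta> y\<bar>) * e powr (1 - p) + 1 * ((p - 1) * e powr (- p) * \<bar>u x - u y\<bar>)"
    proof (intro add_mono mult_mono)
      show "\<bar>?\<eta> x powr p - ?\<eta> y powr p\<bar> \<le> p * \<bar>?\<eta> x - ?\<eta> y\<bar>" using cutoff_bounds by (intro powr_diff_le_unit p1)
      show "?\<eta> y powr p \<le> 1" using cutoff_bounds[of c R y] p0 by (intro powr_le1) auto
      show "\<bar>(u x + e) powr (1 - p) - (u y + e) powr (1 - p)\<bar> \<le> (p - 1) * e powr (- p) * \<bar>u x - u y\<bar>"
        using powr_neg_diff_le[OF p1 e, of "u x + e" "u y + e"] u0 by simp
    qed (use le p0 in auto)
    also have "\<dots> \<le> C * (\<bar>u x - u y\<bar> + \<bar>?\<eta> x - ?\<eta> y\<bar>)"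
      using mult_right_mono[OF C1(1), of "\<bar>u x - u y\<bar>"] mult_right_mono[OF C1(2), of "\<bar>?\<eta> x - ?\<eta> y\<bar>"]
      by (simp add: C_def algebra_simps)
    finally show "\<bar>?\<eta> x powr p * (u x + e) powr (1 - p) - ?\<eta> y powr p * (u y + e) powr (1 - p)\<bar> \<le> C * (\<bar>u x - u y\<bar> + \<bar>?\<eta> x - ?\<eta> y\<bar>)" .
    have "?\<eta> x powr p \<le> p * ?\<eta> x" using powr_diff_le_unit[OF p1, of "?\<eta> x" 0] cutoff_bounds[of c R x] by simp
    then have "?\<eta> x powr p * (u x + e) powr (1 - p) \<le> (p * ?\<eta> x) * e powr (1 - p)"
      using le p0 cutoff_bounds[of c R x] by (intro mult_mono) auto
    also have "\<dots> \<le> C * (\<bar>u x\<bar> + \<bar>?\<eta> x\<bar>)"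
      using mult_right_mono[OF C1(1), of "\<bar>u x\<bar>"] mult_right_mono[OF C1(2), of "\<bar>u x\<bar> + \<bar>?\<eta> x\<bar>"] cutoff_bounds[of c R x]
      by (simp add: C_def algebra_simps)
    finally show "\<bar>?\<eta> x powr p * (u x + e) powr (1 - p)\<bar> \<le> C * (\<bar>u x\<bar> + \<bar>?\<eta> x\<bar>)" by simp
  qed
qed

text \<open>Suppose \<open>u = 0\<close> on a set \<open>Z\<close> of positive measure inside a ball on which \<open>\<eta> = 1\<close>, and \<open>u > \<delta>\<close> on a set \<open>P\<close> of positive
  measure. Test with \<open>\<psi> = \<eta> powr p * (u + e) powr (1 - p)\<close>. On all pairs the integrand is at most \<open>\<bar>dif \<eta>\<bar> powr p\<close> by Picone, and on
  \<open>P \<times> Z\<close> it is at most \<open>1 - (\<delta> / e) powr (p - 1)\<close>, which tends to \<open>- \<infinity>\<close> as \<open>e\<close> tends to \<open>0\<close>. The pairs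
  in \<open>P \<times> Z\<close> need not be close to each other, which is where the nonlocality enters.\<close>

theorem strong_maximum_principle:
  assumes u: "u \<in> W" and u0: "\<And>x. 0 \<le> u x" and nz: "\<not> (AE x in lebesgue. u x = 0)"
    and super: "\<And>h. h \<in> W \<Longrightarrow> (\<And>x. 0 \<le> h x) \<Longrightarrow> 0 \<le> (\<integral>z. dpow p (dif u z) * dif h z \<partial>K0)"
  shows "AE x in lebesgue. x \<in> \<Omega> \<longrightarrow> 0 < u x"
proof -
  have [measurable]: "u \<in> borel_measurable lebesgue" by (rule W_measurable[OF u])
  have "\<exists>n::nat. {x. 1 / real (Suc n) < u x} \<notin> null_sets lebesgue"
  proof (rule ccontr)
    assume "\<nexists>n::nat. {x. 1 / real (Suc n) < u x} \<notin> null_sets lebesgue"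
    then have "(\<Union>n::nat. {x. 1 / real (Suc n) < u x}) \<in> null_sets lebesgue" by (intro null_sets_UN) auto
    moreover have "{x. u x \<noteq> 0} \<subseteq> (\<Union>n::nat. {x. 1 / real (Suc n) < u x})"
    proof
      fix x assume "x \<in> {x. u x \<noteq> 0}"
      then have "0 < u x" using u0[of x] by simp
      then obtain n :: nat where "inverse (real (Suc n)) < u x" using reals_Archimedean by blast
      then show "x \<in> (\<Union>n::nat. {x. 1 / real (Suc n) < u x})" by (auto simp: inverse_eq_divide)
    qed
    ultimately have "AE x in lebesgue. u x = 0" by (intro AE_I') auto
    then show False using nz by simp
  qed
  then obtain \<delta> where \<delta>: "0 < \<delta>" "{x. \<delta> < u x} \<notin> null_sets lebesgue" by (metis of_nat_0_less_iff zero_less_Suc zero_less_divide_1_iff)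
  have "{x \<in> space lebesgue. \<delta> < u x} \<in> sets lebesgue" by measurable
  then have "{x. \<delta> < u x} \<in> sets lebesgue" by simp
  from lebesgue_positive_borel_subset[OF this \<delta>(2)] obtain P where P: "P \<in> sets borel" "P \<subseteq> {x. \<delta> < u x}" "emeasure lborel P \<noteq> 0" by blast
  have local: "{x \<in> ball c R. u x = 0} \<in> null_sets lebesgue" if R: "0 < R" and sub: "ball c (2 * R) \<subseteq> \<Omega>" for c R
  proof (rule ccontr)
    assume nn: "{x \<in> ball c R. u x = 0} \<notin> null_sets lebesgue"
    have "u -` {0} \<inter> space lebesgue \<in> sets lebesgue" by (rule measurable_sets[OF W_measurable[OF u]]) simp
    then have "ball c R \<inter> (u -` {0} \<inter> space lebesgue) \<in> sets lebesgue" by (intro sets.Int) auto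
    moreover have "ball c R \<inter> (u -` {0} \<inter> space lebesgue) = {x \<in> ball c R. u x = 0}" by auto
    ultimately have "{x \<in> ball c R. u x = 0} \<in> sets lebesgue" by simp
    from lebesgue_positive_borel_subset[OF this nn] obtain Z where Z: "Z \<in> sets borel" "Z \<subseteq> {x \<in> ball c R. u x = 0}" "emeasure lborel Z \<noteq> 0" by blast
    let ?\<eta> = "cutoff c R"
    define H where "H = pow_integral K0 p (dif ?\<eta>)"
    have \<eta>W: "?\<eta> \<in> W" by (rule cutoff_W[OF R sub])
    have PZ: "P \<times> Z \<in> sets borel" using P(1) Z(1) by (simp add: borel_prod[symmetric])
    then have PZl: "P \<times> Z \<in> sets K0" by simp
    \<comment> \<open>On \<open>P \<times> Z\<close> the increments of \<open>u\<close> exceed \<open>\<delta>\<close>, so the seminorm bounds its mass although the kernel is singular.\<close>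
    have iS: "integrable K0 (indicator (P \<times> Z) :: _ \<Rightarrow> real)"
    proof (rule Bochner_Integration.integrable_bound)
      show "integrable K0 (\<lambda>z. \<bar>dif u z\<bar> powr p / \<delta> powr p)" using W_dif[OF u] by (simp add: in_Lm_def)
      show "AE z in K0. norm (indicator (P \<times> Z) z :: real) \<le> norm (\<bar>dif u z\<bar> powr p / \<delta> powr p)"
      proof (rule AE_I2)
        fix z :: "'a \<times> 'a"
        show "norm (indicator (P \<times> Z) z :: real) \<le> norm (\<bar>dif u z\<bar> powr p / \<delta> powr p)"
        proof (cases "z \<in> P \<times> Z")
          case True
          then obtain x y where xy: "z = (x, y)" "x \<in> P" "y \<in> Z" by blast
          then have "\<delta> < u x" "u y = 0" using P(2) Z(2) by blast+
          then have "\<delta> \<le> \<bar>dif u z\<bar>" using xy \<delta> by (simp add: dif_def)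
          then have "\<delta> powr p \<le> \<bar>dif u z\<bar> powr p" using \<delta> p0 by (intro powr_mono2) auto
          then show ?thesis using True \<delta> by simp
        qed simp
      qed
      show "(indicator (P \<times> Z) :: _ \<Rightarrow> real) \<in> borel_measurable K0" using PZl by simp
    qed
    define \<kappa> where "\<kappa> = (\<integral>z. (indicator (P \<times> Z) z :: real) \<partial>K0)"
    have \<kappa>0: "\<kappa> \<noteq> 0"
    proof
      assume "\<kappa> = 0"
      then have "AE z in K0. (indicator (P \<times> Z) z :: real) = 0"
        unfolding \<kappa>_def using iS by (subst (asm) integral_nonneg_eq_0_iff_AE) auto
      then have "AE z in lebesgue. fst z \<noteq> snd z \<longrightarrow> (indicator (P \<times> Z) z :: real) = 0" unfolding AE_K0_iff .
      then have "AE z in lebesgue. z \<notin> P \<times> Z"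
      proof eventually_elim
        case (elim z)
        show ?case
        proof
          assume z: "z \<in> P \<times> Z"
          then obtain x y where xy: "z = (x, y)" "x \<in> P" "y \<in> Z" by blast
          then have "\<delta> < u x" "u y = 0" using P(2) Z(2) by blast+
          then have "u (fst z) \<noteq> u (snd z)" using xy \<delta>(1) by simp
          then show False using elim z by auto
        qed
      qed
      then have "AE z in lborel. z \<notin> P \<times> Z" by (simp add: AE_completion_iff)
      then have "P \<times> Z \<in> null_sets lborel" using PZ by (subst (asm) AE_iff_null_sets[symmetric]) auto
      then have "emeasure (lborel \<Otimes>\<^sub>M lborel) (P \<times> Z) = 0" by (simp add: lborel_prod null_sets_def)
      then show False using P Z by (simp add: lborel.emeasure_pair_measure_Times)
    qed
    then have \<kappa>: "0 < \<kappa>" unfolding \<kappa>_def by (simp add: order.strict_iff_order Bochner_Integration.integral_nonneg)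
    have bound: "((\<delta> / e) powr (p - 1) - 1) * \<kappa> \<le> H" if e: "0 < e" for e
    proof -
      define \<psi> where "\<psi> = (\<lambda>x. ?\<eta> x powr p * (u x + e) powr (1 - p))"
      have \<psi>W: "\<psi> \<in> W" unfolding \<psi>_def by (rule picone_test_W[OF u u0 R sub e])
      have i\<psi>: "integrable K0 (\<lambda>z. dpow p (dif u z) * dif \<psi> z)" by (rule integrable_dpow[OF W_dif[OF u] W_dif[OF \<psi>W] p1])
      have "0 \<le> (\<integral>z. dpow p (dif u z) * dif \<psi> z \<partial>K0)" by (rule super[OF \<psi>W]) (simp add: \<psi>_def)
      also have "\<dots> \<le> (\<integral>z. \<bar>dif ?\<eta> z\<bar> powr p - ((\<delta> / e) powr (p - 1) - 1) * indicator (P \<times> Z) z \<partial>K0)"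
      proof (rule integral_mono[OF i\<psi>])
        show "integrable K0 (\<lambda>z. \<bar>dif ?\<eta> z\<bar> powr p - ((\<delta> / e) powr (p - 1) - 1) * indicator (P \<times> Z) z)"
          using W_dif[OF \<eta>W] iS by (auto simp: in_Lm_def)
        fix z :: "'a \<times> 'a"
        obtain x y where z: "z = (x, y)" by (cases z)
        show "dpow p (dif u z) * dif \<psi> z \<le> \<bar>dif ?\<eta> z\<bar> powr p - ((\<delta> / e) powr (p - 1) - 1) * indicator (P \<times> Z) z"
        proof (cases "z \<in> P \<times> Z")
          case False
          have "dpow p (dif u z) * dif \<psi> z = dpow p ((u x + e) - (u y + e)) * (?\<eta> x powr p * (u x + e) powr (1 - p) - ?\<eta> y powr p * (u y + e) powr (1 - p))"
            by (simp add: z dif_def \<psi>_def)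
          also have "\<dots> \<le> \<bar>?\<eta> x - ?\<eta> y\<bar> powr p"
            using u0[of x] u0[of y] e cutoff_bounds by (intro discrete_picone p1) auto
          finally show ?thesis using False by (simp add: z dif_def)
        next
          case True
          have ux: "\<delta> < u x" and uy: "u y = 0" and yb: "y \<in> ball c R" using True P(2) Z(2) z by auto
          have \<eta>y: "?\<eta> y = 1" by (rule cutoff_1[OF R yb])
          have "dpow p (dif u z) * dif \<psi> z = u x powr (p - 1) * (?\<eta> x powr p * (u x + e) powr (1 - p)) - u x powr (p - 1) * e powr (1 - p)"
            using ux \<delta> by (simp add: z dif_def \<psi>_def uy \<eta>y dpow_nonneg algebra_simps)
          moreover have "u x powr (p - 1) * (?\<eta> x powr p * (u x + e) powr (1 - p)) \<le> 1"
          proof -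
            have "u x powr (p - 1) * (?\<eta> x powr p * (u x + e) powr (1 - p)) \<le> (u x + e) powr (p - 1) * (1 * (u x + e) powr (1 - p))"
            proof (rule mult_mono)
              show "u x powr (p - 1) \<le> (u x + e) powr (p - 1)" using ux \<delta>(1) e p1 by (intro powr_mono2) auto
              have "?\<eta> x powr p \<le> 1" using cutoff_bounds[of c R x] p0 by (intro powr_le1) auto
              then show "?\<eta> x powr p * (u x + e) powr (1 - p) \<le> 1 * (u x + e) powr (1 - p)" by (intro mult_right_mono) auto
            qed auto
            also have "\<dots> = 1" using ux \<delta> e by (simp flip: powr_add)
            finally show ?thesis .
          qed
          moreover have "(\<delta> / e) powr (p - 1) \<le> u x powr (p - 1) * e powr (1 - p)"
          proof -
            have "(\<delta> / e) powr (p - 1) \<le> (u x / e) powr (p - 1)" using ux \<delta> e p1 by (intro powr_mono2) (auto simp: divide_right_mono)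
            also have "\<dots> = u x powr (p - 1) * e powr (- (p - 1))"
              unfolding powr_minus_divide using ux \<delta> e by (simp add: powr_divide)
            also have "- (p - 1) = 1 - p" by simp
            finally show ?thesis .
          qed
          ultimately have "dpow p (dif u z) * dif \<psi> z \<le> 1 - (\<delta> / e) powr (p - 1)" by linarith
          moreover have "0 \<le> \<bar>dif ?\<eta> z\<bar> powr p" by simp
          ultimately have "dpow p (dif u z) * dif \<psi> z \<le> \<bar>dif ?\<eta> z\<bar> powr p - ((\<delta> / e) powr (p - 1) - 1)" by linarith
          then show ?thesis using True by simp
        qed
      qed
      also have "\<dots> = H - ((\<delta> / e) powr (p - 1) - 1) * \<kappa>"
        unfolding H_def \<kappa>_def pow_integral_def using W_dif[OF \<eta>W] iS by (simp add: in_Lm_def)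
      finally show ?thesis by simp
    qed
    have H0: "0 \<le> H" unfolding H_def by (rule pow_integral_nonneg)
    \<comment> \<open>Choose \<open>e\<close> so that \<open>(\<delta> / e) powr (p - 1) = L\<close>, which violates the bound.\<close>
    define L where "L = H / \<kappa> + 2"
    have L: "0 < L" using H0 \<kappa> by (simp add: L_def add_nonneg_pos)
    have "((\<delta> / (\<delta> / L powr (1 / (p - 1)))) powr (p - 1) - 1) * \<kappa> \<le> H" using \<delta> L by (intro bound) auto
    moreover have "(\<delta> / (\<delta> / L powr (1 / (p - 1)))) powr (p - 1) = L" using \<delta> L p1 by (simp add: powr_powr)
    ultimately have "(L - 1) * \<kappa> \<le> H" by simp
    moreover have "(L - 1) * \<kappa> = H + \<kappa>" using \<kappa> by (simp add: L_def field_simps)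
    ultimately show False using \<kappa> by simp
  qed
  have "\<forall>x\<in>\<Omega>. \<exists>R>0. ball x (2 * R) \<subseteq> \<Omega>"
  proof
    fix x assume "x \<in> \<Omega>"
    then obtain R where "R > 0" "ball x R \<subseteq> \<Omega>" using open_\<Omega> openE by blast
    then show "\<exists>R>0. ball x (2 * R) \<subseteq> \<Omega>" by (intro exI[of _ "R / 2"]) auto
  qed
  then obtain Rf where Rf: "\<And>x. x \<in> \<Omega> \<Longrightarrow> 0 < Rf x" "\<And>x. x \<in> \<Omega> \<Longrightarrow> ball x (2 * Rf x) \<subseteq> \<Omega>" by metis
  obtain \<F>' where F': "\<F>' \<subseteq> (\<lambda>x. ball x (Rf x)) ` \<Omega>" "countable \<F>'" "\<Union>\<F>' = \<Union>((\<lambda>x. ball x (Rf x)) ` \<Omega>)"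
    using Lindelof[of "(\<lambda>x. ball x (Rf x)) ` \<Omega>"] by blast
  have nul: "(\<Union>B\<in>\<F>'. {x \<in> B. u x = 0}) \<in> null_sets lebesgue"
  proof (rule null_sets_UN'[OF F'(2)])
    fix B assume "B \<in> \<F>'"
    then obtain x where "x \<in> \<Omega>" "B = ball x (Rf x)" using F'(1) by blast
    then show "{x \<in> B. u x = 0} \<in> null_sets lebesgue" using local[OF Rf(1) Rf(2)] by blast
  qed
  show ?thesis
  proof (rule AE_I'[OF nul])
    show "{x \<in> space lebesgue. \<not> (x \<in> \<Omega> \<longrightarrow> 0 < u x)} \<subseteq> (\<Union>B\<in>\<F>'. {x \<in> B. u x = 0})"
    proof
      fix x assume "x \<in> {x \<in> space lebesgue. \<not> (x \<in> \<Omega> \<longrightarrow> 0 < u x)}"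
      then have x: "x \<in> \<Omega>" "u x = 0" using u0[of x] by auto
      then have "x \<in> ball x (Rf x)" using Rf(1) by simp
      then have "x \<in> \<Union>\<F>'" unfolding F'(3) using x by blast
      then show "x \<in> (\<Union>B\<in>\<F>'. {x \<in> B. u x = 0})" using x by auto
    qed
  qed
qed

end

section \<open>The two solutions\<close>

context nehari
begin

theorem positive_solution:
  "\<exists>u. minimizes_among (energy s p \<Omega> \<alpha> q r lam \<mu>) (\<lambda>v. weak_solution s p \<Omega> \<alpha> q r lam \<mu> v \<and> positive_on \<Omega> v) u"
proof -
  obtain w where w: "w \<in> W" "sign_changing w" using ex_sign_changing by blast
  have "\<not> (AE x in lebesgue. w x = 0)"
  proof
    assume "AE x in lebesgue. w x = 0"
    then have "AE x in lebesgue. max (w x) 0 = 0" by eventually_elim simp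
    then show False using w(2) by (simp add: sign_changing_def)
  qed
  then obtain v where v: "on_nehari v" "\<And>x. 0 \<le> v x" and min: "\<And>w. on_nehari w \<Longrightarrow> J v \<le> J w"
    using nehari_minimizer_nonneg[OF w(1)] by blast
  have vW: "v \<in> W" and nz: "\<not> (AE x in lebesgue. v x = 0)" using v(1) by (auto simp: on_nehari_def)
  have crit: "dJ v h = 0" if "h \<in> W" for h by (rule nehari_min_critical[OF v(1) min that])
  have "AE x in lebesgue. x \<in> \<Omega> \<longrightarrow> 0 < v x"
  proof (rule strong_maximum_principle[OF vW v(2) nz])
    fix h assume h: "h \<in> W" "\<And>x. 0 \<le> h x"
    have "0 \<le> (\<integral>x. dpow r (v x) * h x \<partial>Mr)" "0 \<le> (\<integral>x. dpow q (v x) * h x \<partial>Mq)"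
      using v(2) h(2) by (auto intro!: Bochner_Integration.integral_nonneg simp: dpow_nonneg)
    then have "0 \<le> lam * (\<integral>x. dpow r (v x) * h x \<partial>Mr)" "0 \<le> \<mu> * (\<integral>x. dpow q (v x) * h x \<partial>Mq)"
      using lam0 \<mu>0 by auto
    then show "0 \<le> (\<integral>z. dpow p (dif v z) * dif h z \<partial>K0)" using crit[OF h(1)] by (simp add: dJ_def dA_def)
  qed
  then have pos: "positive_on \<Omega> v" by (simp add: positive_on_def)
  have ws: "weak_solution s p \<Omega> \<alpha> q r lam \<mu> v" using vW crit by (simp add: weak_solution_iff)
  have "energy s p \<Omega> \<alpha> q r lam \<mu> v \<le> energy s p \<Omega> \<alpha> q r lam \<mu> z"
    if z: "weak_solution s p \<Omega> \<alpha> q r lam \<mu> z" "positive_on \<Omega> z" for z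
  proof -
    have zW: "z \<in> W" and Ez: "dJ z z = 0" using z(1) by (auto simp: weak_solution_iff)
    have "\<not> (AE x in lebesgue. z x = 0)"
    proof
      assume "AE x in lebesgue. z x = 0"
      then have "AE x in lebesgue. x \<notin> \<Omega>" using z(2) unfolding positive_on_def by eventually_elim auto
      then show False using AE_zero_ball_absurd[OF open_\<Omega> zero_\<Omega>] by simp
    qed
    then have "on_nehari z" using zW Ez by (simp add: on_nehari_def)
    then show ?thesis using min energy_eq[OF vW] energy_eq[OF zW] by simp
  qed
  then show ?thesis using ws pos unfolding minimizes_among_def by blast
qed

theorem sign_changing_solution:
  "\<exists>u. minimizes_among (energy s p \<Omega> \<alpha> q r lam \<mu>) (\<lambda>v. weak_solution s p \<Omega> \<alpha> q r lam \<mu> v \<and> sign_changing v) u"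
proof -
  obtain w where w: "w \<in> W" "sign_changing w" using ex_sign_changing by blast
  obtain v where v: "nodal v" and min: "\<And>w. nodal w \<Longrightarrow> J v \<le> J w" using nodal_minimizer[OF w] by blast
  have vW: "v \<in> W" and sc: "sign_changing v" using v by (auto simp: nodal_def)
  have ws: "weak_solution s p \<Omega> \<alpha> q r lam \<mu> v"
    using vW nodal_min_critical[OF v min] by (simp add: weak_solution_iff)
  have "energy s p \<Omega> \<alpha> q r lam \<mu> v \<le> energy s p \<Omega> \<alpha> q r lam \<mu> z"
    if z: "weak_solution s p \<Omega> \<alpha> q r lam \<mu> z" "sign_changing z" for z
  proof -
    have zW: "z \<in> W" using z(1) by (simp add: weak_solution_iff)
    then have "nodal z" using z W_pos_part[OF zW] W_neg_part[OF zW] by (simp add: weak_solution_iff nodal_def)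
    then show ?thesis using min energy_eq[OF vW] energy_eq[OF zW] by simp
  qed
  then show ?thesis using ws sc unfolding minimizes_among_def by blast
qed

end

theorem theorem1p1:
  fixes \<Omega> :: "'a::euclidean_space set"
    and s p q r \<alpha> lam \<mu> :: real
  assumes "0 < s" and "s < 1" and "1 < p" and "p * s < real DIM('a)"
    and "open \<Omega>" and "bounded \<Omega>" and "smooth_boundary \<Omega>" and "0 \<in> \<Omega>"
    and "0 \<le> \<alpha>" and "\<alpha> < p * s"
    and "q \<in> {p..<crit_exp TYPE('a) s p \<alpha>}"
    and "r \<in> {p..<crit_exp TYPE('a) s p 0}"
    and "max q r > p"
    and "min q r > p \<Longrightarrow> lam > 0 \<and> \<mu> > 0"
    and "r = p \<Longrightarrow> 0 < lam \<and> lam < eigenvalue1 s p \<Omega> 0 \<and> \<mu> > 0"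
    and "q = p \<Longrightarrow> lam > 0 \<and> 0 < \<mu> \<and> \<mu> < eigenvalue1 s p \<Omega> \<alpha>"
  shows "(\<exists>u. minimizes_among (energy s p \<Omega> \<alpha> q r lam \<mu>)
               (\<lambda>v. weak_solution s p \<Omega> \<alpha> q r lam \<mu> v \<and> positive_on \<Omega> v) u) \<and>
         (\<exists>u. minimizes_among (energy s p \<Omega> \<alpha> q r lam \<mu>)
               (\<lambda>v. weak_solution s p \<Omega> \<alpha> q r lam \<mu> v \<and> sign_changing v) u)"
proof -
  have "0 < lam \<and> 0 < \<mu>"
  proof (cases "r = p \<or> q = p")
    case True then show ?thesis using assms(15,16) by blast
  next
    case False
    then have "min q r > p" using assms(11,12) by auto
    then show ?thesis by (rule assms(14))
  qed
  then have "nehari s p \<Omega> \<alpha> q r lam \<mu>"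
    using assms by unfold_locales auto
  then show ?thesis by (intro conjI nehari.positive_solution nehari.sign_changing_solution)
qed

end
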